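(* Let $1\le r<p,q<s\le\infty$ and $m\in\mathbb N$. Let $T$ be a sublinear operator and $b\in L^1_{\rm loc}(\mathbb R^n)$. Assume that $T$ and $\mathcal M^{\#}_{T,s}$ are locally weak $L^r$-bounded. Let $\mu\in A_{p/r}\cap\mathrm{RH}_{(s/p)'}$, $\lambda\in A_{q/r}\cap\mathrm{RH}_{(s/q)'}$ and define the Bloom weight $\nu$ by $$\nu^{1+\frac1{pm}-\frac1{qm}}:=\mu^{\frac1{pm}}\lambda^{-\frac1{qm}}.$$ Then, with constants $C_{\mu,\lambda}$ depending on $\mu,\lambda$ (and on $n,m,p,q,r,s,T$) but not on $b$: (i) If $p\le q$ and $\alpha:=\frac1{pm}-\frac1{qm}$, then $$\|T_b^m\|_{L^p(\mu)\to L^q(\lambda)}\le C_{\mu,\lambda}\|b\|_{\mathrm{BMO}_\nu^{\alpha n}}^m.$$ (ii) If $q\le p$ and $\frac1t:=\frac1{qm}-\frac1{pm}$, then $$\|T_b^m\|_{L^p(\mu)\to L^q(\lambda)}\le C_{\mu,\lambda}\|M_\nu^{\#}b\|_{L^t(\nu)}^m.$$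
   Context: Cubes in $\mathbb R^n$ have sides parallel to the axes; $3Q$ is the cube concentric with $Q$ with three times its side length; $\langle h\rangle_Q:=\frac1{|Q|}\int_Qh$ and, for $h\ge0$, $\langle h\rangle_{t,Q}:=\langle h^t\rangle_Q^{1/t}$. Primes denote H\"older conjugates. Sublinear means $|T(f+g)|\le|Tf|+|Tg|$ and $|T(cf)|=|c||Tf|$; $T$ is assumed to be defined on all functions to which it is applied. $T_b^mf(x):=T\big((b(x)-b(\cdot))^mf\big)(x)$, and $\|T_b^m\|_{L^p(\mu)\to L^q(\lambda)}$ is the best constant $C$ in $\|T_b^mf\|_{L^q(\lambda)}\le C\|f\|_{L^p(\mu)}$ for bounded compactly supported $f$. For $1\le s\le\infty$, $$\mathcal M^{\#}_{T,s}f(x):=\sup_{Q\ni x}\Big(\frac1{|Q|^2}\int_{Q\times Q}\big|T(f\chi_{\mathbb R^n\setminus3Q})(x')-T(f\chi_{\mathbb R^n\setminus3Q})(x'')\big|^s\,dx'\,dx''\Big)^{1/s}$$ (essential supremum if $s=\infty$). An operator $T$ is locally weak $L^r$-bounded ($r\in[1,\infty)$) if there is a non-increasing function $\varphi_{T,r}:(0,1)\to[0,\infty)$ such that for every cube $Q$ and $f\in L^r(Q)$, $|\{x\in Q:|T(f\chi_Q)(x)|>\varphi_{T,r}(\lambda)\langle|f|\rangle_{r,Q}\}|\le\lambda|Q|$ for all $\lambda\in(0,1)$. A weight is a non-negative (a.e. positive) locally integrable function, $\nu(Q):=\int_Q\nu$, $\|f\|_{L^p(w)}:=(\int|f|^pw)^{1/p}$.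 For $1<p<\infty$, $w\in A_p$ iff $[w]_{A_p}:=\sup_Q\langle w\rangle_{1,Q}\langle w^{-1}\rangle_{\frac1{p-1},Q}<\infty$; for $1\le t<\infty$, $w\in\mathrm{RH}_t$ iff $[w]_{\mathrm{RH}_t}:=\sup_Q\langle w\rangle_{t,Q}/\langle w\rangle_{1,Q}<\infty$ (for $s=\infty$, $(s/p)'=1$). For $\gamma\ge0$, $$\|b\|_{\mathrm{BMO}_\nu^\gamma}:=\sup_Q\frac1{\nu(Q)^{1+\gamma/n}}\int_Q|b-\langle b\rangle_Q|,\qquad M_\nu^{\#}b(x):=\sup_{Q\ni x}\frac1{\nu(Q)}\int_Q|b-\langle b\rangle_Q|.$$ If $p=q$, then $t=\infty$ and $L^t(\nu)$ is read as $L^\infty(\mathbb R^n)$. *)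

theory Defs
  imports "HOL-Analysis.Analysis" "HOL-Probability.Essential_Supremum"
begin

text \<open>
  The space is \<^typ>\<open>real ^ 'n\<close>, of dimension \<^term>\<open>CARD('n)\<close>.  Functions are real- or complex-valued:
  the scalars form a type \<^typ>\<open>'k\<close> of sort \<open>{real_normed_field, euclidean_space}\<close>.
  Averages, norms and suprema of nonnegative quantities are taken in \<^typ>\<open>ennreal\<close>.
  Extended exponents (those which may be infinite) also have type \<^typ>\<open>ennreal\<close>.
\<close>

text \<open>Real powers on \<^typ>\<open>ennreal\<close>; only used with exponents \<open>a > 0\<close>.\<close>

definition epowr :: "ennreal \<Rightarrow> real \<Rightarrow> ennreal"
  where "epowr x a = (if x = top then top else ennreal (enn2real x powr a))"

definition hoelder_conj :: "ennreal \<Rightarrow> real"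
  where "hoelder_conj u = (if u = top then 1 else enn2real u / (enn2real u - 1))"


subsection \<open>Cubes and averages\<close>

text \<open>The cube with centre \<open>c\<close> and side length \<open>l\<close>; thus \<open>3Q\<close> is \<^term>\<open>cube c (3 * l)\<close>.\<close>

definition cube :: "real ^ 'n \<Rightarrow> real \<Rightarrow> (real ^ 'n) set"
  where "cube c l = cbox (\<chi> i. c $ i - l / 2) (\<chi> i. c $ i + l / 2)"

definition cubes :: "(real ^ 'n) set set"
  where "cubes = {cube c l |c l. 0 < l}"

definition cutoff :: "('a \<Rightarrow> 'b::zero) \<Rightarrow> 'a set \<Rightarrow> 'a \<Rightarrow> 'b"
  where "cutoff f A = (\<lambda>x. if x \<in> A then f x else 0)"

definition avg :: "(real ^ 'n \<Rightarrow> 'k::euclidean_space) \<Rightarrow> (real ^ 'n) set \<Rightarrow> 'k"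
  where "avg h Q = (LINT x:Q|lebesgue. h x) /\<^sub>R measure lebesgue Q"

text \<open>\<open>\<langle>h\<rangle>\<^bsub>t,Q\<^esub>\<close> for nonnegative \<open>h\<close>.\<close>

definition pavg :: "real \<Rightarrow> (real ^ 'n \<Rightarrow> ennreal) \<Rightarrow> (real ^ 'n) set \<Rightarrow> ennreal"
  where "pavg t h Q =
    epowr ((\<integral>\<^sup>+ x\<in>Q. epowr (h x) t \<partial>lebesgue) / emeasure lebesgue Q) (1 / t)"


subsection \<open>Function spaces\<close>

definition loc_integrable :: "(real ^ 'n \<Rightarrow> 'k::euclidean_space) \<Rightarrow> bool"
  where "loc_integrable b \<longleftrightarrow> (\<forall>K. compact K \<longrightarrow> b absolutely_integrable_on K)"

definition Lr_on :: "real \<Rightarrow> (real ^ 'n) set \<Rightarrow> (real ^ 'n \<Rightarrow> 'k::euclidean_space) set"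
  where "Lr_on r Q = {f. f \<in> borel_measurable (lebesgue_on Q) \<and>
    (\<integral>\<^sup>+ x. ennreal (norm (f x) powr r) \<partial>lebesgue_on Q) < \<infinity>}"

definition Lr_comp :: "real \<Rightarrow> (real ^ 'n \<Rightarrow> 'k::euclidean_space) set"
  where "Lr_comp r = {f \<in> Lr_on r UNIV. bounded {x. f x \<noteq> 0}}"

definition bdd_comp :: "(real ^ 'n \<Rightarrow> 'k::euclidean_space) set"
  where "bdd_comp = {f \<in> borel_measurable lebesgue. bounded (range f) \<and> bounded {x. f x \<noteq> 0}}"

text \<open>The norm of \<open>L\<^sup>t(w)\<close> for \<open>0 < t \<le> \<infinity>\<close>; at \<open>t = \<infinity>\<close> it is the unweighted \<open>L\<^sup>\<infinity>\<close> norm.\<close>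

definition Lnorm :: "ennreal \<Rightarrow> (real ^ 'n \<Rightarrow> real) \<Rightarrow> (real ^ 'n \<Rightarrow> ennreal) \<Rightarrow> ennreal"
  where "Lnorm t w h =
    (if t = top then esssup lebesgue h
     else epowr (\<integral>\<^sup>+ x. epowr (h x) (enn2real t) * ennreal (w x) \<partial>lebesgue) (1 / enn2real t))"


subsection \<open>Weights\<close>

definition weight :: "(real ^ 'n \<Rightarrow> real) \<Rightarrow> bool"
  where "weight w \<longleftrightarrow> loc_integrable w \<and> (\<forall>x. 0 \<le> w x) \<and> (AE x in lebesgue. 0 < w x)"

definition wmeas :: "(real ^ 'n \<Rightarrow> real) \<Rightarrow> (real ^ 'n) set \<Rightarrow> ennreal"
  where "wmeas w Q = (\<integral>\<^sup>+ x\<in>Q. ennreal (w x) \<partial>lebesgue)"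

definition Ap_const :: "real \<Rightarrow> (real ^ 'n \<Rightarrow> real) \<Rightarrow> ennreal"
  where "Ap_const p w = (SUP Q\<in>cubes.
    pavg 1 (\<lambda>x. ennreal (w x)) Q * pavg (1 / (p - 1)) (\<lambda>x. inverse (ennreal (w x))) Q)"

definition Ap :: "real \<Rightarrow> (real ^ 'n \<Rightarrow> real) set"
  where "Ap p = {w. weight w \<and> Ap_const p w < \<infinity>}"

definition RH_const :: "real \<Rightarrow> (real ^ 'n \<Rightarrow> real) \<Rightarrow> ennreal"
  where "RH_const t w = (SUP Q\<in>cubes.
    pavg t (\<lambda>x. ennreal (w x)) Q / pavg 1 (\<lambda>x. ennreal (w x)) Q)"

definition RH :: "real \<Rightarrow> (real ^ 'n \<Rightarrow> real) set"
  where "RH t = {w. weight w \<and> RH_const t w < \<infinity>}"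


subsection \<open>Oscillation\<close>

definition osc :: "(real ^ 'n \<Rightarrow> 'k::euclidean_space) \<Rightarrow> (real ^ 'n) set \<Rightarrow> ennreal"
  where "osc b Q = (\<integral>\<^sup>+ x\<in>Q. ennreal (norm (b x - avg b Q)) \<partial>lebesgue)"

definition BMO_norm ::
  "(real ^ 'n \<Rightarrow> real) \<Rightarrow> real \<Rightarrow> (real ^ 'n \<Rightarrow> 'k::euclidean_space) \<Rightarrow> ennreal"
  where "BMO_norm \<nu> \<gamma> b =
    (SUP Q\<in>cubes. osc b Q / epowr (wmeas \<nu> Q) (1 + \<gamma> / real CARD('n)))"

definition sharp_max ::
  "(real ^ 'n \<Rightarrow> real) \<Rightarrow> (real ^ 'n \<Rightarrow> 'k::euclidean_space) \<Rightarrow> real ^ 'n \<Rightarrow> ennreal"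
  where "sharp_max \<nu> b x = (SUP Q\<in>{Q\<in>cubes. x \<in> Q}. osc b Q / wmeas \<nu> Q)"


subsection \<open>Operators\<close>

type_synonym ('n, 'k) operator = "(real ^ 'n \<Rightarrow> 'k) \<Rightarrow> real ^ 'n \<Rightarrow> 'k"

text \<open>
  Operators act on functions rather than on classes modulo null sets, and the inequalities hold at
  every point: the definition of a commutator applies \<open>T\<close> to a function that depends on the
  point of evaluation.  The set \<open>D\<close> is the domain; the values of \<open>T\<close> elsewhere are irrelevant.
\<close>

definition sublinear_on ::
  "(real ^ 'n \<Rightarrow> 'k) set \<Rightarrow> ('n, 'k::{real_normed_field, euclidean_space}) operator \<Rightarrow> bool"
  where "sublinear_on D T \<longleftrightarrow>
    (\<forall>f\<in>D. T f \<in> borel_measurable lebesgue) \<and>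
    (\<forall>f\<in>D. \<forall>g\<in>D. \<forall>x. norm (T (\<lambda>y. f y + g y) x) \<le> norm (T f x) + norm (T g x)) \<and>
    (\<forall>f\<in>D. \<forall>c x. norm (T (\<lambda>y. c * f y) x) = norm c * norm (T f x))"

definition commutator ::
  "('n, 'k::{real_normed_field, euclidean_space}) operator \<Rightarrow> (real ^ 'n \<Rightarrow> 'k) \<Rightarrow> nat
    \<Rightarrow> ('n, 'k) operator"
  where "commutator T b m f x = T (\<lambda>y. (b x - b y) ^ m * f y) x"

definition op_norm ::
  "real \<Rightarrow> (real ^ 'n \<Rightarrow> real) \<Rightarrow> real \<Rightarrow> (real ^ 'n \<Rightarrow> real)
    \<Rightarrow> ('n, 'k::{real_normed_field, euclidean_space}) operator \<Rightarrow> ennreal"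
  where "op_norm p \<mu> q \<sigma> S = Inf {C. \<forall>f\<in>bdd_comp.
    Lnorm (ennreal q) \<sigma> (\<lambda>x. ennreal (norm (S f x)))
      \<le> C * Lnorm (ennreal p) \<mu> (\<lambda>x. ennreal (norm (f x)))}"

text \<open>\<open>\<M>\<^sup>#\<^bsub>T,s\<^esub>\<close>; the inner functional is the normalised \<open>L\<^sup>s(Q \<times> Q)\<close> norm.\<close>

definition grand_sharp_max ::
  "('n, 'k::{real_normed_field, euclidean_space}) operator \<Rightarrow> ennreal
    \<Rightarrow> (real ^ 'n \<Rightarrow> 'k) \<Rightarrow> real ^ 'n \<Rightarrow> ennreal"
  where "grand_sharp_max T s f x =
    (SUP (c, l)\<in>{(c, l). 0 < l \<and> x \<in> cube c l}.
      let Q = cube c l;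
          g = T (cutoff f (- cube c (3 * l)));
          M = lebesgue_on Q \<Otimes>\<^sub>M lebesgue_on Q;
          d = (\<lambda>z. ennreal (norm (g (fst z) - g (snd z))))
      in if s = top then esssup M d
         else epowr ((\<integral>\<^sup>+ z. epowr (d z) (enn2real s) \<partial>M) / (emeasure lebesgue Q)\<^sup>2)
                (1 / enn2real s))"

text \<open>
  Stated for operators with values in \<open>[0,\<infinity>]\<close>, to cover both \<open>|T|\<close> and \<open>\<M>\<^sup>#\<^bsub>T,s\<^esub>\<close>.  Outer measure
  agrees with Lebesgue measure on measurable sets; \<^const>\<open>emeasure\<close> would give a non-measurable
  set measure zero.
\<close>

definition loc_weak_bounded ::
  "real \<Rightarrow> ((real ^ 'n \<Rightarrow> 'k::euclidean_space) \<Rightarrow> real ^ 'n \<Rightarrow> ennreal) \<Rightarrow> bool"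
  where "loc_weak_bounded r A \<longleftrightarrow>
    (\<exists>\<phi>::real \<Rightarrow> real. antimono_on {0<..<1} \<phi> \<and> (\<forall>\<theta>\<in>{0<..<1}. 0 \<le> \<phi> \<theta>) \<and>
      (\<forall>Q\<in>cubes. \<forall>f\<in>Lr_on r Q. \<forall>\<theta>\<in>{0<..<1}.
        outer_measure_of lebesgue
          {x \<in> Q. A (cutoff f Q) x > ennreal (\<phi> \<theta>) * pavg r (\<lambda>y. ennreal (norm (f y))) Q}
        \<le> ennreal \<theta> * emeasure lebesgue Q))"

end

theory Submission
 imports Defs
begin

text \<open>
 On a dyadic grid, \<open>T\<^sub>b\<^sup>m f\<close> is dominated on a sparse family by sums over \<open>k <= m\<close> of
 \<open>|b - c\<^sub>Q|\<^bsup>m-k\<^esup> h\<^sub>Q\<close>, where the \<open>L\<^sup>s\<close> average of \<open>h\<^sub>Q\<close> over \<open>Q\<close> is bounded by the \<open>L\<^sup>r\<close> average of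
 \<open>(c\<^sub>Q - b)\<^sup>k f\<close> over \<open>3Q\<close>.  Both factors are then controlled by one weighted estimate
 for sums of powers of \<open>|b - c\<^sub>Q|\<close> over a sparse family, in which \<open>b\<close> enters only through the sequence of
 its mean oscillations over \<open>3Q\<close> divided by \<open>\<nu>(3Q)\<^bsup>1-e\<^esup>\<close>, measured in \<open>\<ell>\<^bsup>1/e\<^esup>\<close>, where \<open>me = 1/q - 1/p\<close>: it is
 applied with \<open>\<sigma>\<close> to \<open>|b - c\<^sub>Q|\<^bsup>m-k\<^esup>\<close>, and by duality with the dual weight of \<open>\<mu>\<close> to \<open>|b - c\<^sub>Q|\<^bsup>kr\<^esup>\<close>.
 If \<open>e <= 0\<close> the sequence is bounded by the \<open>BMO\<close> norm; if \<open>e > 0\<close> sparseness bounds its norm by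
 that of the sharp maximal function.
\<close>

section \<open>Summation and integration inequalities\<close>

text \<open>The two factors meet in a sequence space that moves with \<open>k\<close>. The cell
  \<open>Q\<close> carries the \<open>L^r\<close> average of \<open>(c_Q - b)^k f\<close> over
  \<open>3Q\<close> times \<open>\<zeta> k\<close>, essentially
  \<open>\<mu>(3Q)^((1 - k/m)/p) \<sigma>(3Q)^((k/m)/q)\<close>, and the sequence is measured with
  exponent \<open>1 / \<eta> k\<close>, where \<open>\<eta> k = 1/p + k e\<close> runs from
  \<open>1/p\<close> at \<open>k = 0\<close> to \<open>1/q\<close> at \<open>k = m\<close>. Each
  power of the oscillation of \<open>b\<close> costs \<open>e\<close> in the exponent and a fixed
  exchange of \<open>\<mu>\<close> for \<open>\<sigma>\<close>. Arbitrary powers of a sum along a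
  chain of cells are handled by inserting geometric weights of ratio close to 1; such weights remain
  integrable against every weight with the A_infinity property. The obstacle is that
  \<open>b\<close> is only locally integrable: neither the powers of \<open>|b - c_Q|\<close> nor
  \<open>(c - b)^k f\<close> are known to be integrable. The estimate is therefore proved for dyadic
  averages of \<open>b\<close>, where all sums are finite, and passes to \<open>b\<close> by Fatou's
  lemma. That \<open>T\<close> may be applied to \<open>(c - b)^k f\<close> at all is then a
  consequence of it.\<close>

lemma geometric_sum_inj_le:
 fixes n :: "'a => nat" and x :: real
 assumes "finite A" "inj_on n A" "0 <= x" "x < 1"
 shows "(\<Sum>a\<in>A. x ^ n a) <= 1 / (1 - x)"
proof -
 have "(\<Sum>a\<in>A. x ^ n a) = (\<Sum>k\<in>n ` A. x ^ k)"
  using assms by (simp add: sum.reindex)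
 also have "\<dots> <= (\<Sum>k. x ^ k)"
  using assms by (intro sum_le_suminf summable_geometric) auto
 also have "\<dots> = 1 / (1 - x)"
  using assms by (intro suminf_geometric) auto
 finally show ?thesis .
qed

text \<open>The geometric series of ratio \<open>l powr (- 1 / q)\<close> is what remains of the sum
  after its terms are compared with the largest one. The value blows up as \<open>l\<close>
  decreases to 1, so \<open>l\<close> is fixed once, depending on the weights only.\<close>

definition chain_const :: "real => real => real"
 where "chain_const q l = (1 / (1 - l powr (- 1 / q))) powr q"

lemma chain_const_pos: "1 < l ==> 0 < q ==> 0 < chain_const q l"
 using powr_less_one[of l "-1/q"] by (auto simp: chain_const_def)

abbreviation vol :: "(real ^ 'n) set => real" where "vol \<equiv> measure lebesgue"

text \<open>The weights \<open>l ^ n a\<close> pay for the passage from the sum to its largest summand.\<close>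

lemma powr_sum_le_chain:
 fixes n :: "'a => nat" and y :: "'a => real"
 assumes "finite A" "inj_on n A" "1 < l" "0 < q" "!!a. a \<in> A ==> 0 <= y a"
 shows "(\<Sum>a\<in>A. y a) powr q <= chain_const q l * (\<Sum>a\<in>A. l ^ n a * y a powr q)"
proof (cases "A = {}")
 case False
 define k where "k = l powr (- 1 / q)"
 have k: "0 < k" "k < 1" using assms powr_less_one[of l "-1/q"] by (auto simp: k_def)
 \<comment> \<open>Normalised so that every \<open>y a\<close> is at most \<open>z b\<close> times a
   term of a geometric sequence, where \<open>b\<close> maximises \<open>z\<close>.\<close>
 define z where "z a = y a / k ^ n a" for a
 obtain b where b: "b \<in> A" "!!a. a \<in> A ==> z a <= z b"
  using Max_in[of "z ` A"] Max_ge[of "z ` A"] False assms(1) by fastforce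
 have zb: "0 <= z b" using b(1) assms(5) k by (simp add: z_def)
 have "(\<Sum>a\<in>A. y a) = (\<Sum>a\<in>A. z a * k ^ n a)"
  using k by (simp add: z_def)
 also have "\<dots> <= (\<Sum>a\<in>A. z b * k ^ n a)"
  using b k by (intro sum_mono mult_right_mono) auto
 also have "\<dots> = z b * (\<Sum>a\<in>A. k ^ n a)" by (simp add: sum_distrib_left)
 also have "\<dots> <= z b * (1 / (1 - k))"
  using geometric_sum_inj_le[OF assms(1,2), of k] k zb by (intro mult_left_mono) auto
 finally have "(\<Sum>a\<in>A. y a) powr q <= (z b * (1 / (1 - k))) powr q"
  using assms by (intro powr_mono2) (auto intro: sum_nonneg)
 also have "\<dots> = chain_const q l * z b powr q"
  using zb k by (simp add: powr_mult powr_divide chain_const_def k_def)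
 also have "z b powr q = l ^ n b * y b powr q"
 proof -
  have "(k ^ n b) powr q = (l powr (- 1 / q)) powr (n b * q)"
   using k by (simp add: k_def powr_powr powr_realpow[symmetric])
  also have "\<dots> = l powr (- real (n b))" using assms by (simp add: powr_powr)
  also have "\<dots> = inverse (l ^ n b)" using assms by (simp add: powr_minus powr_realpow)
  finally have *: "(k ^ n b) powr q = inverse (l ^ n b)" .
  have "z b powr q = y b powr q / (k ^ n b) powr q"
   using k assms b by (simp add: z_def powr_divide)
  then show ?thesis unfolding * by (simp add: divide_inverse)
 qed
 also have "\<dots> <= (\<Sum>a\<in>A. l ^ n a * y a powr q)"
  using assms b by (intro member_le_sum[where f="\<lambda>a. l ^ n a * y a powr q"]) auto
 finally show ?thesis using chain_const_pos[OF assms(3,4)] by (simp add: mult_left_mono)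
qed (use assms in simp)

text \<open>Young's inequality, scaled so that the right-hand side sums to
  \<open>A powr s * B powr (1 - s)\<close> when \<open>A\<close> and \<open>B\<close> bound the sums
  of \<open>f\<close> and \<open>g\<close>. At the endpoints the value \<open>0 powr 0 = 0\<close>
  only helps.\<close>

lemma weighted_geom_mean_le:
 fixes f g A B s :: real
 assumes "0 <= f" "0 <= g" "0 < A" "0 < B" "0 <= s" "s <= 1"
 shows "f powr s * g powr (1 - s) <= A powr s * B powr (1 - s) * (s * (f / A) + (1 - s) * (g / B))"
proof (cases "s = 0 \<or> s = 1")
 case True
 then show ?thesis using assms by (auto simp: field_simps)
next
 case False
 have "(f/A) powr s * (g/B) powr (1 - s) <= s * (f / A) + (1 - s) * (g / B)"
 proof (cases "f = 0 \<or> g = 0")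
  case True
  then show ?thesis using assms by auto
 next
  case no0: False
  then show ?thesis
   using assms False Youngs_inequality_0[of s "1 - s" "f/A" "g/B"] by auto
 qed
 then show ?thesis using assms by (simp add: powr_divide field_simps)
qed

lemma powr_one_minus: "0 < a ==> a powr s * a powr (1 - s) = (a::real)"
 by (simp add: powr_add[symmetric])

lemma sum_Hoelder:
 fixes f g :: "'a => real"
 assumes "finite I" "!!i. i \<in> I ==> 0 <= f i" "!!i. i \<in> I ==> 0 <= g i" "0 <= s" "s <= 1"
  "(\<Sum>i\<in>I. f i) <= A" "(\<Sum>i\<in>I. g i) <= B"
 shows "(\<Sum>i\<in>I. f i powr s * g i powr (1 - s)) <= A powr s * B powr (1 - s)"
proof (cases "0 < A \<and> 0 < B")
 case True
 have "(\<Sum>i\<in>I. f i powr s * g i powr (1 - s)) \<le>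
   (\<Sum>i\<in>I. A powr s * B powr (1 - s) * (s * (f i / A) + (1 - s) * (g i / B)))"
  using assms True by (intro sum_mono weighted_geom_mean_le) auto
 also have "\<dots> = A powr s * B powr (1 - s) * (s * ((\<Sum>i\<in>I. f i) / A) + (1 - s) * ((\<Sum>i\<in>I. g i) / B))"
  by (simp add: sum_distrib_left sum.distrib sum_divide_distrib distrib_left)
 also have "\<dots> <= A powr s * B powr (1 - s) * (s * 1 + (1 - s) * 1)"
  using assms True by (intro mult_left_mono add_mono) (auto)
 finally show ?thesis by simp
next
 case False
 have *: "0 <= (\<Sum>i\<in>I. f i)" "0 <= (\<Sum>i\<in>I. g i)" using assms by (auto intro: sum_nonneg)
 have "(\<Sum>i\<in>I. f i) = 0 \<or> (\<Sum>i\<in>I. g i) = 0" using False * assms by linarith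
 then have "(\<Sum>i\<in>I. f i powr s * g i powr (1 - s)) = 0"
  using assms by (intro sum.neutral) (auto simp: sum_nonneg_eq_0_iff)
 then show ?thesis using * assms by simp
qed

text \<open>Writing the exponents as \<open>s\<close> and \<open>1 - s\<close> makes
  \<open>s = 0\<close> and \<open>s = 1\<close> ordinary cases. They do occur: the later
  interpolation parameters are \<open>k / m\<close> and \<open>1 - k / m\<close> for
  \<open>k <= m\<close>.\<close>

lemma nn_integral_Hoelder:
 fixes f g :: "'a => real"
 assumes [measurable]: "f \<in> borel_measurable M" "g \<in> borel_measurable M"
  and nn: "!!x. 0 <= f x" "!!x. 0 <= g x" "0 <= s" "s <= 1" "0 <= A" "0 <= B"
  and le: "(\<integral>\<^sup>+x. ennreal (f x) \<partial>M) <= ennreal A" "(\<integral>\<^sup>+x. ennreal (g x) \<partial>M) <= ennreal B"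
 shows "(\<integral>\<^sup>+x. ennreal (f x powr s * g x powr (1 - s)) \<partial>M) <= ennreal (A powr s * B powr (1 - s))"
proof (cases "A = 0 \<or> B = 0")
 case True
 then have "(\<integral>\<^sup>+x. ennreal (f x) \<partial>M) = 0 \<or> (\<integral>\<^sup>+x. ennreal (g x) \<partial>M) = 0" using le by auto
 then have "AE x in M. ennreal (f x powr s * g x powr (1 - s)) = 0"
 proof
  assume "(\<integral>\<^sup>+x. ennreal (f x) \<partial>M) = 0"
  then have "AE x in M. ennreal (f x) = 0" by (subst (asm) nn_integral_0_iff_AE) auto
  then show ?thesis by eventually_elim (use nn in \<open>simp add: order_antisym_conv\<close>)
 next
  assume "(\<integral>\<^sup>+x. ennreal (g x) \<partial>M) = 0"
  then have "AE x in M. ennreal (g x) = 0" by (subst (asm) nn_integral_0_iff_AE) auto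
  then show ?thesis by eventually_elim (use nn in \<open>simp add: order_antisym_conv\<close>)
 qed
 then have "(\<integral>\<^sup>+x. ennreal (f x powr s * g x powr (1 - s)) \<partial>M) = 0"
  by (subst nn_integral_0_iff_AE) auto
 then show ?thesis by simp
next
 case False
 then have AB: "0 < A" "0 < B" using nn by auto
 let ?c = "A powr s * B powr (1 - s)"
 have "(\<integral>\<^sup>+x. ennreal (f x powr s * g x powr (1 - s)) \<partial>M) \<le>
   (\<integral>\<^sup>+x. ennreal (?c * s / A) * ennreal (f x) + ennreal (?c * (1 - s) / B) * ennreal (g x) \<partial>M)"
 proof (intro nn_integral_mono)
  fix x
  have "f x powr s * g x powr (1 - s) <= ?c * (s * (f x / A) + (1 - s) * (g x / B))"
   using nn AB by (intro weighted_geom_mean_le) auto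
  also have "\<dots> = ?c * s / A * f x + ?c * (1 - s) / B * g x" by (simp add: field_simps)
  finally show "ennreal (f x powr s * g x powr (1 - s)) <= ennreal (?c * s / A) * ennreal (f x) + ennreal (?c * (1 - s) / B) * ennreal (g x)"
   using nn AB by (simp add: ennreal_mult[symmetric] ennreal_plus[symmetric] ennreal_leI del: ennreal_plus)
 qed
 also have "\<dots> = ennreal (?c * s / A) * (\<integral>\<^sup>+x. ennreal (f x) \<partial>M) + ennreal (?c * (1 - s) / B) * (\<integral>\<^sup>+x. ennreal (g x) \<partial>M)"
  by (simp add: nn_integral_add nn_integral_cmult)
 also have "\<dots> <= ennreal (?c * s / A) * ennreal A + ennreal (?c * (1 - s) / B) * ennreal B"
  by (intro add_mono mult_left_mono le) auto
 also have "\<dots> = ennreal (?c * s / A * A + ?c * (1 - s) / B * B)"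
  using nn AB by (simp add: ennreal_mult[symmetric] ennreal_plus[symmetric] del: ennreal_plus)
 also have "?c * s / A * A + ?c * (1 - s) / B * B = ?c"
  using AB by (simp add: field_simps)
 finally show ?thesis .
qed

lemma set_nn_integral_Hoelder:
 fixes f g :: "'a => real"
 assumes [measurable]: "f \<in> borel_measurable M" "g \<in> borel_measurable M" "D \<in> sets M"
  and nn: "!!x. 0 <= f x" "!!x. 0 <= g x" "0 <= s" "s <= 1" "0 <= A" "0 <= B"
  and le: "(\<integral>\<^sup>+x\<in>D. ennreal (f x) \<partial>M) <= ennreal A" "(\<integral>\<^sup>+x\<in>D. ennreal (g x) \<partial>M) <= ennreal B"
 shows "(\<integral>\<^sup>+x\<in>D. ennreal (f x powr s * g x powr (1 - s)) \<partial>M) <= ennreal (A powr s * B powr (1 - s))"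
proof -
 have eq: "(\<integral>\<^sup>+x\<in>D. ennreal (h x) \<partial>M) = (\<integral>\<^sup>+x. ennreal (h x * indicator D x) \<partial>M)" for h :: "'a => real"
  by (intro nn_integral_cong) (auto split: split_indicator)
 have "(\<integral>\<^sup>+x. ennreal ((f x * indicator D x) powr s * (g x * indicator D x) powr (1 - s)) \<partial>M) <= ennreal (A powr s * B powr (1 - s))"
  using nn le by (intro nn_integral_Hoelder) (auto simp: eq)
 also have "(\<integral>\<^sup>+x. ennreal ((f x * indicator D x) powr s * (g x * indicator D x) powr (1 - s)) \<partial>M) =
   (\<integral>\<^sup>+x\<in>D. ennreal (f x powr s * g x powr (1 - s)) \<partial>M)"
  by (intro nn_integral_cong) (auto split: split_indicator)
 finally show ?thesis .
qed

text \<open>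
 For \<open>e > 0\<close> this bounds the \<open>\<ell>\<^sup>1\<^sup>/\<^sup>e\<close> norm of \<open>\<beta>\<close>, and for \<open>e <= 0\<close> the supremum norm: a nonpositive
 \<open>e\<close> is the range \<open>p <= q\<close>, where the inclusion of \<open>\<ell>\<^sup>v\<close> in \<open>\<ell>\<^sup>u\<close> takes the place of Hoelder's inequality.
\<close>

definition lnorm_le :: "real => 'a set => ('a => real) => real => bool"
 where "lnorm_le e I \<beta> B \<longleftrightarrow>
  (if 0 < e then (\<Sum>i\<in>I. \<beta> i powr (1 / e)) <= B powr (1 / e) else (\<forall>i\<in>I. \<beta> i <= B))"

lemma sum_powr_le_powr_sum:
 fixes x :: "'a => real"
 assumes "finite I" "!!i. i \<in> I ==> 0 <= x i" "1 <= c"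
 shows "(\<Sum>i\<in>I. x i powr c) <= (\<Sum>i\<in>I. x i) powr c"
proof -
 let ?X = "\<Sum>i\<in>I. x i"
 have X: "0 <= ?X" using assms by (auto intro: sum_nonneg)
 have "(\<Sum>i\<in>I. x i powr c) = (\<Sum>i\<in>I. x i * x i powr (c - 1))"
  using assms by (intro sum.cong) (auto simp: powr_mult_base)
 also have "\<dots> <= (\<Sum>i\<in>I. x i * ?X powr (c - 1))"
  using assms by (intro sum_mono mult_left_mono powr_mono2 member_le_sum) auto
 also have "\<dots> = ?X * ?X powr (c - 1)" by (simp add: sum_distrib_right)
 also have "\<dots> = ?X powr c" using X by (simp add: powr_mult_base)
 finally show ?thesis .
qed

lemma sum_lnorm_Hoelder:
 fixes x \<beta> :: "'a => real"
 assumes fin: "finite I" and nn: "!!i. i \<in> I ==> 0 <= x i" "!!i. i \<in> I ==> 0 < \<beta> i" "0 < B"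
  and uv: "0 < u" "0 < v" "0 <= \<theta>" "1 / u = 1 / v + \<theta> * e" and le: "lnorm_le e I \<beta> B"
 shows "(\<Sum>i\<in>I. (x i * \<beta> i powr \<theta>) powr u) <= B powr (\<theta> * u) * (\<Sum>i\<in>I. x i powr v) powr (u / v)"
proof (cases "0 < e")
 case True
 define s where "s = \<theta> * e * u"
 have s: "0 <= s" "1 - s = u / v" using True uv by (auto simp: s_def field_simps)
 moreover have "0 < u / v" using uv by simp
 ultimately have s1: "s <= 1" by linarith
 have "(\<Sum>i\<in>I. (x i * \<beta> i powr \<theta>) powr u) = (\<Sum>i\<in>I. (\<beta> i powr (1 / e)) powr s * (x i powr v) powr (1 - s))"
  using nn True uv unfolding s(2) by (intro sum.cong) (auto simp: powr_powr powr_mult s_def mult.commute)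
 also have "\<dots> <= (B powr (1 / e)) powr s * (\<Sum>i\<in>I. x i powr v) powr (1 - s)"
  using le True fin s s1 nn uv by (intro sum_Hoelder) (auto simp: lnorm_le_def)
 also have "\<dots> = B powr (\<theta> * u) * (\<Sum>i\<in>I. x i powr v) powr (u / v)"
  using True nn unfolding s(2) by (simp add: powr_powr s_def)
 finally show ?thesis .
next
 case False
 have "\<theta> * e <= 0" using False uv by (simp add: mult_nonneg_nonpos)
 then have "1 / u <= 1 / v" using uv by simp
 then have c: "1 <= u / v" using uv(1,2) by (simp add: field_simps)
 have "(\<Sum>i\<in>I. (x i * \<beta> i powr \<theta>) powr u) <= (\<Sum>i\<in>I. (x i * B powr \<theta>) powr u)"
  using le False nn uv
  by (intro sum_mono powr_mono2 mult_left_mono) (auto simp: lnorm_le_def less_imp_le)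
 also have "\<dots> = B powr (\<theta> * u) * (\<Sum>i\<in>I. (x i powr v) powr (u / v))"
  using nn uv by (auto simp: powr_mult powr_powr sum_distrib_left mult.commute intro!: sum.cong)
 also have "\<dots> <= B powr (\<theta> * u) * (\<Sum>i\<in>I. x i powr v) powr (u / v)"
  using fin c by (intro mult_left_mono sum_powr_le_powr_sum) auto
 finally show ?thesis .
qed

section \<open>Sparse families\<close>

lemma sum_indicator_filter:
 fixes f :: "'a => 'b::semiring_1"
 shows "finite A ==> (\<Sum>j\<in>A. f j * indicator (D j) x) = (\<Sum>j\<in>{j\<in>A. x \<in> D j}. f j)"
 by (rule sum.mono_neutral_cong_right) auto

section \<open>Counting functions of a finite Carleson family\<close>

locale laminar =
 fixes I :: "'i set" and D :: "'i => (real ^ 'n) set" and L :: real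
 assumes fin: "finite I"
  and meas [measurable]: "!!i. i \<in> I ==> D i \<in> sets lebesgue"
  and fm: "!!i. i \<in> I ==> D i \<in> fmeasurable lebesgue"
  and pos: "!!i. i \<in> I ==> 0 < vol (D i)"
  and lam: "!!i j. i \<in> I ==> j \<in> I ==> D i \<inter> D j = {} \<or> D i \<subseteq> D j \<or> D j \<subseteq> D i"
  and inj: "inj_on D I"
  and carl: "!!i. i \<in> I ==> (\<Sum>j\<in>{j\<in>I. D j \<subseteq> D i}. vol (D j)) <= L * vol (D i)"
  and L: "0 < L"
begin

text \<open>Members containing \<open>x\<close> are nested, so \<open>N i x\<close> is the position
  of \<open>D i\<close> in the chain through \<open>x\<close>, counted from 0 at the smallest
  member.\<close>

definition N :: "'i => real ^ 'n => nat"
 where "N i x = card {j\<in>I. x \<in> D j \<and> D j \<subset> D i}"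

text \<open>The number of generations between \<open>D j\<close> and \<open>D i\<close>. The upper
  end is excluded, so \<open>gen i i = 0\<close> and positions add up:
  \<open>N i x = gen j i + N j x\<close> on \<open>D j\<close>.\<close>

definition gen :: "'i => 'i => nat"
 where "gen j i = card {k\<in>I. D j \<subseteq> D k \<and> D k \<subset> D i}"

text \<open>Exceeds twice the packing constant, so that by Chebyshev's inequality \<open>N i\<close>
  reaches \<open>K\<close> on at most half of \<open>D i\<close>.\<close>

definition K :: nat where "K = nat \<lceil>2 * L\<rceil> + 1"

text \<open>The A_infinity property in the form used for families: \<open>g i\<close> stands for the
  \<open>W\<close>-measure of \<open>D i\<close>, and every subset of at least half the volume
  carries a fixed fraction of it. Equality is not imposed because \<open>g i\<close> will be
  computed on the tripled cube.\<close>

definition adm :: "real => real => (real ^ 'n => real) => ('i => real) => bool"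
 where "adm k1 k2 W g \<longleftrightarrow> W \<in> borel_measurable lebesgue \<and> (\<forall>x. 0 <= W x) \<and>
  (\<forall>i\<in>I. 0 < g i \<and> wmeas W (D i) <= ennreal (k1 * g i) \<and>
   (\<forall>F\<in>sets lebesgue. F \<subseteq> D i --> vol (D i) <= 2 * vol F --> ennreal (k2 * g i) <= wmeas W F))"

lemma N_real: "real (N i x) = (\<Sum>j\<in>{j\<in>I. D j \<subset> D i}. indicator (D j) x)"
proof -
 have "(\<Sum>j\<in>{j\<in>I. D j \<subset> D i}. indicator (D j) x) = (\<Sum>j\<in>{j\<in>{j\<in>I. D j \<subset> D i}. x \<in> D j}. 1::real)"
  using sum_indicator_filter[of "{j\<in>I. D j \<subset> D i}" "\<lambda>_. 1::real" D x] fin by simp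
 also have "{j\<in>{j\<in>I. D j \<subset> D i}. x \<in> D j} = {j\<in>I. x \<in> D j \<and> D j \<subset> D i}" by auto
 finally show ?thesis by (simp add: N_def)
qed

lemma N_measurable [measurable]: "(\<lambda>x. real (N i x)) \<in> borel_measurable lebesgue"
 unfolding N_real by (intro borel_measurable_sum) auto

lemma powN_measurable [measurable]: "0 < l ==> (\<lambda>x. l ^ N i x :: real) \<in> borel_measurable lebesgue"
 by (simp add: powr_realpow[symmetric])

lemma N_less:
 assumes "j \<in> I" "k \<in> I" "D j \<subset> D k" "x \<in> D j"
 shows "N j x < N k x"
 unfolding N_def using fin assms by (intro psubset_card_mono) auto

lemma N_inj: "inj_on (\<lambda>j. N j x) {j\<in>I. x \<in> D j}"
proof (rule inj_onI, rule ccontr)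
 fix j k assume jk: "j \<in> {j\<in>I. x \<in> D j}" "k \<in> {j\<in>I. x \<in> D j}" "N j x = N k x" "j \<noteq> k"
 then have "D j \<noteq> D k" using inj by (auto dest: inj_onD)
 then have "D j \<subset> D k \<or> D k \<subset> D j" using lam[of j k] jk by auto
 then show False using N_less[of j k x] N_less[of k j x] jk by auto
qed

lemma N_split:
 assumes "j \<in> I" "i \<in> I" "x \<in> D j" "D j \<subseteq> D i"
 shows "N i x = gen j i + N j x"
proof -
 have "{k\<in>I. x \<in> D k \<and> D k \<subset> D i} = {k\<in>I. D j \<subseteq> D k \<and> D k \<subset> D i} \<union> {k\<in>I. x \<in> D k \<and> D k \<subset> D j}"
  using assms lam by blast
 moreover have "{k\<in>I. D j \<subseteq> D k \<and> D k \<subset> D i} \<inter> {k\<in>I. x \<in> D k \<and> D k \<subset> D j} = {}" by auto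
 ultimately show ?thesis unfolding N_def gen_def using fin by (simp add: card_Un_disjoint)
qed

text \<open>The members strictly below \<open>D i\<close> through \<open>x\<close> occupy the
  positions \<open>0, ..., N i x - 1\<close>, so the sum is geometric. The formula expresses the
  exponential on \<open>D i\<close> by those on smaller members, as an induction requires.\<close>

lemma pow_N:
 fixes l :: real
 assumes "i \<in> I" "x \<in> D i"
 shows "l ^ N i x = 1 + (l - 1) * (\<Sum>j\<in>{j\<in>I. D j \<subset> D i}. l ^ N j x * indicator (D j) x)"
proof -
 let ?A = "{j\<in>I. x \<in> D j \<and> D j \<subset> D i}"
 have inj: "inj_on (\<lambda>j. N j x) ?A" using N_inj[of x] by (rule inj_on_subset) auto
 have "(\<lambda>j. N j x) ` ?A = {..<N i x}"
 proof (rule card_subset_eq)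
  show "(\<lambda>j. N j x) ` ?A \<subseteq> {..<N i x}" using N_less assms by auto
  show "card ((\<lambda>j. N j x) ` ?A) = card {..<N i x}" using card_image[OF inj] by (simp add: N_def)
 qed simp
 then have "(\<Sum>j\<in>?A. l ^ N j x) = (\<Sum>k<N i x. l ^ k)"
  using sum.reindex[OF inj, of "\<lambda>k. l ^ k"] by (simp add: o_def)
 then have "(l - 1) * (\<Sum>j\<in>?A. l ^ N j x) = l ^ N i x - 1"
  by (simp add: power_diff_1_eq)
 moreover have "(\<Sum>j\<in>{j\<in>I. D j \<subset> D i}. l ^ N j x * indicator (D j) x) = (\<Sum>j\<in>?A. l ^ N j x)"
 proof -
  have "?A = {j\<in>{j\<in>I. D j \<subset> D i}. x \<in> D j}" by auto
  then show ?thesis using fin by (subst sum_indicator_filter) simp_all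
 qed
 ultimately show ?thesis by simp
qed

definition F :: "'i => (real ^ 'n) set" where "F i = {x\<in>D i. N i x < K}"

lemma F_meas [measurable]: "i \<in> I ==> F i \<in> sets lebesgue"
proof -
 assume [measurable]: "i \<in> I"
 have "D i \<inter> {x\<in>space lebesgue. real (N i x) < real K} \<in> sets lebesgue" by measurable
 also have "D i \<inter> {x\<in>space lebesgue. real (N i x) < real K} = F i" by (auto simp: F_def)
 finally show ?thesis .
qed

text \<open>Chebyshev: \<open>N i\<close> is at least \<open>K\<close> off \<open>F i\<close>, and
  its integral over \<open>D i\<close> is at most \<open>L\<close> times the volume by the packing
  condition, while \<open>K >= 2 L\<close>.\<close>

lemma F_large: assumes i: "i \<in> I" shows "vol (D i) <= 2 * vol (F i)"
proof -
 let ?m = "vol"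
 have K: "0 < real K" "2 * L <= K" unfolding K_def by linarith+
 have sub: "{j\<in>I. D j \<subset> D i} \<subseteq> {j\<in>I. D j \<subseteq> D i}" by auto
 have fmF: "F i \<in> fmeasurable lebesgue"
  by (rule fmeasurableI2[OF fm[OF i] _ F_meas[OF i]]) (auto simp: F_def)
 have fmG: "D i - F i \<in> fmeasurable lebesgue" using i fmF fm by auto
 have "ennreal (K * ?m (D i - F i)) = (\<integral>\<^sup>+x\<in>D i - F i. ennreal K \<partial>lebesgue)"
  using fmG i by (simp add: nn_integral_cmult_indicator emeasure_eq_measure2 ennreal_mult)
 also have "\<dots> <= (\<integral>\<^sup>+x. (\<Sum>j\<in>{j\<in>I. D j \<subset> D i}. indicator (D j) x) \<partial>lebesgue)"
 proof (intro nn_integral_mono)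
  fix x
  have "(\<Sum>j\<in>{j\<in>I. D j \<subset> D i}. indicator (D j) x) = ennreal (real (N i x))"
   unfolding N_real by (subst sum_ennreal[symmetric]) (auto simp: ennreal_indicator)
  then show "ennreal (real K) * indicator (D i - F i) x <= (\<Sum>j\<in>{j\<in>I. D j \<subset> D i}. indicator (D j) x)"
   by (auto simp: F_def indicator_def intro!: ennreal_leI)
 qed
 also have "\<dots> = (\<Sum>j\<in>{j\<in>I. D j \<subset> D i}. emeasure lebesgue (D j))"
  by (subst nn_integral_sum) auto
 also have "\<dots> = ennreal (\<Sum>j\<in>{j\<in>I. D j \<subset> D i}. ?m (D j))"
  using fm by (subst sum_ennreal[symmetric]) (auto simp: emeasure_eq_measure2 intro!: sum.cong)
 also have "\<dots> <= ennreal (L * ?m (D i))"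
  using fin sub by (intro ennreal_leI order_trans[OF sum_mono2 carl[OF i]]) auto
 finally have "K * ?m (D i - F i) <= L * ?m (D i)"
  using L by (subst (asm) ennreal_le_iff) auto
 moreover have "2 * L * ?m (D i) <= K * ?m (D i)" using K by (intro mult_right_mono) auto
 ultimately have "K * (2 * ?m (D i - F i)) <= K * ?m (D i)" by simp
 then have "2 * ?m (D i - F i) <= ?m (D i)" using K by (simp add: mult_le_cancel_left_pos)
 moreover have "?m (D i - F i) = ?m (D i) - ?m (F i)"
  using fm[OF i] fmF by (intro measurable_measure_Diff) (auto simp: F_def)
 ultimately show ?thesis by simp
qed

text \<open>No measurability of \<open>G\<close> is needed, so \<open>G\<close> may be a power of a maximal function.\<close>

lemma sum_le_nn_integral:
 fixes k1 k2 :: real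
 assumes adm: "adm k1 k2 W g" and k2: "0 < k2" and J: "J \<subseteq> I"
  and a: "!!j. j \<in> J ==> 0 <= a j" "!!j x. j \<in> J ==> x \<in> D j ==> ennreal (a j) <= G x"
 shows "ennreal (\<Sum>j\<in>J. a j * g j) <= ennreal (K / k2) * (\<integral>\<^sup>+x. G x * ennreal (W x) \<partial>lebesgue)"
proof -
 have [measurable]: "W \<in> borel_measurable lebesgue" using adm by (simp add: adm_def)
 have finJ: "finite J" using J fin finite_subset by auto
 have K: "0 < real K" by (simp add: K_def)
 have g: "0 < g j" if "j \<in> J" for j using adm J that by (auto simp: adm_def)
 have [measurable]: "j \<in> J ==> F j \<in> sets lebesgue" for j using J by auto
 have "ennreal (\<Sum>j\<in>J. a j * g j) = (\<Sum>j\<in>J. ennreal (a j * g j))"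
  using a g by (intro sum_ennreal[symmetric] mult_nonneg_nonneg) (auto intro: less_imp_le)
 also have "\<dots> <= (\<Sum>j\<in>J. ennreal (K / k2) * (ennreal (a j / K) * wmeas W (F j)))"
 proof (intro sum_mono)
  fix j assume j: "j \<in> J"
  then have "ennreal (k2 * g j) <= wmeas W (F j)"
   using adm J F_large[of j] F_meas[of j] unfolding adm_def by (auto simp: F_def)
  then have "ennreal (a j / k2) * ennreal (k2 * g j) <= ennreal (a j / k2) * wmeas W (F j)"
   by (intro mult_left_mono) auto
  moreover have "ennreal (a j / k2) * ennreal (k2 * g j) = ennreal (a j * g j)"
   using a g j k2 by (subst ennreal_mult[symmetric]) (auto intro!: less_imp_le)
  moreover have "ennreal (K / k2) * (ennreal (a j / K) * wmeas W (F j)) = ennreal (a j / k2) * wmeas W (F j)"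
   using a j k2 K by (simp add: mult.assoc[symmetric] ennreal_mult[symmetric])
  ultimately show "ennreal (a j * g j) <= ennreal (K / k2) * (ennreal (a j / K) * wmeas W (F j))" by simp
 qed
 also have "\<dots> = ennreal (K / k2) * (\<integral>\<^sup>+x. (\<Sum>j\<in>J. ennreal (a j / K) * (ennreal (W x) * indicator (F j) x)) \<partial>lebesgue)"
  by (simp add: nn_integral_sum nn_integral_cmult wmeas_def sum_distrib_left)
 also have "\<dots> <= ennreal (K / k2) * (\<integral>\<^sup>+x. G x * ennreal (W x) \<partial>lebesgue)"
 proof (intro mult_left_mono nn_integral_mono)
  fix x
  let ?J = "{j\<in>J. x \<in> F j}"
  \<comment> \<open>The members with \<open>x\<close> in their large part have distinct positions,
    all below \<open>K\<close>. Hence the sets \<open>F j\<close> overlap at most \<open>K\<close>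
    times.\<close>
  have c: "card ?J <= K"
  proof -
   have "inj_on (\<lambda>j. N j x) ?J" using N_inj[of x] by (rule inj_on_subset) (use J in \<open>auto simp: F_def\<close>)
   then have "card ?J = card ((\<lambda>j. N j x) ` ?J)" by (simp add: card_image)
   also have "\<dots> <= card {..<K}" by (intro card_mono) (auto simp: F_def)
   finally show ?thesis by simp
  qed
  have "(\<Sum>j\<in>J. ennreal (a j / K) * (ennreal (W x) * indicator (F j) x)) =
    (\<Sum>j\<in>?J. ennreal (a j / K)) * ennreal (W x)"
   using finJ by (simp add: sum_distrib_right sum.inter_filter) (auto intro!: sum.cong simp: indicator_def)
  also have "(\<Sum>j\<in>?J. ennreal (a j / K)) <= (\<Sum>j\<in>?J. ennreal (1 / K) * G x)"
  proof (intro sum_mono)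
   fix j assume j: "j \<in> ?J"
   have "ennreal (a j / K) = ennreal (1 / K) * ennreal (a j)"
    using a j K by (subst ennreal_mult[symmetric]) auto
   also have "\<dots> <= ennreal (1 / K) * G x" using j a by (intro mult_left_mono) (auto simp: F_def)
   finally show "ennreal (a j / K) <= ennreal (1 / K) * G x" .
  qed
  also have "\<dots> = ennreal (card ?J / K) * G x"
   using K by (simp add: mult.assoc[symmetric] ennreal_of_nat_eq_real_of_nat ennreal_mult[symmetric])
  also have "\<dots> <= ennreal 1 * G x"
   using c K by (intro mult_right_mono ennreal_leI) (auto simp: field_simps)
  finally show "(\<Sum>j\<in>J. ennreal (a j / K) * (ennreal (W x) * indicator (F j) x)) <= G x * ennreal (W x)"
   by (simp add: mult_right_mono)
 qed auto
 finally show ?thesis .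
qed

text \<open>The packing condition passes from volume to the weight \<open>W\<close>: test the
  preceding inequality on the indicator of \<open>D i\<close>.\<close>

lemma sum_below_le:
 fixes k1 k2 :: real
 assumes adm: "adm k1 k2 W g" and k: "0 < k1" "0 < k2" and i: "i \<in> I"
 shows "(\<Sum>j\<in>{j\<in>I. D j \<subseteq> D i}. g j) <= K * k1 / k2 * g i"
proof -
 have g: "0 < g i" using adm i by (auto simp: adm_def)
 have "ennreal (\<Sum>j\<in>{j\<in>I. D j \<subseteq> D i}. 1 * g j) <= ennreal (K / k2) * (\<integral>\<^sup>+x. indicator (D i) x * ennreal (W x) \<partial>lebesgue)"
  by (rule sum_le_nn_integral[OF adm k(2)]) (auto simp: indicator_def)
 also have "\<dots> = ennreal (K / k2) * wmeas W (D i)" by (simp add: wmeas_def mult.commute)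
 also have "\<dots> <= ennreal (K / k2) * ennreal (k1 * g i)"
  using adm i by (intro mult_left_mono) (auto simp: adm_def)
 also have "\<dots> = ennreal (K * k1 / k2 * g i)" using k g by (simp add: ennreal_mult[symmetric])
 finally show ?thesis using k g by (simp add: ennreal_le_iff)
qed

text \<open>The John-Nirenberg inequality for the counting function, by induction on the number of
  smaller members. By \<open>pow_N\<close> the integral is \<open>W(D i)\<close> plus
  \<open>l - 1\<close> times the integrals over all smaller members; these are at most
  \<open>2 * k1 * g j\<close>, the packing for \<open>W\<close> sums them, and the bound on
  \<open>l - 1\<close> makes this contribution at most \<open>k1 * g i\<close>.\<close>

lemma exp_integrable:
 fixes k1 k2 :: real
 assumes adm: "adm k1 k2 W g" and k: "0 < k1" "0 < k2" and l: "1 < l" "l <= 1 + k2 / (2 * K * k1)" and i: "i \<in> I"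
 shows "(\<integral>\<^sup>+x\<in>D i. ennreal (l ^ N i x * W x) \<partial>lebesgue) <= ennreal (2 * k1 * g i)"
 using i
proof (induction "card {j\<in>I. D j \<subset> D i}" arbitrary: i rule: less_induct)
 case less
 have [measurable]: "W \<in> borel_measurable lebesgue" and W: "0 <= W x" for x using adm by (auto simp: adm_def)
 have K: "0 < real K" by (simp add: K_def)
 have g: "0 < g j" if "j \<in> I" for j using adm that by (auto simp: adm_def)
 let ?A = "{j\<in>I. D j \<subset> D i}"
 have S0: "0 <= (\<Sum>j\<in>?A. g j)" using g by (intro sum_nonneg) (auto intro: less_imp_le)
 have IH: "(\<integral>\<^sup>+x\<in>D j. ennreal (l ^ N j x * W x) \<partial>lebesgue) <= ennreal (2 * k1 * g j)" if "j \<in> ?A" for j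
  using that fin by (intro less(1) psubset_card_mono) auto
 have [measurable]: "j \<in> ?A ==> D j \<in> sets lebesgue" for j by auto
 have [measurable]: "D i \<in> sets lebesgue" using less by auto
 have "(\<integral>\<^sup>+x\<in>D i. ennreal (l ^ N i x * W x) \<partial>lebesgue) =
   (\<integral>\<^sup>+x. ennreal (W x) * indicator (D i) x + ennreal (l - 1) * (\<Sum>j\<in>?A. ennreal (l ^ N j x * W x) * indicator (D j) x) \<partial>lebesgue)"
 proof (intro nn_integral_cong)
  fix x
  show "ennreal (l ^ N i x * W x) * indicator (D i) x = ennreal (W x) * indicator (D i) x + ennreal (l - 1) * (\<Sum>j\<in>?A. ennreal (l ^ N j x * W x) * indicator (D j) x)"
  proof (cases "x \<in> D i")
   case True
   have *: "(\<Sum>j\<in>?A. ennreal (l ^ N j x * W x) * indicator (D j) x) = ennreal (\<Sum>j\<in>?A. l ^ N j x * W x * indicator (D j) x)"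
    using W l by (subst sum_ennreal[symmetric]) (auto simp: ennreal_mult ennreal_indicator)
   have "l ^ N i x * W x = W x + (l - 1) * (\<Sum>j\<in>?A. l ^ N j x * W x * indicator (D j) x)"
    unfolding pow_N[OF less(2) True] by (simp add: algebra_simps sum_distrib_left sum_distrib_right)
   then show ?thesis using True W l unfolding *
    by (simp add: ennreal_mult[symmetric] ennreal_plus[symmetric] sum_nonneg del: ennreal_plus)
  next
   case False
   then have "indicator (D j) x = (0::ennreal)" if "j \<in> ?A" for j using that by (auto simp: indicator_def)
   then show ?thesis using False by simp
  qed
 qed
 also have "\<dots> = wmeas W (D i) + ennreal (l - 1) * (\<Sum>j\<in>?A. (\<integral>\<^sup>+x\<in>D j. ennreal (l ^ N j x * W x) \<partial>lebesgue))"
  using l by (simp add: nn_integral_add nn_integral_cmult nn_integral_sum wmeas_def)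
 also have "\<dots> <= ennreal (k1 * g i) + ennreal (l - 1) * (\<Sum>j\<in>?A. ennreal (2 * k1 * g j))"
  using adm less(2) IH by (intro add_mono mult_left_mono sum_mono) (auto simp: adm_def)
 also have "(\<Sum>j\<in>?A. ennreal (2 * k1 * g j)) = ennreal (2 * k1 * (\<Sum>j\<in>?A. g j))"
  using k g by (subst sum_ennreal) (auto simp: less_imp_le sum_distrib_left)
 also have "ennreal (k1 * g i) + ennreal (l - 1) * \<dots> = ennreal (k1 * g i + (l - 1) * (2 * k1 * (\<Sum>j\<in>?A. g j)))"
  using k l g less(2) S0 by (simp add: ennreal_mult[symmetric] ennreal_plus[symmetric] less_imp_le del: ennreal_plus)
 also have "\<dots> <= ennreal (2 * k1 * g i)"
 proof (intro ennreal_leI)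
  have "(\<Sum>j\<in>?A. g j) <= (\<Sum>j\<in>{j\<in>I. D j \<subseteq> D i}. g j)"
   using fin g by (intro sum_mono2) (auto intro: less_imp_le)
  also have "\<dots> <= K * k1 / k2 * g i" by (rule sum_below_le[OF adm k less(2)])
  finally have "(l - 1) * (2 * k1 * (\<Sum>j\<in>?A. g j)) <= (k2 / (2 * K * k1)) * (2 * k1 * (K * k1 / k2 * g i))"
   using l k g S0 by (intro mult_mono mult_left_mono) auto
  also have "\<dots> = k1 * g i" using k K by (simp add: field_simps)
  finally show "k1 * g i + (l - 1) * (2 * k1 * (\<Sum>j\<in>?A. g j)) <= 2 * k1 * g i" by simp
 qed
 finally show ?case .
qed

text \<open>On \<open>D j\<close> the generation \<open>gen j i\<close> is at most
  \<open>N i\<close>, so all the weights are dominated by the one function \<open>l ^ N i\<close>,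
  and the packing sum turns into an exponential integral.\<close>

lemma sum_gen_le:
 fixes k1 k2 :: real
 assumes adm: "adm k1 k2 W g" and k: "0 < k1" "0 < k2" and l: "1 < l" "l <= 1 + k2 / (2 * K * k1)" and i: "i \<in> I"
 shows "(\<Sum>j\<in>{j\<in>I. D j \<subseteq> D i}. l ^ gen j i * g j) <= 2 * K * k1 / k2 * g i"
proof -
 have W: "0 <= W x" for x using adm by (auto simp: adm_def)
 have g: "0 < g i" using adm i by (auto simp: adm_def)
 have "ennreal (\<Sum>j\<in>{j\<in>I. D j \<subseteq> D i}. l ^ gen j i * g j) \<le>
   ennreal (K / k2) * (\<integral>\<^sup>+x. ennreal (l ^ N i x) * indicator (D i) x * ennreal (W x) \<partial>lebesgue)"
 proof (rule sum_le_nn_integral[OF adm k(2)])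
  fix j x assume j: "j \<in> {j\<in>I. D j \<subseteq> D i}" "x \<in> D j"
  have "l ^ gen j i <= l ^ N i x" using N_split[of j i x] j i l by (intro power_increasing) auto
  then show "ennreal (l ^ gen j i) <= ennreal (l ^ N i x) * indicator (D i) x"
   using j by (auto simp: indicator_def intro!: ennreal_leI)
 qed (use l in auto)
 also have "(\<integral>\<^sup>+x. ennreal (l ^ N i x) * indicator (D i) x * ennreal (W x) \<partial>lebesgue) = (\<integral>\<^sup>+x\<in>D i. ennreal (l ^ N i x * W x) \<partial>lebesgue)"
  using l W by (intro nn_integral_cong) (auto simp: ennreal_mult indicator_def)
 also have "\<dots> <= ennreal (2 * k1 * g i)" by (rule exp_integrable[OF adm k l i])
 also have "ennreal (K / k2) * ennreal (2 * k1 * g i) = ennreal (2 * K * k1 / k2 * g i)"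
  using k g by (simp add: ennreal_mult[symmetric] mult_ac)
 finally show ?thesis using k g by (simp add: ennreal_le_iff mult_left_mono)
qed

end

section \<open>Weighted norms of chain sums\<close>

context laminar
begin

text \<open>With \<open>h\<close> the mean oscillations of \<open>b\<close> on an adapted family,
  this is the pointwise majorant of \<open>|b - c_i|\<close> on \<open>D i\<close>.\<close>

definition U :: "('i => real) => 'i => real ^ 'n => real"
 where "U h i x = (\<Sum>j\<in>{j\<in>I. D j \<subseteq> D i}. h j * indicator (D j) x)"

lemma U_eq: "U h i x = (\<Sum>j\<in>{j\<in>I. x \<in> D j \<and> D j \<subseteq> D i}. h j)"
 unfolding U_def using fin by (subst sum_indicator_filter) (auto intro: sum.cong)

lemma U_measurable [measurable]: "U h i \<in> borel_measurable lebesgue"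
 unfolding U_def by (intro borel_measurable_sum borel_measurable_times borel_measurable_indicator) auto

lemma U_pos: "i \<in> I ==> x \<in> D i ==> (!!i. i \<in> I ==> 0 < h i) ==> 0 < U h i x"
 unfolding U_eq using fin by (intro sum_pos) auto

text \<open>The members above \<open>D j\<close> form a chain. Geometric weights in the generation
  are thus summable over all members above a fixed one.\<close>

lemma gen_inj: assumes "j \<in> I" shows "inj_on (gen j) {i\<in>I. D j \<subseteq> D i}"
proof -
 have "D j \<noteq> {}" using pos[OF assms] by auto
 then obtain x where x: "x \<in> D j" by auto
 show ?thesis
 proof (rule inj_onI)
  fix i k assume ik: "i \<in> {i\<in>I. D j \<subseteq> D i}" "k \<in> {i\<in>I. D j \<subseteq> D i}" "gen j i = gen j k"
  then have "N i x = N k x" using N_split[of j i x] N_split[of j k x] assms x by auto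
  then show "i = k" using N_inj[of x] ik x by (auto dest: inj_onD)
 qed
qed

definition chain_sum_const :: "real => real => real => real => real => real => real"
 where "chain_sum_const l k1 k2 k3 n \<kappa> = chain_const n l * (2 * k1) * k3 * (2 * real K * k1 / k2) powr \<kappa>"

text \<open>
 The local weighted norm of the chain sum \<open>U\<close>.  The bounds \<open>B' i\<close> carry geometrically decaying
 weights, which is what makes them summable in \<open>i\<close> although the sets \<open>D i\<close> overlap.
\<close>

lemma chain_sum_norm:
 fixes k1 k2 k3 n \<kappa> l e B :: real
 assumes admW: "adm k1 k2 W gW" and admM: "adm k1 k2 M gM" and k: "0 < k1" "0 < k2" "0 < k3"
  and n: "0 < n" "0 < \<kappa>" "\<kappa> = 1 - n * e"
  and l: "1 < l" "l * l <= 1 + k2 / (2 * K * k1)" "l powr ((1 + n * \<bar>e\<bar>) / \<kappa>) <= 1 + k2 / (2 * K * k1)"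
  and h: "!!i. i \<in> I ==> 0 < h i" "!!i. i \<in> I ==> 0 < \<beta> i" "0 < B"
   "!!i. i \<in> I ==> h i powr n * gW i <= k3 * (\<beta> i powr n * gM i powr \<kappa>)"
  and le: "lnorm_le e I \<beta> B"
 shows "\<exists>B'. (\<forall>i\<in>I. 0 < B' i) \<and> lnorm_le e I B' ((1 / (1 - 1 / l)) powr \<bar>e\<bar> * B) \<and>
  (\<forall>i\<in>I. (\<integral>\<^sup>+x\<in>D i. ennreal (l ^ N i x * U h i x powr n * W x) \<partial>lebesgue)
    <= ennreal (chain_sum_const l k1 k2 k3 n \<kappa> * (B' i powr n * gM i powr \<kappa>)))"
proof -
 define S where "S i = {j\<in>I. D j \<subseteq> D i}" for i
 have S: "finite (S i)" "S i \<subseteq> I" "i \<in> I ==> i \<in> S i" for i using fin by (auto simp: S_def)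
 have [measurable]: "W \<in> borel_measurable lebesgue" and W: "0 <= W x" for x using admW by (auto simp: adm_def)
 have K: "0 < real K" by (simp add: K_def)
 have gM: "0 < gM j" and gW: "0 < gW j" if "j \<in> I" for j using admM admW that by (auto simp: adm_def)
 have \<beta>p: "0 < \<beta> j" if "j \<in> S i" for i j using that h(2) S(2) by blast
 \<comment> \<open>For \<open>e > 0\<close> every \<open>\<beta> j\<close> is distributed over the
   members above it with weights decaying in the generation. Exchanging the two sums shows that the
   norm grows only by the sum of a geometric series.\<close>
 define B' where "B' i = (if 0 < e then (\<Sum>j\<in>S i. (1 / l) ^ gen j i * \<beta> j powr (1 / e)) powr e else B)" for i
 have sump: "0 < (\<Sum>j\<in>S i. (1 / l) ^ gen j i * \<beta> j powr (1 / e))" if "i \<in> I" for i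
 proof (rule sum_pos)
  fix j assume "j \<in> S i"
  then show "0 < (1 / l) ^ gen j i * \<beta> j powr (1 / e)"
   using \<beta>p[of j i] l by (intro mult_pos_pos) auto
 qed (use S(1) S(3)[OF that] in auto)
 have B': "0 < B' i" if "i \<in> I" for i
  using sump[OF that] h(3) by (auto simp: B'_def)
 have il: "0 < 1 / l" "1 / l < 1" using l by auto
 have c1: "1 <= 1 / (1 - 1 / l)" using l by (simp add: field_simps)
 have B'le: "lnorm_le e I B' ((1 / (1 - 1 / l)) powr \<bar>e\<bar> * B)"
 proof (cases "0 < e")
  case True
  have "(\<Sum>i\<in>I. B' i powr (1 / e)) = (\<Sum>i\<in>I. \<Sum>j\<in>S i. (1 / l) ^ gen j i * \<beta> j powr (1 / e))"
   using True sump by (intro sum.cong) (auto simp: B'_def powr_powr less_imp_le)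
  also have "\<dots> = (\<Sum>j\<in>I. \<Sum>i\<in>{i\<in>I. D j \<subseteq> D i}. (1 / l) ^ gen j i * \<beta> j powr (1 / e))"
   unfolding S_def using fin by (rule sum.swap_restrict) (use fin in auto)
  also have "\<dots> <= (\<Sum>j\<in>I. 1 / (1 - 1 / l) * \<beta> j powr (1 / e))"
  proof (intro sum_mono)
   fix j assume j: "j \<in> I"
   have "(\<Sum>i\<in>{i\<in>I. D j \<subseteq> D i}. (1 / l) ^ gen j i) <= 1 / (1 - 1 / l)"
    using fin il by (intro geometric_sum_inj_le gen_inj j) auto
   then show "(\<Sum>i\<in>{i\<in>I. D j \<subseteq> D i}. (1 / l) ^ gen j i * \<beta> j powr (1 / e)) <= 1 / (1 - 1 / l) * \<beta> j powr (1 / e)"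
    unfolding sum_distrib_right[symmetric] by (intro mult_right_mono) auto
  qed
  also have "\<dots> <= 1 / (1 - 1 / l) * B powr (1 / e)"
   using le True l unfolding sum_distrib_left[symmetric] by (intro mult_left_mono) (auto simp: lnorm_le_def)
  also have "\<dots> = ((1 / (1 - 1 / l)) powr \<bar>e\<bar> * B) powr (1 / e)"
   using True h c1 il by (simp add: powr_mult powr_powr)
  finally show ?thesis using True by (simp add: lnorm_le_def)
 next
  case False
  then have "1 <= (1 / (1 - 1 / l)) powr \<bar>e\<bar>" using c1 by (intro ge_one_powr_ge_zero) auto
  then have "B <= (1 / (1 - 1 / l)) powr \<bar>e\<bar> * B" using h by simp
  then show ?thesis using False by (simp add: lnorm_le_def B'_def)
 qed
 have main: "(\<integral>\<^sup>+x\<in>D i. ennreal (l ^ N i x * U h i x powr n * W x) \<partial>lebesgue)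
    <= ennreal (chain_sum_const l k1 k2 k3 n \<kappa> * (B' i powr n * gM i powr \<kappa>))" if i: "i \<in> I" for i
 proof -
  let ?cc = "chain_const n l"
  have cc: "0 < ?cc" using l n by (simp add: chain_const_pos)
  have [measurable]: "j \<in> S i ==> D j \<in> sets lebesgue" for j by (simp add: S_def)
  have "(\<integral>\<^sup>+x\<in>D i. ennreal (l ^ N i x * U h i x powr n * W x) \<partial>lebesgue) \<le>
   (\<integral>\<^sup>+x. (\<Sum>j\<in>S i. ennreal (?cc * l ^ gen j i * h j powr n) * (ennreal ((l * l) ^ N j x * W x) * indicator (D j) x)) \<partial>lebesgue)"
  proof (intro nn_integral_mono)
   fix x
   show "ennreal (l ^ N i x * U h i x powr n * W x) * indicator (D i) x <= (\<Sum>j\<in>S i. ennreal (?cc * l ^ gen j i * h j powr n) * (ennreal ((l * l) ^ N j x * W x) * indicator (D j) x))"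
   proof (cases "x \<in> D i")
    case True
    let ?A = "{j\<in>I. x \<in> D j \<and> D j \<subseteq> D i}"
    \<comment> \<open>The chain inequality brings in \<open>l ^ N j x\<close>. The factor
      \<open>l ^ N i x\<close> splits into \<open>l ^ gen j i\<close> and another
      \<open>l ^ N j x\<close>; this is why exponential integrability is needed at the rate
      \<open>l * l\<close>.\<close>
    have "U h i x powr n <= ?cc * (\<Sum>j\<in>?A. l ^ N j x * h j powr n)"
     unfolding U_eq using fin l n N_inj[of x] h
     by (intro powr_sum_le_chain) (auto intro: inj_on_subset less_imp_le)
    then have "l ^ N i x * U h i x powr n * W x <= l ^ N i x * (?cc * (\<Sum>j\<in>?A. l ^ N j x * h j powr n)) * W x"
     using l W by (intro mult_right_mono mult_left_mono) auto
    also have "\<dots> = (\<Sum>j\<in>?A. ?cc * l ^ gen j i * h j powr n * ((l * l) ^ N j x * W x))"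
     unfolding sum_distrib_left sum_distrib_right
    proof (intro sum.cong refl)
     fix j assume "j \<in> ?A"
     then have "N i x = gen j i + N j x" using N_split[of j i x] i by auto
     then show "l ^ N i x * (?cc * (l ^ N j x * h j powr n)) * W x = ?cc * l ^ gen j i * h j powr n * ((l * l) ^ N j x * W x)"
     by (simp add: power_add power_mult_distrib)
    qed
    also have "?A = {j\<in>S i. x \<in> D j}" by (auto simp: S_def)
    also have "(\<Sum>j\<in>{j\<in>S i. x \<in> D j}. ?cc * l ^ gen j i * h j powr n * ((l * l) ^ N j x * W x)) =
     (\<Sum>j\<in>S i. ?cc * l ^ gen j i * h j powr n * ((l * l) ^ N j x * W x) * indicator (D j) x)"
     using S by (subst sum_indicator_filter) auto
    finally have "ennreal (l ^ N i x * U h i x powr n * W x) <= ennreal (\<Sum>j\<in>S i. ?cc * l ^ gen j i * h j powr n * ((l * l) ^ N j x * W x) * indicator (D j) x)"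
     by (rule ennreal_leI)
    also have "\<dots> = (\<Sum>j\<in>S i. ennreal (?cc * l ^ gen j i * h j powr n * ((l * l) ^ N j x * W x) * indicator (D j) x))"
     using cc l W by (intro sum_ennreal[symmetric]) auto
    also have "\<dots> = (\<Sum>j\<in>S i. ennreal (?cc * l ^ gen j i * h j powr n) * (ennreal ((l * l) ^ N j x * W x) * indicator (D j) x))"
    proof (intro sum.cong refl)
     fix j
     show "ennreal (?cc * l ^ gen j i * h j powr n * ((l * l) ^ N j x * W x) * indicator (D j) x) = ennreal (?cc * l ^ gen j i * h j powr n) * (ennreal ((l * l) ^ N j x * W x) * indicator (D j) x)"
     using cc l W by (cases "x \<in> D j") (simp_all add: ennreal_mult)
    qed
    finally show ?thesis using True by simp
   qed simp
  qed
  also have "\<dots> = (\<Sum>j\<in>S i. ennreal (?cc * l ^ gen j i * h j powr n) * (\<integral>\<^sup>+x\<in>D j. ennreal ((l * l) ^ N j x * W x) \<partial>lebesgue))"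
   using l by (subst nn_integral_sum) (auto simp: nn_integral_cmult)
  also have "\<dots> <= (\<Sum>j\<in>S i. ennreal (?cc * l ^ gen j i * h j powr n) * ennreal (2 * k1 * gW j))"
   using l S by (intro sum_mono mult_left_mono exp_integrable[OF admW k(1,2)]) (auto intro: less_1_mult)
  also have "\<dots> = (\<Sum>j\<in>S i. ennreal (?cc * l ^ gen j i * (2 * k1) * (h j powr n * gW j)))"
  proof (intro sum.cong refl)
   fix j assume "j \<in> S i"
   then have "0 < gW j" using gW S by auto
   then have "ennreal (?cc * l ^ gen j i * h j powr n) * ennreal (2 * k1 * gW j) = ennreal ((?cc * l ^ gen j i * h j powr n) * (2 * k1 * gW j))"
    using cc l k by (intro ennreal_mult[symmetric]) auto
   then show "ennreal (?cc * l ^ gen j i * h j powr n) * ennreal (2 * k1 * gW j) = ennreal (?cc * l ^ gen j i * (2 * k1) * (h j powr n * gW j))"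
    by (simp only: mult_ac)
  qed
  also have "\<dots> = ennreal (\<Sum>j\<in>S i. ?cc * l ^ gen j i * (2 * k1) * (h j powr n * gW j))"
  proof (rule sum_ennreal)
   fix j assume "j \<in> S i"
   then have "0 < gW j" using gW S by auto
   then show "0 <= ?cc * l ^ gen j i * (2 * k1) * (h j powr n * gW j)" using cc l k by auto
  qed
  also have "\<dots> <= ennreal (\<Sum>j\<in>S i. ?cc * l ^ gen j i * (2 * k1) * (k3 * (\<beta> j powr n * gM j powr \<kappa>)))"
   using cc l k by (intro ennreal_leI sum_mono mult_left_mono h(4)) (auto simp: S_def)
  also have "(\<Sum>j\<in>S i. ?cc * l ^ gen j i * (2 * k1) * (k3 * (\<beta> j powr n * gM j powr \<kappa>))) =
   ?cc * (2 * k1) * k3 * (\<Sum>j\<in>S i. l ^ gen j i * (\<beta> j powr n * gM j powr \<kappa>))"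
   by (simp add: sum_distrib_left mult_ac)
  also have "(\<Sum>j\<in>S i. l ^ gen j i * (\<beta> j powr n * gM j powr \<kappa>)) <= B' i powr n * (2 * K * k1 / k2 * gM i) powr \<kappa>"
  proof -
   \<comment> \<open>The growing factor \<open>l ^ gen j i\<close> is split between the two
     sequences of Hoelder's inequality. The decay in \<open>b\<close> brings its norm down to
     \<open>B' i\<close>, and the compensating growth is put into \<open>y\<close>, where it becomes
     the rate \<open>l powr ((1 + n * \<bar>e\<bar>) / \<kappa>)\<close> of
     \<open>sum_gen_le\<close>.\<close>
   define b where "b j = \<beta> j * l powr (- \<bar>e\<bar> * gen j i)" for j
   define y where "y j = l powr ((1 + n * \<bar>e\<bar>) * gen j i) * gM j powr \<kappa>" for j
   let ?c = "(1 + n * \<bar>e\<bar>) / \<kappa>"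
   have ly: "y j powr (1 / \<kappa>) = (l powr ?c) ^ gen j i * gM j" if "j \<in> S i" for j
    using n l gM S that by (auto simp: y_def powr_mult powr_powr powr_realpow[symmetric] subset_iff less_imp_le)
   have "(\<Sum>j\<in>S i. l ^ gen j i * (\<beta> j powr n * gM j powr \<kappa>)) = (\<Sum>j\<in>S i. (y j * b j powr n) powr 1)"
   proof (intro sum.cong refl)
    fix j assume "j \<in> S i"
    then have j: "j \<in> I" using S by auto
    have "y j * b j powr n = (l powr ((1 + n * \<bar>e\<bar>) * gen j i) * l powr (- (n * \<bar>e\<bar> * gen j i))) * (\<beta> j powr n * gM j powr \<kappa>)"
     using h j l by (simp add: y_def b_def powr_mult powr_powr mult_ac)
    also have "l powr ((1 + n * \<bar>e\<bar>) * gen j i) * l powr (- (n * \<bar>e\<bar> * gen j i)) = l ^ gen j i"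
     using l by (simp add: powr_add[symmetric] powr_realpow[symmetric] algebra_simps)
    finally show "l ^ gen j i * (\<beta> j powr n * gM j powr \<kappa>) = (y j * b j powr n) powr 1"
     using l by simp
   qed
   \<comment> \<open>The exponents match because \<open>1 = \<kappa> + n * e\<close>.\<close>
   also have "\<dots> <= B' i powr (n * 1) * (\<Sum>j\<in>S i. y j powr (1 / \<kappa>)) powr (1 / (1 / \<kappa>))"
   proof (rule sum_lnorm_Hoelder)
    show "lnorm_le e (S i) b (B' i)"
    proof (cases "0 < e")
     case True
     have "(\<Sum>j\<in>S i. b j powr (1 / e)) = (\<Sum>j\<in>S i. (1 / l) ^ gen j i * \<beta> j powr (1 / e))"
     proof (intro sum.cong refl)
     fix j assume "j \<in> S i"
     then have "0 < \<beta> j" by (rule \<beta>p)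
     then have "b j powr (1 / e) = \<beta> j powr (1 / e) * l powr (- real (gen j i))"
     using True l by (simp add: b_def powr_mult powr_powr)
     also have "l powr (- real (gen j i)) = (1 / l) ^ gen j i"
     using l powr_realpow[of l "gen j i"] powr_minus[of l "gen j i"] power_one_over[of l "gen j i"]
     by (simp only: inverse_eq_divide)
     finally show "b j powr (1 / e) = (1 / l) ^ gen j i * \<beta> j powr (1 / e)" by simp
     qed
     also have "\<dots> = B' i powr (1 / e)"
     using True less_imp_le[OF sump[OF i]] unfolding B'_def if_P[OF True] powr_powr by simp
     finally show ?thesis using True by (simp add: lnorm_le_def)
    next
     case False
     have "b j <= B" if "j \<in> S i" for j
     proof -
     have "j \<in> I" using S that by auto
     have "l powr (- \<bar>e\<bar> * gen j i) <= l powr 0" using l by (intro powr_mono) auto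
     then have "b j <= \<beta> j * 1" unfolding b_def using h(2)[OF \<open>j \<in> I\<close>] l by (intro mult_left_mono) auto
     also have "\<dots> <= B" using le False \<open>j \<in> I\<close> by (simp add: lnorm_le_def)
     finally show ?thesis .
     qed
     then show ?thesis using False by (simp add: lnorm_le_def B'_def)
    qed
    show "0 < b j" if "j \<in> S i" for j using \<beta>p[OF that] l by (simp add: b_def)
   qed (use n B'[OF i] S in \<open>auto simp: y_def\<close>)
   also have "(\<Sum>j\<in>S i. y j powr (1 / \<kappa>)) = (\<Sum>j\<in>{j\<in>I. D j \<subseteq> D i}. (l powr ?c) ^ gen j i * gM j)"
    using ly by (simp add: S_def)
   also have "B' i powr (n * 1) * (\<Sum>j\<in>{j\<in>I. D j \<subseteq> D i}. (l powr ?c) ^ gen j i * gM j) powr (1 / (1 / \<kappa>)) \<le>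
     B' i powr n * (2 * K * k1 / k2 * gM i) powr \<kappa>"
   proof -
    have "(\<Sum>j\<in>{j\<in>I. D j \<subseteq> D i}. (l powr ?c) ^ gen j i * gM j) <= 2 * K * k1 / k2 * gM i"
     using l n by (intro sum_gen_le[OF admM k(1,2) _ _ i]) (auto simp: add_pos_nonneg)
    moreover have "0 <= (\<Sum>j\<in>{j\<in>I. D j \<subseteq> D i}. (l powr ?c) ^ gen j i * gM j)"
     using gM by (intro sum_nonneg mult_nonneg_nonneg) (auto intro: less_imp_le)
    moreover have "1 / (1 / \<kappa>) = \<kappa>" by simp
    ultimately show ?thesis using n(2) by (auto intro!: mult_left_mono powr_mono2)
   qed
   finally show ?thesis .
  qed
  also have "?cc * (2 * k1) * k3 * (B' i powr n * (2 * K * k1 / k2 * gM i) powr \<kappa>) = chain_sum_const l k1 k2 k3 n \<kappa> * (B' i powr n * gM i powr \<kappa>)"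
  proof -
   have "(2 * K * k1 / k2 * gM i) powr \<kappa> = (2 * K * k1 / k2) powr \<kappa> * gM i powr \<kappa>"
    by (rule powr_mult)
   then show ?thesis by (simp add: chain_sum_const_def mult_ac)
  qed
  finally show ?thesis using cc k by (simp add: ennreal_leI mult_left_mono)
 qed
 show ?thesis by (intro exI[of _ B'] conjI ballI B' B'le main)
qed

definition sparse_const :: "real => real => real => real => real => real => real => real => real => real => real"
 where "sparse_const l k1 k2 k3 n \<kappa> e q t s =
  chain_const q (l powr (1 / t)) * (chain_sum_const l k1 k2 k3 n \<kappa> powr s * (2 * k1) powr (1 - s)) powr (1 / t)
   * ((1 / (1 - 1 / l)) powr \<bar>e\<bar>) powr (n * s / t)"

text \<open>
 The functions \<open>h i\<close> enter only through the duality form of an \<open>L\<^sup>s\<close> bound, which also covers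
 \<open>s = \<infinity>\<close>; there \<open>t\<close> is the conjugate exponent of \<open>s / q\<close>.
\<close>

lemma sparse_sum_norm:
 fixes k1 k2 k3 n \<kappa> l e B q t s v :: real
 assumes admW: "adm k1 k2 (\<lambda>x. w x powr t) gW" and admM: "adm k1 k2 M gM" and k: "0 < k1" "0 < k2" "0 < k3"
  and w: "w \<in> borel_measurable lebesgue" "!!x. 0 <= w x"
  and n: "0 < n" "0 < \<kappa>" "\<kappa> = 1 - n * e"
  and l: "1 < l" "l * l <= 1 + k2 / (2 * K * k1)" "l powr ((1 + n * \<bar>e\<bar>) / \<kappa>) <= 1 + k2 / (2 * K * k1)"
  and h: "!!i. i \<in> I ==> 0 < h i" "!!i. i \<in> I ==> 0 < \<beta> i" "0 < B"
   "!!i. i \<in> I ==> h i powr n * gW i <= k3 * (\<beta> i powr n * gM i powr \<kappa>)"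
  and le: "lnorm_le e I \<beta> B"
  and q: "0 < q" "1 <= t" "0 < v" "0 <= s" "s <= 1" "1 / q = 1 / v + n * s / (q * t) * e"
  and J: "J \<subseteq> I"
  and f: "!!i. i \<in> J ==> f i \<in> borel_measurable lebesgue" "!!i x. i \<in> J ==> 0 <= f i x" "!!i. i \<in> J ==> 0 <= a i"
   "!!i G A. i \<in> J ==> G \<in> borel_measurable lebesgue ==> (!!x. 0 <= G x) ==> 0 <= A ==>
    (\<integral>\<^sup>+x\<in>D i. ennreal (G x powr t) \<partial>lebesgue) <= ennreal A ==>
    (\<integral>\<^sup>+x\<in>D i. ennreal (G x * f i x powr q) \<partial>lebesgue) \<le>
     ennreal (a i powr q * vol (D i) powr (1 - 1 / t) * A powr (1 / t))"
 shows "(\<integral>\<^sup>+x. ennreal ((\<Sum>i\<in>J. U h i x powr (n * s / (q * t)) * f i x * indicator (D i) x) powr q * w x) \<partial>lebesgue)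
  <= ennreal (sparse_const l k1 k2 k3 n \<kappa> e q t s * B powr (n * s / t) *
    (\<Sum>i\<in>J. (a i * (vol (D i) powr (1 - 1 / t) *
     ((gM i powr \<kappa>) powr s * gW i powr (1 - s)) powr (1 / t)) powr (1 / q)) powr v) powr (q / v))"
proof -
 note [measurable] = w(1)
 have K: "0 < real K" by (simp add: K_def)
 have finJ: "finite J" using J fin finite_subset by auto
 have gM: "0 < gM j" and gW: "0 < gW j" if "j \<in> I" for j using admM admW that by (auto simp: adm_def)
 obtain B' where B': "!!i. i \<in> I ==> 0 < B' i" "lnorm_le e I B' ((1 / (1 - 1 / l)) powr \<bar>e\<bar> * B)"
  and B'U: "!!i. i \<in> I ==> (\<integral>\<^sup>+x\<in>D i. ennreal (l ^ N i x * U h i x powr n * w x powr t) \<partial>lebesgue)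
    <= ennreal (chain_sum_const l k1 k2 k3 n \<kappa> * (B' i powr n * gM i powr \<kappa>))"
  using chain_sum_norm[OF admW admM k n l h le] by blast
 let ?\<theta> = "n * s / (q * t)"
 let ?l = "l powr (1 / t)"
 have l': "1 < ?l" using l q by simp
 let ?cc = "chain_const q ?l"
 have cc: "0 < ?cc" using l' q by (simp add: chain_const_pos)
 let ?c1 = "chain_sum_const l k1 k2 k3 n \<kappa>"
 have c1: "0 < ?c1" using k K l n chain_const_pos[of l n] by (auto simp: chain_sum_const_def)
 define A where "A i = (?c1 * (B' i powr n * gM i powr \<kappa>)) powr s * (2 * k1 * gW i) powr (1 - s)" for i
 define Z where "Z i = (vol (D i) powr (1 - 1 / t) *
     ((gM i powr \<kappa>) powr s * gW i powr (1 - s)) powr (1 / t)) powr (1 / q)" for i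
 \<comment> \<open>The function against which the \<open>q\<close>-th power of \<open>f i\<close> is
   tested. Its \<open>t\<close>-th power is \<open>l ^ N i\<close> times
   \<open>U powr (n * s)\<close> times \<open>w powr t\<close>, a geometric mean of the two
   functions with known integrals: \<open>l ^ N i * w powr t\<close> with and without the factor
   \<open>U powr n\<close>. The rate \<open>l powr (1 / t)\<close> is chosen to become
   \<open>l\<close> here.\<close>
 let ?G = "\<lambda>i x. ?l ^ N i x * U h i x powr (?\<theta> * q) * w x"
 have [measurable]: "i \<in> J ==> D i \<in> sets lebesgue" "i \<in> J ==> f i \<in> borel_measurable lebesgue" for i using J f by auto
 have Gm[measurable]: "?G i \<in> borel_measurable lebesgue" for i
  using l' by (intro borel_measurable_times powN_measurable powr_real_measurable U_measurable w) auto
 have U0: "0 <= U h i x" for i x unfolding U_eq using h by (intro sum_nonneg) (auto intro: less_imp_le)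
 have step: "(\<integral>\<^sup>+x\<in>D i. ennreal (?G i x * f i x powr q) \<partial>lebesgue) \<le>
  ennreal (a i powr q * vol (D i) powr (1 - 1 / t) * A i powr (1 / t))" if i: "i \<in> J" for i
 proof (rule f(4)[OF i Gm])
  have iI: "i \<in> I" using i J by auto
  have "(\<integral>\<^sup>+x\<in>D i. ennreal (?G i x powr t) \<partial>lebesgue) =
    (\<integral>\<^sup>+x\<in>D i. ennreal ((l ^ N i x * U h i x powr n * w x powr t) powr s * (l ^ N i x * w x powr t) powr (1 - s)) \<partial>lebesgue)"
  proof (intro nn_integral_cong)
   fix x
   show "ennreal (?G i x powr t) * indicator (D i) x = ennreal ((l ^ N i x * U h i x powr n * w x powr t) powr s * (l ^ N i x * w x powr t) powr (1 - s)) * indicator (D i) x"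
   proof (cases "x \<in> D i \<and> w x \<noteq> 0")
    case True
    then have Up: "0 < U h i x" and wp: "0 < w x" using U_pos[of i x h] iI h w(2)[of x] by (auto simp: less_le)
    have "(?l ^ N i x) powr t = l ^ N i x"
     using l q by (simp add: powr_realpow[symmetric] powr_powr)
    then have "?G i x powr t = l ^ N i x * U h i x powr (n * s) * w x powr t"
     using l q Up wp by (simp add: powr_mult powr_powr)
    moreover have "(l ^ N i x * U h i x powr n * w x powr t) powr s * (l ^ N i x * w x powr t) powr (1 - s) =
     ((l ^ N i x) powr s * (l ^ N i x) powr (1 - s)) * U h i x powr (n * s) * ((w x powr t) powr s * (w x powr t) powr (1 - s))"
     using l Up wp by (simp add: powr_mult powr_powr)
    ultimately show ?thesis using l wp by (simp add: powr_one_minus)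
   qed auto
  qed
  also have "\<dots> <= ennreal (A i)" unfolding A_def
  proof (rule set_nn_integral_Hoelder)
   show "(\<integral>\<^sup>+x\<in>D i. ennreal (l ^ N i x * w x powr t) \<partial>lebesgue) <= ennreal (2 * k1 * gW i)"
   proof (rule exp_integrable[OF admW k(1,2) l(1) _ iI])
    have "l * 1 <= l * l" using l by (intro mult_left_mono) auto
    then show "l <= 1 + k2 / (2 * K * k1)" using l(2) by simp
   qed
  qed (use B'U[OF iI] B'(1)[OF iI] c1 k gW[OF iI] gM[OF iI] q l i in auto)
  finally show "(\<integral>\<^sup>+x\<in>D i. ennreal (?G i x powr t) \<partial>lebesgue) <= ennreal (A i)" .
 qed (use l' w in \<open>auto simp: A_def\<close>)
 let ?c2 = "(?c1 powr s * (2 * k1) powr (1 - s)) powr (1 / t)"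
 have AZ: "a i powr q * vol (D i) powr (1 - 1 / t) * A i powr (1 / t) =
  ?c2 * (a i * Z i * B' i powr ?\<theta>) powr q" if i: "i \<in> J" for i
 proof -
  have iI: "i \<in> I" using i J by auto
  let ?Y = "(gM i powr \<kappa>) powr s * gW i powr (1 - s)"
  have "A i = (?c1 powr s * (2 * k1) powr (1 - s)) * (B' i powr (n * s)) * ?Y"
   using c1 k B'(1)[OF iI] gM[OF iI] gW[OF iI] by (simp add: A_def powr_mult powr_powr)
  then have "A i powr (1 / t) = ?c2 * B' i powr (n * s / t) * ?Y powr (1 / t)"
   using c1 k B'(1)[OF iI] gM[OF iI] gW[OF iI] by (simp add: powr_mult powr_powr)
  moreover have "(a i * Z i * B' i powr ?\<theta>) powr q = a i powr q * (vol (D i) powr (1 - 1 / t) * ?Y powr (1 / t)) * B' i powr (n * s / t)"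
   using f(3)[OF i] B'(1)[OF iI] q(1,2) by (simp add: powr_mult powr_powr Z_def)
  ultimately show ?thesis by simp
 qed
 have "(\<integral>\<^sup>+x. ennreal ((\<Sum>i\<in>J. U h i x powr ?\<theta> * f i x * indicator (D i) x) powr q * w x) \<partial>lebesgue) \<le>
   (\<integral>\<^sup>+x. (\<Sum>i\<in>J. ennreal ?cc * (ennreal (?G i x * f i x powr q) * indicator (D i) x)) \<partial>lebesgue)"
 proof (intro nn_integral_mono)
  fix x
  let ?A = "{i\<in>J. x \<in> D i}"
  have "(\<Sum>i\<in>?A. U h i x powr ?\<theta> * f i x) powr q <= ?cc * (\<Sum>i\<in>?A. ?l ^ N i x * (U h i x powr ?\<theta> * f i x) powr q)"
   using finJ l' q f N_inj[of x] J by (intro powr_sum_le_chain) (auto intro: inj_on_subset)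
  then have "(\<Sum>i\<in>?A. U h i x powr ?\<theta> * f i x) powr q * w x <= ?cc * (\<Sum>i\<in>?A. ?l ^ N i x * (U h i x powr ?\<theta> * f i x) powr q) * w x"
   using w by (intro mult_right_mono) auto
  also have "\<dots> = (\<Sum>i\<in>?A. ?cc * (?G i x * f i x powr q))"
   unfolding sum_distrib_left sum_distrib_right
   using U0 f by (intro sum.cong refl) (auto simp: powr_mult powr_powr mult_ac)
  also have "\<dots> = (\<Sum>i\<in>J. ?cc * (?G i x * f i x powr q) * indicator (D i) x)"
   using finJ by (subst sum_indicator_filter) auto
  finally have "ennreal ((\<Sum>i\<in>J. U h i x powr ?\<theta> * f i x * indicator (D i) x) powr q * w x) \<le>
    ennreal (\<Sum>i\<in>J. ?cc * (?G i x * f i x powr q) * indicator (D i) x)"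
   using finJ by (subst sum_indicator_filter) (auto intro: ennreal_leI)
  also have "\<dots> = (\<Sum>i\<in>J. ennreal (?cc * (?G i x * f i x powr q) * indicator (D i) x))"
   using cc l' w by (intro sum_ennreal[symmetric]) auto
  also have "\<dots> = (\<Sum>i\<in>J. ennreal ?cc * (ennreal (?G i x * f i x powr q) * indicator (D i) x))"
  proof (intro sum.cong refl)
   fix i
   show "ennreal (?cc * (?G i x * f i x powr q) * indicator (D i) x) = ennreal ?cc * (ennreal (?G i x * f i x powr q) * indicator (D i) x)"
    using cc l' w(2)[of x] by (cases "x \<in> D i") (simp_all add: ennreal_mult)
  qed
  finally show "ennreal ((\<Sum>i\<in>J. U h i x powr ?\<theta> * f i x * indicator (D i) x) powr q * w x) \<le>
   (\<Sum>i\<in>J. ennreal ?cc * (ennreal (?G i x * f i x powr q) * indicator (D i) x))" .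
 qed
 also have "\<dots> = (\<Sum>i\<in>J. ennreal ?cc * (\<integral>\<^sup>+x\<in>D i. ennreal (?G i x * f i x powr q) \<partial>lebesgue))"
 proof -
  have m: "(\<lambda>x. ennreal (?G i x * f i x powr q) * indicator (D i) x) \<in> borel_measurable lebesgue" if i: "i \<in> J" for i
  proof -
   have "(\<lambda>x. ?G i x * f i x powr q) \<in> borel_measurable lebesgue"
    by (rule borel_measurable_times[OF Gm powr_real_measurable[OF f(1)[OF i] borel_measurable_const]])
   from measurable_compose[OF this measurable_ennreal] show ?thesis
    using i J meas by (intro borel_measurable_times_ennreal borel_measurable_indicator) auto
  qed
  have "(\<integral>\<^sup>+x. (\<Sum>i\<in>J. ennreal ?cc * (ennreal (?G i x * f i x powr q) * indicator (D i) x)) \<partial>lebesgue) =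
   (\<Sum>i\<in>J. (\<integral>\<^sup>+x. ennreal ?cc * (ennreal (?G i x * f i x powr q) * indicator (D i) x) \<partial>lebesgue))"
   by (intro nn_integral_sum borel_measurable_times_ennreal[OF _ m]) simp_all
  also have "\<dots> = (\<Sum>i\<in>J. ennreal ?cc * (\<integral>\<^sup>+x\<in>D i. ennreal (?G i x * f i x powr q) \<partial>lebesgue))"
   by (intro sum.cong refl nn_integral_cmult m)
  finally show ?thesis .
 qed
 also have "\<dots> <= (\<Sum>i\<in>J. ennreal ?cc * ennreal (?c2 * (a i * Z i * B' i powr ?\<theta>) powr q))"
  using step AZ by (intro sum_mono mult_left_mono) auto
 also have "\<dots> = (\<Sum>i\<in>J. ennreal (?cc * ?c2 * (a i * Z i * B' i powr ?\<theta>) powr q))"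
  using cc by (intro sum.cong refl) (simp add: ennreal_mult[symmetric] mult.assoc)
 also have "\<dots> = ennreal (\<Sum>i\<in>J. ?cc * ?c2 * (a i * Z i * B' i powr ?\<theta>) powr q)"
  using cc by (intro sum_ennreal) auto
 also have "(\<Sum>i\<in>J. ?cc * ?c2 * (a i * Z i * B' i powr ?\<theta>) powr q) = ?cc * ?c2 * (\<Sum>i\<in>J. (a i * Z i * B' i powr ?\<theta>) powr q)"
  by (simp add: sum_distrib_left)
 also have "ennreal (?cc * ?c2 * (\<Sum>i\<in>J. (a i * Z i * B' i powr ?\<theta>) powr q)) \<le>
  ennreal (sparse_const l k1 k2 k3 n \<kappa> e q t s * B powr (n * s / t) * (\<Sum>i\<in>J. (a i * Z i) powr v) powr (q / v))"
 proof (rule ennreal_leI)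
  let ?X = "\<Sum>i\<in>J. (a i * Z i) powr v"
  \<comment> \<open>Here the norm of \<open>B'\<close> is spent: it enters with the power
    \<open>?\<theta>\<close>, which lowers the exponent from \<open>v\<close> to \<open>q\<close> or
    raises it, according to the sign of \<open>e\<close>.\<close>
  have "(\<Sum>i\<in>J. (a i * Z i * B' i powr ?\<theta>) powr q) \<le>
   ((1 / (1 - 1 / l)) powr \<bar>e\<bar> * B) powr (?\<theta> * q) * ?X powr (q / v)"
  proof (rule sum_lnorm_Hoelder[where e=e])
   show "lnorm_le e J B' ((1 / (1 - 1 / l)) powr \<bar>e\<bar> * B)"
    using B'(2) J fin by (auto simp: lnorm_le_def intro: order_trans[OF sum_mono2])
  qed (use finJ f q n J B' l h(3) in \<open>auto simp: Z_def\<close>)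
  also have "((1 / (1 - 1 / l)) powr \<bar>e\<bar> * B) powr (?\<theta> * q) = ((1 / (1 - 1 / l)) powr \<bar>e\<bar>) powr (n * s / t) * B powr (n * s / t)"
   using q(1) by (simp add: powr_mult)
  finally have "?cc * ?c2 * (\<Sum>i\<in>J. (a i * Z i * B' i powr ?\<theta>) powr q) \<le>
   ?cc * ?c2 * (((1 / (1 - 1 / l)) powr \<bar>e\<bar>) powr (n * s / t) * B powr (n * s / t) * ?X powr (q / v))"
   using cc by (intro mult_left_mono) auto
  then show "?cc * ?c2 * (\<Sum>i\<in>J. (a i * Z i * B' i powr ?\<theta>) powr q) \<le>
   sparse_const l k1 k2 k3 n \<kappa> e q t s * B powr (n * s / t) * ?X powr (q / v)"
   by (simp only: sparse_const_def mult_ac)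
 qed
 finally show ?thesis unfolding Z_def .
qed

end

section \<open>Weights\<close>

lemma epowr_ennreal: "0 <= x ==> epowr (ennreal x) a = ennreal (x powr a)"
 by (simp add: epowr_def)

lemma epowr_le_iff:
 assumes "0 < a" "0 <= c"
 shows "epowr X a <= ennreal c \<longleftrightarrow> X <= ennreal (c powr (1 / a))"
proof (cases X)
 case (real x)
 have "x powr a <= c \<longleftrightarrow> x <= c powr (1 / a)"
 proof
  assume "x powr a <= c"
  then have "(x powr a) powr (1 / a) <= c powr (1 / a)" using assms by (intro powr_mono2) auto
  then show "x <= c powr (1 / a)" using assms real by (simp add: powr_powr)
 next
  assume "x <= c powr (1 / a)"
  then have "x powr a <= (c powr (1 / a)) powr a" using assms real by (intro powr_mono2) auto
  then show "x powr a <= c" using assms by (simp add: powr_powr)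
 qed
 then show ?thesis using real assms by (simp add: epowr_ennreal ennreal_le_iff)
qed (simp add: epowr_def top_unique)

lemma ennreal_le_of_divide_le:
 assumes "X / ennreal c <= Y" "0 < c"
 shows "X <= Y * ennreal c"
proof -
 have "X / ennreal c * ennreal c = X * (ennreal c * inverse (ennreal c))"
  by (simp add: divide_ennreal_def mult_ac)
 also have "ennreal c * inverse (ennreal c) = 1"
  using assms by (simp add: inverse_ennreal ennreal_mult[symmetric])
 finally show ?thesis using mult_right_mono[OF assms(1), of "ennreal c"] by simp
qed

lemma cube_measure: "0 <= l ==> vol (cube c l :: (real ^ 'n) set) = l ^ CARD('n)"
proof -
 assume l: "0 <= l"
 have "cbox (\<chi> i. c $ i - l / 2) (\<chi> i. c $ i + l / 2) \<noteq> ({} :: (real ^ 'n) set)"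
  using l by (simp add: interval_ne_empty_cart)
 then show ?thesis unfolding cube_def by (simp add: content_cbox_cart)
qed

lemma cube_in_lebesgue [measurable, simp]: "cube c l \<in> sets lebesgue"
 by (simp add: cube_def)

lemma cube_fmeasurable: "cube c l \<in> fmeasurable lebesgue"
 by (simp add: cube_def)

lemma compact_cube: "compact (cube c l)"
 by (simp add: cube_def)

lemma cubes_props:
 assumes "Q \<in> cubes"
 shows "Q \<in> sets lebesgue" "Q \<in> fmeasurable lebesgue" "0 < vol Q" "compact Q"
  "emeasure lebesgue Q = ennreal (vol Q)"
proof -
 obtain c l where Q: "Q = cube c l" "0 < l" using assms by (auto simp: cubes_def)
 then show "Q \<in> sets lebesgue" "Q \<in> fmeasurable lebesgue" "0 < vol Q" "compact Q"
  by (auto simp: cube_fmeasurable compact_cube cube_measure)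
 then show "emeasure lebesgue Q = ennreal (vol Q)" by (simp add: emeasure_eq_measure2)
qed

text \<open>\<open>G\<close> is any positive function of cubes bounding the averages up to a
  constant. In this form the property survives products of powers of weights, with the same
  operation on \<open>G\<close>.\<close>

definition avg_le :: "(real ^ 'n => real) => ((real ^ 'n) set => real) => bool"
 where "avg_le u G \<longleftrightarrow> u \<in> borel_measurable lebesgue \<and> (\<forall>x. 0 <= u x) \<and> (\<forall>Q\<in>cubes. 0 < G Q) \<and>
  (\<exists>K>0. \<forall>Q\<in>cubes. (\<integral>\<^sup>+x\<in>Q. ennreal (u x) \<partial>lebesgue) <= ennreal (K * (G Q * vol Q)))"

text \<open>
 The averages of \<open>W\<close> are comparable to \<open>G\<close>, even over large subsets of cubes: the form in which the
 \<open>A\<^sub>\<infinity>\<close> property of \<open>W\<close> is used.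
\<close>

definition comparable :: "(real ^ 'n => real) => ((real ^ 'n) set => real) => bool"
 where "comparable W G \<longleftrightarrow> avg_le W G \<and>
  (\<forall>\<eta>>0. \<exists>c>0. \<forall>Q\<in>cubes. \<forall>F\<in>sets lebesgue. F \<subseteq> Q --> \<eta> * vol Q <= vol F -->
   ennreal (c * (G Q * vol Q)) <= wmeas W F)"

text \<open>Hoelder with exponents in the ratio of \<open>\<alpha>\<close> to
  \<open>\<beta>\<close>, followed by Jensen for the power \<open>\<alpha> + \<beta> <= 1\<close>,
  written as Hoelder against the constant 1.\<close>

lemma avg_le_mixed:
 assumes u: "avg_le u G" and v: "avg_le v H" and ab: "0 <= \<alpha>" "0 <= \<beta>" "0 < \<alpha> + \<beta>" "\<alpha> + \<beta> <= 1"
 shows "avg_le (\<lambda>x. u x powr \<alpha> * v x powr \<beta>) (\<lambda>Q. G Q powr \<alpha> * H Q powr \<beta>)"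
proof -
 note [measurable] = u[unfolded avg_le_def, THEN conjunct1] v[unfolded avg_le_def, THEN conjunct1]
 have u0: "0 <= u x" "0 <= v x" for x using u v by (auto simp: avg_le_def)
 have G0: "0 < G Q" "0 < H Q" if "Q \<in> cubes" for Q using that u v by (auto simp: avg_le_def)
 obtain K1 where K1: "0 < K1" "!!Q. Q \<in> cubes ==> (\<integral>\<^sup>+x\<in>Q. ennreal (u x) \<partial>lebesgue) <= ennreal (K1 * (G Q * vol Q))"
  using u unfolding avg_le_def by blast
 obtain K2 where K2: "0 < K2" "!!Q. Q \<in> cubes ==> (\<integral>\<^sup>+x\<in>Q. ennreal (v x) \<partial>lebesgue) <= ennreal (K2 * (H Q * vol Q))"
  using v unfolding avg_le_def by blast
 define s where "s = \<alpha> + \<beta>"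
 have s: "0 < s" "s <= 1" "\<alpha> / s <= 1" "1 - \<alpha> / s = \<beta> / s" "0 <= \<alpha> / s" using ab by (auto simp: s_def field_simps)
 have "(\<integral>\<^sup>+x\<in>Q. ennreal (u x powr \<alpha> * v x powr \<beta>) \<partial>lebesgue) \<le>
  ennreal (K1 powr \<alpha> * K2 powr \<beta> * (G Q powr \<alpha> * H Q powr \<beta> * vol Q))" if Q: "Q \<in> cubes" for Q
 proof -
  let ?m = "vol Q"
  note cQ = cubes_props[OF Q]
  let ?A = "K1 * (G Q * ?m)" and ?B = "K2 * (H Q * ?m)"
  have AB: "0 < ?A" "0 < ?B" using K1 K2 G0 Q cQ by auto
  have 1: "(\<integral>\<^sup>+x\<in>Q. ennreal (u x powr (\<alpha> / s) * v x powr (\<beta> / s)) \<partial>lebesgue) <= ennreal (?A powr (\<alpha> / s) * ?B powr (\<beta> / s))"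
   using set_nn_integral_Hoelder[of u lebesgue v Q "\<alpha> / s" ?A ?B] K1(2)[OF Q] K2(2)[OF Q] u0 s AB cQ by simp
  have 2: "(\<integral>\<^sup>+x\<in>Q. ennreal 1 \<partial>lebesgue) <= ennreal ?m" using cQ by simp
  have "(u x powr (\<alpha> / s) * v x powr (\<beta> / s)) powr s * 1 powr (1 - s) = u x powr \<alpha> * v x powr \<beta>" for x
   using s by (simp add: powr_mult powr_powr)
  then have "(\<integral>\<^sup>+x\<in>Q. ennreal (u x powr \<alpha> * v x powr \<beta>) \<partial>lebesgue) = (\<integral>\<^sup>+x\<in>Q. ennreal ((u x powr (\<alpha> / s) * v x powr (\<beta> / s)) powr s * 1 powr (1 - s)) \<partial>lebesgue)"
   by simp
  also have "\<dots> \<le>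
   ennreal ((?A powr (\<alpha> / s) * ?B powr (\<beta> / s)) powr s * ?m powr (1 - s))"
   by (rule set_nn_integral_Hoelder) (use 1 2 s cQ in auto)
  also have "(?A powr (\<alpha> / s) * ?B powr (\<beta> / s)) powr s = ?A powr \<alpha> * ?B powr \<beta>"
   using s by (simp add: powr_mult powr_powr)
  also have "?A powr \<alpha> * ?B powr \<beta> * ?m powr (1 - s) = K1 powr \<alpha> * K2 powr \<beta> * (G Q powr \<alpha> * H Q powr \<beta> * (?m powr \<alpha> * ?m powr \<beta> * ?m powr (1 - s)))"
   by (simp add: powr_mult)
  also have "?m powr \<alpha> * ?m powr \<beta> * ?m powr (1 - s) = ?m" using cQ by (simp add: powr_add[symmetric] s_def)
  finally show ?thesis .
 qed
 moreover have "0 < K1 powr \<alpha> * K2 powr \<beta>" using K1 K2 by simp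
 ultimately have "\<exists>K>0. \<forall>Q\<in>cubes. (\<integral>\<^sup>+x\<in>Q. ennreal (u x powr \<alpha> * v x powr \<beta>) \<partial>lebesgue) \<le>
  ennreal (K * (G Q powr \<alpha> * H Q powr \<beta> * vol Q))" by blast
 moreover have "(\<lambda>x. u x powr \<alpha> * v x powr \<beta>) \<in> borel_measurable lebesgue" by measurable
 moreover have "\<forall>Q\<in>cubes. 0 < G Q powr \<alpha> * H Q powr \<beta>" using G0 by force
 ultimately show ?thesis unfolding avg_le_def by auto
qed

text \<open>By Hoelder \<open>vol F\<close>, the integral of
  \<open>W powr s * v powr (1 - s)\<close> over \<open>F\<close>, is at most
  \<open>W(F) powr s * v(Q) powr (1 - s)\<close>. An upper bound for the averages of
  \<open>v\<close> is thus a lower bound for \<open>W\<close> on every large subset.\<close>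

lemma comparableI:
 assumes W: "avg_le W G" and v: "avg_le v H" and s: "0 < s" "s < 1"
  and one: "AE x in lebesgue. W x powr s * v x powr (1 - s) = 1"
  and G: "!!Q. Q \<in> cubes ==> G Q = H Q powr (- (1 - s) / s)"
 shows "comparable W G"
 unfolding comparable_def
proof (intro conjI allI impI W)
 fix \<eta> :: real assume \<eta>: "0 < \<eta>"
 note [measurable] = W[unfolded avg_le_def, THEN conjunct1] v[unfolded avg_le_def, THEN conjunct1]
 have u0: "0 <= W x" "0 <= v x" for x using W v by (auto simp: avg_le_def)
 obtain K where K: "0 < K" "!!Q. Q \<in> cubes ==> (\<integral>\<^sup>+x\<in>Q. ennreal (v x) \<partial>lebesgue) <= ennreal (K * (H Q * vol Q))"
  using v unfolding avg_le_def by blast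
 let ?c = "\<eta> powr (1 / s) * K powr (- (1 - s) / s)"
 show "\<exists>c>0. \<forall>Q\<in>cubes. \<forall>F\<in>sets lebesgue. F \<subseteq> Q --> \<eta> * vol Q <= vol F -->
   ennreal (c * (G Q * vol Q)) <= wmeas W F"
 proof (intro exI[of _ ?c] conjI ballI impI)
  show "0 < ?c" using \<eta> K by simp
  fix Q F :: "(real ^ 'a) set"
  assume Q: "Q \<in> cubes" and F[measurable]: "F \<in> sets lebesgue" and FQ: "F \<subseteq> Q" "\<eta> * vol Q <= vol F"
  let ?m = "vol Q"
  note cQ = cubes_props[OF Q]
  have H: "0 < H Q" using v Q by (auto simp: avg_le_def)
  let ?B = "K * (H Q * ?m)"
  have B: "0 < ?B" using K H cQ by simp
  have Ffm: "F \<in> fmeasurable lebesgue" using cQ FQ F by (meson fmeasurableI2)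
  show "ennreal (?c * (G Q * ?m)) <= wmeas W F"
  proof (cases "wmeas W F")
   case (real A)
   have "(\<integral>\<^sup>+x\<in>F. ennreal (v x) \<partial>lebesgue) <= (\<integral>\<^sup>+x\<in>Q. ennreal (v x) \<partial>lebesgue)"
    using FQ by (intro nn_integral_mono) (auto split: split_indicator)
   then have vF: "(\<integral>\<^sup>+x\<in>F. ennreal (v x) \<partial>lebesgue) <= ennreal ?B" using K(2)[OF Q] by order
   have "ennreal (vol F) = (\<integral>\<^sup>+x\<in>F. 1 \<partial>lebesgue)"
    using Ffm by (simp add: emeasure_eq_measure2)
   also have "\<dots> = (\<integral>\<^sup>+x\<in>F. ennreal (W x powr s * v x powr (1 - s)) \<partial>lebesgue)"
    by (intro nn_integral_cong_AE) (use one in eventually_elim, simp)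
   also have "\<dots> <= ennreal (A powr s * ?B powr (1 - s))"
    by (rule set_nn_integral_Hoelder) (use s u0 real vF B in \<open>auto simp: wmeas_def\<close>)
   finally have "vol F <= A powr s * ?B powr (1 - s)" by (subst (asm) ennreal_le_iff) auto
   then have "\<eta> * ?m <= A powr s * ?B powr (1 - s)" using FQ by linarith
   then have "(\<eta> * ?m) powr (1 / s) <= (A powr s * ?B powr (1 - s)) powr (1 / s)"
    using s \<eta> cQ by (intro powr_mono2) auto
   also have "\<dots> = A * ?B powr ((1 - s) / s)" using s real by (simp add: powr_mult powr_powr)
   finally have "(\<eta> * ?m) powr (1 / s) * ?B powr (- (1 - s) / s) <= A * ?B powr ((1 - s) / s) * ?B powr (- (1 - s) / s)"
    by (intro mult_right_mono) auto
   also have "\<dots> = A"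
   proof -
    have "?B powr ((1 - s) / s) * ?B powr (- (1 - s) / s) = ?B powr 0"
     unfolding powr_add[symmetric] by (simp add: add_divide_distrib[symmetric])
    then show ?thesis using K(1) H cQ(3) by (simp add: mult.assoc)
   qed
   also have "(\<eta> * ?m) powr (1 / s) * ?B powr (- (1 - s) / s) = ?c * (G Q * (?m powr (1 / s) * ?m powr (- (1 - s) / s)))"
    using G[OF Q] by (simp add: powr_mult)
   also have "?m powr (1 / s) * ?m powr (- (1 - s) / s) = ?m"
    using cQ s by (simp add: powr_add[symmetric] field_simps)
   finally show ?thesis using real by (simp add: ennreal_leI)
  qed simp
 qed
qed

text \<open>Each of the two powers of \<open>w\<close> serves as the companion of the other: with
  the parameter \<open>a / (a + t)\<close> the exponents of \<open>w\<close> cancel.\<close>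

lemma comparable_powr_pair:
 assumes w: "AE x in lebesgue. 0 < (w x :: real)" and at: "0 < a" "0 < t"
  and g: "!!Q. Q \<in> cubes ==> 0 < g Q"
  and le: "avg_le (\<lambda>x. w x powr t) (\<lambda>Q. g Q powr t)" "avg_le (\<lambda>x. w x powr (- a)) (\<lambda>Q. g Q powr (- a))"
 shows "comparable (\<lambda>x. w x powr t) (\<lambda>Q. g Q powr t)" "comparable (\<lambda>x. w x powr (- a)) (\<lambda>Q. g Q powr (- a))"
proof -
 have s: "1 - a / (a + t) = t / (a + t)" "1 - t / (a + t) = a / (a + t)" using at by (auto simp: field_simps)
 show "comparable (\<lambda>x. w x powr t) (\<lambda>Q. g Q powr t)"
 proof (rule comparableI[OF le, where s="a / (a + t)"])
  show "AE x in lebesgue. (w x powr t) powr (a / (a + t)) * (w x powr - a) powr (1 - a / (a + t)) = 1"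
   using w unfolding s by eventually_elim (use at in \<open>simp add: powr_powr powr_add[symmetric] mult.commute\<close>)
  show "g Q powr t = (g Q powr - a) powr (- (1 - a / (a + t)) / (a / (a + t)))" for Q
   unfolding s powr_powr using at by simp
 qed (use at in auto)
 show "comparable (\<lambda>x. w x powr (- a)) (\<lambda>Q. g Q powr (- a))"
 proof (rule comparableI[OF le(2,1), where s="t / (a + t)"])
  show "AE x in lebesgue. (w x powr - a) powr (t / (a + t)) * (w x powr t) powr (1 - t / (a + t)) = 1"
   using w unfolding s by eventually_elim (use at in \<open>simp add: powr_powr powr_add[symmetric] mult.commute\<close>)
  show "g Q powr - a = (g Q powr t) powr (- (1 - t / (a + t)) / (t / (a + t)))" for Q
   unfolding s powr_powr using at by simp
 qed (use at in auto)
qed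

lemma loc_integrable_measurable:
 fixes w :: "real ^ 'n => 'k::euclidean_space"
 shows "loc_integrable w ==> w \<in> borel_measurable lebesgue"
proof -
 assume w: "loc_integrable w"
 have "w absolutely_integrable_on cbox (\<chi> i. - real n) (\<chi> i. real n)" for n
  using w by (simp add: loc_integrable_def)
 then have *: "(\<lambda>x. indicator (cbox (\<chi> i. - real n) (\<chi> i. real n)) x *\<^sub>R w x) \<in> borel_measurable lebesgue" for n
  by (simp add: set_integrable_def)
 show ?thesis
 proof (rule borel_measurable_LIMSEQ_metric[OF *])
  fix x :: "real ^ 'n"
  obtain N :: nat where N: "norm x <= N" using real_arch_simple by blast
  have "(\<lambda>n. w x) \<longlonglongrightarrow> w x" by simp
  moreover have "\<forall>\<^sub>F n in sequentially. w x = indicator (cbox (\<chi> i. - real n) (\<chi> i. real n)) x *\<^sub>R w x"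
   unfolding eventually_sequentially
  proof (intro exI[of _ N] allI impI)
   fix n assume "N <= n"
   then have "\<bar>x $ i\<bar> <= n" for i using N component_le_norm_cart[of x i] by linarith
   then have "- real n <= x $ i \<and> x $ i <= n" for i by (meson abs_le_iff minus_le_iff)
   then have "x \<in> cbox (\<chi> i. - real n) (\<chi> i. real n)" by (simp add: mem_box_cart)
   then show "w x = indicator (cbox (\<chi> i. - real n) (\<chi> i. real n)) x *\<^sub>R w x" by simp
  qed
  ultimately show "(\<lambda>n. indicator (cbox (\<chi> i. - real n) (\<chi> i. real n)) x *\<^sub>R w x) \<longlonglongrightarrow> w x"
   by (rule Lim_transform_eventually)
 qed
qed

lemma weight_measurable: "weight w ==> w \<in> borel_measurable lebesgue"
 by (simp add: weight_def loc_integrable_measurable)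

lemma weight_wmeas:
 assumes w: "weight w" and Q: "Q \<in> cubes"
 shows "wmeas w Q < \<infinity>" "0 < wmeas w Q"
proof -
 have [measurable]: "w \<in> borel_measurable lebesgue" using w by (rule weight_measurable)
 note [measurable] = cubes_props(1)[OF Q]
 have "set_integrable lebesgue Q w" using w cubes_props[OF Q] by (simp add: weight_def loc_integrable_def)
 then have "(\<integral>\<^sup>+x. ennreal (norm (indicator Q x *\<^sub>R w x)) \<partial>lebesgue) < \<infinity>"
  unfolding set_integrable_def by (simp add: integrable_iff_bounded)
 also have "(\<integral>\<^sup>+x. ennreal (norm (indicator Q x *\<^sub>R w x)) \<partial>lebesgue) = wmeas w Q"
  unfolding wmeas_def using w by (intro nn_integral_cong) (auto simp: weight_def split: split_indicator)
 finally show "wmeas w Q < \<infinity>" .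
 show "0 < wmeas w Q"
 proof (rule ccontr)
  assume "\<not> 0 < wmeas w Q"
  then have "AE x in lebesgue. ennreal (w x) * indicator Q x = 0"
   unfolding wmeas_def by (subst (asm) not_gr_zero, subst (asm) nn_integral_0_iff_AE) auto
  moreover have "AE x in lebesgue. 0 < w x" using w by (simp add: weight_def)
  ultimately have "AE x in lebesgue. x \<notin> Q" by eventually_elim (auto split: split_indicator_asm)
  then have "emeasure lebesgue Q = 0" by (subst (asm) AE_iff_measurable[OF cubes_props(1)[OF Q]]) auto
  then show False using cubes_props[OF Q] by simp
 qed
qed

text \<open>\<open>g Q\<close> is the average of \<open>w\<close> over \<open>Q\<close>. The reverse
  Hoelder condition bounds the average of a positive power of \<open>w\<close>, the Muckenhoupt
  condition that of a negative power, and both bounds are the same powers of the single function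
  \<open>g\<close>.\<close>

lemma Ap_RH_avg_le:
 assumes w: "w \<in> Ap P \<inter> RH t" and P: "1 < P" "1 <= t"
 obtains g where "!!Q. Q \<in> cubes ==> 0 < g Q"
  "avg_le (\<lambda>x. w x powr t) (\<lambda>Q. g Q powr t)"
  "avg_le (\<lambda>x. w x powr (- (1 / (P - 1)))) (\<lambda>Q. g Q powr (- (1 / (P - 1))))"
proof -
 let ?a = "1 / (P - 1)"
 have a: "0 < ?a" using P by simp
 have wt: "weight w" using w by (simp add: Ap_def)
 have [measurable]: "w \<in> borel_measurable lebesgue" by (rule weight_measurable[OF wt])
 have w0: "0 <= w x" for x using wt by (simp add: weight_def)
 define g where "g Q = enn2real (wmeas w Q) / vol Q" for Q
 have gp: "0 < g Q" if "Q \<in> cubes" for Q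
  using weight_wmeas[OF wt that] cubes_props[OF that] by (simp add: g_def enn2real_positive_iff)
 obtain A where A: "0 <= A" "Ap_const P w = ennreal A" using w by (auto simp: Ap_def less_top_ennreal)
 obtain R where R: "0 <= R" "RH_const t w = ennreal R" using w by (auto simp: RH_def less_top_ennreal)
 have p1: "pavg 1 (\<lambda>x. ennreal (w x)) Q = ennreal (g Q)" if Q: "Q \<in> cubes" for Q
 proof -
  have "(\<integral>\<^sup>+x\<in>Q. epowr (ennreal (w x)) 1 \<partial>lebesgue) = wmeas w Q"
   unfolding wmeas_def using w0 by (simp add: epowr_ennreal)
  moreover have "wmeas w Q = ennreal (enn2real (wmeas w Q))" using weight_wmeas[OF wt Q] by simp
  ultimately have "pavg 1 (\<lambda>x. ennreal (w x)) Q = epowr (ennreal (enn2real (wmeas w Q)) / ennreal (vol Q)) (1 / 1)"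
   unfolding pavg_def cubes_props(5)[OF Q] by simp
  then show ?thesis using cubes_props(3)[OF Q] by (simp add: g_def divide_ennreal epowr_ennreal)
 qed
 have 1: "(\<integral>\<^sup>+x\<in>Q. ennreal (w x powr t) \<partial>lebesgue) <= ennreal ((R powr t + 1) * (g Q powr t * vol Q))" if Q: "Q \<in> cubes" for Q
 proof -
  note cQ = cubes_props[OF Q]
  have "pavg t (\<lambda>x. ennreal (w x)) Q / pavg 1 (\<lambda>x. ennreal (w x)) Q <= ennreal R"
   using R(2) Q unfolding RH_const_def by (metis (no_types, lifting) SUP_upper)
  then have "pavg t (\<lambda>x. ennreal (w x)) Q <= ennreal R * ennreal (g Q)"
   using gp[OF Q] unfolding p1[OF Q] by (intro ennreal_le_of_divide_le) auto
  then have "pavg t (\<lambda>x. ennreal (w x)) Q <= ennreal (R * g Q)" using R by (simp add: ennreal_mult')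
  then have "(\<integral>\<^sup>+x\<in>Q. epowr (ennreal (w x)) t \<partial>lebesgue) / emeasure lebesgue Q <= ennreal ((R * g Q) powr t)"
   using P R gp[OF Q] epowr_le_iff[of "1 / t" "R * g Q"] unfolding pavg_def by simp
  then have "(\<integral>\<^sup>+x\<in>Q. ennreal (w x powr t) \<partial>lebesgue) <= ennreal ((R * g Q) powr t) * ennreal (vol Q)"
   using cQ(3) w0 unfolding cQ(5) by (intro ennreal_le_of_divide_le) (auto simp: epowr_ennreal)
  also have "\<dots> = ennreal (R powr t * (g Q powr t * vol Q))"
   by (simp add: ennreal_mult[symmetric] powr_mult mult.assoc)
  also have "\<dots> <= ennreal ((R powr t + 1) * (g Q powr t * vol Q))"
   by (intro ennreal_leI mult_right_mono) auto
  finally show ?thesis .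
 qed
 have 2: "(\<integral>\<^sup>+x\<in>Q. ennreal (w x powr (- ?a)) \<partial>lebesgue) <= ennreal ((A powr ?a + 1) * (g Q powr (- ?a) * vol Q))" if Q: "Q \<in> cubes" for Q
 proof -
  note cQ = cubes_props[OF Q]
  let ?p = "pavg ?a (\<lambda>x. inverse (ennreal (w x))) Q"
  have le: "ennreal (g Q) * ?p <= ennreal A"
   unfolding p1[OF Q, symmetric] using A(2) Q unfolding Ap_const_def by (metis (no_types, lifting) SUP_upper)
  have "?p = ennreal (1 / g Q) * (ennreal (g Q) * ?p)"
   using gp[OF Q] by (simp add: mult.assoc[symmetric] ennreal_mult[symmetric])
  also have "\<dots> <= ennreal (1 / g Q) * ennreal A" by (intro mult_left_mono le) auto
  also have "\<dots> = ennreal (A / g Q)" using gp[OF Q] A by (simp add: ennreal_mult[symmetric])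
  finally have "(\<integral>\<^sup>+x\<in>Q. epowr (inverse (ennreal (w x))) ?a \<partial>lebesgue) / emeasure lebesgue Q <= ennreal ((A / g Q) powr ?a)"
   using a A gp[OF Q] epowr_le_iff[of "1 / ?a" "A / g Q"] unfolding pavg_def by simp
  then have "(\<integral>\<^sup>+x\<in>Q. epowr (inverse (ennreal (w x))) ?a \<partial>lebesgue) <= ennreal ((A / g Q) powr ?a) * ennreal (vol Q)"
   using cQ(3) unfolding cQ(5) by (intro ennreal_le_of_divide_le) auto
  also have "(\<integral>\<^sup>+x\<in>Q. epowr (inverse (ennreal (w x))) ?a \<partial>lebesgue) = (\<integral>\<^sup>+x\<in>Q. ennreal (w x powr (- ?a)) \<partial>lebesgue)"
  proof (intro nn_integral_cong_AE)
   have "AE x in lebesgue. 0 < w x" using wt by (simp add: weight_def)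
   then show "AE x in lebesgue. epowr (inverse (ennreal (w x))) ?a * indicator Q x = ennreal (w x powr (- ?a)) * indicator Q x"
    by eventually_elim (simp add: inverse_ennreal epowr_ennreal powr_minus powr_divide inverse_eq_divide)
  qed
  also have "(A / g Q) powr ?a = A powr ?a * g Q powr (- ?a)"
   by (simp only: powr_divide powr_minus_divide) simp
  also have "ennreal (A powr ?a * g Q powr (- ?a)) * ennreal (vol Q) = ennreal (A powr ?a * (g Q powr (- ?a) * vol Q))"
   by (simp add: ennreal_mult[symmetric] mult.assoc)
  also have "\<dots> <= ennreal ((A powr ?a + 1) * (g Q powr (- ?a) * vol Q))"
   by (intro ennreal_leI mult_right_mono) auto
  finally show ?thesis .
 qed
 show thesis
 proof (rule that[of g])
  have "0 < R powr t + 1" "0 < A powr ?a + 1" by (auto intro: add_nonneg_pos)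
  then have "\<exists>K>0. \<forall>Q\<in>cubes. (\<integral>\<^sup>+x\<in>Q. ennreal (w x powr t) \<partial>lebesgue) <= ennreal (K * (g Q powr t * vol Q))"
   "\<exists>K>0. \<forall>Q\<in>cubes. (\<integral>\<^sup>+x\<in>Q. ennreal (w x powr (- ?a)) \<partial>lebesgue) <= ennreal (K * (g Q powr (- ?a) * vol Q))"
   using 1 2 by blast+
  moreover have "0 < g Q powr c" if "Q \<in> cubes" for Q c using gp[OF that] by simp
  ultimately show "avg_le (\<lambda>x. w x powr t) (\<lambda>Q. g Q powr t)" "avg_le (\<lambda>x. w x powr - ?a) (\<lambda>Q. g Q powr - ?a)"
   unfolding avg_le_def by auto
 qed (rule gp)
qed

text \<open>The upper bound mixes \<open>\<mu> powr t1\<close> with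
  \<open>\<sigma> powr (- b)\<close>. The companion for the lower bound must be a negative power of
  the product, so it mixes the other two available functions; \<open>d\<close> normalises their
  exponents to the sum 1, which makes the companion the power \<open>- 1 / d\<close> of the
  product.\<close>

lemma bloom_comparable:
 assumes \<mu>: "avg_le (\<lambda>x. \<mu> x powr t1) (\<lambda>Q. g Q powr t1)" "avg_le (\<lambda>x. \<mu> x powr (- a)) (\<lambda>Q. g Q powr (- a))"
  and \<sigma>: "avg_le (\<lambda>x. \<sigma> x powr t2) (\<lambda>Q. h Q powr t2)" "avg_le (\<lambda>x. \<sigma> x powr (- b)) (\<lambda>Q. h Q powr (- b))"
  and pos: "AE x in lebesgue. 0 < \<mu> x" "AE x in lebesgue. 0 < \<sigma> x"
  and gh: "!!Q. Q \<in> cubes ==> 0 < g Q" "!!Q. Q \<in> cubes ==> 0 < h Q"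
  and e: "0 < t1" "0 < t2" "0 < a" "0 < b" "0 < x" "0 < z" "x / t1 + z / b <= 1"
 shows "comparable (\<lambda>y. \<mu> y powr x * \<sigma> y powr (- z)) (\<lambda>Q. g Q powr x * h Q powr (- z))"
proof -
 have "0 < x / t1" "0 < z / b" using e by auto
 then have up: "avg_le (\<lambda>y. (\<mu> y powr t1) powr (x / t1) * (\<sigma> y powr - b) powr (z / b)) (\<lambda>Q. (g Q powr t1) powr (x / t1) * (h Q powr - b) powr (z / b))"
  using e by (intro avg_le_mixed[OF \<mu>(1) \<sigma>(2)]) linarith+
 then have up': "avg_le (\<lambda>y. \<mu> y powr x * \<sigma> y powr (- z)) (\<lambda>Q. g Q powr x * h Q powr (- z))"
  using e by (simp add: powr_powr)
 define d where "d = x / a + z / t2"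
 have d1: "0 < x / a" "0 < z / t2" using e by auto
 then have d: "0 < d" by (simp add: d_def)
 define \<theta> where "\<theta> = x / a / d"
 have \<theta>2: "1 - \<theta> = z / t2 / d"
 proof -
  have "x / a / d + z / t2 / d = d / d" unfolding add_divide_distrib[symmetric] by (simp add: d_def)
  then show ?thesis using d by (simp add: \<theta>_def)
 qed
 have \<theta>: "0 < \<theta>" "0 < 1 - \<theta>" unfolding \<theta>2 unfolding \<theta>_def using d d1 e by simp_all
 have \<theta>x: "a * \<theta> * d = x" unfolding \<theta>_def using d e by simp
 have \<theta>z: "t2 * (1 - \<theta>) * d = z" unfolding \<theta>2 using d e by simp
 define s where "s = 1 / (1 + d)"
 have s: "0 < s" "s < 1" "1 - s = d * s" "(1 - s) / s = d" using d by (auto simp: s_def field_simps)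
 show ?thesis
 proof (rule comparableI[OF up'])
  show "avg_le (\<lambda>y. (\<mu> y powr - a) powr \<theta> * (\<sigma> y powr t2) powr (1 - \<theta>)) (\<lambda>Q. (g Q powr - a) powr \<theta> * (h Q powr t2) powr (1 - \<theta>))"
   using \<theta> by (intro avg_le_mixed[OF \<mu>(2) \<sigma>(1)]) auto
  show "AE y in lebesgue. (\<mu> y powr x * \<sigma> y powr - z) powr s * ((\<mu> y powr - a) powr \<theta> * (\<sigma> y powr t2) powr (1 - \<theta>)) powr (1 - s) = 1"
   using pos
  proof eventually_elim
   case (elim y)
   have "((\<mu> y powr - a) powr \<theta>) powr (1 - s) = \<mu> y powr (- (x * s))"
    unfolding powr_powr s(3) \<theta>x[symmetric] by (simp add: mult_ac)
   moreover have "((\<sigma> y powr t2) powr (1 - \<theta>)) powr (1 - s) = \<sigma> y powr (z * s)"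
    unfolding powr_powr s(3) \<theta>z[symmetric] by (simp add: mult_ac)
   ultimately show ?case using elim by (simp add: powr_mult powr_powr) (simp add: powr_minus field_simps)
  qed
  fix Q :: "(real ^ 'a) set" assume "Q \<in> cubes"
  have "((g Q powr - a) powr \<theta> * (h Q powr t2) powr (1 - \<theta>)) powr (- d) = g Q powr (a * \<theta> * d) * h Q powr (- (t2 * (1 - \<theta>) * d))"
   by (simp add: powr_mult powr_powr)
  then show "g Q powr x * h Q powr - z = ((g Q powr - a) powr \<theta> * (h Q powr t2) powr (1 - \<theta>)) powr (- (1 - s) / s)"
   unfolding \<theta>x \<theta>z using s by simp
 qed (use s in auto)
qed

definition inv_exponent :: "ennreal => real"
 where "inv_exponent s = (if s = top then 0 else 1 / enn2real s)"

text \<open>Working with \<open>1 / s\<close> gives the single formula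
  \<open>1 / (1 - p / s)\<close> for the conjugate of \<open>s / p\<close>, with
  \<open>s = \<infinity>\<close> included.\<close>

lemma inv_exponent:
 assumes "ennreal p < s" "0 < p"
 shows "0 <= inv_exponent s" "p * inv_exponent s < 1"
  "hoelder_conj (s / ennreal p) = 1 / (1 - p * inv_exponent s)" "1 <= hoelder_conj (s / ennreal p)"
proof -
 have "0 <= inv_exponent s \<and> p * inv_exponent s < 1 \<and>
  hoelder_conj (s / ennreal p) = 1 / (1 - p * inv_exponent s)"
 proof (cases s)
  case (real x)
  have "p < x" using assms real by (simp add: ennreal_less_iff)
  moreover have "s / ennreal p = ennreal (x / p)" using assms real by (simp add: divide_ennreal)
  ultimately show ?thesis using assms real by (auto simp: inv_exponent_def hoelder_conj_def field_simps)
 next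
  case top
  then show ?thesis using assms by (simp add: inv_exponent_def hoelder_conj_def ennreal_top_divide)
 qed
 then show "0 <= inv_exponent s" "p * inv_exponent s < 1"
  "hoelder_conj (s / ennreal p) = 1 / (1 - p * inv_exponent s)" by auto
 from this(1) have "0 <= p * inv_exponent s" using assms by simp
 then have "1 <= 1 / (1 - p * inv_exponent s)" using \<open>p * inv_exponent s < 1\<close> by simp
 then show "1 <= hoelder_conj (s / ennreal p)"
  using \<open>hoelder_conj (s / ennreal p) = 1 / (1 - p * inv_exponent s)\<close> by simp
qed

section \<open>The dyadic grid\<close>

text \<open>
 A cell is a half-open cube of the dyadic grid; it is given by its level \<open>j\<close> and integer position.
 The grid is shifted so that the cell of level \<open>0\<close> at position \<open>0\<close> is centred at the origin.
\<close>

type_synonym 'n idx = "nat \<times> (int ^ 'n)"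

definition position :: "real => nat => real ^ 'n => int ^ 'n"
 where "position l j x = (\<chi> i. \<lfloor>(x $ i + l / 2) * 2 ^ j / l\<rfloor>)"

definition cell :: "real => 'n idx => (real ^ 'n) set"
 where "cell l i = {x. position l (fst i) x = snd i}"

definition side :: "real => 'n idx => real" where "side l i = l / 2 ^ fst i"

definition centre :: "real => 'n idx => real ^ 'n"
 where "centre l i = (\<chi> c. (real_of_int (snd i $ c) + 1 / 2) * side l i - l / 2)"

definition ccell :: "real => 'n idx => (real ^ 'n) set" where "ccell l i = cube (centre l i) (side l i)"
definition triple :: "real => 'n idx => (real ^ 'n) set" where "triple l i = cube (centre l i) (3 * side l i)"

text \<open>The position of the ancestor \<open>d\<close> levels up. Integer \<open>div\<close>
  rounds downwards, so this is right for negative positions too.\<close>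

definition up :: "nat => int ^ 'n => int ^ 'n" where "up d k = (\<chi> i. k $ i div 2 ^ d)"

text \<open>Offsets from a cell to the cells of the same level that make up its triple, the cell
  itself included.\<close>

definition nbs :: "(int ^ 'n) set" where "nbs = {e. \<forall>i. \<bar>e $ i\<bar> <= 1}"
definition shift :: "int ^ 'n => 'n idx => 'n idx" where "shift e i = (fst i, snd i + e)"

lemma floor_div_pow: "\<lfloor>y::real\<rfloor> = \<lfloor>y * 2 ^ d\<rfloor> div 2 ^ d"
proof -
 let ?f = "\<lfloor>y\<rfloor>" and ?m = "2 ^ d :: int"
 have m: "0 < ?m" by simp
 have "of_int ?f <= y" "y < of_int ?f + 1" by linarith+
 then have "of_int ?f * 2 ^ d <= y * 2 ^ d" "y * 2 ^ d < (of_int ?f + 1) * 2 ^ d" by simp_all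
 then have "of_int (?f * ?m) <= y * 2 ^ d" "y * 2 ^ d < of_int ((?f + 1) * ?m)" by simp_all
 then have "?f * ?m <= \<lfloor>y * 2 ^ d\<rfloor>" "\<lfloor>y * 2 ^ d\<rfloor> < (?f + 1) * ?m" by linarith+
 then have "\<lfloor>y * 2 ^ d\<rfloor> div ?m = ?f"
  by (intro int_div_pos_eq[of _ _ _ "\<lfloor>y * 2 ^ d\<rfloor> - ?m * ?f"]) (auto simp: algebra_simps)
 then show ?thesis by simp
qed

lemma position_up: "position l j x = up d (position l (j + d) x)"
proof -
 have eq: "(x $ i + l / 2) * 2 ^ (j + d) / l = (x $ i + l / 2) * 2 ^ j / l * 2 ^ d" for i
  by (simp add: power_add)
 show ?thesis unfolding position_def up_def vec_eq_iff vec_lambda_beta eq by (intro allI floor_div_pow)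
qed

lemma side_pos [simp]: "0 < l ==> 0 < side l i" by (simp add: side_def)

lemma position_iff:
 assumes "0 < l"
 shows "x \<in> cell l i \<longleftrightarrow> (\<forall>c. snd i $ c * side l i - l / 2 <= x $ c \<and> x $ c < (snd i $ c + 1) * side l i - l / 2)"
proof -
 have "\<lfloor>(y + l / 2) * 2 ^ j / l\<rfloor> = k \<longleftrightarrow> k * (l / 2 ^ j) - l / 2 <= y \<and> y < (k + 1) * (l / 2 ^ j) - l / 2" for y :: real and j and k :: int
 proof -
  have "\<lfloor>(y + l / 2) * 2 ^ j / l\<rfloor> = k \<longleftrightarrow> k <= (y + l / 2) * 2 ^ j / l \<and> (y + l / 2) * 2 ^ j / l < k + 1"
   by linarith
  also have "k <= (y + l / 2) * 2 ^ j / l \<longleftrightarrow> k * (l / 2 ^ j) <= y + l / 2"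
   using assms by (simp add: pos_le_divide_eq pos_divide_le_eq)
  also have "(y + l / 2) * 2 ^ j / l < k + 1 \<longleftrightarrow> y + l / 2 < (k + 1) * (l / 2 ^ j)"
   using assms by (simp add: pos_less_divide_eq pos_divide_less_eq)
  finally show ?thesis by linarith
 qed
 then show ?thesis by (auto simp: cell_def position_def side_def vec_eq_iff)
qed

lemma mem_cell_iff: "x \<in> cell l (j, k) \<longleftrightarrow> position l j x = k"
 by (simp add: cell_def)

lemma cell_position: "x \<in> cell l (j, position l j x)"
 by (simp add: cell_def)

lemma cell_nonempty: assumes "0 < l" shows "(\<chi> c. snd i $ c * side l i - l / 2) \<in> cell l i"
 using assms by (simp add: position_iff)

lemma cell_subset_up:
 assumes "0 < l" "cell l i \<inter> cell l i' \<noteq> {}" "fst i' <= fst i"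
 shows "cell l i \<subseteq> cell l i'" "up (fst i - fst i') (snd i) = snd i'"
proof -
 obtain x where "x \<in> cell l i" "x \<in> cell l i'" using assms by auto
 then show u: "up (fst i - fst i') (snd i) = snd i'"
  using position_up[of l "fst i'" x "fst i - fst i'"] assms by (simp add: cell_def)
 show "cell l i \<subseteq> cell l i'"
 proof
  fix y assume "y \<in> cell l i"
  moreover have "position l (fst i') y = up (fst i - fst i') (position l (fst i) y)"
   using position_up[of l "fst i'" y "fst i - fst i'"] assms(3) by simp
  ultimately show "y \<in> cell l i'" by (simp add: cell_def u)
 qed
qed

lemma cell_up: "0 < l ==> cell l (j + d, k) \<subseteq> cell l (j, up d k)"
 using position_up[of l j _ d] by (auto simp: cell_def)

lemma cell_laminar: "0 < l ==> cell l i \<inter> cell l i' = {} \<or> cell l i \<subseteq> cell l i' \<or> cell l i' \<subseteq> cell l i"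
 using cell_subset_up(1)[of l i i'] cell_subset_up(1)[of l i' i] by (metis inf_commute linear)

lemma triple_eq: "triple l i = cbox (\<chi> c. (snd i $ c - 1) * side l i - l / 2) (\<chi> c. (snd i $ c + 2) * side l i - l / 2)"
 unfolding triple_def cube_def centre_def by (intro arg_cong2[where f=cbox]) (auto simp: vec_eq_iff algebra_simps)

lemma ccell_eq: "ccell l i = cbox (\<chi> c. snd i $ c * side l i - l / 2) (\<chi> c. (snd i $ c + 1) * side l i - l / 2)"
 unfolding ccell_def cube_def centre_def by (intro arg_cong2[where f=cbox]) (auto simp: vec_eq_iff algebra_simps)

lemma cell_sandwich:
 assumes "0 < l"
 shows "cell l i \<subseteq> ccell l i" "interior (ccell l i) \<subseteq> cell l i"
 using assms by (auto simp: ccell_eq position_iff mem_box_cart less_imp_le interior_cbox)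

lemma ccell_cubes: assumes "0 < l" shows "ccell l i \<in> cubes" "triple l i \<in> cubes"
proof -
 have "0 < side l i" "0 < 3 * side l i" using assms by simp_all
 then show "ccell l i \<in> cubes" "triple l i \<in> cubes" unfolding ccell_def triple_def cubes_def by blast+
qed

lemma AE_cell_ccell: assumes "0 < l" shows "AE x in lebesgue. x \<in> cell l i \<longleftrightarrow> x \<in> ccell l i"
proof -
 have "negligible (ccell l i - interior (ccell l i))"
  unfolding ccell_eq interior_cbox by (rule negligible_frontier_interval)
 then have "ccell l i - interior (ccell l i) \<in> null_sets lebesgue" by (simp add: negligible_iff_null_sets)
 then have "AE x in lebesgue. x \<notin> ccell l i - interior (ccell l i)" by (rule AE_not_in)
 then show ?thesis by eventually_elim (use cell_sandwich[OF assms, of i] in auto)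
qed

lemma cell_borel: "0 < l ==> cell l i \<in> sets borel"
proof -
 assume l: "0 < l"
 have "cell l i = (\<Inter>c\<in>UNIV. {x. snd i $ c * side l i - l / 2 <= x $ c} \<inter> {x. x $ c < (snd i $ c + 1) * side l i - l / 2})"
  using l by (auto simp: position_iff)
 also have "\<dots> \<in> sets borel"
  by (intro sets.finite_INT sets.Int borel_closed borel_open closed_halfspace_component_ge_cart open_halfspace_component_lt_cart)
   (auto simp: closed_Collect_le open_Collect_less continuous_on_component)
 finally show ?thesis .
qed

lemma cell_sets [measurable]: "0 < l ==> cell l i \<in> sets lebesgue"
 using cell_borel[of l i] by (metis sets_completionI_sets sets_lborel)

lemma measure_eq_AE:
 assumes "AE x in M. x \<in> A \<longleftrightarrow> x \<in> B" "A \<in> sets M" "B \<in> sets M"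
 shows "measure M A = measure M B" "emeasure M A = emeasure M B"
 using emeasure_eq_AE[OF assms] by (auto simp: measure_def)

lemma ccell_sets [measurable, simp]: "ccell l i \<in> sets lebesgue" "triple l i \<in> sets lebesgue"
 by (simp_all add: ccell_def triple_def)

lemma measure_cell: "0 < l ==> vol (cell l i :: (real ^ 'n) set) = side l i ^ CARD('n)"
 using measure_eq_AE(1)[OF AE_cell_ccell[of l i] cell_sets[of l i] ccell_sets(1)[of l i]]
 by (simp add: ccell_def cube_measure less_imp_le)

lemma measure_ccell: "0 < l ==> vol (ccell l i) = vol (cell l i)"
 by (simp add: measure_cell ccell_def cube_measure less_imp_le)

lemma measure_triple: "0 < l ==> vol (triple l i :: (real ^ 'n) set) = 3 ^ CARD('n) * vol (cell l i)"
 by (simp add: measure_cell triple_def cube_measure less_imp_le power_mult_distrib)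

lemma measure_cell_pos: "0 < l ==> 0 < vol (cell l i)"
 by (simp add: measure_cell)

lemma cell_fmeasurable: "0 < l ==> cell l i \<in> fmeasurable lebesgue"
 using cell_sandwich(1)[of l i] cubes_props(2)[OF ccell_cubes(1), of l i] by (meson cell_sets fmeasurableI2)

lemma cell_inj: assumes "0 < l" shows "cell l i = cell l i' ==> i = i'"
proof -
 assume eq: "cell l i = cell l i'"
 have "side l i ^ CARD('a) = side l i' ^ CARD('a)"
  using eq measure_cell[OF assms, of i] measure_cell[OF assms, of i'] by simp
 then have "side l i = side l i'"
  using assms by (simp add: power_eq_iff_eq_base less_imp_le)
 then have "(2::real) ^ fst i = 2 ^ fst i'" using assms by (simp add: side_def)
 then have "fst i = fst i'" by simp
 moreover have "snd i = snd i'"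
  using eq cell_nonempty[OF assms, of i] \<open>fst i = fst i'\<close> by (auto simp: cell_def)
 ultimately show ?thesis by (simp add: prod_eq_iff)
qed

lemma cell_subset_level:
 assumes l: "0 < l" and "cell l i \<subseteq> cell l i'" shows "fst i' <= fst i"
proof (rule ccontr)
 assume "\<not> fst i' <= fst i"
 moreover have "cell l i \<inter> cell l i' \<noteq> {}" using assms cell_nonempty[OF l, of i] by auto
 ultimately have "cell l i' = cell l i" using cell_subset_up(1)[OF l, of i' i] assms by auto
 then show False using cell_inj[OF l] \<open>\<not> fst i' <= fst i\<close> by blast
qed

lemma cell_subset_iff:
 assumes l: "0 < l" shows "cell l i \<subseteq> cell l i' \<longleftrightarrow> fst i' <= fst i \<and> up (fst i - fst i') (snd i) = snd i'"
proof
 assume a: "cell l i \<subseteq> cell l i'"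
 then have "cell l i \<inter> cell l i' \<noteq> {}" using cell_nonempty[OF l, of i] by auto
 then show "fst i' <= fst i \<and> up (fst i - fst i') (snd i) = snd i'"
  using cell_subset_up(2)[OF l, of i i'] cell_subset_level[OF l a] by auto
next
 assume "fst i' <= fst i \<and> up (fst i - fst i') (snd i) = snd i'"
 then show "cell l i \<subseteq> cell l i'"
  using cell_up[OF l, of "fst i'" "fst i - fst i'" "snd i"] by simp
qed

text \<open>Measured in units of the smaller side all corners are integers. The larger triple
  extends by a whole larger side beyond its cell, which leaves room for the smaller side added on
  each side of the smaller cell.\<close>

lemma triple_mono:
 assumes l: "0 < l" and sub: "cell l i \<subseteq> cell l i'" shows "triple l i \<subseteq> triple l i'"
proof -
 define d where "d = fst i - fst i'"
 have d: "fst i = fst i' + d" "snd i' = up d (snd i)" using sub by (auto simp: cell_subset_iff[OF l] d_def)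
 have s: "side l i' = 2 ^ d * side l i" by (simp add: side_def d power_add)
 have "(snd i' $ c - 1) * side l i' - l / 2 <= (snd i $ c - 1) * side l i - l / 2"
  "(snd i $ c + 2) * side l i - l / 2 <= (snd i' $ c + 2) * side l i' - l / 2" for c
 proof -
  let ?k = "snd i $ c" and ?k' = "snd i' $ c" and ?m = "2 ^ d :: int"
  have m: "1 <= ?m" by simp
  have k': "?k' = ?k div ?m" by (simp add: d up_def)
  have "?k' * ?m <= ?k" unfolding k' by (metis div_mult_mod_eq le_add_same_cancel1 m pos_mod_sign zero_less_one order_less_le_trans)
  moreover have "?k + 1 <= (?k' + 1) * ?m"
   unfolding k' distrib_right using pos_mod_bound[of ?m ?k] m div_mult_mod_eq[of ?k ?m] by linarith
  ultimately have "(?k' - 1) * ?m <= ?k - 1" "?k + 2 <= (?k' + 2) * ?m"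
   using m by (auto simp: left_diff_distrib distrib_right)
  then have "real_of_int ((?k' - 1) * ?m) <= real_of_int (?k - 1)" "real_of_int (?k + 2) <= real_of_int ((?k' + 2) * ?m)"
   by (simp_all only: of_int_le_iff)
  then have "real_of_int ((?k' - 1) * ?m) * side l i <= real_of_int (?k - 1) * side l i"
   "real_of_int (?k + 2) * side l i <= real_of_int ((?k' + 2) * ?m) * side l i"
   using l by (auto intro!: mult_right_mono less_imp_le)
  then show "(snd i' $ c - 1) * side l i' - l / 2 <= (snd i $ c - 1) * side l i - l / 2"
   "(snd i $ c + 2) * side l i - l / 2 <= (snd i' $ c + 2) * side l i' - l / 2"
   unfolding s by (simp_all add: mult.assoc)
 qed
 note b = this
 show ?thesis
 proof
  fix x assume "x \<in> triple l i"
  then have "(snd i $ c - 1) * side l i - l / 2 <= x $ c \<and> x $ c <= (snd i $ c + 2) * side l i - l / 2" for c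
   by (simp add: triple_eq mem_box_cart)
  then have "(snd i' $ c - 1) * side l i' - l / 2 <= x $ c \<and> x $ c <= (snd i' $ c + 2) * side l i' - l / 2" for c
   using b[of c] by (meson order_trans)
  then show "x \<in> triple l i'" by (simp add: triple_eq mem_box_cart)
 qed
qed

lemma cell_subset_triple: "0 < l ==> cell l i \<subseteq> triple l i"
proof -
 assume l: "0 < l"
 have "ccell l i \<subseteq> triple l i"
 proof
  fix x assume "x \<in> ccell l i"
  then have "snd i $ c * side l i - l / 2 <= x $ c \<and> x $ c <= (snd i $ c + 1) * side l i - l / 2" for c
   by (simp add: ccell_eq mem_box_cart)
  moreover have "(snd i $ c - 1) * side l i <= snd i $ c * side l i" "(snd i $ c + 1) * side l i <= (snd i $ c + 2) * side l i" for c
   using side_pos[OF l, of i] by (auto simp: algebra_simps)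
  ultimately have "(snd i $ c - 1) * side l i - l / 2 <= x $ c \<and> x $ c <= (snd i $ c + 2) * side l i - l / 2" for c
   by (smt (verit))
  then show "x \<in> triple l i" by (simp add: triple_eq mem_box_cart)
 qed
 then show ?thesis using cell_sandwich(1)[OF l, of i] by auto
qed

lemma finite_int_box: "finite {k :: int ^ 'n. \<forall>c. a c <= k $ c \<and> k $ c <= b c}"
proof (rule finite_surj)
 show "finite (PiE (UNIV :: 'n set) (\<lambda>c. {a c..b c}))" by (intro finite_PiE) auto
 show "{k. \<forall>c. a c <= k $ c \<and> k $ c <= b c} \<subseteq> (\<lambda>f. \<chi> c. f c) ` (PiE UNIV (\<lambda>c. {a c..b c}))"
 proof
  fix k :: "int ^ 'n" assume "k \<in> {k. \<forall>c. a c <= k $ c \<and> k $ c <= b c}"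
  then show "k \<in> (\<lambda>f. \<chi> c. f c) ` (PiE UNIV (\<lambda>c. {a c..b c}))"
   by (intro image_eqI[of _ _ "\<lambda>c. k $ c"]) auto
 qed
qed

lemma finite_nbs: "finite (nbs :: (int ^ 'n) set)"
 using finite_int_box[of "\<lambda>_. -1" "\<lambda>_. 1"] by (simp add: nbs_def abs_le_iff minus_le_iff conj_commute)

lemma zero_nbs: "0 \<in> nbs" by (simp add: nbs_def)

lemma uminus_nbs: "e \<in> nbs ==> - e \<in> nbs" by (simp add: nbs_def)

lemma finite_cells_below: assumes l: "0 < l" shows "finite {i. fst i <= L \<and> cell l i \<subseteq> cell l Q}"
proof (rule finite_subset)
 have "{i. fst i <= L \<and> cell l i \<subseteq> cell l Q} \<subseteq> {..L} \<times> (\<Union>d\<le>L. {k. up d k = snd Q})"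
  using diff_le_self order_trans by (fastforce simp: cell_subset_iff[OF l])
 then show "{i. fst i <= L \<and> cell l i \<subseteq> cell l Q} \<subseteq> {..L} \<times> (\<Union>d\<le>L. {k. up d k = snd Q})" .
 have "finite {k. up d k = snd Q}" for d
 proof (rule finite_subset)
  show "{k. up d k = snd Q} \<subseteq> {k. \<forall>c. snd Q $ c * 2 ^ d <= k $ c \<and> k $ c <= (snd Q $ c + 1) * 2 ^ d}"
  proof (clarsimp simp: up_def vec_eq_iff)
   fix k c assume "\<forall>c. (k :: int ^ 'a) $ c div 2 ^ d = snd Q $ c"
   then have q: "snd Q $ c = k $ c div 2 ^ d" by simp
   have "k $ c = k $ c div 2 ^ d * 2 ^ d + k $ c mod 2 ^ d" by (simp only: div_mult_mod_eq)
   moreover have "0 <= k $ c mod 2 ^ d" "k $ c mod 2 ^ d < 2 ^ d" by auto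
   ultimately show "snd Q $ c * 2 ^ d <= k $ c \<and> k $ c <= (snd Q $ c + 1) * 2 ^ d"
    unfolding q distrib_right by linarith
  qed
 qed (rule finite_int_box)
 then show "finite ({..L} \<times> (\<Union>d\<le>L. {k. up d k = snd Q}))" by auto
qed

section \<open>Neighbouring cells\<close>

lemma cell_shift_inj: "shift e i = shift e i' ==> i = i'"
 by (auto simp: shift_def prod_eq_iff)

lemma measure_shift: "0 < l ==> vol (cell l (shift e i)) = vol (cell l i)"
 by (simp add: measure_cell side_def shift_def)

lemma triple_cells:
 assumes l: "0 < l"
 shows "(\<Union>e\<in>nbs. cell l (shift e i)) \<subseteq> triple l i" "interior (triple l i) \<subseteq> (\<Union>e\<in>nbs. cell l (shift e i))"
proof -
 have s: "0 < side l i" "side l (shift e i) = side l i" for e using l by (simp_all add: side_def shift_def)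
 show "(\<Union>e\<in>nbs. cell l (shift e i)) \<subseteq> triple l i"
 proof safe
  fix e x assume e: "e \<in> nbs" and x: "x \<in> cell l (shift e i)"
  have "(snd i $ c - 1) * side l i - l / 2 <= x $ c \<and> x $ c <= (snd i $ c + 2) * side l i - l / 2" for c
  proof -
   have "- 1 <= e $ c" "e $ c <= 1" using e by (auto simp: nbs_def abs_le_iff minus_le_iff)
   then have "real_of_int (snd i $ c - 1) <= real_of_int (snd i $ c + e $ c)" "real_of_int (snd i $ c + e $ c + 1) <= real_of_int (snd i $ c + 2)"
    by (simp_all only: of_int_le_iff)
   then have "(snd i $ c - 1) * side l i <= (snd i $ c + e $ c) * side l i" "(snd i $ c + e $ c + 1) * side l i <= (snd i $ c + 2) * side l i"
    using s by (auto intro!: mult_right_mono less_imp_le)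
   moreover have "(snd i $ c + e $ c) * side l i - l / 2 <= x $ c \<and> x $ c < (snd i $ c + e $ c + 1) * side l i - l / 2"
    using x[unfolded position_iff[OF l], rule_format, of c] s by (simp add: shift_def)
   ultimately show ?thesis by auto
  qed
  then show "x \<in> triple l i" by (simp add: triple_eq mem_box_cart)
 qed
 show "interior (triple l i) \<subseteq> (\<Union>e\<in>nbs. cell l (shift e i))"
 proof
  fix x assume "x \<in> interior (triple l i)"
  then have x: "(snd i $ c - 1) * side l i - l / 2 < x $ c \<and> x $ c < (snd i $ c + 2) * side l i - l / 2" for c
   by (simp add: triple_eq interior_cbox mem_box_cart)
  define e where "e = position l (fst i) x - snd i"
  have xe: "x \<in> cell l (shift e i)" by (simp add: cell_def shift_def e_def)
  have "\<bar>e $ c\<bar> <= 1" for c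
  proof -
   have "(snd i $ c + e $ c) * side l i - l / 2 <= x $ c \<and> x $ c < (snd i $ c + e $ c + 1) * side l i - l / 2"
    using xe[unfolded position_iff[OF l], rule_format, of c] s by (simp add: shift_def)
   then have "real_of_int (snd i $ c - 1) * side l i < real_of_int (snd i $ c + e $ c + 1) * side l i"
    "real_of_int (snd i $ c + e $ c) * side l i < real_of_int (snd i $ c + 2) * side l i" using x[of c] by auto
   then have "snd i $ c - 1 < snd i $ c + e $ c + 1" "snd i $ c + e $ c < snd i $ c + 2"
    using s(1) by (simp_all only: mult_less_cancel_right_pos of_int_less_iff)
   then show ?thesis by linarith
  qed
  then have "e \<in> nbs" by (simp add: nbs_def)
  then show "x \<in> (\<Union>e\<in>nbs. cell l (shift e i))" using xe by auto
 qed
qed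

lemma AE_triple_cells: assumes "0 < l" shows "AE x in lebesgue. x \<in> triple l i \<longleftrightarrow> (\<exists>e\<in>nbs. x \<in> cell l (shift e i))"
proof -
 have "negligible (triple l i - interior (triple l i))"
  unfolding triple_eq interior_cbox by (rule negligible_frontier_interval)
 then have "triple l i - interior (triple l i) \<in> null_sets lebesgue" by (simp add: negligible_iff_null_sets)
 then have "AE x in lebesgue. x \<notin> triple l i - interior (triple l i)" by (rule AE_not_in)
 then show ?thesis by eventually_elim (use triple_cells[OF assms, of i] in auto)
qed

lemma abs_div_diff_le:
 fixes k e m :: int assumes "\<bar>e\<bar> <= 1" "1 <= m" shows "\<bar>(k + e) div m - k div m\<bar> <= 1"
proof -
 have "(k + e) div m <= (k + m) div m" "(k - m) div m <= (k + e) div m"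
  by (rule zdiv_mono1, use assms in linarith, use assms in linarith)+
 moreover have "(k + m) div m = k div m + 1" "(k - m) div m = k div m - 1"
  using assms div_add_self2[of m k] div_add_self2[of m "k - m"] by auto
 ultimately show ?thesis by linarith
qed

text \<open>Neighbours of cells inside \<open>Q\<close> lie in neighbours of \<open>Q\<close>.\<close>

lemma shift_subset:
 assumes l: "0 < l" and e: "e \<in> nbs" and sub: "cell l (shift e i) \<subseteq> cell l Q"
 shows "\<exists>e'\<in>nbs. cell l i \<subseteq> cell l (shift e' Q)"
proof -
 define d where "d = fst i - fst Q"
 have d: "fst i = fst Q + d" "up d (snd i + e) = snd Q" using sub by (auto simp: cell_subset_iff[OF l] d_def shift_def)
 define e' where "e' = up d (snd i) - snd Q"
 have "\<bar>e' $ c\<bar> <= 1" for c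
  using abs_div_diff_le[of "e $ c" "2 ^ d" "snd i $ c"] e unfolding e'_def d(2)[symmetric] up_def nbs_def
  by (simp add: abs_minus_commute)
 then have "e' \<in> nbs" by (simp add: nbs_def)
 moreover have "cell l i \<subseteq> cell l (shift e' Q)"
  by (simp add: cell_subset_iff[OF l] shift_def d(1) e'_def)
 ultimately show ?thesis by auto
qed

lemma shift_uminus: "shift e (shift (- e) i) = i" "shift (- e) (shift e i) = i"
 by (simp_all add: shift_def)

lemma subset_shift:
 assumes l: "0 < l" and e: "e \<in> nbs" and sub: "cell l i \<subseteq> cell l Q"
 shows "\<exists>e'\<in>nbs. cell l (shift e i) \<subseteq> cell l (shift e' Q)"
 using shift_subset[OF l uminus_nbs[OF e], of "shift e i" Q] sub by (simp add: shift_uminus)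

lemma cell_subset_triple_shift: assumes l: "0 < l" and e: "e \<in> nbs" shows "cell l i \<subseteq> triple l (shift e i)" "cell l (shift e i) \<subseteq> triple l i"
 using triple_cells(1)[OF l, of "shift e i"] triple_cells(1)[OF l, of i] uminus_nbs[OF e] e shift_uminus(2)[of e i]
 by (force)+

section \<open>Mean oscillation\<close>

definition dev :: "(real ^ 'n => 'k::euclidean_space) => 'k => (real ^ 'n) set => ennreal"
 where "dev b c A = (\<integral>\<^sup>+x\<in>A. ennreal (norm (b x - c)) \<partial>lebesgue)"

lemma dev_mono: "A \<subseteq> A' ==> dev b c A <= dev b c A'"
 unfolding dev_def by (intro nn_integral_mono) (auto split: split_indicator)

lemma dev_cong_AE: "AE x in lebesgue. x \<in> A \<longleftrightarrow> x \<in> A' ==> dev b c A = dev b c A'"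
 unfolding dev_def by (intro nn_integral_cong_AE) (auto elim!: eventually_mono split: split_indicator)

lemma loc_integrable_set:
 assumes "loc_integrable b" "compact X" "A \<subseteq> X" "A \<in> sets lebesgue"
 shows "set_integrable lebesgue A b"
 using assms set_integrable_subset[of lebesgue X b A] by (auto simp: loc_integrable_def)

lemma dev_finite:
 fixes b :: "real ^ 'n => 'k::euclidean_space"
 assumes b: "loc_integrable b" and X: "compact X" "A \<subseteq> X" "A \<in> sets lebesgue"
 shows "dev b c A < \<infinity>"
proof -
 have A: "A \<in> fmeasurable lebesgue" using X by (meson fmeasurableI2 lmeasurable_compact)
 have [measurable]: "b \<in> borel_measurable lebesgue" "A \<in> sets lebesgue"
  using loc_integrable_measurable[OF b] X by auto
 have "(\<integral>\<^sup>+x. ennreal (norm (indicator A x *\<^sub>R b x)) \<partial>lebesgue) < \<infinity>"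
  using loc_integrable_set[OF b X] unfolding set_integrable_def by (simp add: integrable_iff_bounded)
 moreover have "dev b c A <= (\<integral>\<^sup>+x. ennreal (norm (indicator A x *\<^sub>R b x)) + ennreal (norm c) * indicator A x \<partial>lebesgue)"
  unfolding dev_def by (intro nn_integral_mono)
   (auto split: split_indicator simp: ennreal_plus[symmetric] norm_triangle_ineq4 intro!: ennreal_leI simp del: ennreal_plus)
 moreover have "(\<integral>\<^sup>+x. ennreal (norm (indicator A x *\<^sub>R b x)) + ennreal (norm c) * indicator A x \<partial>lebesgue) =
   (\<integral>\<^sup>+x. ennreal (norm (indicator A x *\<^sub>R b x)) \<partial>lebesgue) + ennreal (norm c) * emeasure lebesgue A"
  by (subst nn_integral_add) (auto simp: nn_integral_cmult)
 moreover have "ennreal (norm c) * emeasure lebesgue A < \<infinity>"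
  using fmeasurableD2[OF A] by (simp add: ennreal_mult_less_top less_top)
 ultimately show ?thesis by (simp add: order_le_less_trans)
qed

lemma avg_diff_le:
 fixes b :: "real ^ 'n => 'k::euclidean_space"
 assumes b: "set_integrable lebesgue A b" and A: "A \<in> fmeasurable lebesgue" "0 < vol A"
 shows "ennreal (norm (avg b A - c) * vol A) <= dev b c A"
proof -
 let ?m = "vol A"
 have cint: "set_integrable lebesgue A (\<lambda>_. c)"
  using A unfolding set_integrable_def
  by (intro integrable_scaleR_left integrable_real_indicator) (auto simp: fmeasurable_def)
 have "(LINT x:A|lebesgue. b x - c) = ?m *\<^sub>R (avg b A - c)"
 proof -
  have "(LINT x:A|lebesgue. c) = (LINT x|lebesgue. indicator A x) *\<^sub>R c"
   unfolding set_lebesgue_integral_def using A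
   by (intro integral_scaleR_left integrable_real_indicator) (auto simp: fmeasurable_def)
  then have "(LINT x:A|lebesgue. c) = ?m *\<^sub>R c" by simp
  then show ?thesis using set_integral_diff(2)[OF b cint] A by (simp add: avg_def scaleR_right_diff_distrib)
 qed
 then have "norm (avg b A - c) * ?m = norm (LINT x:A|lebesgue. b x - c)" by simp
 also have "ennreal \<dots> <= (\<integral>\<^sup>+x. ennreal (norm (indicator A x *\<^sub>R (b x - c))) \<partial>lebesgue)"
  unfolding set_lebesgue_integral_def
  by (rule integral_norm_bound_ennreal) (use set_integral_diff(1)[OF b cint] in \<open>simp add: set_integrable_def\<close>)
 also have "\<dots> = dev b c A" unfolding dev_def by (intro nn_integral_cong) (auto split: split_indicator)
 finally show ?thesis .
qed

lemma osc_dev: "osc b Q = dev b (avg b Q) Q"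
 by (simp add: osc_def dev_def)

text \<open>The average is within a factor 2 of the best constant, so any convenient
  \<open>c\<close> may be used to estimate oscillations.\<close>

lemma dev_avg_le:
 fixes b :: "real ^ 'n => 'k::euclidean_space"
 assumes b: "set_integrable lebesgue A b" "b \<in> borel_measurable lebesgue"
  and A: "A \<in> fmeasurable lebesgue" "0 < vol A"
 shows "dev b (avg b A) A <= 2 * dev b c A"
proof -
 have [measurable]: "b \<in> borel_measurable lebesgue" "A \<in> sets lebesgue" using b A by auto
 have "dev b (avg b A) A <= (\<integral>\<^sup>+x. ennreal (norm (b x - c)) * indicator A x + ennreal (norm (avg b A - c)) * indicator A x \<partial>lebesgue)"
  unfolding dev_def
 proof (intro nn_integral_mono)
  fix x
  have "norm (b x - avg b A) <= norm (b x - c) + norm (avg b A - c)" by norm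
  then show "ennreal (norm (b x - avg b A)) * indicator A x <= ennreal (norm (b x - c)) * indicator A x + ennreal (norm (avg b A - c)) * indicator A x"
   by (auto split: split_indicator simp: ennreal_plus[symmetric] simp del: ennreal_plus intro!: ennreal_leI)
 qed
 also have "\<dots> = dev b c A + ennreal (norm (avg b A - c) * vol A)"
  using A by (simp add: dev_def nn_integral_add nn_integral_cmult ennreal_mult emeasure_eq_measure2)
 also have "\<dots> <= dev b c A + dev b c A" by (intro add_left_mono avg_diff_le b A)
 finally show ?thesis by (simp add: mult_2)
qed

lemma borel_imp_lebesgue_measurable:
 fixes f :: "'a::euclidean_space => 'b::topological_space"
 shows "f \<in> borel_measurable borel ==> f \<in> borel_measurable lebesgue"
 by (rule measurable_completion) simp

section \<open>Approximation in the mean by continuous functions\<close>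

definition clip :: "real => 'k::real_normed_vector => 'k" where "clip R y = (R / max R (norm y)) *\<^sub>R y"

lemma clip_props:
 fixes y :: "'k::real_normed_vector"
 assumes "0 < R"
 shows "norm (clip R y) <= R" "norm (clip R y) <= norm y" "norm y <= R ==> clip R y = y" "continuous_on UNIV (clip R :: 'k => 'k)"
proof -
 show "norm (clip R y) <= R" "norm (clip R y) <= norm y" "norm y <= R ==> clip R y = y"
  using assms by (auto simp: clip_def max_def field_simps mult_left_mono)
 have "max R (norm z) \<noteq> 0" for z :: 'k using assms by (auto simp: max_def)
 then show "continuous_on UNIV (clip R :: 'k => 'k)"
  unfolding clip_def by (intro continuous_intros) auto
qed

text \<open>Measurability only provides continuous functions converging almost everywhere. Clipping
  supplies the dominating functions: clipping \<open>b\<close> at a high level changes it little in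
  the mean, and the clipped approximants are bounded by that level.\<close>

lemma approx_continuous:
 fixes b :: "real ^ 'n => 'k::euclidean_space"
 assumes b: "loc_integrable b" and X: "compact X" and \<epsilon>: "0 < \<epsilon>"
 shows "\<exists>f. continuous_on UNIV f \<and> (\<integral>\<^sup>+x\<in>X. ennreal (norm (b x - f x)) \<partial>lebesgue) < ennreal \<epsilon>"
proof -
 have Xf: "X \<in> fmeasurable lebesgue" by (rule lmeasurable_compact[OF X])
 then have Xm[measurable]: "X \<in> sets lebesgue" by auto
 have [measurable]: "b \<in> borel_measurable lebesgue" by (rule loc_integrable_measurable[OF b])
 have cm [measurable]: "0 < R ==> clip R \<in> borel_measurable borel" for R :: real
  by (intro borel_measurable_continuous_onI clip_props)
 have bfin: "(\<integral>\<^sup>+x. ennreal (norm (b x)) * indicator X x \<partial>lebesgue) < \<infinity>"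
  using dev_finite[OF b X subset_refl Xm, of 0] by (simp add: dev_def)
 have "(\<lambda>n. \<integral>\<^sup>+x\<in>X. ennreal (norm (b x - clip (Suc n) (b x))) \<partial>lebesgue) \<longlonglongrightarrow> (\<integral>\<^sup>+(x::real ^ 'n). 0 \<partial>lebesgue)"
 proof (rule nn_integral_dominated_convergence[where u'="\<lambda>_. 0" and w="\<lambda>x. 2 * (ennreal (norm (b x)) * indicator X x)"])
  show "AE x in lebesgue. ennreal (norm (b x - clip (real (Suc j)) (b x))) * indicator X x <= 2 * (ennreal (norm (b x)) * indicator X x)" for j
  proof (rule AE_I2)
   fix x
   have "norm (b x - clip (Suc j) (b x)) <= norm (b x) + norm (clip (Suc j) (b x))" by norm
   also have "\<dots> <= 2 * norm (b x)" using clip_props(2)[of "Suc j" "b x"] by simp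
   finally show "ennreal (norm (b x - clip (real (Suc j)) (b x))) * indicator X x <= 2 * (ennreal (norm (b x)) * indicator X x)"
    by (auto split: split_indicator dest!: ennreal_leI simp: ennreal_mult)
  qed
  show "AE x in lebesgue. (\<lambda>i. ennreal (norm (b x - clip (real (Suc i)) (b x))) * indicator X x) \<longlonglongrightarrow> 0"
  proof (rule AE_I2)
   fix x
   obtain n0 where n0: "norm (b x) <= real n0" using real_arch_simple by blast
   have "\<forall>\<^sub>F i in sequentially. 0 = ennreal (norm (b x - clip (real (Suc i)) (b x))) * indicator X x"
    unfolding eventually_sequentially
    by (intro exI[of _ n0] allI impI) (use n0 clip_props(3)[of "real (Suc _)" "b x"] in force)
   then show "(\<lambda>i. ennreal (norm (b x - clip (real (Suc i)) (b x))) * indicator X x) \<longlonglongrightarrow> 0"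
    by (rule Lim_transform_eventually[OF tendsto_const])
  qed
  show "(\<integral>\<^sup>+x. 2 * (ennreal (norm (b x)) * indicator X x) \<partial>lebesgue) < \<infinity>"
   using bfin by (subst nn_integral_cmult) (auto simp: ennreal_mult_less_top)
 qed auto
 then have "\<forall>\<^sub>F n in sequentially. (\<integral>\<^sup>+x\<in>X. ennreal (norm (b x - clip (Suc n) (b x))) \<partial>lebesgue) < ennreal (\<epsilon> / 2)"
  using \<epsilon> by (intro order_tendstoD(2)) auto
 then obtain n1 where n1: "(\<integral>\<^sup>+x\<in>X. ennreal (norm (b x - clip (Suc n1) (b x))) \<partial>lebesgue) < ennreal (\<epsilon> / 2)"
  by (auto simp: eventually_sequentially)
 define R where "R = real (Suc n1)"
 have R: "0 < R" by (simp add: R_def)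
 have "b measurable_on X" by (intro lebesgue_measurable_imp_measurable_on) auto
 then obtain N g where N: "negligible N" and g: "!!n. continuous_on UNIV (g n)"
  and lim: "!!x. x \<notin> N ==> (\<lambda>n. g n x) \<longlonglongrightarrow> (if x \<in> X then b x else 0)"
  unfolding measurable_on_def by blast
 have AEN: "AE x in lebesgue. x \<notin> N" by (rule AE_not_in) (use N in \<open>simp add: negligible_iff_null_sets\<close>)
 have gm [measurable]: "g n \<in> borel_measurable lebesgue" for n
  using borel_measurable_continuous_onI[OF g[of n]] by (rule borel_imp_lebesgue_measurable)
 have "(\<lambda>n. \<integral>\<^sup>+x\<in>X. ennreal (norm (clip R (b x) - clip R (g n x))) \<partial>lebesgue) \<longlonglongrightarrow> (\<integral>\<^sup>+(x::real ^ 'n). 0 \<partial>lebesgue)"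
 proof (rule nn_integral_dominated_convergence[where u'="\<lambda>_. 0" and w="\<lambda>x. ennreal (2 * R) * indicator X x"])
  show "AE x in lebesgue. ennreal (norm (clip R (b x) - clip R (g j x))) * indicator X x <= ennreal (2 * R) * indicator X x" for j
  proof (rule AE_I2)
   fix x
   have "norm (clip R (b x) - clip R (g j x)) <= norm (clip R (b x)) + norm (clip R (g j x))" by norm
   also have "\<dots> <= 2 * R" using clip_props(1)[OF R, of "b x"] clip_props(1)[OF R, of "g j x"] by simp
   finally show "ennreal (norm (clip R (b x) - clip R (g j x))) * indicator X x <= ennreal (2 * R) * indicator X x"
    by (auto split: split_indicator intro!: ennreal_leI)
  qed
  show "AE x in lebesgue. (\<lambda>i. ennreal (norm (clip R (b x) - clip R (g i x))) * indicator X x) \<longlonglongrightarrow> 0"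
   using AEN
  proof eventually_elim
   case (elim x)
   show ?case
   proof (cases "x \<in> X")
    case True
    have "(\<lambda>i. clip R (g i x)) \<longlonglongrightarrow> clip R (b x)"
     using clip_props(4)[OF R] lim[OF elim] True
     by (intro isCont_tendsto_compose[of _ "clip R"]) (auto simp: continuous_on_eq_continuous_at)
    then have "(\<lambda>i. ennreal (norm (clip R (b x) - clip R (g i x)))) \<longlonglongrightarrow> ennreal (norm (clip R (b x) - clip R (b x)))"
     by (intro tendsto_ennrealI tendsto_norm tendsto_diff tendsto_const)
    then show ?thesis using True by simp
   qed simp
  qed
  show "(\<integral>\<^sup>+x. ennreal (2 * R) * indicator X x \<partial>lebesgue) < \<infinity>"
   using Xf by (subst nn_integral_cmult) (auto simp: ennreal_mult_less_top fmeasurable_def)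
 qed (use R in measurable)
 then have "\<forall>\<^sub>F n in sequentially. (\<integral>\<^sup>+x\<in>X. ennreal (norm (clip R (b x) - clip R (g n x))) \<partial>lebesgue) < ennreal (\<epsilon> / 2)"
  using \<epsilon> by (intro order_tendstoD(2)) auto
 then obtain n2 where n2: "(\<integral>\<^sup>+x\<in>X. ennreal (norm (clip R (b x) - clip R (g n2 x))) \<partial>lebesgue) < ennreal (\<epsilon> / 2)"
  by (auto simp: eventually_sequentially)
 show ?thesis
 proof (intro exI[of _ "\<lambda>x. clip R (g n2 x)"] conjI)
  show "continuous_on UNIV (\<lambda>x. clip R (g n2 x))"
   using continuous_on_compose2[OF clip_props(4)[OF R] g[of n2]] by simp
  have "(\<integral>\<^sup>+x\<in>X. ennreal (norm (b x - clip R (g n2 x))) \<partial>lebesgue) \<le>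
   (\<integral>\<^sup>+x. ennreal (norm (b x - clip R (b x))) * indicator X x + ennreal (norm (clip R (b x) - clip R (g n2 x))) * indicator X x \<partial>lebesgue)"
  proof (intro nn_integral_mono)
   fix x
   have "norm (b x - clip R (g n2 x)) <= norm (b x - clip R (b x)) + norm (clip R (b x) - clip R (g n2 x))" by norm
   then show "ennreal (norm (b x - clip R (g n2 x))) * indicator X x <= ennreal (norm (b x - clip R (b x))) * indicator X x + ennreal (norm (clip R (b x) - clip R (g n2 x))) * indicator X x"
    by (auto split: split_indicator simp: ennreal_plus[symmetric] simp del: ennreal_plus intro!: ennreal_leI)
  qed
  also have "\<dots> = (\<integral>\<^sup>+x\<in>X. ennreal (norm (b x - clip R (b x))) \<partial>lebesgue) + (\<integral>\<^sup>+x\<in>X. ennreal (norm (clip R (b x) - clip R (g n2 x))) \<partial>lebesgue)"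
   using R by (intro nn_integral_add) measurable
  also have "\<dots> < ennreal (\<epsilon> / 2) + ennreal (\<epsilon> / 2)"
   using n1 n2 unfolding R_def[symmetric] by (rule add_strict_mono)
  also have "\<dots> = ennreal \<epsilon>" using \<epsilon> by (subst ennreal_plus[symmetric]) auto
  finally show "(\<integral>\<^sup>+x\<in>X. ennreal (norm (b x - clip R (g n2 x))) \<partial>lebesgue) < ennreal \<epsilon>" .
 qed
qed

section \<open>Dyadic averages of \<open>b\<close>\<close>

definition ctr :: "real => (real ^ 'n => 'k::euclidean_space) => 'n idx => 'k" where "ctr l b i = avg b (ccell l i)"

definition lev :: "real => (real ^ 'n => 'k::euclidean_space) => nat => real ^ 'n => 'k"
 where "lev l b j x = ctr l b (j, position l j x)"

text \<open>The support of \<open>f\<close> will lie in the central cell of level 0. This larger set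
  also contains all neighbours of the cells inside the central one.\<close>

definition base :: "real => (real ^ 'n) set" where "base l = (\<Union>e\<in>nbs. cell l (0, e))"

definition leaves :: "real => nat => ('n::finite) idx set"
 where "leaves l L = {i. fst i = L \<and> cell l i \<subseteq> base l}"

lemma base_triple: "0 < l ==> base l \<subseteq> triple l (0, 0)"
 using triple_cells(1)[of l "(0, 0)"] by (simp add: base_def shift_def)

lemma base_sets [measurable]: "0 < l ==> base l \<in> sets lebesgue"
 unfolding base_def using finite_nbs by (intro sets.finite_UN) auto

lemma subset_base_iff: "0 < l ==> cell l i \<subseteq> base l \<longleftrightarrow> (\<exists>e\<in>nbs. cell l i \<subseteq> cell l (0, e))"
proof
 assume l: "0 < l" and sub: "cell l i \<subseteq> base l"
 obtain x where x: "x \<in> cell l i" using cell_nonempty[OF l] by blast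
 then obtain e where e: "e \<in> nbs" "x \<in> cell l (0, e)" using sub by (auto simp: base_def)
 then show "\<exists>e\<in>nbs. cell l i \<subseteq> cell l (0, e)"
  using cell_subset_up(1)[OF l, of i "(0, e)"] x by auto
qed (auto simp: base_def)

lemma finite_base_cells: assumes l: "0 < l" shows "finite {i. fst i <= L \<and> cell l i \<subseteq> base l}"
proof (rule finite_subset)
 show "{i. fst i <= L \<and> cell l i \<subseteq> base l} \<subseteq> (\<Union>e\<in>nbs. {i. fst i <= L \<and> cell l i \<subseteq> cell l (0, e)})"
  by (auto simp: subset_base_iff[OF l])
 show "finite (\<Union>e\<in>nbs. {i. fst i <= L \<and> cell l i \<subseteq> cell l (0, e)})"
  using finite_nbs finite_cells_below[OF l] by blast
qed

lemma finite_leaves: "0 < l ==> finite (leaves l L)"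
 by (rule finite_subset[OF _ finite_base_cells[of l L]]) (auto simp: leaves_def)

lemma leaf_of: assumes l: "0 < l" and x: "x \<in> base l" shows "(L, position l L x) \<in> leaves l L"
proof -
 obtain e where e: "e \<in> nbs" "x \<in> cell l (0, e)" using x by (auto simp: base_def)
 then have "cell l (L, position l L x) \<subseteq> cell l (0, e)"
  using cell_subset_up(1)[OF l, of "(L, position l L x)" "(0, e)"] cell_position[of x l L] by auto
 then show ?thesis using e by (auto simp: leaves_def subset_base_iff[OF l])
qed

lemma sum_leaves:
 fixes f :: "('n::finite) idx => 'b::semiring_1"
 assumes l: "0 < l" and x: "x \<in> base l"
 shows "(\<Sum>i\<in>leaves l L. f i * indicator (cell l i) x) = f (L, position l L x)"
proof -
 have "{i\<in>leaves l L. x \<in> cell l i} = {(L, position l L x)}"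
  using leaf_of[OF l x, of L] by (auto simp: leaves_def cell_def)
 then show ?thesis using sum_indicator_filter[OF finite_leaves[OF l], of f "cell l" x] by simp
qed

lemma dist_in_cell:
 fixes x y :: "real ^ 'n"
 assumes l: "0 < l" and xy: "x \<in> cell l i" "y \<in> cell l i"
 shows "dist x y <= CARD('n) * side l i"
proof -
 have "\<bar>(x - y) $ c\<bar> <= side l i" for c
  using xy[unfolded position_iff[OF l]] by (auto simp: abs_le_iff algebra_simps dest!: spec[of _ c])
 then have "(\<Sum>c\<in>UNIV. \<bar>(x - y) $ c\<bar>) <= (\<Sum>c\<in>(UNIV::'n set). side l i)" by (intro sum_mono)
 then show ?thesis using norm_le_l1_cart[of "x - y"] by (simp add: dist_norm)
qed

lemma ctr_facts:
 assumes b: "loc_integrable b" and l: "0 < l"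
 shows "ennreal (norm (ctr l b i - c) * vol (cell l i)) <= dev b c (cell l i)"
  "dev b (ctr l b i) (cell l i) <= 2 * dev b c (cell l i)" "dev b c (cell l i) < \<infinity>"
proof -
 note cQ = cubes_props[OF ccell_cubes(1)[OF l, of i]]
 have si: "set_integrable lebesgue (ccell l i) b" using loc_integrable_set[OF b cQ(4) subset_refl cQ(1)] .
 have eq: "dev b c (cell l i) = dev b c (ccell l i)" for c by (rule dev_cong_AE[OF AE_cell_ccell[OF l]])
 show "ennreal (norm (ctr l b i - c) * vol (cell l i)) <= dev b c (cell l i)"
  using avg_diff_le[OF si cQ(2,3)] unfolding eq ctr_def measure_ccell[OF l] .
 show "dev b (ctr l b i) (cell l i) <= 2 * dev b c (cell l i)"
  using dev_avg_le[OF si loc_integrable_measurable[OF b] cQ(2,3)] unfolding eq ctr_def .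
 show "dev b c (cell l i) < \<infinity>"
  using dev_finite[OF b cQ(4) cell_sandwich(1)[OF l] cell_sets[OF l]] .
qed

lemma sum_disjoint_cells:
 assumes l: "0 < l" and A: "finite A" "!!i j. i \<in> A ==> j \<in> A ==> i \<noteq> j ==> cell l i \<inter> cell l j = {}"
  "!!i. i \<in> A ==> cell l i \<subseteq> X" and f: "f \<in> borel_measurable lebesgue"
 shows "(\<Sum>i\<in>A. (\<integral>\<^sup>+x\<in>cell l i. f x \<partial>lebesgue)) <= (\<integral>\<^sup>+x\<in>X. f x \<partial>lebesgue)"
proof -
 note [measurable] = f
 have "(\<Sum>i\<in>A. (\<integral>\<^sup>+x\<in>cell l i. f x \<partial>lebesgue)) = (\<integral>\<^sup>+x. (\<Sum>i\<in>A. f x * indicator (cell l i) x) \<partial>lebesgue)"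
  using l by (intro nn_integral_sum[symmetric]) measurable
 also have "\<dots> <= (\<integral>\<^sup>+x\<in>X. f x \<partial>lebesgue)"
 proof (intro nn_integral_mono)
  fix x
  show "(\<Sum>i\<in>A. f x * indicator (cell l i) x) <= f x * indicator X x"
  proof (cases "\<exists>j\<in>A. x \<in> cell l j")
   case True
   then obtain j where j: "j \<in> A" "x \<in> cell l j" by auto
   then have "{i\<in>A. x \<in> cell l i} = {j}" using A(2)[OF _ j(1)] by blast
   then show ?thesis using sum_indicator_filter[OF A(1), of "\<lambda>_. f x" "cell l" x] A(3)[OF j(1)] j by auto
  next
   case False
   then have "(\<Sum>i\<in>A. f x * indicator (cell l i) x) = 0" by (intro sum.neutral) auto
   then show ?thesis by simp
  qed
 qed
 finally show ?thesis .
qed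

lemma sum_disjoint_measure:
 assumes l: "0 < l" and A: "finite A" "!!i j. i \<in> A ==> j \<in> A ==> i \<noteq> j ==> cell l i \<inter> cell l j = {}"
  "!!i. i \<in> A ==> cell l i \<subseteq> X" and X: "X \<in> fmeasurable lebesgue"
 shows "(\<Sum>i\<in>A. vol (cell l i)) <= vol X"
proof -
 have [measurable]: "X \<in> sets lebesgue" using X by auto
 have "(\<Sum>i\<in>A. ennreal (vol (cell l i))) <= emeasure lebesgue X"
  using sum_disjoint_cells[OF l A, of "\<lambda>_. 1"] l by (simp add: emeasure_eq_measure2[OF cell_fmeasurable[OF l], symmetric])
 then show ?thesis using X by (simp add: emeasure_eq_measure2 sum_ennreal ennreal_le_iff)
qed

text \<open>Dyadic differentiation, along a subsequence.\<close>

lemma lev_tendsto: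
 fixes b :: "real ^ 'n => 'k::euclidean_space"
 assumes b: "loc_integrable b" and l: "0 < l"
 shows "\<exists>\<phi>. strict_mono \<phi> \<and> (AE x in lebesgue. x \<in> base l --> (\<lambda>n. lev l b (\<phi> n) x) \<longlonglongrightarrow> b x)"
proof -
 have bm [measurable]: "b \<in> borel_measurable lebesgue" by (rule loc_integrable_measurable[OF b])
 let ?X = "base l :: (real ^ 'n) set"
 have [measurable]: "?X \<in> sets lebesgue" by (rule base_sets[OF l])
 have cT: "compact (triple l (0, 0 :: int ^ 'n))" by (simp add: triple_def compact_cube)
 have Xf: "?X \<in> fmeasurable lebesgue"
  by (rule fmeasurableI2[OF lmeasurable_compact[OF cT] base_triple[OF l]]) simp
 define u where "u n x = indicator ?X x *\<^sub>R b x - (\<Sum>i\<in>leaves l n. indicator (cell l i) x *\<^sub>R ctr l b i)" for n x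
 have u_eq: "u n x = indicator ?X x *\<^sub>R (b x - lev l b n x)" for n x
 proof (cases "x \<in> ?X")
  case True
  have "{i\<in>leaves l n. x \<in> cell l i} = {(n, position l n x)}"
   using leaf_of[OF l True, of n] by (auto simp: leaves_def cell_def)
  moreover have "(\<Sum>i\<in>leaves l n. indicator (cell l i) x *\<^sub>R ctr l b i) = (\<Sum>i\<in>{i\<in>leaves l n. x \<in> cell l i}. ctr l b i)"
   using finite_leaves[OF l] by (intro sum.mono_neutral_cong_right) auto
  ultimately show ?thesis using True by (simp add: u_def lev_def)
 next
  case False
  then have "(\<Sum>i\<in>leaves l n. indicator (cell l i) x *\<^sub>R ctr l b i) = 0"
   by (intro sum.neutral) (auto simp: leaves_def split: split_indicator)
  then show ?thesis using False by (simp add: u_def)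
 qed
 have um [measurable]: "u n \<in> borel_measurable lebesgue" for n
  unfolding u_def using l by measurable
 have small: "\<exists>n0. \<forall>n\<ge>n0. (\<integral>\<^sup>+x. ennreal (norm (u n x)) \<partial>lebesgue) <= ennreal \<epsilon>" if \<epsilon>: "0 < \<epsilon>" for \<epsilon>
 proof -
  let ?m = "vol ?X"
  define \<omega> where "\<omega> = \<epsilon> / (4 * (?m + 1))"
  have \<omega>: "0 < \<omega>" "2 * \<omega> * ?m <= \<epsilon> / 2"
  proof -
   have "0 <= ?m" by simp
   then show "0 < \<omega>" using \<epsilon> unfolding \<omega>_def by (intro divide_pos_pos mult_pos_pos) linarith+
   have "2 * \<omega> * ?m = \<epsilon> / 2 * (?m / (?m + 1))"       proof -
    have "0 < ?m + 1" using \<open>0 <= ?m\<close> by linarith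
    then show ?thesis unfolding \<omega>_def by (simp add: divide_simps)
   qed
   moreover have "?m / (?m + 1) <= 1" using \<open>0 <= ?m\<close> by (intro divide_le_eq_1_pos[THEN iffD2]) linarith+
   then have "\<epsilon> / 2 * (?m / (?m + 1)) <= \<epsilon> / 2 * 1" using \<epsilon> by (intro mult_left_mono) auto
   ultimately show "2 * \<omega> * ?m <= \<epsilon> / 2" by simp
  qed
  \<comment> \<open>The error is shared: \<open>b - f\<close> contributes at most
    \<open>2 * \<epsilon> / 4\<close>, and the oscillation of \<open>f\<close> on small cells at
    most \<open>2 * \<omega> * ?m\<close>. The factor 2 is the cost of replacing a value of
    \<open>f\<close> by the average of \<open>b\<close>.\<close>
  obtain f where f: "continuous_on UNIV f" "(\<integral>\<^sup>+x\<in>triple l (0, 0). ennreal (norm (b x - f x)) \<partial>lebesgue) < ennreal (\<epsilon> / 4)"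
   using approx_continuous[OF b cT, of "\<epsilon> / 4"] \<epsilon> by auto
  have fX: "(\<integral>\<^sup>+x\<in>?X. ennreal (norm (b x - f x)) \<partial>lebesgue) <= ennreal (\<epsilon> / 4)"
  proof -
   have "(\<integral>\<^sup>+x\<in>?X. ennreal (norm (b x - f x)) \<partial>lebesgue) <= (\<integral>\<^sup>+x\<in>triple l (0, 0). ennreal (norm (b x - f x)) \<partial>lebesgue)"
    using base_triple[OF l] by (intro nn_integral_mono) (auto split: split_indicator)
   then show ?thesis using f(2) by simp
  qed
  have fm [measurable]: "f \<in> borel_measurable lebesgue"
   using borel_measurable_continuous_onI[OF f(1)] by (rule borel_imp_lebesgue_measurable)
  have "uniformly_continuous_on (triple l (0, 0)) f"
   using f(1) cT by (intro compact_uniformly_continuous) (auto intro: continuous_on_subset)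
  then obtain \<delta> where \<delta>: "0 < \<delta>" "!!x y. x \<in> triple l (0, 0) ==> y \<in> triple l (0, 0) ==> dist y x < \<delta> ==> dist (f y) (f x) < \<omega>"
   using \<omega> unfolding uniformly_continuous_on_def by metis
  have "(\<lambda>n. CARD('n) * (l / 2 ^ n)) \<longlonglongrightarrow> real CARD('n) * 0"
   by (intro tendsto_mult tendsto_const LIMSEQ_divide_realpow_zero) simp
  then have "\<forall>\<^sub>F n in sequentially. CARD('n) * (l / 2 ^ n) < \<delta>"
   using \<delta> by (intro order_tendstoD(2)) auto
  then obtain n0 where n0: "!!n. n0 <= n ==> CARD('n) * (l / 2 ^ n) < \<delta>" by (auto simp: eventually_sequentially)
  show ?thesis
  proof (intro exI[of _ n0] allI impI)
   fix n assume n: "n0 <= n"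
   let ?L = "leaves l n :: 'n idx set"
   have disj: "i \<in> ?L ==> j \<in> ?L ==> i \<noteq> j ==> cell l i \<inter> cell l j = {}" for i j
    by (auto simp: leaves_def cell_def prod_eq_iff)
   have "(\<integral>\<^sup>+x. ennreal (norm (u n x)) \<partial>lebesgue) = (\<integral>\<^sup>+x. (\<Sum>i\<in>?L. ennreal (norm (b x - ctr l b i)) * indicator (cell l i) x) \<partial>lebesgue)"
   proof (intro nn_integral_cong)
    fix x
    show "ennreal (norm (u n x)) = (\<Sum>i\<in>?L. ennreal (norm (b x - ctr l b i)) * indicator (cell l i) x)"
    proof (cases "x \<in> ?X")
     case True
     then show ?thesis using sum_leaves[OF l True, of "\<lambda>i. ennreal (norm (b x - ctr l b i))" n] by (simp add: u_eq lev_def)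
    next
     case False
     then have "(\<Sum>i\<in>?L. ennreal (norm (b x - ctr l b i)) * indicator (cell l i) x) = 0"
     by (intro sum.neutral) (auto simp: leaves_def split: split_indicator)
     then show ?thesis using False by (simp add: u_eq)
    qed
   qed
   also have "\<dots> = (\<Sum>i\<in>?L. dev b (ctr l b i) (cell l i))"
    unfolding dev_def using l by (intro nn_integral_sum) measurable
   also have "\<dots> <= (\<Sum>i\<in>?L. 2 * ((\<integral>\<^sup>+x\<in>cell l i. ennreal (norm (b x - f x)) \<partial>lebesgue) + ennreal (\<omega> * vol (cell l i))))"
   proof (intro sum_mono)
    fix i assume i: "i \<in> ?L"
    define y where "y = ((\<chi> c. snd i $ c * side l i - l / 2) :: real ^ 'n)"
    have y: "y \<in> cell l i" unfolding y_def by (rule cell_nonempty[OF l])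
    have sub: "cell l i \<subseteq> triple l (0, 0)" using i base_triple[OF l] by (auto simp: leaves_def)
    have "dev b (f y) (cell l i) <= (\<integral>\<^sup>+x. ennreal (norm (b x - f x)) * indicator (cell l i) x + ennreal \<omega> * indicator (cell l i) x \<partial>lebesgue)"
     unfolding dev_def
    proof (intro nn_integral_mono)
     fix x
     have "norm (b x - f y) <= norm (b x - f x) + \<omega>" if x: "x \<in> cell l i"
     proof -
     have "dist x y <= CARD('n) * (l / 2 ^ n)" using dist_in_cell[OF l x y] i by (simp add: leaves_def side_def)
     then have "dist (f x) (f y) < \<omega>" using n0[OF n] \<delta>(2)[of y x] x y sub by auto
     moreover have "norm (b x - f y) <= norm (b x - f x) + norm (f x - f y)" by norm
     ultimately show ?thesis by (simp add: dist_norm)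
     qed
     then show "ennreal (norm (b x - f y)) * indicator (cell l i) x <= ennreal (norm (b x - f x)) * indicator (cell l i) x + ennreal \<omega> * indicator (cell l i) x"
     using \<omega> by (auto split: split_indicator simp: ennreal_plus[symmetric] simp del: ennreal_plus intro!: ennreal_leI)
    qed
    also have "\<dots> = (\<integral>\<^sup>+x\<in>cell l i. ennreal (norm (b x - f x)) \<partial>lebesgue) + ennreal (\<omega> * vol (cell l i))"
     using l \<omega> by (simp add: nn_integral_add nn_integral_cmult ennreal_mult emeasure_eq_measure2[OF cell_fmeasurable[OF l]])
    finally show "dev b (ctr l b i) (cell l i) <= 2 * ((\<integral>\<^sup>+x\<in>cell l i. ennreal (norm (b x - f x)) \<partial>lebesgue) + ennreal (\<omega> * vol (cell l i)))"
     using ctr_facts(2)[OF b l, of i "f y"] by (meson mult_left_mono order_trans zero_le)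
   qed
   also have "\<dots> = 2 * ((\<Sum>i\<in>?L. (\<integral>\<^sup>+x\<in>cell l i. ennreal (norm (b x - f x)) \<partial>lebesgue)) + ennreal (\<omega> * (\<Sum>i\<in>?L. vol (cell l i))))"
    using \<omega> by (simp add: sum_distrib_left[symmetric] sum.distrib sum_ennreal)
   also have "\<dots> <= 2 * (ennreal (\<epsilon> / 4) + ennreal (\<omega> * ?m))"
   proof (intro mult_left_mono add_mono)
    show "(\<Sum>i\<in>?L. (\<integral>\<^sup>+x\<in>cell l i. ennreal (norm (b x - f x)) \<partial>lebesgue)) <= ennreal (\<epsilon> / 4)"
     using disj by (intro order_trans[OF sum_disjoint_cells[OF l finite_leaves[OF l]] fX]) (auto simp: leaves_def)
    show "ennreal (\<omega> * (\<Sum>i\<in>?L. vol (cell l i))) <= ennreal (\<omega> * ?m)"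
     using disj \<omega> by (intro ennreal_leI mult_left_mono sum_disjoint_measure[OF l finite_leaves[OF l] _ _ Xf]) (auto simp: leaves_def)
   qed simp
   also have "\<dots> = ennreal (\<epsilon> / 2 + 2 * \<omega> * ?m)"
    using \<epsilon> \<omega> by (simp add: distrib_left ennreal_plus[symmetric] ennreal_mult''[symmetric] ennreal_numeral[symmetric] ennreal_mult[symmetric] del: ennreal_plus ennreal_numeral)
   also have "\<dots> <= ennreal \<epsilon>" using \<omega> by (intro ennreal_leI) linarith
   finally show "(\<integral>\<^sup>+x. ennreal (norm (u n x)) \<partial>lebesgue) <= ennreal \<epsilon>" .
  qed
 qed
 obtain n1 where n1: "!!n. n1 <= n ==> (\<integral>\<^sup>+x. ennreal (norm (u n x)) \<partial>lebesgue) <= ennreal 1"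
  using small[of 1] by auto
 have int: "integrable lebesgue (u (n + n1))" for n
  using n1[of "n + n1"] by (auto simp: integrable_iff_bounded intro: order_le_less_trans)
 have "(\<lambda>n. LINT x|lebesgue. norm (u (n + n1) x)) \<longlonglongrightarrow> 0"
 proof (rule LIMSEQ_I)
  fix \<epsilon> :: real assume \<epsilon>: "0 < \<epsilon>"
  obtain n0 where n0: "!!n. n0 <= n ==> (\<integral>\<^sup>+x. ennreal (norm (u n x)) \<partial>lebesgue) <= ennreal (\<epsilon> / 2)"
   using small[of "\<epsilon> / 2"] \<epsilon> by auto
  have "norm ((LINT x|lebesgue. norm (u (n + n1) x)) - 0) < \<epsilon>" if "n0 <= n" for n
  proof -
   have "ennreal (LINT x|lebesgue. norm (u (n + n1) x)) <= ennreal (\<epsilon> / 2)"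
    using n0[of "n + n1"] that integrable_norm[OF int[of n]] by (subst nn_integral_eq_integral[symmetric]) auto
   then have "(LINT x|lebesgue. norm (u (n + n1) x)) <= \<epsilon> / 2" using \<epsilon> by (simp add: ennreal_le_iff)
   then show ?thesis using \<epsilon> by (simp add: integral_nonneg_AE)
  qed
  then show "\<exists>no. \<forall>n\<ge>no. norm ((LINT x|lebesgue. norm (u (n + n1) x)) - 0) < \<epsilon>" by blast
 qed
 then obtain \<rho> where \<rho>: "strict_mono \<rho>" "AE x in lebesgue. (\<lambda>n. u (\<rho> n + n1) x) \<longlonglongrightarrow> 0"
  using tendsto_L1_AE_subseq[of lebesgue "\<lambda>n. u (n + n1)", OF int] by blast
 show ?thesis
 proof (intro exI[of _ "\<lambda>n. \<rho> n + n1"] conjI)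
  show "strict_mono (\<lambda>n. \<rho> n + n1)" using \<rho>(1) by (simp add: strict_mono_def)
  show "AE x in lebesgue. x \<in> base l --> (\<lambda>n. lev l b (\<rho> n + n1) x) \<longlonglongrightarrow> b x"
   using \<rho>(2)
  proof eventually_elim
   case (elim x)
   show ?case
   proof
    assume "x \<in> base l"
    then have "(\<lambda>n. b x - lev l b (\<rho> n + n1) x) \<longlonglongrightarrow> 0" using elim by (simp add: u_eq)
    then have "(\<lambda>n. b x - (b x - lev l b (\<rho> n + n1) x)) \<longlonglongrightarrow> b x - 0" by (intro tendsto_intros)
    then show "(\<lambda>n. lev l b (\<rho> n + n1) x) \<longlonglongrightarrow> b x" by simp
   qed
  qed
 qed
qed

lemma sum_Un_le:
 fixes f :: "'a => real"
 assumes "finite A" "finite B" "!!x. 0 <= f x"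
 shows "sum f (A \<union> B) <= sum f A + sum f B"
 using assms by (subst sum_Un) (auto simp: sum_nonneg)

lemma sum_UN_le:
 fixes f :: "'a => real"
 assumes "finite E" "!!e. e \<in> E ==> finite (A e)" "!!x. 0 <= f x"
 shows "sum f (\<Union>e\<in>E. A e) <= (\<Sum>e\<in>E. sum f (A e))"
 using assms
proof (induction E rule: finite_induct)
 case (insert e E)
 have "sum f (A e \<union> (\<Union>e\<in>E. A e)) <= sum f (A e) + sum f (\<Union>e\<in>E. A e)"
  using insert by (subst sum_Un) (auto simp: sum_nonneg)
 then show ?case using insert by auto
qed simp

section \<open>Principal cells of a stopping rule\<close>

primrec prin :: "('n::finite idx => 'n idx => bool) => nat => int ^ 'n => 'n idx"
 where "prin st 0 k = (0, k)"
 | "prin st (Suc j) k = (if st (prin st j (up 1 k)) (Suc j, k) then (Suc j, k) else prin st j (up 1 k))"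

text \<open>\<open>prin st j k\<close> is the last cell selected on the way down from level 0 to the
  cell \<open>(j, k)\<close>, where \<open>st P R\<close> decides whether \<open>R\<close> is
  selected when \<open>P\<close> was the last one. Every cell of level 0 is selected.\<close>

definition principal :: "('n::finite idx => 'n idx => bool) => 'n idx => bool"
 where "principal st i \<longleftrightarrow> prin st (fst i) (snd i) = i"

text \<open>At level 0 the truncated subtraction produces an arbitrary cell of level 0, so uses of
  this definition carry the condition \<open>0 < fst i\<close>.\<close>

definition pparent :: "('n::finite idx => 'n idx => bool) => 'n idx => 'n idx"
 where "pparent st i = prin st (fst i - 1) (up 1 (snd i))"

lemma cell_parent: "0 < l ==> cell l (Suc j, k) \<subseteq> cell l (j, up 1 k)"
 using cell_up[of l j 1 k] by simp

lemma prin_level: "fst (prin st j k) <= j"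
 by (induction j arbitrary: k) (auto intro: le_SucI)

lemma prin_subset: assumes l: "0 < l" shows "cell l (j, k) \<subseteq> cell l (prin st j k)"
proof (induction j arbitrary: k)
 case (Suc j)
 show ?case using cell_parent[OF l, of j k] Suc[of "up 1 k"] by auto
qed simp

lemma principal_prin: "principal st (prin st j k)"
 by (induction j arbitrary: k) (auto simp: principal_def)

lemma principal_zero [simp]: "principal st (0, k)"
 by (simp add: principal_def)

lemma principal_stop: "principal st i ==> 0 < fst i ==> st (pparent st i) i"
proof -
 assume p: "principal st i" "0 < fst i"
 then obtain j k where i: "i = (Suc j, k)" by (cases i) (auto simp: gr0_conv_Suc)
 show "st (pparent st i) i"
 proof (rule ccontr)
  assume "\<not> st (pparent st i) i"
  then have "prin st j (up 1 k) = i" using p by (simp add: principal_def i pparent_def)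
  then show False using prin_level[of st j "up 1 k"] by (simp add: i)
 qed
qed

lemma stop_principal: "st (pparent st (Suc j, k)) (Suc j, k) ==> principal st (Suc j, k)"
 by (simp add: principal_def pparent_def)

text \<open>A principal \<open>Q\<close> is selected on the path to every cell inside it, so the
  last selection on such a path cannot lie above \<open>Q\<close>.\<close>

lemma prin_below:
 assumes l: "0 < l" and Q: "principal st Q"
 shows "cell l (j, k) \<subseteq> cell l Q ==> cell l (prin st j k) \<subseteq> cell l Q"
proof (induction j arbitrary: k)
 case 0
 then show ?case by simp
next
 case (Suc j)
 show ?case
 proof (cases "fst Q = Suc j")
  case True
  then have "(Suc j, k) = Q" using Suc.prems by (auto simp: cell_subset_iff[OF l] up_def prod_eq_iff)
  then show ?thesis using Q by (auto simp: principal_def)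
 next
  case False
  then have "fst Q <= j" using Suc.prems by (simp add: cell_subset_iff[OF l])
  moreover have "cell l (j, up 1 k) \<inter> cell l Q \<noteq> {}"
   using cell_parent[OF l, of j k] Suc.prems cell_nonempty[OF l, of "(Suc j, k)"] by auto
  ultimately have "cell l (j, up 1 k) \<subseteq> cell l Q" using cell_subset_up(1)[OF l, of "(j, up 1 k)" Q] by auto
  then show ?thesis using Suc.IH[of "up 1 k"] Suc.prems by auto
 qed
qed

lemma pparent_props:
 assumes l: "0 < l" and i: "0 < fst i"
 shows "cell l i \<subseteq> cell l (pparent st i)" "fst (pparent st i) < fst i" "principal st (pparent st i)"
proof -
 obtain j k where ij: "i = (Suc j, k)" using i by (cases i) (auto simp: gr0_conv_Suc)
 show "cell l i \<subseteq> cell l (pparent st i)"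
  using cell_parent[OF l, of j k] prin_subset[OF l, of j "up 1 k" st] by (simp add: ij pparent_def)
 show "fst (pparent st i) < fst i" using prin_level[of st j "up 1 k"] by (simp add: ij pparent_def)
 show "principal st (pparent st i)" by (simp add: pparent_def principal_prin)
qed

lemma pparent_below:
 assumes l: "0 < l" and Q: "principal st Q" and sub: "cell l i \<subseteq> cell l Q" "i \<noteq> Q"
 shows "0 < fst i" "cell l (pparent st i) \<subseteq> cell l Q"
proof -
 have lt: "fst Q < fst i"
 proof (rule ccontr)
  assume "\<not> fst Q < fst i"
  then have "fst i = fst Q" using sub by (auto simp: cell_subset_iff[OF l])
  then show False using sub by (auto simp: cell_subset_iff[OF l] up_def prod_eq_iff)
 qed
 then show "0 < fst i" by simp
 obtain j k where ij: "i = (Suc j, k)" using \<open>0 < fst i\<close> by (cases i) (auto simp: gr0_conv_Suc)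
 have "cell l (j, up 1 k) \<inter> cell l Q \<noteq> {}"
  using cell_parent[OF l, of j k] sub cell_nonempty[OF l, of i] by (auto simp: ij)
 then have "cell l (j, up 1 k) \<subseteq> cell l Q" using cell_subset_up(1)[OF l, of "(j, up 1 k)" Q] lt by (simp add: ij)
 then show "cell l (pparent st i) \<subseteq> cell l Q" using prin_below[OF l Q] by (simp add: ij pparent_def)
qed

text \<open>If one were inside the other, the larger would separate the smaller from its principal
  parent.\<close>

lemma siblings_disjoint:
 assumes l: "0 < l" and i: "principal st i" "0 < fst i" and j: "principal st j" "0 < fst j"
  and p: "pparent st i = pparent st j" "i \<noteq> j"
 shows "cell l i \<inter> cell l j = {}"
proof (rule ccontr)
 have *: False if "principal st i" "0 < fst i" "principal st j" "0 < fst j" "pparent st i = pparent st j" "i \<noteq> j" "cell l i \<subseteq> cell l j" for i j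
 proof -
  have "cell l (pparent st j) \<subseteq> cell l j" using pparent_below(2)[OF l that(3,7,6)] that(5) by simp
  from cell_subset_level[OF l this] show False using pparent_props(2)[OF l that(4), of st] by simp
 qed
 assume "cell l i \<inter> cell l j \<noteq> {}"
 then have "cell l i \<subseteq> cell l j \<or> cell l j \<subseteq> cell l i" using cell_laminar[OF l, of i j] by blast
 then show False using *[OF i j p] *[OF j i p(1)[symmetric] p(2)[symmetric]] by blast
qed

text \<open>\<open>Q\<close> runs over all cells, members of \<open>S\<close> or not. The level
  bound \<open>n\<close> keeps the sums finite, as \<open>S\<close> may be infinite.\<close>

definition carleson :: "real => ('n::finite idx) set => real => bool"
 where "carleson l S L \<longleftrightarrow> (\<forall>Q n. (\<Sum>i\<in>{i\<in>S. fst i <= n \<and> cell l i \<subseteq> cell l Q}. vol (cell l i)) <= L * vol (cell l Q))"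

text \<open>The principal cells in \<open>Q\<close> are of three kinds. Those without a principal
  parent inside \<open>Q\<close> are disjoint; those in \<open>S\<close> are packed by assumption;
  the volume of the rest is, parent by parent, at most half of the whole sum. The sum is finite by
  truncation, so this half is absorbed, which gives the factor 2.\<close>

lemma principal_carleson:
 assumes l: "0 < l" and S: "carleson l S L"
  and half: "!!P n. (\<Sum>i\<in>{i. principal st i \<and> 0 < fst i \<and> fst i <= n \<and> pparent st i = P \<and> i \<notin> S}. vol (cell l i)) <= vol (cell l P) / 2"
 shows "carleson l {i. principal st i} (2 * (1 + L))"
 unfolding carleson_def
proof (intro allI)
 fix Q n
 let ?m = "\<lambda>i. vol (cell l i)"
 let ?A = "{i. principal st i \<and> fst i <= n \<and> cell l i \<subseteq> cell l Q}"
 let ?A1 = "{i\<in>?A. fst i = 0 \<or> \<not> cell l (pparent st i) \<subseteq> cell l Q}"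
 let ?A2 = "{i\<in>S. fst i <= n \<and> cell l i \<subseteq> cell l Q}"
 let ?A3 = "{i\<in>?A. 0 < fst i \<and> cell l (pparent st i) \<subseteq> cell l Q \<and> i \<notin> S}"
 have fin: "finite ?A" "finite ?A1" "finite ?A2" "finite ?A3"
  by (rule finite_subset[OF _ finite_cells_below[OF l, of n Q]], auto)+
 have A1: "(\<Sum>i\<in>?A1. ?m i) <= ?m Q"
 proof (rule sum_disjoint_measure[OF l fin(2) _ _ cell_fmeasurable[OF l]])
  fix i j assume ij: "i \<in> ?A1" "j \<in> ?A1" "i \<noteq> j"
  have *: False if "i \<in> ?A1" "j \<in> ?A1" "i \<noteq> j" "cell l i \<subseteq> cell l j" for i j
  proof -
   have "principal st j" using that(2) by simp
   from pparent_below[OF l this that(4,3)] have "cell l (pparent st i) \<subseteq> cell l j" "0 < fst i" by blast+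
   moreover have "cell l j \<subseteq> cell l Q" using that(2) by simp
   moreover have "fst i = 0 \<or> \<not> cell l (pparent st i) \<subseteq> cell l Q" using that(1) by blast
   ultimately show False by (metis order_trans less_irrefl)
  qed
  show "cell l i \<inter> cell l j = {}" using cell_laminar[OF l, of i j] *[of i j] *[of j i] ij by blast
 qed auto
 have A3: "(\<Sum>i\<in>?A3. ?m i) <= (\<Sum>i\<in>?A. ?m i) / 2"
 proof -
  have "(\<Sum>i\<in>?A3. ?m i) = (\<Sum>P\<in>?A. \<Sum>i\<in>{i\<in>?A3. pparent st i = P}. ?m i)"
  proof (rule sum.group[symmetric, OF fin(4,1)])
   show "pparent st ` ?A3 \<subseteq> ?A"
   proof (rule image_subsetI)
    fix i assume i: "i \<in> ?A3"
    then show "pparent st i \<in> ?A" using pparent_props(2,3)[OF l, of i st] by auto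
   qed
  qed
  also have "\<dots> <= (\<Sum>P\<in>?A. ?m P / 2)"
  proof (intro sum_mono)
   fix P
   have "(\<Sum>i\<in>{i\<in>?A3. pparent st i = P}. ?m i) <= (\<Sum>i\<in>{i. principal st i \<and> 0 < fst i \<and> fst i <= n \<and> pparent st i = P \<and> i \<notin> S}. ?m i)"
   proof (rule sum_mono2)
    show "finite {i. principal st i \<and> 0 < fst i \<and> fst i <= n \<and> pparent st i = P \<and> i \<notin> S}"
     by (rule finite_subset[OF _ finite_cells_below[OF l, of n P]]) (use pparent_props(1)[OF l, of _ st] in auto)
   qed auto
   then show "(\<Sum>i\<in>{i\<in>?A3. pparent st i = P}. ?m i) <= ?m P / 2" using half[of n P] by linarith
  qed
  finally show ?thesis by (simp add: sum_divide_distrib)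
 qed
 have "(\<Sum>i\<in>?A. ?m i) <= (\<Sum>i\<in>?A1 \<union> (?A2 \<union> ?A3). ?m i)"
  using fin by (intro sum_mono2) auto
 also have "\<dots> <= (\<Sum>i\<in>?A1. ?m i) + (\<Sum>i\<in>?A2 \<union> ?A3. ?m i)"
  by (intro sum_Un_le finite_UnI fin measure_nonneg)
 also have "(\<Sum>i\<in>?A2 \<union> ?A3. ?m i) <= (\<Sum>i\<in>?A2. ?m i) + (\<Sum>i\<in>?A3. ?m i)"
  by (intro sum_Un_le fin measure_nonneg)
 finally have "(\<Sum>i\<in>?A. ?m i) <= (\<Sum>i\<in>?A1. ?m i) + ((\<Sum>i\<in>?A2. ?m i) + (\<Sum>i\<in>?A3. ?m i))" by simp
 moreover have "(\<Sum>i\<in>?A2. ?m i) <= L * ?m Q" using S unfolding carleson_def by blast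
 ultimately have "(\<Sum>i\<in>?A. ?m i) <= 2 * ((1 + L) * ?m Q)" using A1 A3 by (simp add: algebra_simps)
 moreover have "{i\<in>{i. principal st i}. fst i <= n \<and> cell l i \<subseteq> cell l Q} = ?A" by auto
 ultimately show "(\<Sum>i\<in>{i\<in>{i. principal st i}. fst i <= n \<and> cell l i \<subseteq> cell l Q}. ?m i) <= 2 * (1 + L) * ?m Q"
  by (simp only: mult.assoc)
qed

text \<open>A shifted member inside \<open>Q\<close> comes from a member inside some neighbour of
  \<open>Q\<close>. One factor of the number of neighbours counts the shifts of the family, the
  other the neighbours of \<open>Q\<close>.\<close>

lemma carleson_shifts:
 fixes S :: "('n::finite) idx set"
 assumes l: "0 < l" and S: "carleson l S L"
 shows "carleson l (\<Union>e\<in>nbs. shift e ` S) (real (card (nbs :: (int ^ 'n) set)) ^ 2 * L)"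
 unfolding carleson_def
proof (intro allI)
 fix Q :: "'n idx" and n
 let ?m = "\<lambda>i. vol (cell l i)"
 let ?E = "nbs :: (int ^ 'n) set"
 let ?B = "\<lambda>P. {i\<in>S. fst i <= n \<and> cell l i \<subseteq> cell l P}"
 have finB: "finite (?B P)" for P by (rule finite_subset[OF _ finite_cells_below[OF l, of n P]]) auto
 have sub: "{i\<in>(\<Union>e\<in>?E. shift e ` S). fst i <= n \<and> cell l i \<subseteq> cell l Q} \<subseteq> (\<Union>e\<in>?E. \<Union>e'\<in>?E. shift e ` ?B (shift e' Q))"
 proof
  fix i assume "i \<in> {i\<in>(\<Union>e\<in>?E. shift e ` S). fst i <= n \<and> cell l i \<subseteq> cell l Q}"
  then obtain e j where e: "e \<in> ?E" "i = shift e j" "j \<in> S" "fst i <= n" "cell l (shift e j) \<subseteq> cell l Q" by auto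
  then obtain e' where "e' \<in> ?E" "cell l j \<subseteq> cell l (shift e' Q)" using shift_subset[OF l e(1,5)] by auto
  then show "i \<in> (\<Union>e\<in>?E. \<Union>e'\<in>?E. shift e ` ?B (shift e' Q))" using e by (auto simp: shift_def)
 qed
 have inj: "inj_on (shift e) A" for e :: "int ^ 'n" and A by (rule inj_onI) (rule cell_shift_inj)
 have re: "(\<Sum>i\<in>shift e ` X. ?m i) = (\<Sum>i\<in>X. ?m i)" for e :: "int ^ 'n" and X
  by (simp add: sum.reindex[OF inj] measure_shift[OF l])
 have "(\<Sum>i\<in>{i\<in>(\<Union>e\<in>?E. shift e ` S). fst i <= n \<and> cell l i \<subseteq> cell l Q}. ?m i) <= (\<Sum>i\<in>(\<Union>e\<in>?E. \<Union>e'\<in>?E. shift e ` ?B (shift e' Q)). ?m i)"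
  by (intro sum_mono2 sub finite_UN_I finite_imageI finB finite_nbs measure_nonneg)
 also have "\<dots> <= (\<Sum>e\<in>?E. \<Sum>i\<in>(\<Union>e'\<in>?E. shift e ` ?B (shift e' Q)). ?m i)"
  by (intro sum_UN_le finite_UN_I finite_imageI finB finite_nbs measure_nonneg)
 also have "\<dots> <= (\<Sum>e\<in>?E. \<Sum>e'\<in>?E. \<Sum>i\<in>shift e ` ?B (shift e' Q). ?m i)"
  by (intro sum_mono sum_UN_le finite_UN_I finite_imageI finB finite_nbs measure_nonneg)
 also have "\<dots> = (\<Sum>e\<in>?E. \<Sum>e'\<in>?E. \<Sum>i\<in>?B (shift e' Q). ?m i)"
  by (simp only: re)
 also have "\<dots> <= (\<Sum>e\<in>?E. \<Sum>e'\<in>?E. L * ?m Q)"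
 proof (intro sum_mono)
  fix e' :: "int ^ 'n"
  have "(\<Sum>i\<in>?B (shift e' Q). ?m i) <= L * ?m (shift e' Q)" using S unfolding carleson_def by blast
  then show "(\<Sum>i\<in>?B (shift e' Q). ?m i) <= L * ?m Q" by (simp only: measure_shift[OF l])
 qed
 also have "\<dots> = real (card ?E) ^ 2 * L * ?m Q" by (simp add: power2_eq_square)
 finally show "(\<Sum>i\<in>{i\<in>(\<Union>e\<in>?E. shift e ` S). fst i <= n \<and> cell l i \<subseteq> cell l Q}. ?m i) <= real (card ?E) ^ 2 * L * ?m Q" .
qed

section \<open>Stopping at large oscillation of \<open>b\<close>\<close>

definition mosc :: "real => (real ^ 'n => 'k::euclidean_space) => 'n idx => real"
 where "mosc l b i = enn2real (dev b (ctr l b i) (cell l i)) / vol (cell l i)"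

definition tosc :: "real => (real ^ 'n => 'k::euclidean_space) => 'n idx => real"
 where "tosc l b i = enn2real (osc b (triple l i)) / vol (triple l i)"

text \<open>Cells of \<open>S\<close> are always selected, so the principal cells contain the given
  family. The other cells are selected where the mean deviation of \<open>b\<close> from the current
  centre exceeds twice its value on the current cell; strictness prevents such selections below a
  cell on which the oscillation vanishes.\<close>

definition bstop :: "real => (real ^ 'n => 'k::euclidean_space) => ('n idx) set => 'n idx => 'n idx => bool"
 where "bstop l b S Q R \<longleftrightarrow> R \<in> S \<or>
  ennreal (2 * mosc l b Q * vol (cell l R)) < dev b (ctr l b Q) (cell l R)"

lemma mosc_nonneg: "0 <= mosc l b i" "0 <= tosc l b i" by (simp_all add: mosc_def tosc_def)

lemma dev_mosc:
 assumes b: "loc_integrable b" and l: "0 < l"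
 shows "dev b (ctr l b i) (cell l i) = ennreal (mosc l b i * vol (cell l i))"
 using ctr_facts(3)[OF b l, of "ctr l b i" i] measure_cell_pos[OF l, of i] by (simp add: mosc_def)

lemma osc_tosc:
 assumes b: "loc_integrable b" and l: "0 < l"
 shows "osc b (triple l i) = ennreal (tosc l b i * vol (triple l i))" "osc b (triple l i) < \<infinity>"
proof -
 note cQ = cubes_props[OF ccell_cubes(2)[OF l, of i]]
 show fin: "osc b (triple l i) < \<infinity>" unfolding osc_dev by (rule dev_finite[OF b cQ(4) subset_refl cQ(1)])
 then show "osc b (triple l i) = ennreal (tosc l b i * vol (triple l i))" using cQ(3) by (simp add: tosc_def)
qed

lemma dev_triple_le:
 assumes b: "loc_integrable b" and l: "0 < l" and sub: "cell l i \<subseteq> triple l i'" "fst i = fst i'"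
 shows "dev b (avg b (triple l i')) (cell l i) <= ennreal (3 ^ CARD('n) * tosc l b i' * vol (cell l i :: (real ^ 'n) set))"
proof -
 have "vol (cell l i) = vol (cell l i')" using sub by (simp add: measure_cell[OF l] side_def)
 moreover have "dev b (avg b (triple l i')) (cell l i) <= osc b (triple l i')" unfolding osc_dev by (rule dev_mono[OF sub(1)])
 moreover have "tosc l b i' * vol (triple l i') = 3 ^ CARD('n) * tosc l b i' * vol (cell l i')"
  by (simp add: measure_triple[OF l])
 ultimately show ?thesis unfolding osc_tosc(1)[OF b l] by simp
qed

lemma mosc_le_tosc:
 fixes b :: "real ^ 'n => 'k::euclidean_space"
 assumes b: "loc_integrable b" and l: "0 < l"
 shows "mosc l b i <= 2 * 3 ^ CARD('n) * tosc l b i"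
proof -
 have "ennreal (mosc l b i * vol (cell l i)) <= 2 * dev b (avg b (triple l i)) (cell l i)"
  using ctr_facts(2)[OF b l] unfolding dev_mosc[OF b l, symmetric] .
 also have "\<dots> <= 2 * ennreal (3 ^ CARD('n) * tosc l b i * vol (cell l i))"
  by (intro mult_left_mono dev_triple_le[OF b l cell_subset_triple[OF l] refl]) auto
 also have "\<dots> = ennreal (2 * 3 ^ CARD('n) * tosc l b i * vol (cell l i))"
  by (simp add: ennreal_mult'[symmetric] ennreal_numeral[symmetric] mult.assoc del: ennreal_numeral)
 finally have "mosc l b i * vol (cell l i) <= 2 * 3 ^ CARD('n) * tosc l b i * vol (cell l i)"
  by (subst (asm) ennreal_le_iff) (auto intro!: mult_nonneg_nonneg mosc_nonneg)
 then show ?thesis using measure_cell_pos[OF l, of i] by simp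
qed

lemma ctr_shift_le:
 fixes b :: "real ^ 'n => 'k::euclidean_space"
 assumes b: "loc_integrable b" and l: "0 < l" and e: "e \<in> nbs"
 shows "norm (ctr l b (shift e i) - ctr l b i) <= 2 * 3 ^ CARD('n) * tosc l b i"
proof -
 have *: "norm (ctr l b j - avg b (triple l i)) <= 3 ^ CARD('n) * tosc l b i" if "cell l j \<subseteq> triple l i" "fst j = fst i" for j
 proof -
  have "ennreal (norm (ctr l b j - avg b (triple l i)) * vol (cell l j)) <= ennreal (3 ^ CARD('n) * tosc l b i * vol (cell l j))"
   by (rule order_trans[OF ctr_facts(1)[OF b l] dev_triple_le[OF b l that]])
  then show ?thesis using measure_cell_pos[OF l, of j]
   by (subst (asm) ennreal_le_iff) (auto intro!: mult_nonneg_nonneg mosc_nonneg)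
 qed
 have "norm (ctr l b (shift e i) - ctr l b i) <= norm (ctr l b (shift e i) - avg b (triple l i)) + norm (ctr l b i - avg b (triple l i))" by norm
 moreover have "fst (shift e i) = fst i" by (simp add: shift_def)
 ultimately show ?thesis
  using *[OF cell_subset_triple_shift(2)[OF l e]] *[OF cell_subset_triple[OF l] refl] by linarith
qed

text \<open>Chebyshev's inequality: the selected siblings are disjoint, and on each the mean
  deviation from the centre of \<open>P\<close> is more than twice that on \<open>P\<close>.\<close>

lemma bstop_half:
 assumes b: "loc_integrable b" and l: "0 < l"
 shows "(\<Sum>i\<in>{i. principal (bstop l b S) i \<and> 0 < fst i \<and> fst i <= n \<and> pparent (bstop l b S) i = P \<and> i \<notin> S}. vol (cell l i))
  <= vol (cell l P) / 2"
proof -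
 let ?st = "bstop l b S" and ?m = "\<lambda>i. vol (cell l i)"
 let ?A = "{i. principal ?st i \<and> 0 < fst i \<and> fst i <= n \<and> pparent ?st i = P \<and> i \<notin> S}"
 have [measurable]: "b \<in> borel_measurable lebesgue" by (rule loc_integrable_measurable[OF b])
 have sub: "cell l i \<subseteq> cell l P" if "i \<in> ?A" for i using that pparent_props(1)[OF l, of i ?st] by auto
 have fin: "finite ?A" by (rule finite_subset[OF _ finite_cells_below[OF l, of n P]]) (use sub in auto)
 have st: "ennreal (2 * mosc l b P * ?m i) < dev b (ctr l b P) (cell l i)" if "i \<in> ?A" for i
  using principal_stop[of ?st i] that by (auto simp: bstop_def)
 have "(\<Sum>i\<in>?A. dev b (ctr l b P) (cell l i)) <= dev b (ctr l b P) (cell l P)"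
  unfolding dev_def
 proof (rule sum_disjoint_cells[OF l fin])
  fix i j assume "i \<in> ?A" "j \<in> ?A" "i \<noteq> j"
  then show "cell l i \<inter> cell l j = {}" using siblings_disjoint[OF l, of ?st i j] by auto
 qed (use sub in auto)
 then have le: "(\<Sum>i\<in>?A. dev b (ctr l b P) (cell l i)) <= ennreal (mosc l b P * ?m P)" unfolding dev_mosc[OF b l] .
 show ?thesis
 proof (cases "mosc l b P = 0")
  case True
  have "?A = {}"
  proof (rule ccontr)
   assume "?A \<noteq> {}"
   then obtain i where i: "i \<in> ?A" by auto
   have "dev b (ctr l b P) (cell l i) <= (\<Sum>i\<in>?A. dev b (ctr l b P) (cell l i))"
    using fin i by (intro member_le_sum) auto
   then show False using st[OF i] le True by simp
  qed
  then show ?thesis by (simp only: sum.empty) simp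
 next
  case False
  then have mp: "0 < mosc l b P" using mosc_nonneg[of l b P] by linarith
  have "ennreal (\<Sum>i\<in>?A. 2 * mosc l b P * ?m i) = (\<Sum>i\<in>?A. ennreal (2 * mosc l b P * ?m i))"
   using mp by (intro sum_ennreal[symmetric]) auto
  also have "\<dots> <= (\<Sum>i\<in>?A. dev b (ctr l b P) (cell l i))" using st by (intro sum_mono) (auto intro: less_imp_le)
  finally have "ennreal (\<Sum>i\<in>?A. 2 * mosc l b P * ?m i) <= ennreal (mosc l b P * ?m P)" using le by order
  then have "2 * mosc l b P * (\<Sum>i\<in>?A. ?m i) <= mosc l b P * ?m P"
   using mp by (subst (asm) ennreal_le_iff) (auto simp: sum_distrib_left)
  then have "mosc l b P * (2 * (\<Sum>i\<in>?A. ?m i)) <= mosc l b P * ?m P" by (simp only: mult_ac)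
  then show ?thesis using mp by (simp only: mult_le_cancel_left_pos)
 qed
qed

lemma bstop_prin_dev:
 assumes b: "loc_integrable b" and l: "0 < l"
 shows "dev b (ctr l b (prin (bstop l b S) j k)) (cell l (j, k)) \<le>
  ennreal (2 * mosc l b (prin (bstop l b S) j k) * vol (cell l (j, k)))"
proof -
 let ?p = "prin (bstop l b S) j k"
 show ?thesis
 proof (cases "?p = (j, k)")
  case True
  show ?thesis unfolding True dev_mosc[OF b l] using mosc_nonneg[of l b "(j, k)"]
   by (intro ennreal_leI mult_right_mono) auto
 next
  case False
  then obtain j' where j: "j = Suc j'" by (cases j) auto
  have "\<not> bstop l b S ?p (j, k)" using False unfolding j by (auto split: if_splits)
  then show ?thesis by (simp add: bstop_def not_less)
 qed
qed

text \<open>The centre changes only when a new cell is selected. The jump is controlled because the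
  dyadic parent of the new cell still obeys the non-stopping bound; passing from the parent to the
  cell costs \<open>2 ^ CARD('n)\<close>. The second summand on the left pays in advance for the
  next jump and makes the induction close.\<close>

lemma adapted_bound:
 fixes b :: "real ^ 'n => 'k::euclidean_space"
 assumes b: "loc_integrable b" and l: "0 < l" and Q: "principal (bstop l b S) Q" "x \<in> cell l Q" "fst Q <= j"
 defines "st \<equiv> bstop l b S" and "C \<equiv> 2 * 2 ^ CARD('n)"
 shows "norm (ctr l b (prin st j (position l j x)) - ctr l b Q) + C * mosc l b (prin st j (position l j x)) \<le>
  C * (\<Sum>i\<in>{i\<in>{fst Q..j}. principal st (i, position l i x)}. mosc l b (i, position l i x))"
 using Q(3)
proof (induction j rule: dec_induct)
 case base
 have "(fst Q, position l (fst Q) x) = Q" using Q(2) by (simp add: cell_def)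
 moreover have "prin st (fst Q) (position l (fst Q) x) = Q" using Q(1,2) by (simp add: cell_def principal_def st_def)
 moreover have "{i\<in>{fst Q..fst Q}. principal st (i, position l i x)} = {fst Q}"
  using Q(1) calculation by (auto simp: st_def)
 ultimately show ?case by simp
next
 case (step j)
 let ?x = "\<lambda>i. (i, position l i x)"
 let ?p = "prin st j (position l j x)"
 have upx: "up 1 (position l (Suc j) x) = position l j x" using position_up[of l j x 1] by simp
 have pS: "prin st (Suc j) (position l (Suc j) x) = (if st ?p (?x (Suc j)) then ?x (Suc j) else ?p)"
  unfolding prin.simps upx by simp
 have sum: "{i\<in>{fst Q..Suc j}. principal st (?x i)} = (if principal st (?x (Suc j)) then insert (Suc j) {i\<in>{fst Q..j}. principal st (?x i)} else {i\<in>{fst Q..j}. principal st (?x i)})"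
  using step(1) by (auto simp: le_Suc_eq)
 show ?case
 proof (cases "st ?p (?x (Suc j))")
  case True
  then have P: "principal st (?x (Suc j))" using upx by (intro stop_principal) (simp add: pparent_def)
  have "norm (ctr l b (?x (Suc j)) - ctr l b ?p) <= C * mosc l b ?p"
  proof -
   let ?R = "?x (Suc j)" and ?P = "?x j"
   have "ennreal (norm (ctr l b ?R - ctr l b ?p) * vol (cell l ?R)) <= dev b (ctr l b ?p) (cell l ?R)"
    by (rule ctr_facts(1)[OF b l])
   also have "\<dots> <= dev b (ctr l b ?p) (cell l ?P)"
    using cell_parent[OF l, of j "position l (Suc j) x"] unfolding upx by (rule dev_mono)
   also have "\<dots> <= ennreal (2 * mosc l b ?p * vol (cell l ?P))"
    unfolding st_def by (rule bstop_prin_dev[OF b l])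
   finally have "norm (ctr l b ?R - ctr l b ?p) * vol (cell l ?R) <= 2 * mosc l b ?p * vol (cell l ?P)"
    by (subst (asm) ennreal_le_iff) (auto intro!: mult_nonneg_nonneg mosc_nonneg)
   moreover have "vol (cell l ?P) = 2 ^ CARD('n) * vol (cell l ?R)"
    by (simp add: measure_cell[OF l] side_def power_mult_distrib[symmetric])
   ultimately have "norm (ctr l b ?R - ctr l b ?p) * vol (cell l ?R) <= C * mosc l b ?p * vol (cell l ?R)"
    by (simp add: C_def mult_ac)
   then show ?thesis using measure_cell_pos[OF l, of ?R] by simp
  qed
  moreover have "norm (ctr l b (?x (Suc j)) - ctr l b Q) <= norm (ctr l b (?x (Suc j)) - ctr l b ?p) + norm (ctr l b ?p - ctr l b Q)" by norm
  ultimately show ?thesis using True P step.IH unfolding pS sum by (simp add: distrib_left)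
 next
  case False
  have "(\<Sum>i\<in>{i\<in>{fst Q..j}. principal st (?x i)}. mosc l b (?x i)) <= (\<Sum>i\<in>{i\<in>{fst Q..Suc j}. principal st (?x i)}. mosc l b (?x i))"
   by (intro sum_mono2) (auto simp: mosc_nonneg)
  then have "C * (\<Sum>i\<in>{i\<in>{fst Q..j}. principal st (?x i)}. mosc l b (?x i)) <= C * (\<Sum>i\<in>{i\<in>{fst Q..Suc j}. principal st (?x i)}. mosc l b (?x i))"
   by (intro mult_left_mono) (simp_all add: C_def)
  then show ?thesis using False step.IH unfolding pS by simp
 qed
qed

section \<open>A weighted oscillation estimate for sparse families\<close>

text \<open>Chain sums are formed with positive coefficients. For \<open>e > 0\<close> each term
  receives an equal share of \<open>B powr (1 / e)\<close>, doubling the sum; for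
  \<open>e <= 0\<close> the constant sequence \<open>B\<close> does.\<close>

lemma lnorm_le_pos:
 assumes "finite I" "!!i. i \<in> I ==> 0 <= \<beta> i" "0 < B" "lnorm_le e I \<beta> B"
 shows "\<exists>\<beta>'. (\<forall>i\<in>I. \<beta> i <= \<beta>' i \<and> 0 < \<beta>' i) \<and> lnorm_le e I \<beta>' (2 powr \<bar>e\<bar> * B)"
proof (cases "0 < e \<and> I \<noteq> {}")
 case True
 let ?c = "B powr (1 / e) / card I"
 have c: "0 < ?c" using True assms by (simp add: card_gt_0_iff)
 define \<beta>' where "\<beta>' i = (\<beta> i powr (1 / e) + ?c) powr e" for i
 have "\<beta> i <= \<beta>' i \<and> 0 < \<beta>' i" if "i \<in> I" for i
 proof
  have "(\<beta> i powr (1 / e)) powr e <= \<beta>' i" unfolding \<beta>'_def using True c by (intro powr_mono2) auto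
  then show "\<beta> i <= \<beta>' i" using True assms(2)[OF that] by (simp add: powr_powr)
  have "0 < \<beta> i powr (1 / e) + ?c" using c by (intro add_nonneg_pos) auto
  then show "0 < \<beta>' i" by (simp add: \<beta>'_def)
 qed
 moreover have "lnorm_le e I \<beta>' (2 powr \<bar>e\<bar> * B)"
 proof -
  have "(\<Sum>i\<in>I. \<beta>' i powr (1 / e)) = (\<Sum>i\<in>I. \<beta> i powr (1 / e)) + B powr (1 / e)"
  proof -
   have "(\<Sum>i\<in>I. \<beta>' i powr (1 / e)) = (\<Sum>i\<in>I. \<beta> i powr (1 / e) + ?c)"
    using True c by (intro sum.cong refl) (auto simp: \<beta>'_def powr_powr intro!: add_nonneg_nonneg)
   then show ?thesis using True assms(1) by (simp add: sum.distrib)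
  qed
  also have "\<dots> <= 2 * B powr (1 / e)" using assms(4) True by (simp add: lnorm_le_def)
  also have "\<dots> = (2 powr \<bar>e\<bar> * B) powr (1 / e)" using True assms by (simp add: powr_mult powr_powr)
  finally show ?thesis using True by (simp add: lnorm_le_def)
 qed
 ultimately show ?thesis by blast
next
 case False
 have "1 <= 2 powr \<bar>e\<bar>" by (intro ge_one_powr_ge_zero) auto
 then have "B <= 2 powr \<bar>e\<bar> * B" using assms(3) by simp
 then show ?thesis using False assms(3,4) by (intro exI[of _ "\<lambda>_. B"]) (auto simp: lnorm_le_def)
qed

lemma nn_integral_le_lim:
 assumes "!!k. u k \<in> borel_measurable M" "!!k. (\<integral>\<^sup>+x. u k x \<partial>M) <= K" "AE x in M. (\<lambda>k. u k x) \<longlonglongrightarrow> v x"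
 shows "(\<integral>\<^sup>+x. v x \<partial>M) <= K"
proof -
 have "(\<integral>\<^sup>+x. v x \<partial>M) = (\<integral>\<^sup>+x. liminf (\<lambda>k. u k x) \<partial>M)"
  using assms(3) by (intro nn_integral_cong_AE) (auto elim!: eventually_mono simp: lim_imp_Liminf)
 also have "\<dots> <= liminf (\<lambda>k. \<integral>\<^sup>+x. u k x \<partial>M)" by (rule nn_integral_liminf[OF assms(1)])
 also have "\<dots> <= limsup (\<lambda>k. \<integral>\<^sup>+x. u k x \<partial>M)" by (rule Liminf_le_Limsup) simp
 also have "\<dots> <= K" using assms(2) by (intro Limsup_bounded) auto
 finally show ?thesis .
qed

text \<open>Agrees with \<open>lev\<close> on \<open>base l\<close> and vanishes outside; as a
  finite sum of indicators it is visibly measurable.\<close>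

definition levb :: "real => (real ^ 'n => 'k::euclidean_space) => nat => real ^ 'n => 'k"
 where "levb l b j x = (\<Sum>i\<in>leaves l j. indicator (cell l i) x *\<^sub>R ctr l b i)"

lemma levb_measurable: "0 < l ==> levb l b j \<in> borel_measurable lebesgue"
 unfolding levb_def by measurable

lemma levb_eq: assumes "0 < l" "x \<in> base l" shows "levb l b j x = lev l b j x"
proof -
 have "{i\<in>leaves l j. x \<in> cell l i} = {(j, position l j x)}"
  using leaf_of[OF assms, of j] by (auto simp: leaves_def cell_def)
 moreover have "levb l b j x = (\<Sum>i\<in>{i\<in>leaves l j. x \<in> cell l i}. ctr l b i)"
  unfolding levb_def using finite_leaves[OF assms(1)] by (intro sum.mono_neutral_cong_right) auto
 ultimately show ?thesis by (simp add: lev_def)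
qed

definition fam :: "real => (real ^ 'n => 'k::euclidean_space) => ('n idx) set => nat => ('n idx) set"
 where "fam l b S L = {i. principal (bstop l b S) i \<and> fst i <= L \<and> cell l i \<subseteq> base l}"

lemma laminar_fam:
 fixes b :: "real ^ 'n => 'k::euclidean_space"
 assumes b: "loc_integrable b" and l: "0 < l" and S: "carleson l S L0" "0 <= L0"
 shows "laminar (fam l b S L) (cell l) (2 * (1 + L0))"
proof
 show "finite (fam l b S L)" by (rule finite_subset[OF _ finite_base_cells[OF l, of L]]) (auto simp: fam_def)
 show "inj_on (cell l) (fam l b S L)" by (rule inj_onI) (rule cell_inj[OF l])
 fix i j :: "'n idx"
 show "cell l i \<in> sets lebesgue" "cell l i \<in> fmeasurable lebesgue" "0 < vol (cell l i)"
  using l by (auto simp: cell_fmeasurable measure_cell_pos)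
 show "cell l i \<inter> cell l j = {} \<or> cell l i \<subseteq> cell l j \<or> cell l j \<subseteq> cell l i" by (rule cell_laminar[OF l])
 have "(\<Sum>j\<in>{j\<in>fam l b S L. cell l j \<subseteq> cell l i}. vol (cell l j)) \<le>
  (\<Sum>j\<in>{j\<in>{j. principal (bstop l b S) j}. fst j <= L \<and> cell l j \<subseteq> cell l i}. vol (cell l j))"
  by (rule sum_mono2) (auto simp: fam_def intro: finite_subset[OF _ finite_cells_below[OF l, of L i]])
 also have "\<dots> <= 2 * (1 + L0) * vol (cell l i)"
  using principal_carleson[OF l S(1) bstop_half[OF b l]] unfolding carleson_def by blast
 finally show "(\<Sum>j\<in>{j\<in>fam l b S L. cell l j \<subseteq> cell l i}. vol (cell l j)) <= 2 * (1 + L0) * vol (cell l i)" .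
qed (use S in auto)

lemma subset_fam:
 assumes "!!i. i \<in> S ==> cell l i \<subseteq> base l" "!!i. i \<in> S ==> fst i <= L"
 shows "S \<subseteq> fam l b S L"
proof
 fix i assume i: "i \<in> S"
 have "principal (bstop l b S) i"
 proof (cases "fst i")
  case 0
  then show ?thesis by (cases i) auto
 next
  case (Suc j)
  then have "i = (Suc j, snd i)" by (simp add: prod_eq_iff)
  then show ?thesis using i stop_principal[of "bstop l b S" j "snd i"] by (simp add: bstop_def)
 qed
 then show "i \<in> fam l b S L" using assms i by (simp add: fam_def)
qed

text \<open>The first summand is the constant of the path of centres times that for passing from a
  cell to its triple; the second is the cost of moving the centre to a neighbour.\<close>

definition osc_const :: "'n itself => real"
 where "osc_const _ = 2 * 2 ^ CARD('n) * (2 * 3 ^ CARD('n)) + 2 * 3 ^ CARD('n)"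

text \<open>The averages of \<open>b\<close> along the path from \<open>i\<close> to level
  \<open>L\<close> are compared through the adapted family, and each \<open>mosc\<close> is replaced
  by the oscillation on the triple. The centre may belong to a neighbour because an average over the
  triple of a cell will be cut into integrals over neighbours while the centre stays.\<close>

lemma lev_ctr_le:
 fixes b :: "real ^ 'n => 'k::euclidean_space"
 assumes b: "loc_integrable b" and l: "0 < l" and i: "i \<in> fam l b S L" "x \<in> cell l i" and e: "e \<in> nbs"
 shows "norm (lev l b L x - ctr l b (shift e i)) <= osc_const TYPE('n) *
  (\<Sum>j\<in>{j\<in>fam l b S L. x \<in> cell l j \<and> cell l j \<subseteq> cell l i}. tosc l b j)"
proof -
 let ?st = "bstop l b S" and ?x = "\<lambda>j. (j, position l j x)"
 let ?p = "prin ?st L (position l L x)"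
 let ?A = "{j\<in>fam l b S L. x \<in> cell l j \<and> cell l j \<subseteq> cell l i}"
 have pi: "principal ?st i" "fst i <= L" and ib: "cell l i \<subseteq> base l" using i by (auto simp: fam_def)
 have finA: "finite ?A" by (rule finite_subset[OF _ finite_base_cells[OF l, of L]]) (auto simp: fam_def)
 have "norm (lev l b L x - ctr l b ?p) <= 2 * mosc l b ?p"
 proof -
  have "ennreal (norm (ctr l b (?x L) - ctr l b ?p) * vol (cell l (?x L))) <= ennreal (2 * mosc l b ?p * vol (cell l (?x L)))"
   by (rule order_trans[OF ctr_facts(1)[OF b l] bstop_prin_dev[OF b l]])
  then have "norm (ctr l b (?x L) - ctr l b ?p) * vol (cell l (?x L)) <= 2 * mosc l b ?p * vol (cell l (?x L))"
   by (subst (asm) ennreal_le_iff) (auto intro!: mult_nonneg_nonneg mosc_nonneg)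
  then show ?thesis using measure_cell_pos[OF l, of "?x L"] by (simp add: lev_def)
 qed
 also have "\<dots> <= 2 * 2 ^ CARD('n) * mosc l b ?p" using mosc_nonneg[of l b ?p] by (intro mult_right_mono) auto
 finally have 1: "norm (lev l b L x - ctr l b i) <= 2 * 2 ^ CARD('n) * (\<Sum>j\<in>{j\<in>{fst i..L}. principal ?st (?x j)}. mosc l b (?x j))"
  using adapted_bound[OF b l pi(1) i(2) pi(2)] norm_triangle_le_diff norm_triangle_ineq[of "lev l b L x - ctr l b ?p" "ctr l b ?p - ctr l b i"] by simp
 have "(\<Sum>j\<in>{j\<in>{fst i..L}. principal ?st (?x j)}. mosc l b (?x j)) = (\<Sum>j\<in>?x ` {j\<in>{fst i..L}. principal ?st (?x j)}. mosc l b j)"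
  by (subst sum.reindex) (auto intro: inj_onI)
 also have "\<dots> <= (\<Sum>j\<in>?A. mosc l b j)"
 proof (rule sum_mono2[OF finA])
  show "?x ` {j\<in>{fst i..L}. principal ?st (?x j)} \<subseteq> ?A"
  proof (rule image_subsetI)
   fix j assume j: "j \<in> {j\<in>{fst i..L}. principal ?st (?x j)}"
   have "x \<in> cell l (?x j)" by (rule cell_position)
   moreover from this have "cell l (?x j) \<subseteq> cell l i" using cell_subset_up(1)[OF l, of "?x j" i] i(2) j by auto
   ultimately show "?x j \<in> ?A" using j ib by (auto simp: fam_def)
  qed
 qed (rule mosc_nonneg)
 also have "\<dots> <= 2 * 3 ^ CARD('n) * (\<Sum>j\<in>?A. tosc l b j)"
  unfolding sum_distrib_left by (intro sum_mono mosc_le_tosc[OF b l])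
 finally have 2: "2 * 2 ^ CARD('n) * (\<Sum>j\<in>{j\<in>{fst i..L}. principal ?st (?x j)}. mosc l b (?x j)) <= 2 * 2 ^ CARD('n) * (2 * 3 ^ CARD('n) * (\<Sum>j\<in>?A. tosc l b j))"
  by (intro mult_left_mono) auto
 have "tosc l b i <= (\<Sum>j\<in>?A. tosc l b j)"
  using i by (intro member_le_sum finA mosc_nonneg) auto
 then have 3: "norm (ctr l b (shift e i) - ctr l b i) <= 2 * 3 ^ CARD('n) * (\<Sum>j\<in>?A. tosc l b j)"
  by (intro order_trans[OF ctr_shift_le[OF b l e]] mult_left_mono) auto
 have "norm (lev l b L x - ctr l b (shift e i)) <= norm (lev l b L x - ctr l b i) + norm (ctr l b (shift e i) - ctr l b i)" by norm
 also have "\<dots> <= 2 * 2 ^ CARD('n) * (2 * 3 ^ CARD('n) * (\<Sum>j\<in>?A. tosc l b j)) + 2 * 3 ^ CARD('n) * (\<Sum>j\<in>?A. tosc l b j)"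
  by (intro add_mono order_trans[OF 1 2] 3)
 also have "\<dots> = osc_const TYPE('n) * (\<Sum>j\<in>?A. tosc l b j)"
  by (simp only: osc_const_def distrib_right mult.assoc)
 finally show ?thesis .
qed

text \<open>In Isabelle \<open>0 powr 0 = 0\<close>, whereas the zeroth power of
  \<open>|b - c|\<close> has to be 1 also where \<open>b = c\<close>; the exponent 0 occurs at
  \<open>k = 0\<close> and \<open>k = m\<close>.\<close>

definition rpow :: "real => real => real" where "rpow x a = (if a = 0 then 1 else x powr a)"

lemma rpow_mono: "0 <= x ==> x <= y ==> 0 <= a ==> rpow x a <= rpow y a"
 by (auto simp: rpow_def intro: powr_mono2)

lemma rpow_nonneg [simp]: "0 <= rpow x a" by (simp add: rpow_def)

lemma rpow_of_nat: "0 <= x ==> rpow x (real k) = x ^ k"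
 by (cases "x = 0") (auto simp: rpow_def powr_realpow)

lemma rpow_measurable [measurable]: "f \<in> borel_measurable M ==> (\<lambda>x. rpow (f x) a) \<in> borel_measurable M"
 unfolding rpow_def by (cases "a = 0") auto

lemma tendsto_rpow: "(f \<longlongrightarrow> y) F ==> (!!x. 0 <= f x) ==> 0 <= a ==> ((\<lambda>x. rpow (f x) a) \<longlongrightarrow> rpow y a) F"
 unfolding rpow_def by (cases "a = 0") (auto intro!: tendsto_powr')

text \<open>The geometric factor on the right of \<open>sparse_sum_norm\<close>, with the weight
  data \<open>gM\<close> and \<open>gW\<close> read off on the triple.\<close>

definition zfac :: "((real ^ 'n) set => real) => ((real ^ 'n) set => real) => real => real => real => real => real => 'n idx => real"
 where "zfac GW GM \<kappa> s t q l i = (vol (cell l i) powr (1 - 1 / t) *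
  (((GM (triple l i) * vol (triple l i)) powr \<kappa>) powr s *
   (GW (triple l i) * vol (triple l i)) powr (1 - s)) powr (1 / t)) powr (1 / q)"

text \<open>Half of a cell is the fraction \<open>1 / (2 * 3 ^ CARD('n))\<close> of its triple.
  Letting the constants be weakened allows two weights to share one pair.\<close>

lemma comparable_adm:
 fixes W :: "real ^ 'n => real"
 assumes "comparable W G"
 shows "\<exists>k1>0. \<exists>k2>0. \<forall>k1' k2' I l L. k1 <= k1' --> k2' <= k2 --> 0 < l --> laminar I (cell l) L -->
   laminar.adm I (cell l) k1' k2' W (\<lambda>i. G (triple l i) * vol (triple l i))"
proof -
 have W: "W \<in> borel_measurable lebesgue" "!!x. 0 <= W x" "!!Q. Q \<in> cubes ==> 0 < G Q"
  using assms by (auto simp: comparable_def avg_le_def)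
 have "\<exists>K>0. \<forall>Q\<in>cubes. wmeas W Q <= ennreal (K * (G Q * vol Q))"
  using assms by (simp add: comparable_def avg_le_def wmeas_def)
 then obtain k1 where k1: "0 < k1" "!!Q. Q \<in> cubes ==> wmeas W Q <= ennreal (k1 * (G Q * vol Q))"
  by blast
 define \<eta> where "\<eta> = (1 / (2 * 3 ^ CARD('n)) :: real)"
 have "0 < \<eta>" by (simp add: \<eta>_def)
 then have "\<exists>c>0. \<forall>Q\<in>cubes. \<forall>F\<in>sets lebesgue. F \<subseteq> Q --> \<eta> * vol Q <= vol F -->
   ennreal (c * (G Q * vol Q)) <= wmeas W F"
  using assms by (simp add: comparable_def)
 then obtain k2 where k2: "0 < k2" "!!Q F. Q \<in> cubes ==> F \<in> sets lebesgue ==> F \<subseteq> Q ==> \<eta> * vol Q <= vol F ==>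
   ennreal (k2 * (G Q * vol Q)) <= wmeas W F"
  by blast
 have "laminar.adm I (cell l) k1' k2' W (\<lambda>i. G (triple l i) * vol (triple l i))"
  if k: "k1 <= k1'" "k2' <= k2" and l: "0 < l" and lam: "laminar I (cell l) L" for k1' k2' l L :: real and I :: "'n idx set"
 proof -
  show "laminar.adm I (cell l) k1' k2' W (\<lambda>i. G (triple l i) * vol (triple l i))"
   unfolding laminar.adm_def[OF lam]
  proof (intro conjI ballI impI allI W)
   fix i assume "i \<in> I"
   note cT = ccell_cubes(2)[OF l, of i]
   let ?g = "G (triple l i) * vol (triple l i)"
   show g: "0 < ?g" using W(3)[OF cT] cubes_props(3)[OF cT] by simp
   have "wmeas W (cell l i) <= wmeas W (triple l i)"
    unfolding wmeas_def using cell_subset_triple[OF l, of i] by (intro nn_integral_mono) (auto split: split_indicator)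
   also have "\<dots> <= ennreal (k1 * ?g)" by (rule k1(2)[OF cT])
   also have "\<dots> <= ennreal (k1' * ?g)" using k g by (intro ennreal_leI mult_right_mono) auto
   finally show "wmeas W (cell l i) <= ennreal (k1' * ?g)" .
   fix F assume F: "F \<in> sets lebesgue" "F \<subseteq> cell l i" "vol (cell l i) <= 2 * vol F"
   have "ennreal (k2' * ?g) <= ennreal (k2 * ?g)" using k g by (intro ennreal_leI mult_right_mono) auto
   also have "\<dots> <= wmeas W F"
    using F cell_subset_triple[OF l, of i] by (intro k2(2)[OF cT]) (auto simp: measure_triple[OF l] \<eta>_def)
   finally show "ennreal (k2' * ?g) <= wmeas W F" .
  qed
 qed
 then show ?thesis using k1(1) k2(1) by blast
qed

text \<open>For dyadic averages of \<open>b\<close> at a high level the oscillation is majorised by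
  the chain sum of a family adapted to \<open>S\<close>, and \<open>sparse_sum_norm\<close> applies;
  Fatou's lemma removes the level. The second condition on \<open>\<Psi>\<close> is what turns a
  bound of \<open>tosc\<close> by \<open>\<beta> i * \<Psi>\<close> into the relation between the
  two weights required there.\<close>

lemma sparse_osc_norm:
 fixes t q n \<kappa> e s v L0 :: real and w M :: "real ^ 'n => real"
 assumes cW: "comparable (\<lambda>x. w x powr t) GW" and cM: "comparable M GM"
  and w: "w \<in> borel_measurable lebesgue" "!!x. 0 <= w x"
  and n: "0 < n" "0 < \<kappa>" "\<kappa> = 1 - n * e"
  and q: "0 < q" "1 <= t" "0 < v" "0 <= s" "s <= 1" "1 / q = 1 / v + n * s / (q * t) * e" and L0: "0 <= L0"
  and \<Psi>: "!!Q. Q \<in> cubes ==> 0 < \<Psi> Q"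
   "!!Q. Q \<in> cubes ==> \<Psi> Q powr n * (GW Q * vol Q) <= (GM Q * vol Q) powr \<kappa>"
 obtains C where "0 < C" "!!l (b :: real ^ 'n => 'k::euclidean_space) B S J e0 f a. 0 < l ==> loc_integrable b ==> 0 < B ==>
   (!!I. laminar I (cell l) (2 * (1 + L0)) ==> lnorm_le e I (\<lambda>i. tosc l b i / \<Psi> (triple l i)) B) ==>
   finite S ==> (!!i. i \<in> S ==> cell l i \<subseteq> base l) ==> carleson l S L0 ==> J \<subseteq> S ==> e0 \<in> nbs ==>
   (!!i. i \<in> J ==> f i \<in> borel_measurable lebesgue) ==> (!!i x. i \<in> J ==> 0 <= f i x) ==> (!!i. i \<in> J ==> 0 <= a i) ==>
   (!!i G A. i \<in> J ==> G \<in> borel_measurable lebesgue ==> (!!x. 0 <= G x) ==> 0 <= A ==>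
    (\<integral>\<^sup>+x\<in>cell l i. ennreal (G x powr t) \<partial>lebesgue) <= ennreal A ==>
    (\<integral>\<^sup>+x\<in>cell l i. ennreal (G x * f i x powr q) \<partial>lebesgue) \<le>
     ennreal (a i powr q * vol (cell l i) powr (1 - 1 / t) * A powr (1 / t))) ==>
   (\<integral>\<^sup>+x. ennreal ((\<Sum>i\<in>J. rpow (norm (b x - ctr l b (shift e0 i))) (n * s / (q * t)) * f i x * indicator (cell l i) x) powr q * w x) \<partial>lebesgue)
    <= ennreal (C * B powr (n * s / t) * (\<Sum>i\<in>J. (a i * zfac GW GM \<kappa> s t q l i) powr v) powr (q / v))"
proof -
 note [measurable] = w(1)
 let ?\<theta> = "n * s / (q * t)"
 have \<theta>: "0 <= ?\<theta>" using n q by simp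
 let ?L = "2 * (1 + L0)"
 obtain a1 a2 where a12: "0 < a1" "0 < a2"
  "!!k1' k2' I l L. a1 <= k1' ==> k2' <= a2 ==> 0 < l ==> laminar I (cell l) L ==>
   laminar.adm I (cell l) k1' k2' (\<lambda>x. w x powr t) (\<lambda>i. GW (triple l i) * vol (triple l i))"
  using comparable_adm[OF cW] by blast
 obtain b1 b2 where b12: "0 < b1" "0 < b2"
  "!!k1' k2' I l L. b1 <= k1' ==> k2' <= b2 ==> 0 < l ==> laminar I (cell l) L ==>
   laminar.adm I (cell l) k1' k2' M (\<lambda>i. GM (triple l i) * vol (triple l i))"
  using comparable_adm[OF cM] by blast
 define k1 where "k1 = max a1 b1"
 define k2 where "k2 = min a2 b2"
 have k: "0 < k1" "0 < k2" using a12 b12 by (auto simp: k1_def k2_def)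
 define Kc where "Kc = laminar.K ?L"
 define \<delta> where "\<delta> = k2 / (2 * real Kc * k1)"
 \<comment> \<open>The constants of the locale depend on the packing constant alone. The empty
   family gives access to their definitions before any family is fixed.\<close>
 have lam0: "laminar ({} :: 'n idx set) (cell 1) ?L" by unfold_locales (use L0 in auto)
 have "0 < real Kc" unfolding Kc_def laminar.K_def[OF lam0] by simp
 then have \<delta>: "0 < \<delta>" using k by (simp add: \<delta>_def)
 define c where "c = (1 + n * \<bar>e\<bar>) / \<kappa>"
 have c: "0 < c" using n by (auto simp: c_def intro!: divide_pos_pos add_pos_nonneg)
 \<comment> \<open>The exponent is chosen so that both the square and the \<open>c\<close>-th power
   stay below \<open>1 + \<delta>\<close>, the two conditions on the rate \<open>l\<close> in
   \<open>sparse_sum_norm\<close>.\<close>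
 define \<zeta> where "\<zeta> = (1 + \<delta>) powr (1 / (2 + c))"
 have \<zeta>: "1 < \<zeta>" "\<zeta> * \<zeta> <= 1 + \<delta>" "\<zeta> powr c <= 1 + \<delta>"
 proof -
  show "1 < \<zeta>" using \<delta> c by (simp add: \<zeta>_def)
  have "\<zeta> * \<zeta> = (1 + \<delta>) powr (2 / (2 + c))" using \<delta> by (simp add: \<zeta>_def powr_add[symmetric])
  also have "\<dots> <= (1 + \<delta>) powr 1" using \<delta> c by (intro powr_mono) auto
  finally show "\<zeta> * \<zeta> <= 1 + \<delta>" using \<delta> by simp
  have "\<zeta> powr c = (1 + \<delta>) powr (c / (2 + c))" by (simp add: \<zeta>_def powr_powr)
  also have "\<dots> <= (1 + \<delta>) powr 1" using \<delta> c by (intro powr_mono) auto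
  finally show "\<zeta> powr c <= 1 + \<delta>" using \<delta> by simp
 qed
 define C1 where "C1 = laminar.sparse_const ?L \<zeta> k1 k2 1 n \<kappa> e q t s"
 have C1: "0 <= C1" unfolding C1_def laminar.sparse_const_def[OF lam0]
  using chain_const_pos[of "\<zeta> powr (1 / t)" q] \<zeta> q by simp
 define c3 where "c3 = osc_const TYPE('n)"
 have c3: "0 < c3" by (simp add: c3_def osc_const_def add_pos_pos)
 define C where "C = c3 powr (?\<theta> * q) * (C1 * (2 powr \<bar>e\<bar>) powr (n * s / t)) + 1"
 show thesis
 proof (rule that[of C])
  show "0 < C" using C1 by (simp add: C_def add_nonneg_pos)
  fix l :: real and b :: "real ^ 'n => 'k" and B :: real and S J :: "'n idx set" and e0 :: "int ^ 'n" and f :: "'n idx => real ^ 'n => real" and a :: "'n idx => real"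
  assume l: "0 < l" and b: "loc_integrable b" and B: "0 < B"
   and BB: "!!I. laminar I (cell l) ?L ==> lnorm_le e I (\<lambda>i. tosc l b i / \<Psi> (triple l i)) B"
   and S: "finite S" "!!i. i \<in> S ==> cell l i \<subseteq> base l" "carleson l S L0" and J: "J \<subseteq> S" and e0: "e0 \<in> nbs"
   and f: "!!i. i \<in> J ==> f i \<in> borel_measurable lebesgue" "!!i x. i \<in> J ==> 0 <= f i x" "!!i. i \<in> J ==> 0 <= a i"
   "!!i G A. i \<in> J ==> G \<in> borel_measurable lebesgue ==> (!!x. 0 <= G x) ==> 0 <= A ==>
    (\<integral>\<^sup>+x\<in>cell l i. ennreal (G x powr t) \<partial>lebesgue) <= ennreal A ==>
    (\<integral>\<^sup>+x\<in>cell l i. ennreal (G x * f i x powr q) \<partial>lebesgue) \<le>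
     ennreal (a i powr q * vol (cell l i) powr (1 - 1 / t) * A powr (1 / t))"
  note f(1)[measurable]
  have finJ: "finite J" using J S finite_subset by auto
  let ?Sum = "\<Sum>i\<in>J. (a i * zfac GW GM \<kappa> s t q l i) powr v"
  let ?bd = "ennreal (C * B powr (n * s / t) * ?Sum powr (q / v))"
  \<comment> \<open>From this level on the truncated adapted family contains all of
    \<open>S\<close>.\<close>
  obtain L1 where L1: "!!i. i \<in> S ==> fst i <= L1"
   using S(1) finite_imageI[of S fst] by (meson Max_ge finite_imageI imageI)
  let ?g = "\<lambda>y x. ennreal ((\<Sum>i\<in>J. rpow (norm (y - ctr l b (shift e0 i))) ?\<theta> * f i x * indicator (cell l i) x) powr q * w x)"
  have level: "(\<integral>\<^sup>+x. ?g (levb l b L x) x \<partial>lebesgue) <= ?bd" if Lv: "L1 <= L" for L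
  proof -
   let ?I = "fam l b S L"
   interpret laminar ?I "cell l" ?L by (rule laminar_fam[OF b l S(3) L0])
   have SI: "S \<subseteq> ?I" by (rule subset_fam[OF S(2) order_trans[OF L1 Lv]])
   then have JI: "J \<subseteq> ?I" using J by auto
   have \<Psi>p: "0 < \<Psi> (triple l i)" for i by (rule \<Psi>(1)[OF ccell_cubes(2)[OF l]])
   obtain \<beta> where \<beta>: "!!i. i \<in> ?I ==> tosc l b i / \<Psi> (triple l i) <= \<beta> i" "!!i. i \<in> ?I ==> 0 < \<beta> i"
    "lnorm_le e ?I \<beta> (2 powr \<bar>e\<bar> * B)"
    using lnorm_le_pos[OF fin _ B BB[OF laminar_axioms]] mosc_nonneg(2) \<Psi>p by (metis divide_nonneg_pos)
   define h where "h i = \<beta> i * \<Psi> (triple l i)" for i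
   have h: "0 < h i" "tosc l b i <= h i" if "i \<in> ?I" for i
    using \<beta>(1,2)[OF that] \<Psi>p[of i] by (auto simp: h_def field_simps)
   have ub: "norm (levb l b L x - ctr l b (shift e0 i)) <= c3 * U h i x" if i: "i \<in> J" and x: "x \<in> cell l i" for i x
   proof -
    have "x \<in> base l" using S(2)[of i] i J x by auto
    then have "norm (levb l b L x - ctr l b (shift e0 i)) <= c3 * (\<Sum>j\<in>{j\<in>?I. x \<in> cell l j \<and> cell l j \<subseteq> cell l i}. tosc l b j)"
     unfolding levb_eq[OF l \<open>x \<in> base l\<close>] c3_def using i JI x by (intro lev_ctr_le[OF b l _ _ e0]) auto
    also have "\<dots> <= c3 * U h i x" unfolding U_eq using h c3 by (intro mult_left_mono sum_mono) auto
    finally show ?thesis .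
   qed
   have "(\<integral>\<^sup>+x. ?g (levb l b L x) x \<partial>lebesgue) \<le>
    (\<integral>\<^sup>+x. ennreal (c3 powr (?\<theta> * q)) * ennreal ((\<Sum>i\<in>J. U h i x powr ?\<theta> * f i x * indicator (cell l i) x) powr q * w x) \<partial>lebesgue)"
   proof (intro nn_integral_mono)
    fix x
    have "(\<Sum>i\<in>J. rpow (norm (levb l b L x - ctr l b (shift e0 i))) ?\<theta> * f i x * indicator (cell l i) x) \<le>
     (\<Sum>i\<in>J. c3 powr ?\<theta> * (U h i x powr ?\<theta> * f i x * indicator (cell l i) x))"
    proof (rule sum_mono)
     fix i assume i: "i \<in> J"
     show "rpow (norm (levb l b L x - ctr l b (shift e0 i))) ?\<theta> * f i x * indicator (cell l i) x \<le>
     c3 powr ?\<theta> * (U h i x powr ?\<theta> * f i x * indicator (cell l i) x)"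
     proof (cases "x \<in> cell l i")
     case True
     have Up: "0 < U h i x" using i JI True h by (intro U_pos) auto
     have "rpow (norm (levb l b L x - ctr l b (shift e0 i))) ?\<theta> <= rpow (c3 * U h i x) ?\<theta>"
     by (rule rpow_mono[OF _ ub[OF i True] \<theta>]) simp
     also have "\<dots> = c3 powr ?\<theta> * U h i x powr ?\<theta>" using Up c3 by (auto simp: rpow_def powr_mult)
     finally show ?thesis using True f(2)[OF i, of x] by (simp add: mult_right_mono mult.assoc[symmetric])
     qed simp
    qed
    then have "(\<Sum>i\<in>J. rpow (norm (levb l b L x - ctr l b (shift e0 i))) ?\<theta> * f i x * indicator (cell l i) x) powr q \<le>
     (c3 powr ?\<theta> * (\<Sum>i\<in>J. U h i x powr ?\<theta> * f i x * indicator (cell l i) x)) powr q"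
     unfolding sum_distrib_left using f(2) q by (intro powr_mono2 sum_nonneg) auto
    also have "\<dots> = c3 powr (?\<theta> * q) * (\<Sum>i\<in>J. U h i x powr ?\<theta> * f i x * indicator (cell l i) x) powr q"
     by (simp add: powr_mult powr_powr)
    finally have "(\<Sum>i\<in>J. rpow (norm (levb l b L x - ctr l b (shift e0 i))) ?\<theta> * f i x * indicator (cell l i) x) powr q * w x \<le>
     c3 powr (?\<theta> * q) * ((\<Sum>i\<in>J. U h i x powr ?\<theta> * f i x * indicator (cell l i) x) powr q * w x)"
     using w(2)[of x] by (simp add: mult_right_mono mult.assoc[symmetric])
    then show "?g (levb l b L x) x <= ennreal (c3 powr (?\<theta> * q)) * ennreal ((\<Sum>i\<in>J. U h i x powr ?\<theta> * f i x * indicator (cell l i) x) powr q * w x)"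
     using w(2)[of x] by (simp add: ennreal_mult[symmetric] ennreal_leI)
   qed
   also have "\<dots> = ennreal (c3 powr (?\<theta> * q)) * (\<integral>\<^sup>+x. ennreal ((\<Sum>i\<in>J. U h i x powr ?\<theta> * f i x * indicator (cell l i) x) powr q * w x) \<partial>lebesgue)"
   proof (rule nn_integral_cmult)
    have "(\<lambda>x. \<Sum>i\<in>J. U h i x powr ?\<theta> * f i x * indicator (cell l i) x) \<in> borel_measurable lebesgue"
     using f(1) l by (intro borel_measurable_sum borel_measurable_times powr_real_measurable U_measurable) auto
    from measurable_compose[OF borel_measurable_times[OF powr_real_measurable[OF this borel_measurable_const] w(1)] measurable_ennreal]
    show "(\<lambda>x. ennreal ((\<Sum>i\<in>J. U h i x powr ?\<theta> * f i x * indicator (cell l i) x) powr q * w x)) \<in> borel_measurable lebesgue" .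
   qed
   also have "\<dots> <= ennreal (c3 powr (?\<theta> * q)) * ennreal (C1 * (2 powr \<bar>e\<bar> * B) powr (n * s / t) * ?Sum powr (q / v))"
    unfolding C1_def zfac_def
   proof (intro mult_left_mono sparse_sum_norm[where \<beta>=\<beta> and gW="\<lambda>i. GW (triple l i) * vol (triple l i)" and gM="\<lambda>i. GM (triple l i) * vol (triple l i)" and M=M])
    show "adm k1 k2 (\<lambda>x. w x powr t) (\<lambda>i. GW (triple l i) * vol (triple l i))"
     by (rule a12(3)[OF _ _ l laminar_axioms]) (auto simp: k1_def k2_def)
    show "adm k1 k2 M (\<lambda>i. GM (triple l i) * vol (triple l i))"
     by (rule b12(3)[OF _ _ l laminar_axioms]) (auto simp: k1_def k2_def)
    show "\<zeta> * \<zeta> <= 1 + k2 / (real (2 * laminar.K ?L) * k1)" "\<zeta> powr ((1 + n * \<bar>e\<bar>) / \<kappa>) <= 1 + k2 / (real (2 * laminar.K ?L) * k1)"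
     using \<zeta>(2,3) unfolding \<delta>_def Kc_def c_def of_nat_mult of_nat_numeral by blast+
    show "0 < 2 powr \<bar>e\<bar> * B" using B by simp
    fix i assume i: "i \<in> ?I"
    have "h i powr n = \<beta> i powr n * \<Psi> (triple l i) powr n" by (simp add: h_def powr_mult)
    then show "h i powr n * (GW (triple l i) * vol (triple l i)) <= 1 * (\<beta> i powr n * (GM (triple l i) * vol (triple l i)) powr \<kappa>)"
     using \<Psi>(2)[OF ccell_cubes(2)[OF l, of i]] by (simp add: mult.assoc mult_left_mono)
   qed (use k w n \<zeta> q \<beta> h JI f in auto)
   also have "\<dots> = ennreal (c3 powr (?\<theta> * q) * (C1 * (2 powr \<bar>e\<bar>) powr (n * s / t)) * B powr (n * s / t) * ?Sum powr (q / v))"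
    by (simp add: ennreal_mult'[symmetric] powr_mult mult_ac)
   also have "\<dots> <= ?bd"
    by (intro ennreal_leI mult_right_mono) (auto simp: C_def)
   finally show ?thesis .
  qed
  obtain \<phi> where \<phi>: "strict_mono \<phi>" "AE x in lebesgue. x \<in> base l --> (\<lambda>n. lev l b (\<phi> n) x) \<longlonglongrightarrow> b x"
   using lev_tendsto[OF b l] by blast
  show "(\<integral>\<^sup>+x. ?g (b x) x \<partial>lebesgue) <= ?bd"
  proof (rule nn_integral_le_lim[where u="\<lambda>k x. ?g (levb l b (\<phi> (k + L1)) x) x"])
   fix k
   note [measurable] = levb_measurable[OF l, of b "\<phi> (k + L1)"]
   show "(\<lambda>x. ?g (levb l b (\<phi> (k + L1)) x) x) \<in> borel_measurable lebesgue" using l by measurable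
   show "(\<integral>\<^sup>+x. ?g (levb l b (\<phi> (k + L1)) x) x \<partial>lebesgue) <= ?bd"
    using seq_suble[OF \<phi>(1), of "k + L1"] by (intro level) simp
  next
   show "AE x in lebesgue. (\<lambda>k. ?g (levb l b (\<phi> (k + L1)) x) x) \<longlonglongrightarrow> ?g (b x) x"
    using \<phi>(2)
   proof eventually_elim
    case (elim x)
    have "(\<lambda>k. rpow (norm (levb l b (\<phi> (k + L1)) x - ctr l b (shift e0 i))) ?\<theta> * f i x * indicator (cell l i) x)
     \<longlonglongrightarrow> rpow (norm (b x - ctr l b (shift e0 i))) ?\<theta> * f i x * indicator (cell l i) x" if i: "i \<in> J" for i
    proof (cases "x \<in> cell l i")
     case True
     then have xb: "x \<in> base l" using S(2)[of i] i J by auto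
     then have "(\<lambda>n. levb l b (\<phi> (n + L1)) x) \<longlonglongrightarrow> b x"
     using LIMSEQ_ignore_initial_segment[of "\<lambda>n. lev l b (\<phi> n) x" "b x" L1] elim by (simp add: levb_eq[OF l])
     then show ?thesis using \<theta> by (intro tendsto_mult tendsto_const tendsto_rpow tendsto_norm tendsto_diff) auto
    qed simp
    then have "(\<lambda>k. (\<Sum>i\<in>J. rpow (norm (levb l b (\<phi> (k + L1)) x - ctr l b (shift e0 i))) ?\<theta> * f i x * indicator (cell l i) x))
     \<longlonglongrightarrow> (\<Sum>i\<in>J. rpow (norm (b x - ctr l b (shift e0 i))) ?\<theta> * f i x * indicator (cell l i) x)"
     by (intro tendsto_sum)
    then show ?case using q f(2)
     by (intro tendsto_ennrealI tendsto_mult tendsto_const tendsto_powr') (auto intro!: always_eventually sum_nonneg)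
   qed
  qed
 qed
qed

section \<open>Sparse domination of commutators\<close>

lemma cutoff_indicator: "cutoff f A x = indicator A x *\<^sub>R (f x :: 'k::real_normed_vector)"
 by (simp add: cutoff_def indicator_def)

lemma cutoff_cutoff: "cutoff (cutoff f A) B = cutoff f (A \<inter> B)"
 by (auto simp: cutoff_def fun_eq_iff)

lemma Lr_comp_iff:
 fixes f :: "real ^ 'n => 'k::euclidean_space"
 shows "f \<in> Lr_comp r \<longleftrightarrow> f \<in> borel_measurable lebesgue \<and> (\<integral>\<^sup>+x. ennreal (norm (f x) powr r) \<partial>lebesgue) < \<infinity> \<and> bounded {x. f x \<noteq> 0}"
 by (auto simp: Lr_comp_def Lr_on_def lebesgue_on_UNIV_eq)

lemma Lr_comp_add:
 fixes f g :: "real ^ 'n => 'k::euclidean_space"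
 assumes f: "f \<in> Lr_comp r" and g: "g \<in> Lr_comp r" and r: "0 <= r"
 shows "(\<lambda>x. f x + g x) \<in> Lr_comp r"
proof -
 note [measurable] = f[unfolded Lr_comp_iff, THEN conjunct1] g[unfolded Lr_comp_iff, THEN conjunct1]
 have "(\<integral>\<^sup>+x. ennreal (norm (f x + g x) powr r) \<partial>lebesgue) \<le>
  (\<integral>\<^sup>+x. ennreal (2 powr r) * ennreal (norm (f x) powr r) + ennreal (2 powr r) * ennreal (norm (g x) powr r) \<partial>lebesgue)"
 proof (rule nn_integral_mono)
  fix x
  have "norm (f x + g x) <= 2 * max (norm (f x)) (norm (g x))" using norm_triangle_ineq[of "f x" "g x"] by linarith
  then have "norm (f x + g x) powr r <= (2 * max (norm (f x)) (norm (g x))) powr r" using r by (intro powr_mono2) auto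
  also have "\<dots> = 2 powr r * max (norm (f x)) (norm (g x)) powr r" by (simp add: powr_mult)
  also have "\<dots> <= 2 powr r * (norm (f x) powr r + norm (g x) powr r)" by (intro mult_left_mono) (auto simp: max_def)
  finally show "ennreal (norm (f x + g x) powr r) <= ennreal (2 powr r) * ennreal (norm (f x) powr r) + ennreal (2 powr r) * ennreal (norm (g x) powr r)"
   by (simp add: ennreal_mult[symmetric] ennreal_plus[symmetric] distrib_left ennreal_leI del: ennreal_plus)
 qed
 also have "\<dots> < \<infinity>"
  using f g by (simp add: Lr_comp_iff nn_integral_add nn_integral_cmult ennreal_mult_less_top)
 finally have "(\<integral>\<^sup>+x. ennreal (norm (f x + g x) powr r) \<partial>lebesgue) < \<infinity>" .
 moreover have "bounded {x. f x + g x \<noteq> 0}"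
  by (rule bounded_subset[of "{x. f x \<noteq> 0} \<union> {x. g x \<noteq> 0}"]) (use f g in \<open>auto simp: Lr_comp_iff\<close>)
 ultimately show ?thesis by (simp add: Lr_comp_iff)
qed

lemma Lr_comp_cmult:
 fixes f :: "real ^ 'n => 'k::{real_normed_field, euclidean_space}"
 assumes f: "f \<in> Lr_comp r"
 shows "(\<lambda>x. c * f x) \<in> Lr_comp r"
proof -
 note [measurable] = f[unfolded Lr_comp_iff, THEN conjunct1]
 have "(\<integral>\<^sup>+x. ennreal (norm (c * f x) powr r) \<partial>lebesgue) = (\<integral>\<^sup>+x. ennreal (norm c powr r) * ennreal (norm (f x) powr r) \<partial>lebesgue)"
  by (simp add: norm_mult powr_mult ennreal_mult)
 also have "\<dots> < \<infinity>" using f by (simp add: Lr_comp_iff nn_integral_cmult ennreal_mult_less_top)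
 finally have "(\<integral>\<^sup>+x. ennreal (norm (c * f x) powr r) \<partial>lebesgue) < \<infinity>" .
 moreover have "bounded {x. c * f x \<noteq> 0}"
  by (rule bounded_subset[of "{x. f x \<noteq> 0}"]) (use f in \<open>auto simp: Lr_comp_iff\<close>)
 ultimately show ?thesis by (simp add: Lr_comp_iff)
qed

lemma Lr_comp_cutoff:
 fixes f :: "real ^ 'n => 'k::euclidean_space"
 assumes f: "f \<in> Lr_comp r" and A[measurable]: "A \<in> sets lebesgue"
 shows "cutoff f A \<in> Lr_comp r"
proof -
 note [measurable] = f[unfolded Lr_comp_iff, THEN conjunct1]
 have "(\<integral>\<^sup>+x. ennreal (norm (cutoff f A x) powr r) \<partial>lebesgue) <= (\<integral>\<^sup>+x. ennreal (norm (f x) powr r) \<partial>lebesgue)"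
  by (intro nn_integral_mono) (auto simp: cutoff_def)
 also have "\<dots> < \<infinity>" using f by (simp add: Lr_comp_iff)
 finally have "(\<integral>\<^sup>+x. ennreal (norm (cutoff f A x) powr r) \<partial>lebesgue) < \<infinity>" .
 moreover have "bounded {x. cutoff f A x \<noteq> 0}"
  by (rule bounded_subset[of "{x. f x \<noteq> 0}"]) (use f in \<open>auto simp: Lr_comp_iff cutoff_def\<close>)
 moreover have "cutoff f A \<in> borel_measurable lebesgue"
  unfolding cutoff_indicator[abs_def] by measurable
 ultimately show ?thesis by (simp add: Lr_comp_iff)
qed

text \<open>Sublinearity is assumed on \<open>Lr_comp r\<close> only, so membership of the partial
  sums in this domain is carried through the induction.\<close>

lemma sublinear_sum:
 fixes T :: "('n::finite, 'k::{real_normed_field, euclidean_space}) operator"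
 assumes T: "sublinear_on (Lr_comp r) T" and r: "0 <= r" and K: "finite K" "!!k. k \<in> K ==> g k \<in> Lr_comp r" "K \<noteq> {}"
 shows "(\<lambda>y. \<Sum>k\<in>K. a k * g k y) \<in> Lr_comp r \<and> norm (T (\<lambda>y. \<Sum>k\<in>K. a k * g k y) x) <= (\<Sum>k\<in>K. norm (a k) * norm (T (g k) x))"
 using K(1,3,2)
proof (induction K rule: finite_ne_induct)
 case (singleton k)
 then show ?case using T Lr_comp_cmult[of "g k" r "a k"] by (simp add: sublinear_on_def)
next
 case (insert k K)
 let ?h = "\<lambda>y. \<Sum>k\<in>K. a k * g k y"
 have IH: "?h \<in> Lr_comp r" "norm (T ?h x) <= (\<Sum>k\<in>K. norm (a k) * norm (T (g k) x))" using insert by auto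
 have k: "(\<lambda>y. a k * g k y) \<in> Lr_comp r" using insert by (intro Lr_comp_cmult) auto
 have "norm (T (\<lambda>y. a k * g k y + ?h y) x) <= norm (T (\<lambda>y. a k * g k y) x) + norm (T ?h x)"
  using T k IH by (simp add: sublinear_on_def)
 also have "norm (T (\<lambda>y. a k * g k y) x) = norm (a k) * norm (T (g k) x)" using T insert by (simp add: sublinear_on_def)
 finally show ?case using insert IH Lr_comp_add[OF k IH(1) r] by simp
qed

definition norm_le_on :: "ennreal => (real ^ 'n) set => (real ^ 'n => real) => real => bool"
 where "norm_le_on s X h a \<longleftrightarrow> (if s = top then (AE x in lebesgue. x \<in> X --> h x <= a)
  else (\<integral>\<^sup>+x\<in>X. ennreal (h x powr enn2real s) \<partial>lebesgue) <= ennreal (a powr enn2real s * vol X))"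

text \<open>
 A function that oscillates little over \<open>P\<close> and is bounded on a large part of \<open>P\<close> has small norm;
 the oscillation is written as in \<^const>\<open>grand_sharp_max\<close>.
\<close>

lemma norm_le_on_of_oscillation:
 fixes g :: "real ^ 'n => 'k::euclidean_space"
 assumes s: "1 <= s" and P: "P \<in> cubes" and g: "g \<in> borel_measurable lebesgue"
  and osc: "(let M = lebesgue_on P \<Otimes>\<^sub>M lebesgue_on P; d = (\<lambda>z. ennreal (norm (g (fst z) - g (snd z))))
   in if s = top then esssup M d
     else epowr ((\<integral>\<^sup>+ z. epowr (d z) (enn2real s) \<partial>M) / (emeasure lebesgue P)\<^sup>2) (1 / enn2real s)) <= ennreal A"
  and Y: "Y \<in> sets lebesgue" "Y \<subseteq> P" "vol P <= 4 * vol Y"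
  and B: "!!x. x \<in> Y ==> norm (g x) <= B" and AB: "0 <= A" "0 <= B"
 shows "norm_le_on s P (\<lambda>x. norm (g x)) (10 * (A + B))"
proof -
 note cP = cubes_props[OF P]
 let ?L = "lebesgue_on P"
 let ?d = "\<lambda>z. ennreal (norm (g (fst z) - g (snd z)))"
 have gL [measurable]: "g \<in> borel_measurable ?L" by (rule measurable_restrict_space1[OF g])
 interpret L: finite_measure ?L by (rule finite_measure_lebesgue_on[OF cP(2)])
 interpret LL: pair_sigma_finite ?L ?L ..
 have Yf: "Y \<in> fmeasurable lebesgue" using cP(2) Y by (meson fmeasurableI2)
 have YL [measurable]: "Y \<in> sets ?L" using Y cP(1) by (simp add: sets_restrict_space_iff)
 have Lem: "emeasure ?L Z = emeasure lebesgue Z" if "Z \<in> sets lebesgue" "Z \<subseteq> P" for Z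
  using that cP(1) by (intro emeasure_restrict_space) auto
 have Yp: "0 < vol Y" using Y cP(3) by linarith
 have eY: "emeasure ?L Y = ennreal (vol Y)" using Lem[OF Y(1,2)] emeasure_eq_measure2[OF Yf] by metis
 have eP: "emeasure ?L (space ?L) = ennreal (vol P)" using Lem[of P] cP by (simp add: space_restrict_space del: emeasure_completion)
 have [measurable]: "?d \<in> borel_measurable (?L \<Otimes>\<^sub>M ?L)" by measurable
 show ?thesis
 proof (cases "s = top")
  case True
  have "AE z in ?L \<Otimes>\<^sub>M ?L. ?d z <= esssup (?L \<Otimes>\<^sub>M ?L) ?d" by (rule esssup_AE) measurable
  then have "AE z in ?L \<Otimes>\<^sub>M ?L. ?d z <= ennreal A"
   using osc True by (auto simp: Let_def elim!: eventually_mono intro: order_trans)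
  then have "AE x in ?L. AE y in ?L. ?d (x, y) <= ennreal A" by (rule LL.AE_pair)
  note 1 = this
  have 2: "\<not> (AE x in ?L. x \<notin> Y)"
  proof
   assume "AE x in ?L. x \<notin> Y"
   then have "emeasure ?L Y = 0" using sets.sets_into_space[OF YL] by (subst (asm) AE_iff_measurable[OF YL]) auto
   then show False using eY Yp by simp
  qed
  \<comment> \<open>Fubini gives a full set of points \<open>x\<close> at which the oscillation
    bound holds for almost every \<open>y\<close>; it meets \<open>Y\<close>, which has positive
    volume.\<close>
  have "\<not> (AE x in ?L. \<not> ((AE y in ?L. ?d (x, y) <= ennreal A) \<and> x \<in> Y))"
  proof
   assume "AE x in ?L. \<not> ((AE y in ?L. ?d (x, y) <= ennreal A) \<and> x \<in> Y)"
   with 1 have "AE x in ?L. x \<notin> Y" by eventually_elim blast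
   then show False using 2 by simp
  qed
  then obtain x where x: "AE y in ?L. ?d (x, y) <= ennreal A" "x \<in> Y" by (metis (mono_tags, lifting) AE_I2)
  have "AE y in ?L. norm (g y) <= 10 * (A + B)"
   using x(1)
  proof eventually_elim
   case (elim y)
   have "norm (g x - g y) <= A" using elim AB by simp
   moreover have "norm (g y) <= norm (g x - g y) + norm (g x)" by norm
   ultimately have "norm (g y) <= A + B" using B[OF x(2)] by (meson add_mono order_trans)
   also have "\<dots> <= 10 * (A + B)" using AB by simp
   finally show ?case .
  qed
  then show ?thesis using True cP(1) by (simp add: norm_le_on_def AE_restrict_space_iff)
 next
  case False
  define u where "u = enn2real s"
  have u: "1 <= u" using s False by (cases s) (auto simp: u_def)
  let ?mP = "vol P" and ?mY = "vol Y"
  let ?I = "\<integral>\<^sup>+y. ennreal (norm (g y) powr u) \<partial>?L"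
  let ?D = "\<lambda>z. ennreal (norm (g (fst z) - g (snd z)) powr u)"
  have "(\<integral>\<^sup>+z. epowr (?d z) u \<partial>(?L \<Otimes>\<^sub>M ?L)) / (emeasure lebesgue P)\<^sup>2 <= ennreal (A powr u)"
   using osc False AB u epowr_le_iff[of "1 / u" A] by (simp add: Let_def u_def)
  then have "(\<integral>\<^sup>+z. ?D z \<partial>(?L \<Otimes>\<^sub>M ?L)) / ennreal (?mP\<^sup>2) <= ennreal (A powr u)"
   using AB unfolding cP(5) by (simp add: epowr_ennreal ennreal_power)
  then have "(\<integral>\<^sup>+z. ?D z \<partial>(?L \<Otimes>\<^sub>M ?L)) <= ennreal (A powr u) * ennreal (?mP\<^sup>2)"
   using cP(3) by (intro ennreal_le_of_divide_le) auto
  then have D: "(\<integral>\<^sup>+x. \<integral>\<^sup>+y. ?D (x, y) \<partial>?L \<partial>?L) <= ennreal (A powr u * ?mP\<^sup>2)"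
   by (subst L.nn_integral_fst) (auto simp: ennreal_mult)
  \<comment> \<open>Averaging over \<open>x\<close> in \<open>Y\<close> replaces the choice of one
    good point. Since \<open>Y\<close> is at least a quarter of \<open>P\<close>, the oscillation
    term costs 4 and the bound on \<open>Y\<close> costs 1; with \<open>5 <= 5 powr u\<close> and
    the factor \<open>2 powr u\<close> this is the constant 10.\<close>
  have "ennreal ?mY * ?I = (\<integral>\<^sup>+x. \<integral>\<^sup>+y. indicator Y x * ennreal (norm (g y) powr u) \<partial>?L \<partial>?L)"
   using eY by (simp add: nn_integral_cmult nn_integral_multc)
  also have "\<dots> <= (\<integral>\<^sup>+x. \<integral>\<^sup>+y. ennreal (2 powr u) * ?D (x, y) + ennreal (2 powr u * B powr u) * indicator Y x \<partial>?L \<partial>?L)"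
  proof (intro nn_integral_mono)
   fix x y
   show "indicator Y x * ennreal (norm (g y) powr u) <= ennreal (2 powr u) * ?D (x, y) + ennreal (2 powr u * B powr u) * indicator Y x"
   proof (cases "x \<in> Y")
    case True
    have "norm (g y) <= norm (g x - g y) + norm (g x)" by norm
    then have "norm (g y) <= 2 * max (norm (g x - g y)) B" using B[OF True] by linarith
    then have "norm (g y) powr u <= (2 * max (norm (g x - g y)) B) powr u" using u by (intro powr_mono2) auto
    also have "\<dots> = 2 powr u * max (norm (g x - g y)) B powr u" by (simp add: powr_mult)
    also have "\<dots> <= 2 powr u * (norm (g x - g y) powr u + B powr u)" by (intro mult_left_mono) (auto simp: max_def)
    finally show ?thesis using True
     by (simp add: ennreal_mult[symmetric] ennreal_plus[symmetric] distrib_left ennreal_leI del: ennreal_plus)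
   qed simp
  qed
  also have "\<dots> = ennreal (2 powr u) * (\<integral>\<^sup>+x. \<integral>\<^sup>+y. ?D (x, y) \<partial>?L \<partial>?L) + ennreal (2 powr u * B powr u) * ennreal ?mP * ennreal ?mY"
   using eY eP by (simp add: nn_integral_add nn_integral_cmult nn_integral_multc L.borel_measurable_nn_integral_fst mult_ac)
  also have "\<dots> <= ennreal (2 powr u) * ennreal (A powr u * ?mP\<^sup>2) + ennreal (2 powr u * B powr u) * ennreal ?mP * ennreal ?mY"
   by (intro add_mono mult_left_mono D) auto
  also have "\<dots> = ennreal (2 powr u * (A powr u * ?mP\<^sup>2 + B powr u * ?mP * ?mY))"
   by (simp add: ennreal_mult[symmetric] ennreal_plus[symmetric] distrib_left mult_ac del: ennreal_plus)
  also have "\<dots> <= ennreal (?mY * ((10 * (A + B)) powr u * ?mP))"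
  proof (rule ennreal_leI)
   have AB': "A powr u <= (A + B) powr u" "B powr u <= (A + B) powr u" using AB u by (auto intro!: powr_mono2)
   have "A powr u * ?mP\<^sup>2 <= (A + B) powr u * (4 * ?mY * ?mP)"
    unfolding power2_eq_square using Y(3) AB' cP(3) by (intro mult_mono) auto
   moreover have "B powr u * ?mP * ?mY <= (A + B) powr u * ?mP * ?mY"
    using AB' cP(3) Yp by (intro mult_right_mono) auto
   ultimately have "A powr u * ?mP\<^sup>2 + B powr u * ?mP * ?mY <= 5 * (A + B) powr u * ?mY * ?mP" by (simp add: algebra_simps)
   also have "\<dots> <= 5 powr u * (A + B) powr u * ?mY * ?mP"
    using u cP(3) Yp powr_mono[of 1 u 5] by (intro mult_right_mono) auto
   finally have "2 powr u * (A powr u * ?mP\<^sup>2 + B powr u * ?mP * ?mY) <= 2 powr u * (5 powr u * (A + B) powr u * ?mY * ?mP)"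
    by (intro mult_left_mono) auto
   also have "\<dots> = ?mY * ((2 powr u * 5 powr u * (A + B) powr u) * ?mP)" by (simp add: mult_ac)
   also have "2 powr u * 5 powr u * (A + B) powr u = (10 * (A + B)) powr u"
    by (simp add: powr_mult[symmetric])
   finally show "2 powr u * (A powr u * ?mP\<^sup>2 + B powr u * ?mP * ?mY) <= ?mY * ((10 * (A + B)) powr u * ?mP)" .
  qed
  finally have *: "ennreal ?mY * ?I <= ennreal (?mY * ((10 * (A + B)) powr u * ?mP))" .
  have "?I = ennreal (1 / ?mY) * (ennreal ?mY * ?I)"
   using Yp by (simp add: mult.assoc[symmetric] ennreal_mult[symmetric])
  also have "\<dots> <= ennreal (1 / ?mY) * ennreal (?mY * ((10 * (A + B)) powr u * ?mP))" by (intro mult_left_mono *) auto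
  also have "\<dots> = ennreal ((10 * (A + B)) powr u * ?mP)" using Yp by (simp add: ennreal_mult[symmetric])
  finally show ?thesis using False cP(1) by (simp add: norm_le_on_def u_def nn_integral_restrict_space)
 qed
qed

section \<open>Exceptional sets for the operator on one cell\<close>

locale domination =
 fixes T :: "('n::finite, 'k::{real_normed_field, euclidean_space}) operator"
  and r :: real and s :: ennreal and m :: nat and \<phi>1 \<phi>2 :: "real => real"
  and b f :: "real ^ 'n => 'k" and l :: real
 assumes r: "1 <= r" and s: "1 <= s" and l: "0 < l"
  and sub: "sublinear_on (Lr_comp r) T"
  and \<phi>: "!!\<theta>. \<theta> \<in> {0<..<1} ==> 0 <= \<phi>1 \<theta>" "!!\<theta>. \<theta> \<in> {0<..<1} ==> 0 <= \<phi>2 \<theta>"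
  and weak1: "!!Q g \<theta>. Q \<in> cubes ==> g \<in> Lr_on r Q ==> \<theta> \<in> {0<..<1} ==>
   outer_measure_of lebesgue {x \<in> Q. ennreal (norm (T (cutoff g Q) x)) > ennreal (\<phi>1 \<theta>) * pavg r (\<lambda>y. ennreal (norm (g y))) Q}
    <= ennreal \<theta> * emeasure lebesgue Q"
  and weak2: "!!Q g \<theta>. Q \<in> cubes ==> g \<in> Lr_on r Q ==> \<theta> \<in> {0<..<1} ==>
   outer_measure_of lebesgue {x \<in> Q. grand_sharp_max T s (cutoff g Q) x > ennreal (\<phi>2 \<theta>) * pavg r (\<lambda>y. ennreal (norm (g y))) Q}
    <= ennreal \<theta> * emeasure lebesgue Q"
  and Fd: "!!c k. k <= m ==> (\<lambda>y. (c - b y) ^ k * f y) \<in> Lr_comp r"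
begin

definition G :: "'n idx => nat => real ^ 'n => 'k" where "G Q k = (\<lambda>y. (ctr l b Q - b y) ^ k * f y)"

definition av :: "'n idx => nat => real"
 where "av Q k = (enn2real (\<integral>\<^sup>+x\<in>triple l Q. ennreal (norm (G Q k x) powr r) \<partial>lebesgue) / vol (triple l Q)) powr (1 / r)"

lemma G_comp: "k <= m ==> G Q k \<in> Lr_comp r" unfolding G_def by (rule Fd)

lemma G_measurable: "k <= m ==> G Q k \<in> borel_measurable lebesgue"
 using G_comp by (simp add: Lr_comp_iff)

lemma cut_comp: "k <= m ==> A \<in> sets lebesgue ==> cutoff (G Q k) A \<in> Lr_comp r"
 by (intro Lr_comp_cutoff G_comp)

lemma T_measurable: "g \<in> Lr_comp r ==> T g \<in> borel_measurable lebesgue"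
 using sub by (simp add: sublinear_on_def)

lemma av_nonneg: "0 <= av Q k" by (simp add: av_def)

lemma int_av:
 assumes k: "k <= m"
 shows "(\<integral>\<^sup>+x\<in>triple l Q. ennreal (norm (G Q k x) powr r) \<partial>lebesgue) = ennreal (av Q k powr r * vol (triple l Q))"
proof -
 let ?I = "\<integral>\<^sup>+x\<in>triple l Q. ennreal (norm (G Q k x) powr r) \<partial>lebesgue"
 have "?I <= (\<integral>\<^sup>+x. ennreal (norm (G Q k x) powr r) \<partial>lebesgue)"
  by (intro nn_integral_mono) (auto split: split_indicator)
 also have "\<dots> < \<infinity>" using G_comp[OF k] by (simp add: Lr_comp_iff)
 finally have "?I = ennreal (enn2real ?I)" by simp
 moreover have "av Q k powr r * vol (triple l Q) = enn2real ?I"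
  using r cubes_props(3)[OF ccell_cubes(2)[OF l, of Q]] by (simp add: av_def powr_powr)
 ultimately show ?thesis by simp
qed

lemma pavg_G:
 assumes k: "k <= m" and Q': "Q' \<in> cubes"
  and le: "(\<integral>\<^sup>+x\<in>Q'. ennreal (norm (G Q k x) powr r) \<partial>lebesgue) <= ennreal (a powr r * vol Q')" "0 <= a"
 shows "pavg r (\<lambda>y. ennreal (norm (G Q k y))) Q' <= ennreal a"
proof -
 note cQ = cubes_props[OF Q']
 have "(\<integral>\<^sup>+x\<in>Q'. epowr (ennreal (norm (G Q k x))) r \<partial>lebesgue) <= ennreal (a powr r) * ennreal (vol Q')"
  using le by (simp add: epowr_ennreal ennreal_mult)
 then have "(\<integral>\<^sup>+x\<in>Q'. epowr (ennreal (norm (G Q k x))) r \<partial>lebesgue) / emeasure lebesgue Q' <= ennreal (a powr r)"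
  using cQ(3) unfolding cQ(5) by (intro divide_le_posI_ennreal) (auto simp: mult.commute)
 then show ?thesis using r le(2) unfolding pavg_def by (subst epowr_le_iff) auto
qed

lemma G_Lr_on: "k <= m ==> Q' \<in> cubes ==> G Q k \<in> Lr_on r Q'"
proof -
 assume k: "k <= m" and Q': "Q' \<in> cubes"
 note [measurable] = G_measurable[OF k, of Q]
 have m: "G Q k \<in> borel_measurable (lebesgue_on Q')" by (rule measurable_restrict_space1) measurable
 have "(\<integral>\<^sup>+x. ennreal (norm (G Q k x) powr r) \<partial>lebesgue_on Q') = (\<integral>\<^sup>+x\<in>Q'. ennreal (norm (G Q k x) powr r) \<partial>lebesgue)"
  using cubes_props(1)[OF Q'] by (subst nn_integral_restrict_space) auto
 also have "\<dots> <= (\<integral>\<^sup>+x. ennreal (norm (G Q k x) powr r) \<partial>lebesgue)"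
  by (intro nn_integral_mono) (auto split: split_indicator)
 also have "\<dots> < \<infinity>" using G_comp[OF k] by (simp add: Lr_comp_iff)
 finally show ?thesis using m by (simp add: Lr_on_def)
qed

text \<open>At a fixed point of evaluation \<open>b x\<close> is a constant, so the binomial formula
  for \<open>(ctr l b Q - b y) + (b x - ctr l b Q)\<close> writes the argument of \<open>T\<close>
  as a linear combination of the functions \<open>G Q k\<close>. This relies on the sublinearity
  inequalities holding at every point.\<close>

lemma commutator_le:
 assumes A: "A \<in> sets lebesgue"
 shows "norm (commutator T b m (cutoff f A) x) <= (\<Sum>k\<le>m. (m choose k) * norm (b x - ctr l b Q) ^ (m - k) * norm (T (cutoff (G Q k) A) x))"
proof -
 let ?c = "ctr l b Q"
 let ?a = "\<lambda>k. of_nat (m choose k) * (b x - ?c) ^ (m - k)"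
 have "(b x - b y) ^ m * cutoff f A y = (\<Sum>k\<le>m. ?a k * cutoff (G Q k) A y)" for y
 proof -
  have "(b x - b y) ^ m = ((?c - b y) + (b x - ?c)) ^ m" by simp
  also have "\<dots> = (\<Sum>k\<le>m. of_nat (m choose k) * (?c - b y) ^ k * (b x - ?c) ^ (m - k))" by (rule binomial_ring)
  finally show ?thesis by (cases "y \<in> A") (simp_all add: cutoff_def G_def sum_distrib_left sum_distrib_right mult_ac)
 qed
 then have "commutator T b m (cutoff f A) x = T (\<lambda>y. \<Sum>k\<in>{..m}. ?a k * cutoff (G Q k) A y) x"
  by (simp add: commutator_def)
 then show ?thesis
  using sublinear_sum[OF sub, of "{..m}" "\<lambda>k. cutoff (G Q k) A" ?a x] cut_comp[OF _ A] r by (simp add: norm_mult norm_power)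
qed

lemma commutator_split:
 assumes A: "A \<in> sets lebesgue" "B \<in> sets lebesgue" "B \<subseteq> A"
 shows "norm (commutator T b m (cutoff f A) x) <= norm (commutator T b m (cutoff f (A - B)) x) + norm (commutator T b m (cutoff f B) x)"
proof -
 let ?g = "\<lambda>A y. (b x - b y) ^ m * cutoff f A y"
 have g: "?g A \<in> Lr_comp r" if "A \<in> sets lebesgue" for A
 proof -
  have "?g A = cutoff (\<lambda>y. (b x - b y) ^ m * f y) A" by (auto simp: cutoff_def fun_eq_iff)
  then show ?thesis using Lr_comp_cutoff[OF Fd[of m "b x"] that] by simp
 qed
 have "?g A = (\<lambda>y. ?g (A - B) y + ?g B y)" using A(3) by (auto simp: cutoff_def fun_eq_iff)
 moreover have "norm (T (\<lambda>y. ?g (A - B) y + ?g B y) x) <= norm (T (?g (A - B)) x) + norm (T (?g B) x)"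
  using A by (intro sub[unfolded sublinear_on_def, THEN conjunct2, THEN conjunct1, rule_format] g) auto
 ultimately show ?thesis by (simp add: commutator_def)
qed

lemma T_diff_le:
 assumes k: "k <= m" and A: "A \<in> sets lebesgue" "B \<in> sets lebesgue" "B \<subseteq> A"
 shows "norm (T (cutoff (G Q k) (A - B)) x) <= norm (T (cutoff (G Q k) A) x) + norm (T (cutoff (G Q k) B) x)"
proof -
 have "cutoff (G Q k) (A - B) = (\<lambda>y. \<Sum>j\<in>{True, False}. (if j then 1 else -1) * (if j then cutoff (G Q k) A else cutoff (G Q k) B) y)"
  using A(3) by (auto simp: cutoff_def fun_eq_iff)
 then show ?thesis
  using sublinear_sum[OF sub, of "{True, False}" "\<lambda>j. if j then cutoff (G Q k) A else cutoff (G Q k) B" "\<lambda>j. if j then 1 else -1" x]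
   cut_comp[OF k A(1), of Q] cut_comp[OF k A(2), of Q] r by auto
qed

text \<open>Solves \<open>4 * (m + 1) * \<theta>0 * vol (3Q) = vol Q / 2 ^ (CARD('n) + 3)\<close>:
  there are \<open>m + 1\<close> functions, two weak type sets for each, and passing to open sets
  doubles the measure.\<close>

definition \<theta>0 :: real where "\<theta>0 = 1 / (4 * (m + 1) * 3 ^ CARD('n) * 2 ^ (CARD('n) + 3))"
text \<open>Makes the exceptional set on \<open>3P\<close> at most an eighth of \<open>P\<close>,
  and the open set containing it at most a quarter.\<close>

definition \<theta>1 :: real where "\<theta>1 = 1 / (8 * 3 ^ CARD('n))"
text \<open>In \<open>9 ^ CARD('n)\<close> one factor \<open>3 ^ CARD('n)\<close> is the volume of
  \<open>3Q\<close> relative to \<open>Q\<close>, the other is the cost of passing from heavy cells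
  to their triples. The rest makes the halos for all \<open>k <= m\<close> together as small as the
  weak type sets.\<close>

definition H0 :: real where "H0 = (m + 1) * 9 ^ CARD('n) * 2 ^ (CARD('n) + 3)"

lemma \<theta>_props: "\<theta>0 \<in> {0<..<1}" "\<theta>1 \<in> {0<..<1}" "0 < H0"
proof -
 have 3: "(1::real) <= 3 ^ CARD('n)" "(1::real) <= 2 ^ (CARD('n) + 3)" by (rule one_le_power, simp)+
 have "1 * 1 <= 3 ^ CARD('n) * (2::real) ^ (CARD('n) + 3)" using 3 by (intro mult_mono) auto
 then have "(4 * (real m + 1)) * 1 <= (4 * (real m + 1)) * (3 ^ CARD('n) * (2::real) ^ (CARD('n) + 3))"
  by (intro mult_left_mono) auto
 then have "1 < (4 * (real m + 1)) * (3 ^ CARD('n) * (2::real) ^ (CARD('n) + 3))" by (rule less_le_trans[rotated]) simp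
 then have X: "1 < 4 * (real m + 1) * 3 ^ CARD('n) * (2::real) ^ (CARD('n) + 3)" by (simp only: mult.assoc)
 have "\<theta>0 = 1 / (4 * (real m + 1) * 3 ^ CARD('n) * (2::real) ^ (CARD('n) + 3))"
  by (simp add: \<theta>0_def add.commute)
 then show "\<theta>0 \<in> {0<..<1}" using X by simp
 have "(1::real) < 8 * 3 ^ CARD('n)" using 3 by linarith
 then show "\<theta>1 \<in> {0<..<1}" by (simp add: \<theta>1_def)
 show "0 < H0" unfolding H0_def of_nat_0_less_iff by simp
qed

definition heavy :: "'n idx => nat => 'n idx => bool"
 where "heavy Q k R \<longleftrightarrow> (\<exists>e\<in>nbs. cell l R \<subseteq> cell l (shift e Q)) \<and>
  ennreal (H0 * av Q k powr r * vol (cell l R)) < (\<integral>\<^sup>+x\<in>cell l R. ennreal (norm (G Q k x) powr r) \<partial>lebesgue)"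

text \<open>If a point of \<open>P\<close> lies outside all halos, then no neighbour of
  \<open>P\<close> is heavy, which controls the average over the whole of \<open>3P\<close>. The
  bound on the level keeps the union finite.\<close>

definition halo :: "'n idx => nat => nat => (real ^ 'n) set"
 where "halo Q k J = (\<Union>R\<in>{R. heavy Q k R \<and> fst R <= J}. \<Union>e\<in>nbs. cell l (shift e R))"

lemma finite_heavy: "finite {R. heavy Q k R \<and> fst R <= J}"
proof (rule finite_subset)
 show "{R. heavy Q k R \<and> fst R <= J} \<subseteq> (\<Union>e\<in>nbs. {R. fst R <= J \<and> cell l R \<subseteq> cell l (shift e Q)})"
  by (auto simp: heavy_def)
 show "finite (\<Union>e\<in>nbs. {R. fst R <= J \<and> cell l R \<subseteq> cell l (shift e Q)})"
  by (intro finite_UN_I finite_nbs finite_cells_below[OF l])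
qed

lemma halo_sets [measurable]: "halo Q k J \<in> sets lebesgue"
 unfolding halo_def using finite_heavy finite_nbs l by (intro sets.finite_UN) auto

text \<open>The weak type estimate for the dyadic maximal function, over maximal heavy cells.\<close>

lemma halo_measure:
 assumes k: "k <= m"
 shows "emeasure lebesgue (halo Q k J) <= ennreal (vol (cell l Q) / ((m + 1) * 2 ^ (CARD('n) + 3)))"
proof -
 let ?H = "{R. heavy Q k R \<and> fst R <= J}"
 let ?M = "{R\<in>?H. \<forall>R'\<in>?H. cell l R \<subseteq> cell l R' --> R' = R}"
 let ?g = "\<lambda>x. ennreal (norm (G Q k x) powr r)"
 note [measurable] = G_measurable[OF k, of Q]
 have finM: "finite ?M" using finite_heavy[of Q k J] by (rule rev_finite_subset) auto
 have max: "\<exists>U\<in>?M. cell l R \<subseteq> cell l U" if R: "R \<in> ?H" for R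
 proof -
  let ?X = "{U\<in>?H. cell l R \<subseteq> cell l U}"
  have "R \<in> ?X" using R by auto
  then obtain U where U: "U \<in> ?X" "!!U'. U' \<in> ?X ==> fst U <= fst U'"
   using arg_min_nat_lemma[of "\<lambda>U. U \<in> ?X" R fst] by blast
  have "U' = U" if U': "U' \<in> ?H" "cell l U \<subseteq> cell l U'" for U'
  proof -
   have "U' \<in> ?X" using U' U(1) by auto
   then have "fst U = fst U'" using U(2) cell_subset_level[OF l U'(2)] by (meson le_antisym)
   then show "U' = U" using U'(2) by (auto simp: cell_subset_iff[OF l] up_def prod_eq_iff)
  qed
  then show ?thesis using U(1) by blast
 qed
 have disj: "cell l i \<inter> cell l j = {}" if "i \<in> ?M" "j \<in> ?M" "i \<noteq> j" for i j
  using cell_laminar[OF l, of i j] that by blast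
 have subT: "cell l i \<subseteq> triple l Q" if "i \<in> ?M" for i
  using that cell_subset_triple_shift(2)[OF l, of _ Q] by (auto simp: heavy_def)
 have 1: "(\<Sum>R\<in>?M. (\<integral>\<^sup>+x\<in>cell l R. ?g x \<partial>lebesgue)) <= ennreal (av Q k powr r * vol (triple l Q))"
  unfolding int_av[OF k, symmetric] by (rule sum_disjoint_cells[OF l finM disj subT]) auto
 have halo: "halo Q k J \<subseteq> (\<Union>R\<in>?M. triple l R)"
 proof
  fix x assume "x \<in> halo Q k J"
  then obtain R e where R: "R \<in> ?H" "e \<in> nbs" "x \<in> cell l (shift e R)" by (auto simp: halo_def)
  obtain U where U: "U \<in> ?M" "cell l R \<subseteq> cell l U" using max[OF R(1)] by auto
  obtain e' where "e' \<in> nbs" "cell l (shift e R) \<subseteq> cell l (shift e' U)" using subset_shift[OF l R(2) U(2)] by auto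
  then show "x \<in> (\<Union>R\<in>?M. triple l R)" using U(1) R(3) cell_subset_triple_shift(2)[OF l, of e' U] by blast
 qed
 show ?thesis
 proof (cases "av Q k = 0")
  case True
  have "?M = {}"
  proof (rule ccontr)
   assume "?M \<noteq> {}"
   then obtain R where R: "R \<in> ?M" by blast
   have "(\<integral>\<^sup>+x\<in>cell l R. ?g x \<partial>lebesgue) <= (\<Sum>R\<in>?M. (\<integral>\<^sup>+x\<in>cell l R. ?g x \<partial>lebesgue))"
    using finM R by (intro member_le_sum) auto
   then show False using 1 R True r by (simp add: heavy_def)
  qed
  then have "(\<Union>R\<in>?M. triple l R) = {}" by (simp only: UN_empty)
  then have "halo Q k J = {}" using halo by (simp only: subset_empty)
  then show ?thesis by simp
 next
  case False
  then have a: "0 < av Q k powr r" using av_nonneg[of Q k] by simp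
  have "ennreal (\<Sum>R\<in>?M. H0 * av Q k powr r * vol (cell l R)) = (\<Sum>R\<in>?M. ennreal (H0 * av Q k powr r * vol (cell l R)))"
   using \<theta>_props(3) by (intro sum_ennreal[symmetric]) auto
  also have "\<dots> <= (\<Sum>R\<in>?M. (\<integral>\<^sup>+x\<in>cell l R. ?g x \<partial>lebesgue))"
   by (intro sum_mono) (auto simp: heavy_def intro: less_imp_le)
  finally have "ennreal (\<Sum>R\<in>?M. H0 * av Q k powr r * vol (cell l R)) <= ennreal (av Q k powr r * vol (triple l Q))"
   using 1 by order
  then have "(\<Sum>R\<in>?M. H0 * av Q k powr r * vol (cell l R)) <= av Q k powr r * vol (triple l Q)"
   by (subst (asm) ennreal_le_iff) auto
  then have "av Q k powr r * (H0 * (\<Sum>R\<in>?M. vol (cell l R))) <= av Q k powr r * vol (triple l Q)"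
   by (simp add: sum_distrib_left mult_ac)
  then have 2: "H0 * (\<Sum>R\<in>?M. vol (cell l R)) <= 3 ^ CARD('n) * vol (cell l Q)"
   using a by (simp only: mult_le_cancel_left_pos measure_triple[OF l])
  have "emeasure lebesgue (halo Q k J) <= emeasure lebesgue (\<Union>R\<in>?M. triple l R)"
   using halo finM by (intro emeasure_mono sets.finite_UN) auto
  also have "\<dots> <= (\<Sum>R\<in>?M. emeasure lebesgue (triple l R))"
   using finM by (intro emeasure_subadditive_finite) auto
  also have "\<dots> = (\<Sum>R\<in>?M. ennreal (3 ^ CARD('n) * vol (cell l R)))"
   by (intro sum.cong refl) (simp only: cubes_props(5)[OF ccell_cubes(2)[OF l]] measure_triple[OF l])
  also have "\<dots> = ennreal (3 ^ CARD('n) * (\<Sum>R\<in>?M. vol (cell l R)))"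
   by (subst sum_ennreal) (auto simp: sum_distrib_left)
  also have "\<dots> <= ennreal (vol (cell l Q) / ((m + 1) * 2 ^ (CARD('n) + 3)))"
  proof (rule ennreal_leI)
   let ?S = "\<Sum>R\<in>?M. vol (cell l R)" and ?d = "(real m + 1) * 2 ^ (CARD('n) + 3)"
   have d: "0 < ?d" by (intro mult_pos_pos) auto
   have "H0 = ?d * (3 ^ CARD('n) * 3 ^ CARD('n))"
    by (simp add: H0_def power_mult_distrib[symmetric] distrib_right)
   then have "3 ^ CARD('n) * (?d * (3 ^ CARD('n) * ?S)) <= 3 ^ CARD('n) * vol (cell l Q)"
    using 2 by (simp add: mult_ac)
   then have "?d * (3 ^ CARD('n) * ?S) <= vol (cell l Q)" by (simp add: mult_le_cancel_left_pos)
   then have "3 ^ CARD('n) * ?S <= vol (cell l Q) / ?d" using d by (subst pos_le_divide_eq) (auto simp: mult.commute)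
   then show "3 ^ CARD('n) * ?S <= vol (cell l Q) / ((m + 1) * 2 ^ (CARD('n) + 3))" by (simp add: add.commute distrib_right)
  qed
  finally show ?thesis .
 qed
qed

text \<open>The weak type sets may fail to be measurable, hence the outer measure. The hull is taken
  open so that each of its points has entire small cells inside it.\<close>

lemma open_hull:
 assumes "outer_measure_of lebesgue X <= ennreal t" "0 < t"
 shows "\<exists>U. open U \<and> X \<subseteq> U \<and> emeasure lebesgue U <= ennreal (2 * t)"
proof -
 obtain Y where Y: "Y \<in> sets lebesgue" "X \<subseteq> Y" "emeasure lebesgue Y = outer_measure_of lebesgue X"
  using outer_measure_of_attain[of X lebesgue] by (auto simp del: emeasure_completion)
 obtain U where U: "open U" "Y \<subseteq> U" "U - Y \<in> lmeasurable" "emeasure lebesgue (U - Y) < ennreal t"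
  using sets_lebesgue_outer_open[OF Y(1) assms(2)] by metis
 have Us: "U \<in> sets lebesgue" using U(1) by simp
 have "emeasure lebesgue U <= emeasure lebesgue Y + emeasure lebesgue (U - Y)"
  using U(2) Y(1) Us emeasure_subadditive[of Y lebesgue "U - Y"] by (simp add: Un_absorb1 del: emeasure_completion)
 also have "\<dots> <= ennreal t + ennreal t" using assms(1) Y(3) U(4) by (intro add_mono) (auto simp del: emeasure_completion)
 also have "\<dots> = ennreal (2 * t)" using assms(2) by (subst ennreal_plus[symmetric]) auto
 finally show ?thesis using U(1,2) Y(2) by blast
qed

definition card_nbs :: real where "card_nbs = card (nbs :: (int ^ 'n) set)"

definition c_local :: real where "c_local = \<phi>1 \<theta>0 + \<phi>1 \<theta>1 * (card_nbs * H0) powr (1 / r)"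
definition c_dom :: real where "c_dom = 10 * (\<phi>2 \<theta>0 + c_local)"

lemma c_local: "\<phi>1 \<theta>0 <= c_local" "0 <= c_local" "c_local <= c_dom" "0 <= c_dom"
proof -
 have "0 <= \<phi>1 \<theta>0" "0 <= \<phi>1 \<theta>1" "0 <= \<phi>2 \<theta>0" using \<phi> \<theta>_props by auto
 then show "\<phi>1 \<theta>0 <= c_local" "0 <= c_local" "c_local <= c_dom" "0 <= c_dom" by (simp_all add: c_local_def c_dom_def)
qed

text \<open>\<open>E\<close> contains the points where the weak type bounds on \<open>3Q\<close>
  fail, \<open>V\<close> the halos. Openness is kept for \<open>E\<close> alone: \<open>V\<close> is
  avoided only at points of large sets, while \<open>E\<close> has to be avoided at almost every
  point where the stopping process ends.\<close>

definition exc :: "'n idx => (real ^ 'n) set => (real ^ 'n) set => bool"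
 where "exc Q E V \<longleftrightarrow> open E \<and> V \<in> sets lebesgue \<and>
  emeasure lebesgue (E \<union> V) <= ennreal (vol (cell l Q) / 2 ^ (CARD('n) + 2)) \<and>
  (\<forall>x\<in>triple l Q - E. \<forall>k\<le>m. norm (T (cutoff (G Q k) (triple l Q)) x) <= \<phi>1 \<theta>0 * av Q k \<and>
   grand_sharp_max T s (cutoff (G Q k) (triple l Q)) x <= ennreal (\<phi>2 \<theta>0 * av Q k)) \<and>
  (\<forall>k\<le>m. \<forall>J. halo Q k J \<subseteq> V)"

lemma exc_exists: "\<exists>E V. exc Q E V"
proof -
 let ?m = "vol (cell l Q)" and ?TQ = "triple l Q"
 note cT = ccell_cubes(2)[OF l, of Q]
 have mp: "0 < ?m" by (rule measure_cell_pos[OF l])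
 let ?t = "\<theta>0 * vol ?TQ"
 have t: "0 < ?t" using \<theta>_props(1) cubes_props(3)[OF cT] by simp
 let ?X1 = "\<lambda>k. {x \<in> ?TQ. ennreal (norm (T (cutoff (G Q k) ?TQ) x)) > ennreal (\<phi>1 \<theta>0) * pavg r (\<lambda>y. ennreal (norm (G Q k y))) ?TQ}"
 let ?X2 = "\<lambda>k. {x \<in> ?TQ. grand_sharp_max T s (cutoff (G Q k) ?TQ) x > ennreal (\<phi>2 \<theta>0) * pavg r (\<lambda>y. ennreal (norm (G Q k y))) ?TQ}"
 have em: "ennreal \<theta>0 * emeasure lebesgue ?TQ = ennreal ?t"
  unfolding cubes_props(5)[OF cT] using \<theta>_props(1) by (simp add: ennreal_mult)
 have "\<exists>U. open U \<and> ?X1 k \<union> ?X2 k \<subseteq> U \<and> emeasure lebesgue U <= ennreal (4 * ?t)" if k: "k <= m" for k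
 proof -
  obtain U1 where U1: "open U1" "?X1 k \<subseteq> U1" "emeasure lebesgue U1 <= ennreal (2 * ?t)"
   using open_hull[OF weak1[OF cT G_Lr_on[OF k cT] \<theta>_props(1), unfolded em] t] by blast
  obtain U2 where U2: "open U2" "?X2 k \<subseteq> U2" "emeasure lebesgue U2 <= ennreal (2 * ?t)"
   using open_hull[OF weak2[OF cT G_Lr_on[OF k cT] \<theta>_props(1), unfolded em] t] by blast
  have "emeasure lebesgue (U1 \<union> U2) <= emeasure lebesgue U1 + emeasure lebesgue U2"
   using U1(1) U2(1) by (intro emeasure_subadditive) auto
  also have "\<dots> <= ennreal (2 * ?t) + ennreal (2 * ?t)" by (intro add_mono U1 U2)
  also have "\<dots> = ennreal (4 * ?t)" using t by (subst ennreal_plus[symmetric]) auto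
  finally show ?thesis using U1 U2 by (intro exI[of _ "U1 \<union> U2"]) auto
 qed
 then have "\<forall>k. \<exists>U. k <= m --> open U \<and> ?X1 k \<union> ?X2 k \<subseteq> U \<and> emeasure lebesgue U <= ennreal (4 * ?t)" by blast
 from choice[OF this] obtain U where "\<forall>k. k <= m --> open (U k) \<and> ?X1 k \<union> ?X2 k \<subseteq> U k \<and> emeasure lebesgue (U k) <= ennreal (4 * ?t)" ..
 then have U: "!!k. k <= m ==> open (U k)" "!!k. k <= m ==> ?X1 k \<union> ?X2 k \<subseteq> U k" "!!k. k <= m ==> emeasure lebesgue (U k) <= ennreal (4 * ?t)"
  by blast+
 define E where "E = (\<Union>k\<in>{..m}. U k)"
 define V where "V = (\<Union>k\<in>{..m}. \<Union>J. halo Q k J)"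
 have Eo: "open E" using U(1) by (auto simp: E_def)
 have Vs: "V \<in> sets lebesgue" unfolding V_def by (intro sets.finite_UN sets.countable_UN) auto
 have E: "emeasure lebesgue E <= ennreal (?m / 2 ^ (CARD('n) + 3))"
 proof -
  have "emeasure lebesgue E <= (\<Sum>k\<in>{..m}. emeasure lebesgue (U k))"
   unfolding E_def using U(1) by (intro emeasure_subadditive_finite) auto
  also have "\<dots> <= (\<Sum>k\<in>{..m}. ennreal (4 * ?t))" using U(3) by (intro sum_mono) auto
  also have "\<dots> = ennreal ((m + 1) * (4 * ?t))" using t by (simp add: ennreal_mult ennreal_of_nat_eq_real_of_nat add.commute)
  also have "(m + 1) * (4 * ?t) = ?m / 2 ^ (CARD('n) + 3)"
  proof -
   have "\<theta>0 = 1 / (4 * (real m + 1) * 3 ^ CARD('n) * (2::real) ^ (CARD('n) + 3))"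
    by (simp add: \<theta>0_def add.commute)
   then have \<theta>: "\<theta>0 = 1 / (4 * (real m + 1) * 3 ^ CARD('n) * (2::real) ^ (CARD('n) + 3))" .
   have "a * (4 * (1 / (4 * a * b * c) * (b * M))) = M / c" if "0 < a" "0 < b" for a b c M :: real
    using that by simp
   then show ?thesis unfolding measure_triple[OF l] \<theta> of_nat_add of_nat_1 by this auto
  qed
  finally show ?thesis .
 qed
 have V: "emeasure lebesgue V <= ennreal (?m / 2 ^ (CARD('n) + 3))"
 proof -
  have h: "emeasure lebesgue (\<Union>J. halo Q k J) <= ennreal (?m / ((m + 1) * 2 ^ (CARD('n) + 3)))" if k: "k <= m" for k
  proof -
   have "incseq (halo Q k)" by (auto simp: incseq_def halo_def intro: order_trans)
   then have "emeasure lebesgue (\<Union>J. halo Q k J) = (SUP J. emeasure lebesgue (halo Q k J))"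
    by (intro SUP_emeasure_incseq[symmetric]) auto
   also have "\<dots> <= ennreal (?m / ((m + 1) * 2 ^ (CARD('n) + 3)))" by (intro SUP_least halo_measure[OF k])
   finally show ?thesis .
  qed
  have "emeasure lebesgue V <= (\<Sum>k\<in>{..m}. emeasure lebesgue (\<Union>J. halo Q k J))"
   unfolding V_def by (intro emeasure_subadditive_finite) auto
  also have "\<dots> <= (\<Sum>k\<in>{..m}. ennreal (?m / ((m + 1) * 2 ^ (CARD('n) + 3))))" using h by (intro sum_mono) auto
  also have "\<dots> = ennreal ((m + 1) * (?m / ((m + 1) * 2 ^ (CARD('n) + 3))))"
   by (subst sum_ennreal) (auto simp only: sum_constant card_atMost Suc_eq_plus1 intro!: divide_nonneg_nonneg mult_nonneg_nonneg measure_nonneg of_nat_0_le_iff zero_le_power zero_le_numeral)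
  also have "(m + 1) * (?m / ((m + 1) * 2 ^ (CARD('n) + 3))) = ?m / 2 ^ (CARD('n) + 3)"
  proof -
   have "a * (M / (a * c)) = M / c" if "0 < a" for a c M :: real using that by simp
   then show ?thesis unfolding of_nat_mult of_nat_power of_nat_numeral of_nat_add of_nat_1 by this auto
  qed
  finally show ?thesis .
 qed
 have "emeasure lebesgue (E \<union> V) <= emeasure lebesgue E + emeasure lebesgue V"
  using Eo Vs by (intro emeasure_subadditive) auto
 also have "\<dots> <= ennreal (?m / 2 ^ (CARD('n) + 3)) + ennreal (?m / 2 ^ (CARD('n) + 3))" by (intro add_mono E V)
 also have "\<dots> = ennreal (?m / 2 ^ (CARD('n) + 2))"
  using mp by (subst ennreal_plus[symmetric]) (auto simp: power_add)
 finally have EV: "emeasure lebesgue (E \<union> V) <= ennreal (?m / 2 ^ (CARD('n) + 2))" .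
 have "norm (T (cutoff (G Q k) ?TQ) x) <= \<phi>1 \<theta>0 * av Q k \<and> grand_sharp_max T s (cutoff (G Q k) ?TQ) x <= ennreal (\<phi>2 \<theta>0 * av Q k)"
  if x: "x \<in> ?TQ - E" and k: "k <= m" for x k
 proof -
  have p: "pavg r (\<lambda>y. ennreal (norm (G Q k y))) ?TQ <= ennreal (av Q k)"
   by (rule pavg_G[OF k cT _ av_nonneg]) (simp add: int_av[OF k])
  have "x \<notin> ?X1 k" "x \<notin> ?X2 k" using x k U(2)[OF k] by (auto simp: E_def)
  then have "ennreal (norm (T (cutoff (G Q k) ?TQ) x)) <= ennreal (\<phi>1 \<theta>0) * pavg r (\<lambda>y. ennreal (norm (G Q k y))) ?TQ"
   "grand_sharp_max T s (cutoff (G Q k) ?TQ) x <= ennreal (\<phi>2 \<theta>0) * pavg r (\<lambda>y. ennreal (norm (G Q k y))) ?TQ"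
   using x by (auto simp: not_less)
  then have "ennreal (norm (T (cutoff (G Q k) ?TQ) x)) <= ennreal (\<phi>1 \<theta>0) * ennreal (av Q k)"
   "grand_sharp_max T s (cutoff (G Q k) ?TQ) x <= ennreal (\<phi>2 \<theta>0) * ennreal (av Q k)"
   using mult_left_mono[OF p] by (meson order_trans zero_le)+
  then show ?thesis using \<phi> \<theta>_props av_nonneg[of Q k] by (simp add: ennreal_mult[symmetric])
 qed
 then have "exc Q E V" unfolding exc_def using Eo Vs EV by (auto simp: V_def)
 then show ?thesis by blast
qed

text \<open>By sublinearity the function is at most the sum of \<open>T\<close> applied to the parts
  on \<open>3Q\<close> and on \<open>3P\<close>. The former is bounded off \<open>E\<close>; the
  latter is bounded on most of \<open>P\<close> by the weak type estimate on \<open>3P\<close>,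
  where avoiding \<open>V\<close> controls the average. At least a quarter of \<open>P\<close>
  remains, and the oscillation bound carries the estimate from there to all of
  \<open>P\<close>.\<close>

lemma exc_oscillation:
 assumes e: "exc Q E V" and P: "cell l P \<subseteq> cell l Q" "2 * vol (cell l P \<inter> (E \<union> V)) <= vol (cell l P)" and k: "k <= m"
 shows "norm_le_on s (cell l P) (\<lambda>x. norm (T (cutoff (G Q k) (triple l Q - triple l P)) x)) (c_dom * av Q k)"
proof -
 note [measurable] = G_measurable[OF k, of Q]
 let ?a = "av Q k" and ?mP = "vol (cell l P)"
 note cT = ccell_cubes(2)[OF l, of P]
 have mp: "0 < ?mP" by (rule measure_cell_pos[OF l])
 have EVs: "E \<in> sets lebesgue" "V \<in> sets lebesgue" using e by (auto simp: exc_def)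
 have Pf: "cell l P \<in> fmeasurable lebesgue" by (rule cell_fmeasurable[OF l])
 let ?X = "cell l P - (E \<union> V)"
 have Xs: "?X \<in> sets lebesgue" using EVs l by auto
 have Xf: "?X \<in> fmeasurable lebesgue" by (rule fmeasurableI2[OF Pf _ Xs]) auto
 have If: "cell l P \<inter> (E \<union> V) \<in> fmeasurable lebesgue" by (rule fmeasurableI2[OF Pf]) (use EVs l in auto)
 have "vol (cell l P - (cell l P \<inter> (E \<union> V))) = ?mP - vol (cell l P \<inter> (E \<union> V))"
  by (rule measurable_measure_Diff[OF Pf]) (use If in auto)
 moreover have "cell l P - (cell l P \<inter> (E \<union> V)) = ?X" by auto
 ultimately have mX: "?mP <= 2 * vol ?X" using P(2) by simp
 then have "?X \<noteq> {}" using mp by force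
 then obtain y where y: "y \<in> cell l P" "y \<notin> V" by auto
 \<comment> \<open>\<open>P\<close> is itself a neighbour of each of its neighbours, so a heavy one
   would put the point \<open>y\<close> of \<open>P\<close> into a halo.\<close>
 have nh: "\<not> heavy Q k (shift e P)" if e0: "e \<in> nbs" for e
 proof
  assume "heavy Q k (shift e P)"
  moreover have "y \<in> cell l (shift (- e) (shift e P))" using y(1) by (simp add: shift_uminus)
  ultimately have "y \<in> halo Q k (fst P)" unfolding halo_def using uminus_nbs[OF e0] by (fastforce simp: shift_def)
  moreover have "halo Q k (fst P) \<subseteq> V" using e k unfolding exc_def by blast
  ultimately show False using y(2) by blast
 qed
 have int: "(\<integral>\<^sup>+x\<in>cell l (shift e P). ennreal (norm (G Q k x) powr r) \<partial>lebesgue) <= ennreal (H0 * ?a powr r * ?mP)" if e0: "e \<in> nbs" for e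
  using nh[OF e0] subset_shift[OF l e0 P(1)] by (simp add: heavy_def not_less measure_shift[OF l])
 let ?c = "(card_nbs * H0) powr (1 / r)"
 have cn: "0 <= card_nbs" by (simp add: card_nbs_def)
 have "(\<integral>\<^sup>+x\<in>triple l P. ennreal (norm (G Q k x) powr r) \<partial>lebesgue) <= (\<integral>\<^sup>+x. (\<Sum>e\<in>nbs. ennreal (norm (G Q k x) powr r) * indicator (cell l (shift e P)) x) \<partial>lebesgue)"
 proof (rule nn_integral_mono_AE)
  show "AE x in lebesgue. ennreal (norm (G Q k x) powr r) * indicator (triple l P) x <= (\<Sum>e\<in>nbs. ennreal (norm (G Q k x) powr r) * indicator (cell l (shift e P)) x)"
   using AE_triple_cells[OF l, of P]
  proof eventually_elim
   case (elim x)
   show ?case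
   proof (cases "x \<in> triple l P")
    case True
    then obtain e where e0: "e \<in> nbs" "x \<in> cell l (shift e P)" using elim by auto
    have "ennreal (norm (G Q k x) powr r) * indicator (cell l (shift e P)) x <= (\<Sum>e\<in>nbs. ennreal (norm (G Q k x) powr r) * indicator (cell l (shift e P)) x)"
     by (rule member_le_sum[OF e0(1)]) (auto simp: finite_nbs)
    then show ?thesis using True e0 by simp
   qed simp
  qed
 qed
 also have "\<dots> = (\<Sum>e\<in>nbs. (\<integral>\<^sup>+x\<in>cell l (shift e P). ennreal (norm (G Q k x) powr r) \<partial>lebesgue))"
  using l by (intro nn_integral_sum) measurable
 also have "\<dots> <= (\<Sum>e\<in>(nbs :: (int ^ 'n) set). ennreal (H0 * ?a powr r * ?mP))" by (intro sum_mono int)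
 also have "\<dots> = ennreal (card_nbs * (H0 * ?a powr r * ?mP))"
  using \<theta>_props(3) by (simp add: ennreal_mult card_nbs_def ennreal_of_nat_eq_real_of_nat)
 also have "\<dots> <= ennreal ((?c * ?a) powr r * vol (triple l P))"
 proof (rule ennreal_leI)
  have "(?c * ?a) powr r = card_nbs * H0 * ?a powr r" using r cn \<theta>_props(3) by (simp add: powr_mult powr_powr)
  moreover have "?mP <= vol (triple l P)" unfolding measure_triple[OF l] using mp by simp
  ultimately show "card_nbs * (H0 * ?a powr r * ?mP) <= (?c * ?a) powr r * vol (triple l P)"
   using cn \<theta>_props(3) by (simp add: mult_left_mono mult.assoc[symmetric])
 qed
 finally have pP: "pavg r (\<lambda>y. ennreal (norm (G Q k y))) (triple l P) <= ennreal (?c * ?a)"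
  by (intro pavg_G[OF k cT]) (auto simp: av_nonneg)
 let ?Z = "{x \<in> triple l P. ennreal (norm (T (cutoff (G Q k) (triple l P)) x)) > ennreal (\<phi>1 \<theta>1) * pavg r (\<lambda>y. ennreal (norm (G Q k y))) (triple l P)}"
 have "ennreal \<theta>1 * emeasure lebesgue (triple l P) = ennreal (?mP / 8)"
  unfolding cubes_props(5)[OF cT] measure_triple[OF l] \<theta>1_def by (simp add: ennreal_mult'[symmetric])
 then have "outer_measure_of lebesgue ?Z <= ennreal (?mP / 8)"
  using weak1[OF cT G_Lr_on[OF k cT] \<theta>_props(2)] by simp
 then obtain U where U: "open U" "?Z \<subseteq> U" "emeasure lebesgue U <= ennreal (2 * (?mP / 8))"
  using open_hull[of ?Z "?mP / 8"] mp by auto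
 have Us: "U \<in> sets lebesgue" using U(1) by simp
 let ?Y = "?X - U"
 have Ys: "?Y \<in> sets lebesgue" using Xs Us by auto
 have mY: "?mP <= 4 * vol ?Y"
 proof -
  have XU: "?X \<inter> U \<in> fmeasurable lebesgue" by (rule fmeasurableI2[OF Xf]) (use Xs Us in auto)
  have "vol (?X - (?X \<inter> U)) = vol ?X - vol (?X \<inter> U)"
   by (rule measurable_measure_Diff[OF Xf]) (use XU in auto)
  moreover have "?X - (?X \<inter> U) = ?Y" by auto
  moreover have "vol (?X \<inter> U) <= ?mP / 4"
  proof -
   have "emeasure lebesgue (?X \<inter> U) <= emeasure lebesgue U" using Us by (intro emeasure_mono) auto
   then have "ennreal (vol (?X \<inter> U)) <= ennreal (?mP / 4)"
    unfolding emeasure_eq_measure2[OF XU, symmetric] using U(3) by (auto intro: order_trans)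
   then show ?thesis using mp by (subst (asm) ennreal_le_iff) auto
  qed
  ultimately show ?thesis using mX by simp
 qed
 let ?g = "T (cutoff (G Q k) (triple l Q - triple l P))"
 have sT: "triple l P \<subseteq> triple l Q" by (rule triple_mono[OF l P(1)])
 have Ysub: "?Y \<subseteq> triple l P" "?Y \<subseteq> triple l Q" "?Y \<subseteq> ccell l P"
  using cell_subset_triple[OF l, of P] sT cell_sandwich(1)[OF l, of P] by auto
 have gY: "norm (?g x) <= c_local * ?a" if x: "x \<in> ?Y" for x
 proof -
  have "x \<in> triple l Q - E" using x Ysub by auto
  then have 1: "norm (T (cutoff (G Q k) (triple l Q)) x) <= \<phi>1 \<theta>0 * ?a" using e k by (auto simp: exc_def)
  have "x \<notin> ?Z" using x U(2) by auto
  then have "ennreal (norm (T (cutoff (G Q k) (triple l P)) x)) <= ennreal (\<phi>1 \<theta>1) * pavg r (\<lambda>y. ennreal (norm (G Q k y))) (triple l P)"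
   using x Ysub by (auto simp: not_less)
  also have "\<dots> <= ennreal (\<phi>1 \<theta>1) * ennreal (?c * ?a)" by (intro mult_left_mono pP) auto
  also have "\<dots> = ennreal (\<phi>1 \<theta>1 * (?c * ?a))" using \<phi> \<theta>_props by (intro ennreal_mult'[symmetric]) auto
  finally have 2: "norm (T (cutoff (G Q k) (triple l P)) x) <= \<phi>1 \<theta>1 * (?c * ?a)"
   using \<phi> \<theta>_props av_nonneg[of Q k] by (subst (asm) ennreal_le_iff) auto
  have "norm (?g x) <= norm (T (cutoff (G Q k) (triple l Q)) x) + norm (T (cutoff (G Q k) (triple l P)) x)"
   by (rule T_diff_le[OF k _ _ sT]) auto
  then show ?thesis using 1 2 by (simp add: c_local_def distrib_right mult.assoc)
 qed
 have Yne: "?Y \<noteq> {}" using mY mp by force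
 \<comment> \<open>One point off \<open>E\<close> is enough for the oscillation: \<open>P\<close>
   competes in the supremum defining the sharp maximal function at \<open>z\<close>, and removing
   \<open>3P\<close> from the part of \<open>G Q k\<close> on \<open>3Q\<close> leaves exactly the
   function \<open>?g\<close> is built on.\<close>
 then obtain z where z: "z \<in> ?Y" by blast
 have "z \<in> triple l Q - E" using z Ysub by auto
 then have gs: "grand_sharp_max T s (cutoff (G Q k) (triple l Q)) z <= ennreal (\<phi>2 \<theta>0 * ?a)" using e k by (auto simp: exc_def)
 have cut: "cutoff (cutoff (G Q k) (triple l Q)) (- cube (centre l P) (3 * side l P)) = cutoff (G Q k) (triple l Q - triple l P)"
  unfolding cutoff_cutoff triple_def[symmetric] by (simp add: Diff_eq)
 have osc: "(let M = lebesgue_on (ccell l P) \<Otimes>\<^sub>M lebesgue_on (ccell l P); d = (\<lambda>z. ennreal (norm (?g (fst z) - ?g (snd z))))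
   in if s = top then esssup M d
     else epowr ((\<integral>\<^sup>+ z. epowr (d z) (enn2real s) \<partial>M) / (emeasure lebesgue (ccell l P))\<^sup>2) (1 / enn2real s)) <= ennreal (\<phi>2 \<theta>0 * ?a)"
 proof -
  have "(centre l P, side l P) \<in> {(c, l'). 0 < l' \<and> z \<in> cube c l'}"
   using z Ysub(3) l by (auto simp: ccell_def)
  from order_trans[OF SUP_upper[OF this] gs[unfolded grand_sharp_max_def]]
  show ?thesis unfolding prod.case Let_def cut unfolding ccell_def .
 qed
 have "norm_le_on s (ccell l P) (\<lambda>x. norm (?g x)) (10 * (\<phi>2 \<theta>0 * ?a + c_local * ?a))"
 proof (rule norm_le_on_of_oscillation[OF s ccell_cubes(1)[OF l] _ osc Ys Ysub(3) _ gY])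
  show "?g \<in> borel_measurable lebesgue" by (rule T_measurable[OF cut_comp[OF k]]) auto
  show "vol (ccell l P) <= 4 * vol ?Y" using mY by (simp add: measure_ccell[OF l])
  show "0 <= \<phi>2 \<theta>0 * ?a" "0 <= c_local * ?a" using \<phi> \<theta>_props av_nonneg[of Q k] c_local by auto
 qed
 also have "10 * (\<phi>2 \<theta>0 * ?a + c_local * ?a) = c_dom * ?a" by (simp add: c_dom_def distrib_right)
 finally have n: "norm_le_on s (ccell l P) (\<lambda>x. norm (?g x)) (c_dom * ?a)" .
 have AEc: "AE x in lebesgue. x \<in> cell l P \<longleftrightarrow> x \<in> ccell l P" by (rule AE_cell_ccell[OF l])
 show ?thesis
 proof (cases "s = top")
  case True
  then have "AE x in lebesgue. x \<in> ccell l P --> norm (?g x) <= c_dom * ?a" using n by (simp add: norm_le_on_def)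
  with AEc have "AE x in lebesgue. x \<in> cell l P --> norm (?g x) <= c_dom * ?a" by eventually_elim simp
  then show ?thesis using True by (simp add: norm_le_on_def)
 next
  case False
  have "(\<integral>\<^sup>+x\<in>cell l P. ennreal (norm (?g x) powr enn2real s) \<partial>lebesgue) = (\<integral>\<^sup>+x\<in>ccell l P. ennreal (norm (?g x) powr enn2real s) \<partial>lebesgue)"
   by (intro nn_integral_cong_AE) (use AEc in eventually_elim, auto split: split_indicator)
  then show ?thesis using n False by (simp add: norm_le_on_def measure_ccell[OF l])
 qed
qed

end

text \<open>Hoelder with the exponents \<open>s / q\<close> and its conjugate \<open>t\<close>; for
  \<open>s = \<infinity>\<close> this is the pointwise bound with \<open>t = 1\<close>. It is the
  only property of the local functions that the weighted estimates use.\<close>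

lemma norm_le_on_dual:
 fixes h G :: "real ^ 'n => real" and s :: ennreal
 assumes n: "norm_le_on s X h a" "0 <= a" and X: "X \<in> sets lebesgue" "0 < vol X"
  and h: "h \<in> borel_measurable lebesgue" "!!x. 0 <= h x"
  and q: "0 < q" "ennreal q < s" "t = 1 / (1 - q * inv_exponent s)"
  and G: "G \<in> borel_measurable lebesgue" "!!x. 0 <= G x" and A: "0 <= A" "(\<integral>\<^sup>+x\<in>X. ennreal (G x powr t) \<partial>lebesgue) <= ennreal A"
 shows "(\<integral>\<^sup>+x\<in>X. ennreal (G x * h x powr q) \<partial>lebesgue) <= ennreal (a powr q * vol X powr (1 - 1 / t) * A powr (1 / t))"
proof (cases "s = top")
 case True
 note [measurable] = G(1) X(1)
 have t: "t = 1" using True q by (simp add: inv_exponent_def)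
 have "(\<integral>\<^sup>+x\<in>X. ennreal (G x * h x powr q) \<partial>lebesgue) <= (\<integral>\<^sup>+x. ennreal (a powr q) * (ennreal (G x powr t) * indicator X x) \<partial>lebesgue)"
 proof (rule nn_integral_mono_AE)
  have "AE x in lebesgue. x \<in> X --> h x <= a" using n True by (simp add: norm_le_on_def)
  then show "AE x in lebesgue. ennreal (G x * h x powr q) * indicator X x <= ennreal (a powr q) * (ennreal (G x powr t) * indicator X x)"
  proof eventually_elim
   case (elim x)
   show ?case
   proof (cases "x \<in> X")
    case True
    then have "h x powr q <= a powr q" using elim h q by (intro powr_mono2) auto
    then have "G x * h x powr q <= a powr q * G x" using G(2)[of x] by (simp add: mult.commute mult_left_mono)
    then show ?thesis using True G(2)[of x] t by (simp add: ennreal_mult[symmetric] ennreal_leI)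
   qed simp
  qed
 qed
 also have "\<dots> = ennreal (a powr q) * (\<integral>\<^sup>+x\<in>X. ennreal (G x powr t) \<partial>lebesgue)"
  by (intro nn_integral_cmult) measurable
 also have "\<dots> <= ennreal (a powr q) * ennreal A" by (intro mult_left_mono A) simp
 also have "\<dots> = ennreal (a powr q * vol X powr (1 - 1 / t) * A powr (1 / t))"
  using t X A by (simp add: ennreal_mult)
 finally show ?thesis .
next
 case False
 define u where "u = enn2real s"
 have s: "s = ennreal u" "0 < u" "q < u"
 proof -
  show 1: "s = ennreal u" using False by (simp add: u_def less_top)
  show "q < u" using q(1,2) unfolding 1 by (simp add: ennreal_less_iff)
  then show "0 < u" using q(1) by simp
 qed
 have t: "1 / t = 1 - q / u" "0 < 1 / t" using q s False by (auto simp: inv_exponent_def)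
 have t0: "0 < t" using t(2) by simp
 let ?c = "a powr u * vol X"
 have hs: "(\<integral>\<^sup>+x\<in>X. ennreal (h x powr u) \<partial>lebesgue) <= ennreal ?c" using n(1) False by (simp add: norm_le_on_def u_def)
 have [measurable]: "h \<in> borel_measurable lebesgue" "G \<in> borel_measurable lebesgue" by fact+
 have "(\<integral>\<^sup>+x\<in>X. ennreal ((h x powr u) powr (q / u) * (G x powr t) powr (1 - q / u)) \<partial>lebesgue) <= ennreal (?c powr (q / u) * A powr (1 - q / u))"
  using hs A q s by (intro set_nn_integral_Hoelder X) auto
 moreover have "(h x powr u) powr (q / u) * (G x powr t) powr (1 - q / u) = G x * h x powr q" for x
  using s t0 h G by (simp add: powr_powr t(1)[symmetric])
 moreover have "?c powr (q / u) * A powr (1 - q / u) = a powr q * vol X powr (1 - 1 / t) * A powr (1 / t)"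
  using s t n(2) by (simp add: powr_mult powr_powr)
 ultimately show ?thesis by simp
qed

section \<open>The stopping family of the operator and the telescoping sum\<close>

context domination begin

definition Ex :: "'n idx => (real ^ 'n) set" where "Ex Q = (SOME E. \<exists>V. exc Q E V)"
definition Vx :: "'n idx => (real ^ 'n) set" where "Vx Q = (SOME V. exc Q (Ex Q) V)"
definition Z :: "'n idx => (real ^ 'n) set" where "Z Q = Ex Q \<union> Vx Q"
text \<open>The threshold \<open>2 ^ (CARD('n) + 1)\<close> serves two ends. Since
  \<open>Z Q\<close> is at most \<open>vol (cell l Q) / 2 ^ (CARD('n) + 2)\<close>, the selected
  cells fill at most half of \<open>Q\<close>. The dyadic parent of a selected cell is not above the
  threshold, so \<open>Z Q\<close> covers at most half of the selected cell itself.\<close>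

definition st :: "'n idx => 'n idx => bool"
 where "st Q R \<longleftrightarrow> vol (cell l R) < 2 ^ (CARD('n) + 1) * vol (cell l R \<inter> Z Q)"

lemma exc: "exc Q (Ex Q) (Vx Q)"
proof -
 have "\<exists>V. exc Q (Ex Q) V" unfolding Ex_def by (rule someI_ex[of "\<lambda>E. \<exists>V. exc Q E V"]) (rule exc_exists)
 then show ?thesis unfolding Vx_def by (rule someI_ex)
qed

lemma Z_props: "open (Ex Q)" "Z Q \<in> fmeasurable lebesgue" "2 ^ (CARD('n) + 2) * vol (Z Q) <= vol (cell l Q)"
proof -
 show o: "open (Ex Q)" using exc[of Q] by (simp add: exc_def)
 have V: "Vx Q \<in> sets lebesgue" using exc[of Q] by (simp add: exc_def)
 have e: "emeasure lebesgue (Z Q) <= ennreal (vol (cell l Q) / 2 ^ (CARD('n) + 2))"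
  using exc[of Q] unfolding exc_def Z_def by blast
 show f: "Z Q \<in> fmeasurable lebesgue"
 proof (rule fmeasurableI)
  show "Z Q \<in> sets lebesgue" using V o by (auto simp: Z_def)
  show "emeasure lebesgue (Z Q) < \<infinity>" using e by (rule le_less_trans) simp
 qed
 have "vol (Z Q) <= vol (cell l Q) / 2 ^ (CARD('n) + 2)"
  using e unfolding emeasure_eq_measure2[OF f] by (subst (asm) ennreal_le_iff) auto
 then show "2 ^ (CARD('n) + 2) * vol (Z Q) <= vol (cell l Q)"
  by (simp add: pos_le_divide_eq mult.commute)
qed

lemma Ex_sets [measurable]: "Ex Q \<in> sets lebesgue" using Z_props(1)[of Q] by simp

lemma cell_Z: "cell l R \<inter> Z Q \<in> fmeasurable lebesgue"
 by (rule fmeasurable.Int[OF cell_fmeasurable[OF l] Z_props(2)])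

lemma prin_light: "2 ^ (CARD('n) + 1) * vol (cell l (j, k) \<inter> Z (prin st j k)) <= vol (cell l (j, k))"
proof -
 have self: "2 ^ (CARD('n) + 1) * vol (cell l Q \<inter> Z Q) <= vol (cell l Q)" for Q
 proof -
  have "vol (cell l Q \<inter> Z Q) <= vol (Z Q)"
   using cell_Z[of Q Q] Z_props(2) by (intro measure_mono_fmeasurable) auto
  then have "2 ^ (CARD('n) + 1) * vol (cell l Q \<inter> Z Q) <= 2 ^ (CARD('n) + 2) * vol (Z Q)"
   by (intro mult_mono) auto
  then show ?thesis using Z_props(3)[of Q] by linarith
 qed
 show ?thesis
 proof (cases j)
  case 0
  then show ?thesis using self[of "(0, k)"] by simp
 next
  case (Suc j')
  show ?thesis
  proof (cases "st (prin st j' (up 1 k)) (Suc j', k)")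
   case True
   then show ?thesis using self[of "(Suc j', k)"] Suc by simp
  next
   case False
   then show ?thesis using Suc by (simp add: st_def not_less)
  qed
 qed
qed

text \<open>The principal children of \<open>Q\<close>, cut off at level \<open>n\<close> to have a
  finite set.\<close>

definition ch :: "nat => 'n idx => 'n idx set"
 where "ch n Q = {i. principal st i \<and> 0 < fst i \<and> fst i <= n \<and> pparent st i = Q}"

lemma ch_props:
 "finite (ch n Q)" "i \<in> ch n Q ==> cell l i \<subseteq> cell l Q"
 "i \<in> ch n Q ==> i' \<in> ch n Q ==> i \<noteq> i' ==> cell l i \<inter> cell l i' = {}"
 "i \<in> ch n Q ==> 2 * vol (cell l i \<inter> Z Q) <= vol (cell l i)"
 "(\<Sum>i\<in>ch n Q. vol (cell l i)) <= vol (cell l Q) / 2"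
proof -
 show sub: "cell l i \<subseteq> cell l Q" if "i \<in> ch n Q" for i
  using that pparent_props(1)[OF l, of i st] by (auto simp: ch_def)
 show fin: "finite (ch n Q)"
  by (rule finite_subset[OF _ finite_cells_below[OF l, of n Q]]) (use sub in \<open>auto simp: ch_def\<close>)
 show disj: "cell l i \<inter> cell l i' = {}" if "i \<in> ch n Q" "i' \<in> ch n Q" "i \<noteq> i'" for i i'
  using siblings_disjoint[OF l, of st i i'] that by (simp add: ch_def)
 show "2 * vol (cell l i \<inter> Z Q) <= vol (cell l i)" if i: "i \<in> ch n Q"
 proof -
  obtain j k where ij: "i = (Suc j, k)" using i by (cases i) (auto simp: ch_def gr0_conv_Suc)
  have Q: "Q = prin st j (up 1 k)" using i by (simp add: ch_def ij pparent_def)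
  have "vol (cell l i \<inter> Z Q) <= vol (cell l (j, up 1 k) \<inter> Z Q)"
   using cell_parent[OF l, of j k] cell_Z[of i Q] cell_Z[of "(j, up 1 k)" Q] by (intro measure_mono_fmeasurable) (auto simp: ij)
  moreover have "vol (cell l (j, up 1 k) :: (real ^ 'n) set) = 2 ^ CARD('n) * vol (cell l i)"
   by (simp add: measure_cell[OF l] side_def ij power_divide power_mult_distrib)
  ultimately have "2 ^ CARD('n) * (2 * vol (cell l i \<inter> Z Q)) <= 2 ^ CARD('n) * vol (cell l i)"
   using prin_light[of j "up 1 k"] unfolding Q by simp
  then show ?thesis by (simp add: mult_le_cancel_left_pos)
 qed
 show "(\<Sum>i\<in>ch n Q. vol (cell l i)) <= vol (cell l Q) / 2"
 proof -
  have "(\<Sum>i\<in>ch n Q. vol (cell l i)) <= (\<Sum>i\<in>ch n Q. 2 ^ (CARD('n) + 1) * vol (cell l i \<inter> Z Q))"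
  proof (rule sum_mono)
   fix i assume "i \<in> ch n Q"
   then have "st Q i" using principal_stop[of st i] by (auto simp: ch_def)
   then show "vol (cell l i) <= 2 ^ (CARD('n) + 1) * vol (cell l i \<inter> Z Q)" by (simp add: st_def)
  qed
  also have "\<dots> = 2 ^ (CARD('n) + 1) * (\<Sum>i\<in>ch n Q. vol (cell l i \<inter> Z Q))" by (simp add: sum_distrib_left)
  also have "(\<Sum>i\<in>ch n Q. vol (cell l i \<inter> Z Q)) = vol (\<Union>i\<in>ch n Q. cell l i \<inter> Z Q)"
  proof (intro measure_UNION_AE[symmetric, OF fin] cell_Z)
   show "pairwise (\<lambda>i j. AE x in lebesgue. x \<notin> cell l i \<inter> Z Q \<or> x \<notin> cell l j \<inter> Z Q) (ch n Q)"
    unfolding pairwise_def by (intro ballI impI AE_I2) (use disj in blast)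
  qed
  also have "\<dots> <= vol (Z Q)"
   using fin cell_Z Z_props(2) by (intro measure_mono_fmeasurable sets.finite_UN) auto
  finally have "(\<Sum>i\<in>ch n Q. vol (cell l i)) <= 2 ^ (CARD('n) + 1) * vol (Z Q)" by simp
  then show ?thesis using Z_props(3)[of Q] by simp
 qed
qed

text \<open>No cell is prescribed here, so the packing constant is
  \<open>2 * (1 + 0)\<close>.\<close>

lemma principal_sparse: "carleson l {i. principal st i} 2"
proof -
 have "carleson l {} 0" by (simp add: carleson_def)
 from principal_carleson[OF l this, of st] have "carleson l {i. principal st i} (2 * (1 + 0))"
  using ch_props(5) unfolding ch_def by simp
 then show ?thesis by simp
qed

text \<open>On a child \<open>R\<close> only the part of \<open>G Q k\<close> on \<open>3Q\<close>
  without \<open>3R\<close> is charged to \<open>Q\<close>; the part on \<open>3R\<close> is left to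
  \<open>R\<close>. Outside the children the whole local part is charged, but put to 0 on
  \<open>Ex Q\<close>, where nothing is known about it.\<close>

definition H :: "nat => nat => 'n idx => real ^ 'n => real"
 where "H n k Q x = (\<Sum>i\<in>ch n Q. indicator (cell l i) x * norm (T (cutoff (G Q k) (triple l Q - triple l i)) x)) +
  indicator (cell l Q - Ex Q - (\<Union>i\<in>ch n Q. cell l i)) x * norm (T (cutoff (G Q k) (triple l Q)) x)"

lemma H_nonneg: "0 <= H n k Q x" unfolding H_def by (intro add_nonneg_nonneg sum_nonneg mult_nonneg_nonneg) auto

lemma H_measurable: assumes k: "k <= m" shows "H n k Q \<in> borel_measurable lebesgue"
proof -
 have [measurable]: "(\<Union>i\<in>ch n Q. cell l i) \<in> sets lebesgue" using ch_props(1) l by (intro sets.finite_UN) auto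
 have [measurable]: "T (cutoff (G Q k) (triple l Q - triple l i)) \<in> borel_measurable lebesgue"
  "T (cutoff (G Q k) (triple l Q)) \<in> borel_measurable lebesgue" for i
  by (rule T_measurable[OF cut_comp[OF k]], simp)+
 show ?thesis unfolding H_def using l by measurable
qed

lemma H_child:
 assumes i: "i \<in> ch n Q" "x \<in> cell l i"
 shows "H n k Q x = norm (T (cutoff (G Q k) (triple l Q - triple l i)) x)"
proof -
 have "(\<Sum>j\<in>ch n Q. indicator (cell l j) x * norm (T (cutoff (G Q k) (triple l Q - triple l j)) x)) =
  (\<Sum>j\<in>{i}. indicator (cell l j) x * norm (T (cutoff (G Q k) (triple l Q - triple l j)) x))"
  by (intro sum.mono_neutral_right ch_props(1)) (use i ch_props(3)[of i n Q] in \<open>auto simp: indicator_def\<close>)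
 moreover have "x \<notin> cell l Q - Ex Q - (\<Union>i\<in>ch n Q. cell l i)" using i by auto
 ultimately show ?thesis using i by (simp add: H_def del: Diff_iff)
qed

lemma H_no_child:
 assumes "x \<notin> (\<Union>i\<in>ch n Q. cell l i)"
 shows "H n k Q x = indicator (cell l Q - Ex Q) x * norm (T (cutoff (G Q k) (triple l Q)) x)"
proof -
 have "(\<Sum>j\<in>ch n Q. indicator (cell l j) x * norm (T (cutoff (G Q k) (triple l Q - triple l j)) x)) = 0"
  using assms by (intro sum.neutral) (auto simp: indicator_def)
 moreover have "indicator (cell l Q - Ex Q - (\<Union>i\<in>ch n Q. cell l i)) x = (indicator (cell l Q - Ex Q) x :: real)"
  using assms by (auto simp: indicator_def)
 ultimately show ?thesis by (simp only: H_def)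
qed

text \<open>The children are disjoint and fill at most half of \<open>Q\<close>, and outside them
  the bound is pointwise. For finite \<open>s\<close> the sum of both contributions is absorbed by
  the factor 2, because \<open>2 <= 2 powr u\<close>.\<close>

lemma H_norm:
 assumes k: "k <= m"
 shows "norm_le_on s (cell l Q) (H n k Q) (2 * c_dom * av Q k)"
proof -
 let ?a = "c_dom * av Q k"
 let ?T = "\<lambda>i x. norm (T (cutoff (G Q k) (triple l Q - triple l i)) x)"
 have a0: "0 <= ?a" using c_local(4) av_nonneg[of Q k] by simp
 have child: "norm_le_on s (cell l i) (?T i) ?a" if "i \<in> ch n Q" for i
  by (rule exc_oscillation[OF exc ch_props(2)[OF that] ch_props(4)[OF that, unfolded Z_def] k])
 have self: "indicator (cell l Q - Ex Q) x * norm (T (cutoff (G Q k) (triple l Q)) x) <= ?a" for x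
 proof (cases "x \<in> cell l Q - Ex Q")
  case True
  then have "norm (T (cutoff (G Q k) (triple l Q)) x) <= \<phi>1 \<theta>0 * av Q k"
   using exc[of Q] cell_subset_triple[OF l, of Q] k unfolding exc_def by blast
  also have "\<dots> <= ?a" using c_local(1,3) av_nonneg[of Q k] by (intro mult_right_mono) auto
  finally show ?thesis using True by simp
 qed (simp add: a0)
 have [measurable]: "?T i \<in> borel_measurable lebesgue" for i
  using T_measurable[OF cut_comp[OF k, of "triple l Q - triple l i" Q]] by measurable
 show ?thesis
 proof (cases "s = top")
  case True
  have "AE x in lebesgue. \<forall>i\<in>ch n Q. x \<in> cell l i --> ?T i x <= ?a"
   by (rule AE_finite_allI[OF ch_props(1)]) (use child True in \<open>simp add: norm_le_on_def\<close>)
  then have "AE x in lebesgue. x \<in> cell l Q --> H n k Q x <= 2 * c_dom * av Q k"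
  proof eventually_elim
   case (elim x)
   have "H n k Q x <= ?a"
   proof (cases "\<exists>i\<in>ch n Q. x \<in> cell l i")
    case True
    then obtain i where "i \<in> ch n Q" "x \<in> cell l i" by blast
    then show ?thesis using elim by (simp add: H_child)
   next
    case False
    then show ?thesis using self[of x] H_no_child[of x n Q k] by simp
   qed
   then show ?case using a0 by simp
  qed
  then show ?thesis using True by (simp add: norm_le_on_def)
 next
  case False
  define u where "u = enn2real s"
  have u: "1 <= u" using s False by (cases s) (auto simp: u_def)
  have child': "(\<integral>\<^sup>+x\<in>cell l i. ennreal (?T i x powr u) \<partial>lebesgue) <= ennreal (?a powr u * vol (cell l i))" if "i \<in> ch n Q" for i
   using child[OF that] False by (simp add: norm_le_on_def u_def)
  have "(\<integral>\<^sup>+x\<in>cell l Q. ennreal (H n k Q x powr u) \<partial>lebesgue) \<le>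
   (\<integral>\<^sup>+x. (\<Sum>i\<in>ch n Q. ennreal (?T i x powr u) * indicator (cell l i) x) + ennreal (?a powr u) * indicator (cell l Q) x \<partial>lebesgue)"
  proof (intro nn_integral_mono)
   fix x
   show "ennreal (H n k Q x powr u) * indicator (cell l Q) x \<le>
    (\<Sum>i\<in>ch n Q. ennreal (?T i x powr u) * indicator (cell l i) x) + ennreal (?a powr u) * indicator (cell l Q) x"
   proof (cases "\<exists>i\<in>ch n Q. x \<in> cell l i")
    case True
    then obtain i where i: "i \<in> ch n Q" "x \<in> cell l i" by blast
    have "ennreal (H n k Q x powr u) * indicator (cell l Q) x <= ennreal (?T i x powr u) * indicator (cell l i) x"
     using i by (simp add: H_child indicator_def)
    also have "\<dots> <= (\<Sum>i\<in>ch n Q. ennreal (?T i x powr u) * indicator (cell l i) x)"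
     by (rule member_le_sum[OF i(1)]) (auto simp: ch_props(1))
    also have "\<dots> <= (\<Sum>i\<in>ch n Q. ennreal (?T i x powr u) * indicator (cell l i) x) + ennreal (?a powr u) * indicator (cell l Q) x" by simp
    finally show ?thesis .
   next
    case False
    then have "H n k Q x <= ?a" using self[of x] H_no_child[of x n Q k] by simp
    then have "H n k Q x powr u <= ?a powr u" using u H_nonneg by (intro powr_mono2) auto
    then have "ennreal (H n k Q x powr u) * indicator (cell l Q) x <= ennreal (?a powr u) * indicator (cell l Q) x"
     by (intro mult_right_mono ennreal_leI) auto
    then show ?thesis by (rule order_trans) simp
   qed
  qed
  also have "\<dots> = (\<Sum>i\<in>ch n Q. (\<integral>\<^sup>+x\<in>cell l i. ennreal (?T i x powr u) \<partial>lebesgue)) + ennreal (?a powr u) * ennreal (vol (cell l Q))"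
  proof -
   have "(\<integral>\<^sup>+x. (\<Sum>i\<in>ch n Q. ennreal (?T i x powr u) * indicator (cell l i) x) \<partial>lebesgue) = (\<Sum>i\<in>ch n Q. (\<integral>\<^sup>+x\<in>cell l i. ennreal (?T i x powr u) \<partial>lebesgue))"
    using l by (intro nn_integral_sum) measurable
   moreover have "(\<integral>\<^sup>+x. ennreal (?a powr u) * indicator (cell l Q) x \<partial>lebesgue) = ennreal (?a powr u) * ennreal (vol (cell l Q))"
    unfolding emeasure_eq_measure2[OF cell_fmeasurable[OF l], symmetric] by (rule nn_integral_cmult_indicator[OF cell_sets[OF l]])
   ultimately show ?thesis using l by (subst nn_integral_add) auto
  qed
  also have "\<dots> <= (\<Sum>i\<in>ch n Q. ennreal (?a powr u * vol (cell l i))) + ennreal (?a powr u) * ennreal (vol (cell l Q))"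
   by (intro add_mono sum_mono child') auto
  also have "\<dots> = ennreal (?a powr u * (\<Sum>i\<in>ch n Q. vol (cell l i)) + ?a powr u * vol (cell l Q))"
   by (subst sum_ennreal) (auto simp: ennreal_mult[symmetric] ennreal_plus[symmetric] sum_distrib_left sum_nonneg simp del: ennreal_plus)
  also have "\<dots> <= ennreal ((2 * c_dom * av Q k) powr u * vol (cell l Q))"
  proof (rule ennreal_leI)
   have "?a powr u * (\<Sum>i\<in>ch n Q. vol (cell l i)) <= ?a powr u * (vol (cell l Q) / 2)"
    by (intro mult_left_mono ch_props(5)) auto
   moreover have "2 * ?a powr u <= (2 * ?a) powr u"
    using powr_mono[of 1 u 2] u by (simp add: powr_mult mult_right_mono)
   then have "2 * ?a powr u * vol (cell l Q) <= (2 * ?a) powr u * vol (cell l Q)"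
    by (intro mult_right_mono) auto
   moreover have "?a powr u * (vol (cell l Q) / 2) <= ?a powr u * vol (cell l Q)"
    by (intro mult_left_mono) auto
   ultimately show "?a powr u * (\<Sum>i\<in>ch n Q. vol (cell l i)) + ?a powr u * vol (cell l Q) <= (2 * c_dom * av Q k) powr u * vol (cell l Q)"
    unfolding mult.assoc[of 2 c_dom] by linarith
  qed
  finally show ?thesis using False by (simp add: norm_le_on_def u_def)
 qed
qed

definition Hs :: "nat => 'n idx => real ^ 'n => real"
 where "Hs n Q x = (\<Sum>k\<le>m. (m choose k) * norm (b x - ctr l b Q) ^ (m - k) * H n k Q x)"

lemma Hs_nonneg: "0 <= Hs n Q x" unfolding Hs_def by (intro sum_nonneg mult_nonneg_nonneg H_nonneg) auto

definition pc :: "nat => real ^ 'n => 'n idx" where "pc j x = prin st j (position l j x)"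

lemma pc_props: "principal st (pc j x)" "fst (pc j x) <= j" "x \<in> cell l (pc j x)"
 unfolding pc_def using prin_subset[OF l, of j "position l j x" st] cell_position[of x l j] by (auto simp: principal_prin prin_level)

lemma pc_Suc: "pc (Suc j) x = (if st (pc j x) (Suc j, position l (Suc j) x) then (Suc j, position l (Suc j) x) else pc j x)"
 using position_up[of l j x 1] by (simp add: pc_def)

lemma pc_mono: "i <= j ==> fst (pc i x) <= fst (pc j x)"
proof (induction j)
 case (Suc j)
 then show ?case using pc_Suc[of j x] pc_props(2)[of j x] by (cases "i = Suc j") (auto intro: order_trans le_SucI)
qed simp

definition fam :: "nat => 'n idx set" where "fam n = {i. principal st i \<and> fst i <= n \<and> cell l i \<subseteq> cell l (0, 0)}"

lemma fam_finite: "finite (fam n)"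
 by (rule finite_subset[OF _ finite_cells_below[OF l, of n "(0, 0)"]]) (auto simp: fam_def)

lemma finite_containing: "finite {i. fst i <= j \<and> x \<in> cell l i}"
 by (rule finite_subset[of _ "(\<lambda>j. (j, position l j x)) ` {..j}"]) (auto simp: cell_def)

text \<open>Each time the path to \<open>x\<close> selects a child \<open>R\<close> of the current
  cell \<open>Q\<close>, the function on \<open>3Q\<close> is split along \<open>3R\<close>. The
  outer part is at most \<open>Hs n Q x\<close> by the binomial formula centred at \<open>Q\<close>;
  the inner part is carried on.\<close>

lemma telescope:
 "j <= n ==> norm (commutator T b m (cutoff f (triple l (pc 0 x))) x) \<le>
  (\<Sum>i\<in>{i. principal st i \<and> x \<in> cell l i \<and> fst i < fst (pc j x)}. Hs n i x) + norm (commutator T b m (cutoff f (triple l (pc j x))) x)"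
proof (induction j)
 case 0
 have "0 <= (\<Sum>i\<in>{i. principal st i \<and> x \<in> cell l i \<and> fst i < fst (pc 0 x)}. Hs n i x)" by (intro sum_nonneg Hs_nonneg)
 then show ?case by simp
next
 case (Suc j)
 let ?D = "\<lambda>j. {i. principal st i \<and> x \<in> cell l i \<and> fst i < fst (pc j x)}"
 let ?R = "(Suc j, position l (Suc j) x)"
 let ?c = "\<lambda>A. norm (commutator T b m (cutoff f A) x)"
 show ?case
 proof (cases "st (pc j x) ?R")
  case False
  then show ?thesis using Suc by (simp add: pc_Suc)
 next
  case True
  then have R: "pc (Suc j) x = ?R" by (simp add: pc_Suc)
  have pp: "pparent st ?R = pc j x" using position_up[of l j x 1] by (simp add: pparent_def pc_def)
  have "?R \<in> ch n (pc j x)"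
   using stop_principal[of st j "position l (Suc j) x"] True pp Suc.prems by (simp add: ch_def)
  note ch = this cell_position[of x l "Suc j"]
  have sub: "triple l ?R \<subseteq> triple l (pc j x)" by (rule triple_mono[OF l ch_props(2)[OF ch(1)]])
  have "?c (triple l (pc j x)) <= ?c (triple l (pc j x) - triple l ?R) + ?c (triple l ?R)"
   by (rule commutator_split) (use sub in auto)
  moreover have "?c (triple l (pc j x) - triple l ?R) <= Hs n (pc j x) x"
   using commutator_le[of "triple l (pc j x) - triple l ?R" x "pc j x"] unfolding Hs_def by (simp add: H_child[OF ch])
  moreover have "(\<Sum>i\<in>?D j. Hs n i x) + Hs n (pc j x) x <= (\<Sum>i\<in>?D (Suc j). Hs n i x)"
  proof -
   have fin: "finite (?D j)" for j by (rule finite_subset[OF _ finite_containing[of "fst (pc j x)" x]]) auto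
   have "fst (pc j x) < fst (pc (Suc j) x)" using pc_props(2)[of j x] by (simp add: R)
   then have "insert (pc j x) (?D j) \<subseteq> ?D (Suc j)" using pc_props(1)[of j x] pc_props(3)[of x j] by auto
   then have "(\<Sum>i\<in>insert (pc j x) (?D j). Hs n i x) <= (\<Sum>i\<in>?D (Suc j). Hs n i x)"
    by (intro sum_mono2 fin Hs_nonneg)
   then show ?thesis using fin by simp
  qed
  ultimately show ?thesis using Suc by (simp add: R)
 qed
qed

text \<open>Borel-Cantelli: by the packing condition the volumes of the principal cells of all
  levels have a finite sum.\<close>

lemma AE_finitely_many: "AE x in lebesgue. x \<in> cell l (0, 0) --> (\<forall>\<^sub>F j in sequentially. \<not> principal st (j, position l j x))"
proof -
 define A where "A j = (\<Union>i\<in>{i\<in>fam j. fst i = j}. cell l i)" for j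
 let ?\<mu> = "\<lambda>i :: 'n idx. vol (cell l i)"
 have fin: "finite {i\<in>fam j. fst i = j}" for j using fam_finite[of j] by simp
 have fm: "A j \<in> fmeasurable lebesgue" for j unfolding A_def by (rule fmeasurable.finite_UN[OF fin cell_fmeasurable[OF l]])
 have le: "vol (A j) <= (\<Sum>i\<in>{i\<in>fam j. fst i = j}. ?\<mu> i)" for j
  unfolding A_def by (rule measure_UNION_le[OF fin]) (rule cell_sets[OF l])
 have "(\<Sum>j<N. vol (A j)) <= 2 * ?\<mu> (0, 0)" for N
 proof -
  have "(\<Sum>j<N. vol (A j)) <= (\<Sum>j<N. \<Sum>i\<in>{i\<in>fam j. fst i = j}. ?\<mu> i)" by (intro sum_mono le)
  also have "\<dots> = (\<Sum>i\<in>(\<Union>j\<in>{..<N}. {i\<in>fam j. fst i = j}). ?\<mu> i)"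
   using fin by (intro sum.UNION_disjoint[symmetric]) auto
  also have "\<dots> <= (\<Sum>i\<in>fam N. ?\<mu> i)" by (intro sum_mono2 fam_finite) (auto simp: fam_def)
  also have "\<dots> <= 2 * ?\<mu> (0, 0)"
  proof -
   have "fam N = {i \<in> {i. principal st i}. fst i <= N \<and> cell l i \<subseteq> cell l (0, 0)}" by (auto simp: fam_def)
   then show ?thesis using principal_sparse[unfolded carleson_def, THEN spec, of "(0, 0)", THEN spec, of N] by (simp add: fam_def)
  qed
  finally show ?thesis .
 qed
 then have "summable (\<lambda>j. vol (A j))" by (intro summableI_nonneg_bounded) auto
 moreover have "emeasure lebesgue (A j) < \<infinity>" for j using fm[of j] by (auto simp: fmeasurable_def)
 ultimately have "AE x in lebesgue. eventually (\<lambda>n. x \<in> space lebesgue - A n) sequentially"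
  using fm by (intro borel_cantelli_AE1) auto
 then show ?thesis
 proof eventually_elim
  case (elim x)
  show ?case
  proof
   assume x: "x \<in> cell l (0, 0)"
   show "\<forall>\<^sub>F j in sequentially. \<not> principal st (j, position l j x)"
    using elim
   proof eventually_elim
    case (elim j)
    have "cell l (j, position l j x) \<inter> cell l (0, 0) \<noteq> {}" using x cell_position[of x l j] by blast
    then have "cell l (j, position l j x) \<subseteq> cell l (0, 0)" using cell_subset_up(1)[OF l, of "(j, position l j x)" "(0, 0)"] by simp
    then show ?case using elim cell_position[of x l j] by (auto simp: A_def fam_def)
   qed
  qed
 qed
qed

lemma sparse_domination:
 assumes supp: "!!y. f y \<noteq> 0 ==> y \<in> cell l (0, 0)"
 shows "AE x in lebesgue. x \<in> cell l (0, 0) -->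
  (\<forall>\<^sub>F n in sequentially. norm (commutator T b m f x) <= (\<Sum>i\<in>fam n. Hs n i x * indicator (cell l i) x))"
 using AE_finitely_many
proof eventually_elim
 case (elim x)
 show ?case
 proof
  assume x: "x \<in> cell l (0, 0)"
  then obtain j0 where j0: "!!j. j0 <= j ==> \<not> principal st (j, position l j x)"
   using elim by (auto simp: eventually_sequentially)
  define Q where "Q = pc j0 x"
  have Qc: "pc j x = Q" if "j0 <= j" for j
   using that
  proof (induction j rule: dec_induct)
   case (step j)
   have "\<not> st (pc j x) (Suc j, position l (Suc j) x)"
    using stop_principal[of st j "position l (Suc j) x"] j0[of "Suc j"] step(1) position_up[of l j x 1]
    by (auto simp: pparent_def pc_def)
   then show ?case using step by (simp add: pc_Suc)
  qed (simp add: Q_def)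
  \<comment> \<open>\<open>Q\<close> is the last selected cell on the path to \<open>x\<close>. If
    \<open>x\<close> lay in the open set \<open>Ex Q\<close>, some late cell of the path would lie
    inside \<open>Ex Q\<close> and would have been selected. This takes the place of a density point
    argument.\<close>
  have Ex: "x \<notin> Ex Q"
  proof
   assume "x \<in> Ex Q"
   then obtain \<epsilon> where \<epsilon>: "0 < \<epsilon>" "ball x \<epsilon> \<subseteq> Ex Q" using Z_props(1)[of Q] open_contains_ball by blast
   have "(\<lambda>j. CARD('n) * l * (1 / 2) ^ j) \<longlonglongrightarrow> CARD('n) * l * 0" by (intro tendsto_intros) auto
   then have "\<forall>\<^sub>F j in sequentially. CARD('n) * l * (1 / 2) ^ j < \<epsilon>" using \<epsilon>(1) by (intro order_tendstoD) auto
   then obtain j where j: "j0 <= j" "CARD('n) * l * (1 / 2) ^ j < \<epsilon>"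
    by (metis (mono_tags, lifting) eventually_sequentially linear order_refl)
   let ?P = "(j, position l j x)"
   have "cell l ?P \<subseteq> ball x \<epsilon>"
   proof
    fix y assume y: "y \<in> cell l ?P"
    have "\<bar>(x - y) $ c\<bar> <= l * (1 / 2) ^ j" for c
    proof -
     let ?K = "real_of_int (position l j x $ c)" and ?S = "l * (1 / 2) ^ j"
     have "?K * ?S - l / 2 <= y $ c \<and> y $ c < (?K + 1) * ?S - l / 2" "?K * ?S - l / 2 <= x $ c \<and> x $ c < (?K + 1) * ?S - l / 2"
     using y cell_position[of x l j] unfolding position_iff[OF l] side_def by (simp_all add: power_one_over)
     then show ?thesis unfolding distrib_right vector_minus_component abs_le_iff by linarith
    qed
    then have "(\<Sum>c\<in>UNIV. \<bar>(x - y) $ c\<bar>) <= (\<Sum>c\<in>(UNIV :: 'n set). l * (1 / 2) ^ j)" by (intro sum_mono)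
    then have "norm (x - y) <= CARD('n) * l * (1 / 2) ^ j" using norm_le_l1_cart[of "x - y"] by simp
    then show "y \<in> ball x \<epsilon>" using j(2) by (simp add: dist_norm)
   qed
   then have "cell l ?P \<inter> Z Q = cell l ?P" using \<epsilon>(2) by (auto simp: Z_def)
   moreover have "2 ^ (CARD('n) + 1) * vol (cell l ?P \<inter> Z Q) <= vol (cell l ?P)"
    using prin_light[of j "position l j x"] Qc[OF j(1)] by (simp add: pc_def)
   ultimately have "2 ^ (CARD('n) + 1) * vol (cell l ?P) <= 1 * vol (cell l ?P)" by simp
   then have "(2::real) ^ (CARD('n) + 1) <= 1" using measure_cell_pos[OF l, of ?P] by (simp only: mult_le_cancel_right_pos)
   moreover have "(1::real) < 2 ^ (CARD('n) + 1)" by (rule one_less_power) auto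
   ultimately show False by linarith
  qed
  have px: "position l 0 x = 0" using x by (simp add: mem_cell_iff)
  have f0: "cutoff f (triple l (pc 0 x)) = f"
   using supp cell_subset_triple[OF l, of "(0, 0)"] px by (force simp: cutoff_def pc_def fun_eq_iff)
  show "\<forall>\<^sub>F n in sequentially. norm (commutator T b m f x) <= (\<Sum>i\<in>fam n. Hs n i x * indicator (cell l i) x)"
   unfolding eventually_sequentially
  proof (intro exI[of _ j0] allI impI)
   fix n assume n: "j0 <= n"
   let ?D = "{i. principal st i \<and> x \<in> cell l i \<and> fst i < fst Q}"
   have nc: "x \<notin> (\<Union>i\<in>ch n Q. cell l i)"
   proof
    assume "x \<in> (\<Union>i\<in>ch n Q. cell l i)"
    then obtain i where i: "i \<in> ch n Q" "x \<in> cell l i" by blast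
    have p: "principal st i" "fst i <= n" using i(1) by (auto simp: ch_def)
    have "snd i = position l (fst i) x" using i(2) by (simp add: cell_def)
    then have "pc (fst i) x = i" using p(1) by (simp add: principal_def pc_def)
    then have "fst i <= fst Q" using pc_mono[OF p(2), of x] Qc[OF n] by simp
    moreover have "fst Q < fst i" using pparent_props(2)[OF l, of i st] i(1) by (auto simp: ch_def)
    ultimately show False by simp
   qed
   have xQ: "x \<in> cell l Q" using pc_props(3)[of x j0] by (simp add: Q_def)
   have "norm (commutator T b m (cutoff f (triple l Q)) x) <= Hs n Q x"
    using commutator_le[of "triple l Q" x Q] Ex xQ unfolding Hs_def by (simp add: H_no_child[OF nc])
   then have "norm (commutator T b m f x) <= (\<Sum>i\<in>?D. Hs n i x) + Hs n Q x"
    using telescope[of n n x] Qc[OF n] f0 by simp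
   also have "\<dots> = (\<Sum>i\<in>insert Q ?D. Hs n i x)"
   proof -
    have "finite ?D" by (rule finite_subset[OF _ finite_containing[of "fst Q" x]]) auto
    then show ?thesis by simp
   qed
   also have "\<dots> = (\<Sum>i\<in>insert Q ?D. Hs n i x * indicator (cell l i) x)" using xQ by (intro sum.cong) auto
   also have "\<dots> <= (\<Sum>i\<in>fam n. Hs n i x * indicator (cell l i) x)"
   proof (intro sum_mono2 fam_finite subsetI mult_nonneg_nonneg Hs_nonneg)
    fix i assume "i \<in> insert Q ?D"
    then have i: "principal st i" "x \<in> cell l i" "fst i <= fst Q" using xQ pc_props(1)[of j0 x] by (auto simp: Q_def)
    have "fst Q <= n" using pc_props(2)[of n x] Qc[OF n] by simp
    moreover have "cell l i \<inter> cell l (0, 0) \<noteq> {}" using x i by blast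
    then have "cell l i \<subseteq> cell l (0, 0)" using cell_subset_up(1)[OF l, of i "(0, 0)"] by simp
    ultimately show "i \<in> fam n" using i by (simp add: fam_def)
   qed simp
   finally show "norm (commutator T b m f x) <= (\<Sum>i\<in>fam n. Hs n i x * indicator (cell l i) x)" .
  qed
 qed
qed

end

section \<open>Two-weight estimates\<close>

lemma rpow_power: assumes "0 <= x" "1 <= r" shows "(x ^ k) powr r = rpow x (real k * r)"
proof (cases "k = 0 \<or> x = 0")
 case False
 then have "(x ^ k) powr r = (x powr real k) powr r" using assms by (simp add: powr_realpow)
 then show ?thesis using False assms by (simp add: rpow_def powr_powr)
qed (use assms in \<open>auto simp: rpow_def\<close>)

text \<open>After taking logarithms everything is linear in the logarithms of \<open>G\<close>,
  \<open>F\<close> and the two volumes. Only the volume of the cell itself is enlarged to that of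
  the triple, which is why its exponent must be nonnegative.\<close>

lemma zfac_le:
 fixes F G :: "(real ^ 'n) set => real"
 assumes l: "0 < l" and pos: "0 < G (triple l i)" "0 < F (triple l i)" and tq: "0 < t" "0 < q" "0 <= (1 - 1 / t) / q"
  and x: "x = \<tau> * \<kappa> * s / (t * q)" and y: "y = \<rho> * (1 - s) / (t * q)"
  and z: "z = (1 - 1 / t) / q + \<kappa> * s / (t * q) + (1 - s) / (t * q)"
 shows "zfac (\<lambda>Q. F Q powr \<rho>) (\<lambda>Q. G Q powr \<tau>) \<kappa> s t q l i
  <= G (triple l i) powr x * F (triple l i) powr y * vol (triple l i) powr z"
proof -
 let ?c = "vol (cell l i)" and ?M = "vol (triple l i)"
 let ?G = "G (triple l i)" and ?F = "F (triple l i)"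
 have c: "0 < ?c" by (rule measure_cell_pos[OF l])
 have cM: "?c <= ?M" "0 < ?M" using c by (simp_all add: measure_triple[OF l])
 have "ln (zfac (\<lambda>Q. F Q powr \<rho>) (\<lambda>Q. G Q powr \<tau>) \<kappa> s t q l i) =
   1 / q * ((1 - 1 / t) * ln ?c + 1 / t * (s * (\<kappa> * (\<tau> * ln ?G + ln ?M)) + (1 - s) * (\<rho> * ln ?F + ln ?M)))"
  using c cM pos by (simp add: zfac_def ln_mult_pos ln_powr)
 also have "\<dots> = (1 - 1 / t) / q * ln ?c + x * ln ?G + y * ln ?F + (\<kappa> * s / (t * q) + (1 - s) / (t * q)) * ln ?M"
  unfolding x y using tq(1,2) by (simp add: divide_simps) (simp add: algebra_simps)
 also have "\<dots> <= (1 - 1 / t) / q * ln ?M + x * ln ?G + y * ln ?F + (\<kappa> * s / (t * q) + (1 - s) / (t * q)) * ln ?M"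
  using mult_left_mono[OF _ tq(3), of "ln ?c" "ln ?M"] c cM by simp
 also have "\<dots> = ln (?G powr x * ?F powr y * ?M powr z)"
  unfolding z using c cM pos by (simp add: ln_mult_pos ln_powr distrib_right)
 finally show ?thesis using c cM pos by (subst (asm) ln_le_cancel_iff) (auto simp: zfac_def)
qed

text \<open>A cell is a fixed fraction of its own triple and is contained in the triple of every
  neighbour, so its \<open>W\<close>-measure mediates between the two values of
  \<open>G\<close>.\<close>

lemma comparable_neighbours:
 fixes W :: "real ^ 'n::finite => real"
 assumes "comparable W G"
 shows "\<exists>c>0. \<forall>l e i. 0 < l --> e \<in> nbs --> G (triple l i) <= c * G (triple l (shift e i))"
proof -
 have "\<exists>K>0. \<forall>Q\<in>cubes. wmeas W Q <= ennreal (K * (G Q * vol Q))"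
  using assms by (simp add: comparable_def avg_le_def wmeas_def)
 then obtain K where K: "0 < K" "!!Q. Q \<in> cubes ==> wmeas W Q <= ennreal (K * (G Q * vol Q))" by blast
 have G0: "0 < G Q" if "Q \<in> cubes" for Q using assms that by (auto simp: comparable_def avg_le_def)
 define \<eta> where "\<eta> = (1 / 3 ^ CARD('n) :: real)"
 have "0 < \<eta>" by (simp add: \<eta>_def)
 then obtain c where c: "0 < c" "!!Q F. Q \<in> cubes ==> F \<in> sets lebesgue ==> F \<subseteq> Q ==> \<eta> * vol Q <= vol F ==>
   ennreal (c * (G Q * vol Q)) <= wmeas W F"
  using assms unfolding comparable_def by meson
 have "G (triple l i) <= K / c * G (triple l (shift e i))" if l: "0 < l" and e: "e \<in> nbs" for l e and i :: "'n idx"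
 proof -
  let ?m = "vol (triple l i)"
  note cu = ccell_cubes(2)[OF l]
  have m: "0 < ?m" "vol (triple l (shift e i)) = ?m"
   using measure_cell_pos[OF l, of i] by (simp_all add: measure_triple[OF l] measure_shift[OF l])
  have "ennreal (c * (G (triple l i) * ?m)) <= wmeas W (cell l i)"
   using l by (intro c(2) cu cell_subset_triple) (auto simp: \<eta>_def measure_triple[OF l])
  also have "\<dots> <= wmeas W (triple l (shift e i))"
   unfolding wmeas_def using cell_subset_triple_shift(1)[OF l e, of i] by (intro nn_integral_mono) (auto split: split_indicator)
  also have "\<dots> <= ennreal (K * (G (triple l (shift e i)) * ?m))" using K(2)[OF cu[of "shift e i"]] by (simp add: m)
  finally have "c * (G (triple l i) * ?m) <= K * (G (triple l (shift e i)) * ?m)"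
   using mult_pos_pos[OF K(1) mult_pos_pos[OF G0[OF cu[of "shift e i"]] m(1)]] by (subst (asm) ennreal_le_iff) (auto intro: less_imp_le)
  then have "(c * G (triple l i)) * ?m <= (K * G (triple l (shift e i))) * ?m" by (simp only: mult.assoc)
  then have "c * G (triple l i) <= K * G (triple l (shift e i))" using m(1) by (simp only: mult_le_cancel_right_pos)
  then show ?thesis using c(1) by (simp add: pos_le_divide_eq mult.commute)
 qed
 then show ?thesis using K(1) c(1) by (intro exI[of _ "K / c"]) simp
qed

text \<open>
 The functions \<open>g\<close> and \<open>h\<close> of cubes represent the averages of the weights \<open>\<mu>\<close> and \<open>\<sigma>\<close>: raised to
 the powers at hand, they are comparable to the averages of these powers.
\<close>

locale bloom =
 fixes \<mu> \<sigma> :: "real ^ 'n::finite => real" and g h :: "(real ^ 'n) set => real" and p q r rs :: real and m :: nat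
 assumes r: "1 <= r" "r < p" "r < q" and rs: "0 <= rs" "p * rs < 1" "q * rs < 1" and m: "1 <= m"
  and \<mu>: "AE x in lebesgue. 0 < \<mu> x" "!!x. 0 <= \<mu> x" "\<mu> \<in> borel_measurable lebesgue" and mu_loc: "!!Q. Q \<in> cubes ==> wmeas \<mu> Q < \<infinity>"
  and \<sigma>: "AE x in lebesgue. 0 < \<sigma> x" "!!x. 0 <= \<sigma> x" "\<sigma> \<in> borel_measurable lebesgue"
  and g: "!!Q. Q \<in> cubes ==> 0 < g Q" and h: "!!Q. Q \<in> cubes ==> 0 < h Q"
  and avg_\<mu>: "avg_le (\<lambda>x. \<mu> x powr (1 / (1 - p * rs))) (\<lambda>Q. g Q powr (1 / (1 - p * rs)))"
   "avg_le (\<lambda>x. \<mu> x powr (- (r / (p - r)))) (\<lambda>Q. g Q powr (- (r / (p - r))))"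
  and avg_\<sigma>: "avg_le (\<lambda>x. \<sigma> x powr (1 / (1 - q * rs))) (\<lambda>Q. h Q powr (1 / (1 - q * rs)))"
   "avg_le (\<lambda>x. \<sigma> x powr (- (r / (q - r)))) (\<lambda>Q. h Q powr (- (r / (q - r))))"
begin

text \<open>This is \<open>1 / t\<close> in the part with \<open>q <= p\<close> and
  \<open>- \<alpha>\<close> in the part with \<open>p <= q\<close>, so that both parts are treated
  at once.\<close>

definition e :: real where "e = 1 / (q * m) - 1 / (p * m)"
text \<open>The size of \<open>\<nu>(Q) powr (1 - e) / vol Q\<close> in terms of the averages
  \<open>g\<close> and \<open>h\<close>: the scale against which the mean oscillation of
  \<open>b\<close> is measured.\<close>

definition \<Psi> :: "(real ^ 'n) set => real"
 where "\<Psi> Q = vol Q powr (- e) * g Q powr (1 / (p * m)) * h Q powr (- (1 / (q * m)))"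
definition \<eta> :: "nat => real" where "\<eta> k = 1 / p + k * e"
text \<open>Equal to \<open>(g Q * vol Q) powr ((1 - k / m) / p) * (h Q * vol Q) powr (k / m /
  q)\<close>, a geometric interpolation between the norms of the indicator of \<open>Q\<close> in
  the two weighted spaces.\<close>

definition \<zeta> :: "nat => (real ^ 'n) set => real"
 where "\<zeta> k Q = g Q powr ((1 - k / m) / p) * h Q powr (k / m / q) * vol Q powr \<eta> k"
text \<open>The stopping family of the operator has packing constant 2; the square is the price of
  adjoining all neighbours of its cells.\<close>

definition L0 :: real where "L0 = real (card (nbs :: (int ^ 'n) set)) ^ 2 * 2"

text \<open>The hypothesis on \<open>b\<close>, common to both parts of the theorem.\<close>

definition tame :: "real => (real ^ 'n => 'k::euclidean_space) => real => bool"
 where "tame l b B \<longleftrightarrow> (\<forall>I. laminar I (cell l) (2 * (1 + L0)) --> lnorm_le e I (\<lambda>i. tosc l b i / \<Psi> (triple l i)) B)"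

lemma pq: "0 < p" "0 < q" "0 < r" "p \<noteq> 0" "q \<noteq> 0" "r \<noteq> 0" "p - r \<noteq> 0" "q - r \<noteq> 0" "0 < p - r" "0 < q - r" "0 < real m" "real m \<noteq> 0"
 "1 - p * rs \<noteq> 0" "1 - q * rs \<noteq> 0"
 using r rs m by auto

lemma me: "m * e = 1 / q - 1 / p" using pq by (simp add: e_def field_simps)

text \<open>A convex combination of \<open>1 / p\<close> and \<open>1 / q\<close>. That
  \<open>r * \<eta> k\<close> is below 1 makes \<open>1 / (r * \<eta> k)\<close> an exponent above
  1, to which sequence duality applies.\<close>

lemma \<eta>: assumes k: "k <= m" shows "0 < \<eta> k" "r * \<eta> k < 1" "\<eta> k = (1 - k / m) / p + k / m / q"
proof -
 have "k * e = k / m * (m * e)" using pq by simp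
 then have ke: "k * e = k / m * (1 / q - 1 / p)" by (simp only: me)
 have "1 / p + u * (1 / q - 1 / p) = (1 - u) / p + u / q" for u :: real
  by (simp add: right_diff_distrib diff_divide_distrib)
 then show 1: "\<eta> k = (1 - k / m) / p + k / m / q" unfolding \<eta>_def ke .
 have k1: "0 <= k / m" "k / m <= 1" using k pq by auto
 have conv: "(1 - u) * X + u * X = X" for u X :: real by (simp add: algebra_simps)
 have 2: "\<eta> k = (1 - k / m) * (1 / p) + k / m * (1 / q)" using 1 by simp
 have "1 / max p q <= 1 / p" "1 / max p q <= 1 / q" using pq by (auto intro!: divide_left_mono)
 then have "(1 - k / m) * (1 / max p q) + k / m * (1 / max p q) <= (1 - k / m) * (1 / p) + k / m * (1 / q)"
  using k1 by (intro add_mono mult_left_mono) auto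
 then have "1 / max p q <= \<eta> k" unfolding 2 conv .
 moreover have "0 < 1 / max p q" using pq by auto
 ultimately show "0 < \<eta> k" by linarith
 have "1 / p <= 1 / min p q" "1 / q <= 1 / min p q" using pq by (auto intro!: divide_left_mono)
 then have "(1 - k / m) * (1 / p) + k / m * (1 / q) <= (1 - k / m) * (1 / min p q) + k / m * (1 / min p q)"
  using k1 by (intro add_mono mult_left_mono) auto
 then have "\<eta> k <= 1 / min p q" unfolding 2 conv .
 then have "r * \<eta> k <= r * (1 / min p q)" using pq by (intro mult_left_mono) auto
 also have "\<dots> < 1" using r pq by (auto simp: min_def)
 finally show "r * \<eta> k < 1" .
qed

lemma \<zeta>_pos: "Q \<in> cubes ==> 0 < \<zeta> k Q"
 using g[of Q] h[of Q] cubes_props(3)[of Q] by (simp add: \<zeta>_def)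

lemma \<Psi>_pos: "Q \<in> cubes ==> 0 < \<Psi> Q"
 using g[of Q] h[of Q] cubes_props(3)[of Q] by (simp add: \<Psi>_def)

lemma L0: "0 <= L0" "1 <= L0"
proof -
 have "1 <= card (nbs :: (int ^ 'n) set)" using finite_nbs zero_nbs by (metis One_nat_def Suc_leI card_gt_0_iff empty_iff)
 then have "1 ^ 2 <= real (card (nbs :: (int ^ 'n) set)) ^ 2" by (intro power_mono) auto
 then show "1 <= L0" by (simp add: L0_def)
 then show "0 <= L0" by simp
qed

lemma comparable_weights:
 "comparable (\<lambda>x. \<mu> x powr (1 / (1 - p * rs))) (\<lambda>Q. g Q powr (1 / (1 - p * rs)))"
 "comparable (\<lambda>x. \<mu> x powr (- (r / (p - r)))) (\<lambda>Q. g Q powr (- (r / (p - r))))"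
 "comparable (\<lambda>x. \<sigma> x powr (1 / (1 - q * rs))) (\<lambda>Q. h Q powr (1 / (1 - q * rs)))"
 "comparable (\<lambda>x. \<sigma> x powr (- (r / (q - r)))) (\<lambda>Q. h Q powr (- (r / (q - r))))"
 using comparable_powr_pair[OF \<mu>(1) _ _ g avg_\<mu>] comparable_powr_pair[OF \<sigma>(1) _ _ h avg_\<sigma>] pq rs by simp_all

text \<open>Both instances of the following hold with equality.\<close>

lemma \<Psi>_balance:
 assumes Q: "Q \<in> cubes" and 1: "n / (q * m) = \<rho>2" "n / (p * m) = \<rho>1" "\<kappa> = 1 - n * e"
 shows "\<Psi> Q powr n * (h Q powr \<rho>2 * vol Q) = g Q powr \<rho>1 * vol Q powr \<kappa>"
  "\<Psi> Q powr n * (g Q powr (- \<rho>1) * vol Q) = h Q powr (- \<rho>2) * vol Q powr \<kappa>"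
proof -
 let ?M = "vol Q"
 note pos = g[OF Q] h[OF Q] cubes_props(3)[OF Q]
 have "1 / (p * m) * n = \<rho>1" "- (1 / (q * m)) * n = - \<rho>2" unfolding 1(1,2)[symmetric] by simp_all
 then have \<Psi>n: "\<Psi> Q powr n = ?M powr (- e * n) * g Q powr \<rho>1 * h Q powr (- \<rho>2)"
  by (simp only: \<Psi>_def powr_mult powr_powr)
 have M: "?M powr (- e * n) * ?M = ?M powr \<kappa>"
  using pos powr_add[of ?M "- e * n" 1] by (simp add: 1(3) algebra_simps)
 have hh: "h Q powr (- \<rho>2) * h Q powr \<rho>2 = 1" "g Q powr \<rho>1 * g Q powr (- \<rho>1) = 1"
  using pos by (simp_all add: powr_add[symmetric])
 have "\<Psi> Q powr n * (h Q powr \<rho>2 * ?M) = (?M powr (- e * n) * ?M) * g Q powr \<rho>1 * (h Q powr (- \<rho>2) * h Q powr \<rho>2)"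
  unfolding \<Psi>n by (simp only: mult_ac)
 then show "\<Psi> Q powr n * (h Q powr \<rho>2 * ?M) = g Q powr \<rho>1 * ?M powr \<kappa>" unfolding M hh by simp
 have "\<Psi> Q powr n * (g Q powr (- \<rho>1) * ?M) = (?M powr (- e * n) * ?M) * h Q powr (- \<rho>2) * (g Q powr \<rho>1 * g Q powr (- \<rho>1))"
  unfolding \<Psi>n by (simp only: mult_ac)
 then show "\<Psi> Q powr n * (g Q powr (- \<rho>1) * ?M) = h Q powr (- \<rho>2) * ?M powr \<kappa>" unfolding M hh by simp
qed

text \<open>The oscillation estimate with the weight \<open>\<sigma>\<close>, where \<open>t\<close>
  is the conjugate of \<open>s / q\<close> and \<open>\<mu>\<close> is raised to the conjugate of
  \<open>s / p\<close>. The choice \<open>n = m * q * t\<close> makes \<open>1 - k / m\<close> the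
  interpolation parameter that produces the power \<open>m - k\<close>. Then \<open>\<kappa>\<close>
  equals \<open>t * q * (1 / p - rs)\<close>, positive because \<open>p * rs < 1\<close>.\<close>

lemma upper_norm:
 assumes k: "k <= m"
 obtains C where "0 < C" "!!l (b :: real ^ 'n => 'k::euclidean_space) B S f a. 0 < l ==> loc_integrable b ==> 0 < B ==> tame l b B ==>
   finite S ==> (!!i. i \<in> S ==> cell l i \<subseteq> base l) ==> carleson l S L0 ==>
   (!!i. i \<in> S ==> f i \<in> borel_measurable lebesgue) ==> (!!i x. i \<in> S ==> 0 <= f i x) ==> (!!i. i \<in> S ==> 0 <= a i) ==>
   (!!i G A. i \<in> S ==> G \<in> borel_measurable lebesgue ==> (!!x. 0 <= G x) ==> 0 <= A ==>
    (\<integral>\<^sup>+x\<in>cell l i. ennreal (G x powr (1 / (1 - q * rs))) \<partial>lebesgue) <= ennreal A ==>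
    (\<integral>\<^sup>+x\<in>cell l i. ennreal (G x * f i x powr q) \<partial>lebesgue) \<le>
     ennreal (a i powr q * vol (cell l i) powr (1 - 1 / (1 / (1 - q * rs))) * A powr (1 / (1 / (1 - q * rs))))) ==>
   (\<integral>\<^sup>+x. ennreal ((\<Sum>i\<in>S. norm (b x - ctr l b i) ^ (m - k) * f i x * indicator (cell l i) x) powr q * \<sigma> x) \<partial>lebesgue)
    <= ennreal (C * B powr (q * real (m - k)) * (\<Sum>i\<in>S. (a i * \<zeta> k (triple l i)) powr (1 / \<eta> k)) powr (q * \<eta> k))"
proof -
 define t where "t = 1 / (1 - q * rs)"
 define tp where "tp = 1 / (1 - p * rs)"
 define n where "n = m * q * t"
 define \<kappa> where "\<kappa> = 1 - n * e"
 define s where "s = 1 - k / m"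
 have qrs: "0 <= q * rs" using pq rs by simp
 have t: "0 < t" "1 <= t" "1 / t = 1 - q * rs" "t \<noteq> 0" using qrs rs by (auto simp: t_def)
 have n: "0 < n" using pq t by (simp add: n_def)
 have ks: "0 <= s" "s <= 1" using k pq by (auto simp: s_def)
 have "n * e = q * t * (m * e)" by (simp add: n_def)
 then have "\<kappa> = 1 - q * t * (1 / q - 1 / p)" by (simp only: \<kappa>_def me)
 moreover have "t * (1 / t) = 1" using t(4) by simp
 ultimately have "\<kappa> = t * (1 / t) - q * t * (1 / q - 1 / p)" by (simp only:)
 also have "\<dots> = t * (1 / t - 1 + q / p)" using pq by (simp add: algebra_simps)
 also have "\<dots> = t * q * ((1 - p * rs) / p)" using pq by (simp add: t(3) field_simps)
 finally have \<kappa>: "\<kappa> = t * q * ((1 - p * rs) / p)" .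
 have \<kappa>0: "0 < \<kappa>" unfolding \<kappa> using t pq rs by simp
 have tp\<kappa>: "tp * \<kappa> = t * q / p" unfolding \<kappa> tp_def using pq by simp
 have sk: "n * s / (q * t) = real (m - k)" using k pq t by (simp add: n_def s_def field_simps of_nat_diff)
 have ns: "n * s / t = q * real (m - k)" using sk pq t by (simp add: field_simps)
 have v: "0 < 1 / \<eta> k" using \<eta>(1)[OF k] by simp
 have cond: "1 / q = 1 / (1 / \<eta> k) + n * s / (q * t) * e"
  unfolding sk using k me by (simp add: \<eta>_def of_nat_diff algebra_simps)
 have bal: "\<Psi> Q powr n * (h Q powr t * vol Q) <= (g Q powr tp * vol Q) powr \<kappa>" if Q: "Q \<in> cubes" for Q
 proof -
  have "n / (q * m) = t" "n / (p * m) = tp * \<kappa>" unfolding tp\<kappa> using pq by (simp_all add: n_def)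
  from \<Psi>_balance(1)[OF Q this \<kappa>_def] show ?thesis
   using cubes_props(3)[OF Q] by (simp add: powr_mult powr_powr)
 qed
 show ?thesis
 proof (rule sparse_osc_norm[where 'k='k and w=\<sigma> and M="\<lambda>x. \<mu> x powr tp" and \<Psi>=\<Psi>, OF comparable_weights(3)[folded t_def] comparable_weights(1)[folded tp_def] \<sigma>(3,2) n \<kappa>0 \<kappa>_def pq(2) t(2) v ks cond L0(1) \<Psi>_pos bal])
  fix C :: real
  assume C: "0 < C" and main: "!!l (b :: real ^ 'n => 'k) B S J e0 f a. 0 < l ==> loc_integrable b ==> 0 < B ==>
   (!!I. laminar I (cell l) (2 * (1 + L0)) ==> lnorm_le e I (\<lambda>i. tosc l b i / \<Psi> (triple l i)) B) ==>
   finite S ==> (!!i. i \<in> S ==> cell l i \<subseteq> base l) ==> carleson l S L0 ==> J \<subseteq> S ==> e0 \<in> nbs ==>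
   (!!i. i \<in> J ==> f i \<in> borel_measurable lebesgue) ==> (!!i x. i \<in> J ==> 0 <= f i x) ==> (!!i. i \<in> J ==> 0 <= a i) ==>
   (!!i G A. i \<in> J ==> G \<in> borel_measurable lebesgue ==> (!!x. 0 <= G x) ==> 0 <= A ==>
    (\<integral>\<^sup>+x\<in>cell l i. ennreal (G x powr t) \<partial>lebesgue) <= ennreal A ==>
    (\<integral>\<^sup>+x\<in>cell l i. ennreal (G x * f i x powr q) \<partial>lebesgue) \<le>
     ennreal (a i powr q * vol (cell l i) powr (1 - 1 / t) * A powr (1 / t))) ==>
   (\<integral>\<^sup>+x. ennreal ((\<Sum>i\<in>J. rpow (norm (b x - ctr l b (shift e0 i))) (n * s / (q * t)) * f i x * indicator (cell l i) x) powr q * \<sigma> x) \<partial>lebesgue)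
    <= ennreal (C * B powr (n * s / t) * (\<Sum>i\<in>J. (a i * zfac (\<lambda>Q. h Q powr t) (\<lambda>Q. g Q powr tp) \<kappa> s t q l i) powr (1 / \<eta> k)) powr (q / (1 / \<eta> k)))"
 show ?thesis
 proof (rule that[OF C])
  fix l B and S :: "'n idx set" and f a and b :: "real ^ 'n => 'k"
  assume l: "0 < l" and b: "loc_integrable b" "0 < B" "tame l b B" and S: "finite S" "!!i. i \<in> S ==> cell l i \<subseteq> base l" "carleson l S L0"
   and f: "!!i. i \<in> S ==> f i \<in> borel_measurable lebesgue" "!!i x. i \<in> S ==> 0 <= f i x" "!!i. i \<in> S ==> 0 <= (a i :: real)"
   and dual: "!!i G A. i \<in> S ==> G \<in> borel_measurable lebesgue ==> (!!x. 0 <= G x) ==> 0 <= A ==>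
    (\<integral>\<^sup>+x\<in>cell l i. ennreal (G x powr (1 / (1 - q * rs))) \<partial>lebesgue) <= ennreal A ==>
    (\<integral>\<^sup>+x\<in>cell l i. ennreal (G x * f i x powr q) \<partial>lebesgue) \<le>
     ennreal (a i powr q * vol (cell l i) powr (1 - 1 / (1 / (1 - q * rs))) * A powr (1 / (1 / (1 - q * rs))))"
  have sh: "shift 0 i = i" for i :: "'n idx" by (simp add: shift_def)
  have "(\<integral>\<^sup>+x. ennreal ((\<Sum>i\<in>S. norm (b x - ctr l b i) ^ (m - k) * f i x * indicator (cell l i) x) powr q * \<sigma> x) \<partial>lebesgue)
    <= ennreal (C * B powr (q * real (m - k)) * (\<Sum>i\<in>S. (a i * zfac (\<lambda>Q. h Q powr t) (\<lambda>Q. g Q powr tp) \<kappa> s t q l i) powr (1 / \<eta> k)) powr (q * \<eta> k))"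
  proof -
   have "(\<integral>\<^sup>+x. ennreal ((\<Sum>i\<in>S. rpow (norm (b x - ctr l b (shift 0 i))) (n * s / (q * t)) * f i x * indicator (cell l i) x) powr q * \<sigma> x) \<partial>lebesgue)
    <= ennreal (C * B powr (n * s / t) * (\<Sum>i\<in>S. (a i * zfac (\<lambda>Q. h Q powr t) (\<lambda>Q. g Q powr tp) \<kappa> s t q l i) powr (1 / \<eta> k)) powr (q / (1 / \<eta> k)))"
   proof (rule main)
    show "lnorm_le e I (\<lambda>i. tosc l b i / \<Psi> (triple l i)) B" if "laminar I (cell l) (2 * (1 + L0))" for I
     using b(3) that unfolding tame_def by blast
    show "(\<integral>\<^sup>+x\<in>cell l i. ennreal (G x * f i x powr q) \<partial>lebesgue) <= ennreal (a i powr q * vol (cell l i) powr (1 - 1 / t) * A powr (1 / t))"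
     if "i \<in> S" "G \<in> borel_measurable lebesgue" "!!x. 0 <= G x" "0 <= A" "(\<integral>\<^sup>+x\<in>cell l i. ennreal (G x powr t) \<partial>lebesgue) <= ennreal A" for i G A
     by (rule dual[folded t_def, OF that])
   qed (fact l b S f subset_refl zero_nbs)+
   then show ?thesis unfolding sk ns sh by (simp only: rpow_of_nat norm_ge_zero div_by_1 divide_divide_eq_right)
  qed
  also have "\<dots> <= ennreal (C * B powr (q * real (m - k)) * (\<Sum>i\<in>S. (a i * \<zeta> k (triple l i)) powr (1 / \<eta> k)) powr (q * \<eta> k))"
  proof (intro ennreal_leI mult_left_mono powr_mono2 sum_mono sum_nonneg)
   fix i assume i: "i \<in> S"
   note cu = ccell_cubes(2)[OF l, of i]
   have tq: "(1 - 1 / t) / q = rs" using pq t by simp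
   have s1: "1 - s = k / m" by (simp add: s_def)
   have x: "s / p = tp * \<kappa> * s / (t * q)" unfolding tp\<kappa> using pq t by simp
   have y: "k / m / q = t * (1 - s) / (t * q)" using t by (simp add: s1)
   have z: "\<eta> k = (1 - 1 / t) / q + \<kappa> * s / (t * q) + (1 - s) / (t * q)"
   proof -
    have "\<kappa> * s / (t * q) = (1 - p * rs) / p * s" unfolding \<kappa> using pq t by simp
    also have "\<dots> = s / p - rs * s" using pq by (simp add: field_simps)
    finally have A: "\<kappa> * s / (t * q) = s / p - rs * s" .
    have "(1 - s) / (t * q) = (1 - s) * (1 / t) / q" by simp
    also have "\<dots> = (1 - s) / q - rs * (1 - s)" unfolding t(3) using pq by (simp add: field_simps)
    finally have B: "(1 - s) / (t * q) = (1 - s) / q - rs * (1 - s)" .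
    show ?thesis unfolding A B tq \<eta>(3)[OF k] s_def[symmetric] s1[symmetric] by (simp add: algebra_simps)
   qed
   have "zfac (\<lambda>Q. h Q powr t) (\<lambda>Q. g Q powr tp) \<kappa> s t q l i <= g (triple l i) powr (s / p) * h (triple l i) powr (k / m / q) * vol (triple l i) powr \<eta> k"
    using rs by (intro zfac_le[where G=g and F=h, OF l g[OF cu] h[OF cu] t(1) pq(2) _ x y z]) (simp add: tq)
   then show "zfac (\<lambda>Q. h Q powr t) (\<lambda>Q. g Q powr tp) \<kappa> s t q l i <= \<zeta> k (triple l i)" by (simp add: \<zeta>_def s_def)
   show "0 <= a i" by (rule f(3)[OF i])
   show "0 <= a i * zfac (\<lambda>Q. h Q powr t) (\<lambda>Q. g Q powr tp) \<kappa> s t q l i" using f(3)[OF i] by (simp add: zfac_def)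
  qed (use C v \<eta>(1)[OF k] pq in auto)
  finally show "(\<integral>\<^sup>+x. ennreal ((\<Sum>i\<in>S. norm (b x - ctr l b i) ^ (m - k) * f i x * indicator (cell l i) x) powr q * \<sigma> x) \<partial>lebesgue)
    <= ennreal (C * B powr (q * real (m - k)) * (\<Sum>i\<in>S. (a i * \<zeta> k (triple l i)) powr (1 / \<eta> k)) powr (q * \<eta> k))" .
 qed
 qed
qed

text \<open>The dual instance: the exponent is the conjugate \<open>P\<close> of
  \<open>p / r\<close>, the weight is the dual weight of \<open>\<mu>\<close>, and the roles of
  \<open>\<mu>\<close> and \<open>\<sigma>\<close> are exchanged. The local functions are constants
  \<open>\<gamma> i\<close>, so \<open>t = 1\<close>. Now \<open>k / m\<close> is the interpolation
  parameter giving the power \<open>k * r\<close>, and \<open>\<kappa> = P * (1 - r / q)\<close> is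
  positive because \<open>r < q\<close>.\<close>

lemma lower_norm:
 assumes k: "k <= m"
 obtains C where "0 < C" "!!l (b :: real ^ 'n => 'k::euclidean_space) B S J e0 \<gamma>. 0 < l ==> loc_integrable b ==> 0 < B ==> tame l b B ==>
   finite S ==> (!!i. i \<in> S ==> cell l i \<subseteq> base l) ==> carleson l S L0 ==> J \<subseteq> S ==> e0 \<in> nbs ==> (!!i. i \<in> J ==> 0 <= \<gamma> i) ==>
   (\<integral>\<^sup>+x. ennreal ((\<Sum>i\<in>J. rpow (norm (b x - ctr l b (shift e0 i))) (k * r) * \<gamma> i * indicator (cell l i) x) powr (p / (p - r)) * \<mu> x powr (- (r / (p - r)))) \<partial>lebesgue)
    <= ennreal (C * B powr (k * r * (p / (p - r))) * (\<Sum>i\<in>J. (\<gamma> i * (vol (triple l i) * \<zeta> k (triple l i) powr (- r))) powr (1 / (1 - r * \<eta> k))) powr (p / (p - r) * (1 - r * \<eta> k)))"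
proof -
 define P where "P = p / (p - r)"
 define a where "a = r / (p - r)"
 define c where "c = r / (q - r)"
 define n where "n = m * r * P"
 define \<kappa> where "\<kappa> = 1 - n * e"
 define s where "s = k / m"
 have P: "0 < P" "P \<noteq> 0" "1 / P = 1 - r / p" using pq by (auto simp: P_def field_simps)
 have n: "0 < n" using pq P by (simp add: n_def)
 have ks: "0 <= s" "s <= 1" using k pq by (auto simp: s_def)
 have "n * e = r * P * (m * e)" by (simp add: n_def)
 then have "\<kappa> = 1 - r * P * (1 / q - 1 / p)" by (simp only: \<kappa>_def me)
 moreover have "P * (1 / P) = 1" using P(2) by simp
 ultimately have "\<kappa> = P * (1 / P) - r * P * (1 / q - 1 / p)" by (simp only:)
 also have "\<dots> = P * (1 - r / q)" using pq unfolding P(3) by (simp add: algebra_simps)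
 finally have \<kappa>: "\<kappa> = P * (1 - r / q)" .
 have \<kappa>0: "0 < \<kappa>" unfolding \<kappa> using P pq r by simp
 have aP: "a = r / p * P" unfolding a_def P_def using pq by simp
 have c\<kappa>: "c * \<kappa> = r / q * P" unfolding \<kappa> c_def using pq by (simp add: field_simps)
 have sk: "n * s / (P * 1) = k * r" using pq P by (simp add: n_def s_def)
 have ns: "n * s / 1 = k * r * P" using pq by (simp add: n_def s_def)
 have v: "0 < 1 / (1 - r * \<eta> k)" using \<eta>(2)[OF k] by simp
 have cond: "1 / P = 1 / (1 / (1 - r * \<eta> k)) + n * s / (P * 1) * e"
  unfolding sk P(3) by (simp add: \<eta>_def algebra_simps)
 have cW: "comparable (\<lambda>x. (\<mu> x powr (- a)) powr 1) (\<lambda>Q. g Q powr (- a))"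
  using comparable_weights(2) by (simp add: a_def)
 have bal: "\<Psi> Q powr n * (g Q powr (- a) * vol Q) <= (h Q powr (- c) * vol Q) powr \<kappa>" if Q: "Q \<in> cubes" for Q
 proof -
  have "n / (q * m) = c * \<kappa>" "n / (p * m) = a" unfolding c\<kappa> aP using pq by (simp_all add: n_def)
  from \<Psi>_balance(2)[OF Q this \<kappa>_def] show ?thesis
   using cubes_props(3)[OF Q] by (simp add: powr_mult powr_powr)
 qed
 have wm: "(\<lambda>x. \<mu> x powr (- a)) \<in> borel_measurable lebesgue" using \<mu>(3) by measurable
 show ?thesis
 proof (rule sparse_osc_norm[where 'k='k and w="\<lambda>x. \<mu> x powr (- a)" and M="\<lambda>x. \<sigma> x powr (- c)" and \<Psi>=\<Psi>, OF cW comparable_weights(4)[folded c_def] wm powr_ge_zero n \<kappa>0 \<kappa>_def P(1) order_refl v ks cond L0(1) \<Psi>_pos bal])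
  fix C :: real
  assume C: "0 < C" and main: "!!l (b :: real ^ 'n => 'k) B S J e0 f a'. 0 < l ==> loc_integrable b ==> 0 < B ==>
   (!!I. laminar I (cell l) (2 * (1 + L0)) ==> lnorm_le e I (\<lambda>i. tosc l b i / \<Psi> (triple l i)) B) ==>
   finite S ==> (!!i. i \<in> S ==> cell l i \<subseteq> base l) ==> carleson l S L0 ==> J \<subseteq> S ==> e0 \<in> nbs ==>
   (!!i. i \<in> J ==> f i \<in> borel_measurable lebesgue) ==> (!!i x. i \<in> J ==> 0 <= f i x) ==> (!!i. i \<in> J ==> 0 <= a' i) ==>
   (!!i G A. i \<in> J ==> G \<in> borel_measurable lebesgue ==> (!!x. 0 <= G x) ==> 0 <= A ==>
    (\<integral>\<^sup>+x\<in>cell l i. ennreal (G x powr 1) \<partial>lebesgue) <= ennreal A ==>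
    (\<integral>\<^sup>+x\<in>cell l i. ennreal (G x * f i x powr P) \<partial>lebesgue) \<le>
     ennreal (a' i powr P * vol (cell l i) powr (1 - 1 / 1) * A powr (1 / 1))) ==>
   (\<integral>\<^sup>+x. ennreal ((\<Sum>i\<in>J. rpow (norm (b x - ctr l b (shift e0 i))) (n * s / (P * 1)) * f i x * indicator (cell l i) x) powr P * \<mu> x powr (- a)) \<partial>lebesgue)
    <= ennreal (C * B powr (n * s / 1) * (\<Sum>i\<in>J. (a' i * zfac (\<lambda>Q. g Q powr (- a)) (\<lambda>Q. h Q powr (- c)) \<kappa> s 1 P l i) powr (1 / (1 - r * \<eta> k))) powr (P / (1 / (1 - r * \<eta> k))))"
 show ?thesis
 proof (rule that[OF C])
  fix l B and S J :: "'n idx set" and e0 :: "int ^ 'n" and \<gamma> and b :: "real ^ 'n => 'k"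
  assume l: "0 < l" and b: "loc_integrable b" "0 < B" "tame l b B" and S: "finite S" "!!i. i \<in> S ==> cell l i \<subseteq> base l" "carleson l S L0"
   and J: "J \<subseteq> S" "e0 \<in> nbs" and \<gamma>: "!!i. i \<in> J ==> 0 <= (\<gamma> i :: real)"
  let ?I = "\<integral>\<^sup>+x. ennreal ((\<Sum>i\<in>J. rpow (norm (b x - ctr l b (shift e0 i))) (k * r) * \<gamma> i * indicator (cell l i) x) powr P * \<mu> x powr (- a)) \<partial>lebesgue"
  have dual: "(\<integral>\<^sup>+x\<in>cell l i. ennreal (G x * \<gamma> i powr P) \<partial>lebesgue) \<le>
     ennreal (\<gamma> i powr P * vol (cell l i) powr (1 - 1 / 1) * A powr (1 / 1))"
   if i: "i \<in> J" and G: "G \<in> borel_measurable lebesgue" "!!x. 0 <= G x" and A: "0 <= A" "(\<integral>\<^sup>+x\<in>cell l i. ennreal (G x powr 1) \<partial>lebesgue) <= ennreal A"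
   for i :: "'n idx" and G A
  proof -
   note [measurable] = G(1) cell_sets[OF l, of i]
   have "(\<integral>\<^sup>+x\<in>cell l i. ennreal (G x * \<gamma> i powr P) \<partial>lebesgue) = (\<integral>\<^sup>+x. ennreal (\<gamma> i powr P) * (ennreal (G x powr 1) * indicator (cell l i) x) \<partial>lebesgue)"
    using G(2) by (intro nn_integral_cong) (simp add: ennreal_mult[symmetric] mult.commute split: split_indicator)
   also have "\<dots> = ennreal (\<gamma> i powr P) * (\<integral>\<^sup>+x\<in>cell l i. ennreal (G x powr 1) \<partial>lebesgue)"
    by (intro nn_integral_cmult) measurable
   also have "\<dots> <= ennreal (\<gamma> i powr P) * ennreal A" by (intro mult_left_mono A) simp
   also have "\<dots> = ennreal (\<gamma> i powr P * vol (cell l i) powr (1 - 1 / 1) * A powr (1 / 1))"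
    using A measure_cell_pos[OF l, of i] by (simp add: ennreal_mult)
   finally show ?thesis .
  qed
  have "?I <= ennreal (C * B powr (k * r * P) * (\<Sum>i\<in>J. (\<gamma> i * zfac (\<lambda>Q. g Q powr (- a)) (\<lambda>Q. h Q powr (- c)) \<kappa> s 1 P l i) powr (1 / (1 - r * \<eta> k))) powr (P / (1 / (1 - r * \<eta> k))))"
  proof -
   have "(\<integral>\<^sup>+x. ennreal ((\<Sum>i\<in>J. rpow (norm (b x - ctr l b (shift e0 i))) (n * s / (P * 1)) * \<gamma> i * indicator (cell l i) x) powr P * \<mu> x powr (- a)) \<partial>lebesgue)
    <= ennreal (C * B powr (n * s / 1) * (\<Sum>i\<in>J. (\<gamma> i * zfac (\<lambda>Q. g Q powr (- a)) (\<lambda>Q. h Q powr (- c)) \<kappa> s 1 P l i) powr (1 / (1 - r * \<eta> k))) powr (P / (1 / (1 - r * \<eta> k))))"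
   proof (rule main)
    show "lnorm_le e I (\<lambda>i. tosc l b i / \<Psi> (triple l i)) B" if "laminar I (cell l) (2 * (1 + L0))" for I
     using b(3) that unfolding tame_def by blast
    show "(\<lambda>x. \<gamma> i) \<in> borel_measurable lebesgue" for i by simp
   qed (fact l b S J \<gamma> dual)+
   then show ?thesis unfolding sk ns .
  qed
  also have "\<dots> <= ennreal (C * B powr (k * r * P) * (\<Sum>i\<in>J. (\<gamma> i * (vol (triple l i) * \<zeta> k (triple l i) powr (- r))) powr (1 / (1 - r * \<eta> k))) powr (P / (1 / (1 - r * \<eta> k))))"
  proof (intro ennreal_leI mult_left_mono powr_mono2 sum_mono sum_nonneg)
   fix i assume i: "i \<in> J"
   note cu = ccell_cubes(2)[OF l, of i]
   let ?M = "vol (triple l i)"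
   have x: "- (r / q * s) = (- c) * \<kappa> * s / (1 * P)" unfolding minus_mult_left[symmetric] c\<kappa> using P by simp
   have y: "- (r / p * (1 - s)) = (- a) * (1 - s) / (1 * P)" unfolding aP using P by simp
   have z: "1 - r * \<eta> k = (1 - 1 / 1) / P + \<kappa> * s / (1 * P) + (1 - s) / (1 * P)"
   proof -
    have "(1 - s) / (1 * P) = (1 - s) * (1 / P)" by simp
    then show ?thesis unfolding P(3) \<kappa> \<eta>(3)[OF k] s_def[symmetric] using P by (simp add: algebra_simps add_divide_distrib diff_divide_distrib)
   qed
   have "zfac (\<lambda>Q. g Q powr (- a)) (\<lambda>Q. h Q powr (- c)) \<kappa> s 1 P l i <= h (triple l i) powr (- (r / q * s)) * g (triple l i) powr (- (r / p * (1 - s))) * ?M powr (1 - r * \<eta> k)"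
    using P(1) by (intro zfac_le[where G=h and F=g, OF l h[OF cu] g[OF cu] _ P(1) _ x y z]) simp_all
   also have "\<dots> = ?M * \<zeta> k (triple l i) powr (- r)"
   proof -
    have "?M powr (1 - r * \<eta> k) = ?M * ?M powr (- (r * \<eta> k))" using cubes_props(3)[OF cu] powr_add[of ?M 1 "- (r * \<eta> k)"] by simp
    moreover have "\<zeta> k (triple l i) powr (- r) = g (triple l i) powr (- (r / p * (1 - s))) * h (triple l i) powr (- (r / q * s)) * ?M powr (- (r * \<eta> k))"
     by (simp add: \<zeta>_def powr_mult powr_powr s_def mult_ac)
    ultimately show ?thesis by (simp add: mult_ac)
   qed
   finally show "zfac (\<lambda>Q. g Q powr (- a)) (\<lambda>Q. h Q powr (- c)) \<kappa> s 1 P l i <= ?M * \<zeta> k (triple l i) powr (- r)" .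
   show "0 <= \<gamma> i" by (rule \<gamma>[OF i])
   show "0 <= \<gamma> i * zfac (\<lambda>Q. g Q powr (- a)) (\<lambda>Q. h Q powr (- c)) \<kappa> s 1 P l i" using \<gamma>[OF i] by (simp add: zfac_def)
  qed (use C v P in auto)
  finally show "(\<integral>\<^sup>+x. ennreal ((\<Sum>i\<in>J. rpow (norm (b x - ctr l b (shift e0 i))) (k * r) * \<gamma> i * indicator (cell l i) x) powr (p / (p - r)) * \<mu> x powr (- (r / (p - r)))) \<partial>lebesgue)
    <= ennreal (C * B powr (k * r * (p / (p - r))) * (\<Sum>i\<in>J. (\<gamma> i * (vol (triple l i) * \<zeta> k (triple l i) powr (- r))) powr (1 / (1 - r * \<eta> k))) powr (p / (p - r) * (1 - r * \<eta> k)))"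
   by (simp add: P_def a_def)
 qed
 qed
qed

end

lemma sum_powr_le_card:
 fixes z :: "'a => real"
 assumes E: "finite E" and z: "!!e. e \<in> E ==> 0 <= z e" and V: "0 < V"
 shows "(\<Sum>e\<in>E. z e) powr V <= real (card E) powr V * (\<Sum>e\<in>E. z e powr V)"
proof (cases "E = {}")
 case False
 then have "Max (z ` E) \<in> z ` E" using E by (intro Max_in) auto
 then obtain e where e: "e \<in> E" "Max (z ` E) = z e" by auto
 have "(\<Sum>e\<in>E. z e) <= (\<Sum>e'\<in>E. z e)" using E e by (intro sum_mono) (metis Max_ge finite_imageI imageI)
 then have "(\<Sum>e\<in>E. z e) powr V <= (card E * z e) powr V"
  using z V by (intro powr_mono2 sum_nonneg) auto
 also have "\<dots> = card E powr V * z e powr V" by (simp add: powr_mult)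
 also have "\<dots> <= card E powr V * (\<Sum>e\<in>E. z e powr V)"
  using E e by (intro mult_left_mono member_le_sum) auto
 finally show ?thesis .
qed simp

lemma epowr_mono: "x <= y ==> 0 <= a ==> epowr x a <= epowr y a"
proof -
 assume xy: "x <= y" "0 <= a"
 show ?thesis
 proof (cases "y = top")
  case False
  then have "x \<noteq> top" using xy by (auto simp: top_unique)
  moreover have "enn2real x powr a <= enn2real y powr a"
   using xy False by (intro powr_mono2 enn2real_mono) (auto simp: less_top)
  ultimately show ?thesis using False by (simp add: epowr_def ennreal_leI)
 qed (simp add: epowr_def)
qed

text \<open>Fatou's lemma along two limits; the majorised function need not be measurable.\<close>

lemma nn_integral_le_of_cover:
 fixes u :: "nat => nat => 'a => ennreal"
 assumes u: "!!j n. u j n \<in> borel_measurable M" "!!j n. (\<integral>\<^sup>+x. u j n x \<partial>M) <= K"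
  and F: "!!j. AE x in M. x \<in> X j --> (\<forall>\<^sub>F n in sequentially. F x <= u j n x)"
  and X: "!!x. \<forall>\<^sub>F j in sequentially. x \<in> X j"
 shows "(\<integral>\<^sup>+x. F x \<partial>M) <= K"
proof -
 define v where "v j x = liminf (\<lambda>n. u j n x)" for j x
 have v: "v j \<in> borel_measurable M" for j unfolding v_def using u(1) by measurable
 have vK: "(\<integral>\<^sup>+x. v j x \<partial>M) <= K" for j
 proof -
  have "(\<integral>\<^sup>+x. v j x \<partial>M) <= liminf (\<lambda>n. \<integral>\<^sup>+x. u j n x \<partial>M)" unfolding v_def by (rule nn_integral_liminf[OF u(1)])
  also have "\<dots> <= limsup (\<lambda>n. \<integral>\<^sup>+x. u j n x \<partial>M)" by (rule Liminf_le_Limsup) simp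
  also have "\<dots> <= K" using u(2) by (intro Limsup_bounded) auto
  finally show ?thesis .
 qed
 have "AE x in M. \<forall>j. x \<in> X j --> (\<forall>\<^sub>F n in sequentially. F x <= u j n x)" using F by (simp add: AE_all_countable)
 then have "AE x in M. F x <= liminf (\<lambda>j. v j x)"
 proof eventually_elim
  case (elim x)
  show ?case
  proof (rule Liminf_bounded)
   show "\<forall>\<^sub>F j in sequentially. F x <= v j x"
    using X[of x]
   proof eventually_elim
    case (elim j)
    then show ?case unfolding v_def using \<open>\<forall>j. x \<in> X j --> (\<forall>\<^sub>F n in sequentially. F x <= u j n x)\<close> by (intro Liminf_bounded) blast
   qed
  qed
 qed
 then have "(\<integral>\<^sup>+x. F x \<partial>M) <= (\<integral>\<^sup>+x. liminf (\<lambda>j. v j x) \<partial>M)" by (rule nn_integral_mono_AE)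
 also have "\<dots> <= liminf (\<lambda>j. \<integral>\<^sup>+x. v j x \<partial>M)" by (rule nn_integral_liminf[OF v])
 also have "\<dots> <= limsup (\<lambda>j. \<integral>\<^sup>+x. v j x \<partial>M)" by (rule Liminf_le_Limsup) simp
 also have "\<dots> <= K" using vK by (intro Limsup_bounded) auto
 finally show ?thesis .
qed

lemma carleson_subset:
 fixes S S' :: "('n::finite) idx set"
 assumes l: "0 < l" and S: "carleson l S L" "S' \<subseteq> S"
 shows "carleson l S' L"
 unfolding carleson_def
proof (intro allI)
 fix Q :: "'n idx" and n
 have "(\<Sum>i\<in>{i\<in>S'. fst i <= n \<and> cell l i \<subseteq> cell l Q}. vol (cell l i)) <= (\<Sum>i\<in>{i\<in>S. fst i <= n \<and> cell l i \<subseteq> cell l Q}. vol (cell l i))"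
 proof (rule sum_mono2)
  show "finite {i\<in>S. fst i <= n \<and> cell l i \<subseteq> cell l Q}" by (rule finite_subset[OF _ finite_cells_below[OF l, of n Q]]) auto
 qed (use S in auto)
 also have "\<dots> <= L * vol (cell l Q)" using S(1) unfolding carleson_def by blast
 finally show "(\<Sum>i\<in>{i\<in>S'. fst i <= n \<and> cell l i \<subseteq> cell l Q}. vol (cell l i)) <= L * vol (cell l Q)" .
qed

section \<open>Duality and the embedding of averages\<close>

context bloom begin

definition family :: "real => 'n idx set => bool"
 where "family l S \<longleftrightarrow> finite S \<and> (\<forall>i\<in>S. cell l i \<subseteq> base l) \<and> carleson l S L0"

text \<open>Hoelder for the exponent \<open>p / r\<close> and its conjugate, after inserting
  \<open>\<mu> powr (r / p)\<close> and its inverse, which is possible almost everywhere.\<close>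

lemma pairing:
 assumes F: "F \<in> borel_measurable lebesgue" "!!x. 0 <= F x" and X: "X \<in> borel_measurable lebesgue" "!!x. 0 <= X x"
  and A: "0 <= A" "(\<integral>\<^sup>+x. ennreal (F x powr (p / r) * \<mu> x) \<partial>lebesgue) <= ennreal A"
  and D: "0 <= D" "(\<integral>\<^sup>+x. ennreal (X x powr (p / (p - r)) * \<mu> x powr (- (r / (p - r)))) \<partial>lebesgue) <= ennreal D"
 shows "(\<integral>\<^sup>+x. ennreal (F x * X x) \<partial>lebesgue) <= ennreal (A powr (r / p) * D powr (1 - r / p))"
proof -
 note [measurable] = F(1) X(1) \<mu>(3)
 have "(\<integral>\<^sup>+x. ennreal (F x * X x) \<partial>lebesgue) = (\<integral>\<^sup>+x. ennreal ((F x powr (p / r) * \<mu> x) powr (r / p) *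
   (X x powr (p / (p - r)) * \<mu> x powr (- (r / (p - r)))) powr (1 - r / p)) \<partial>lebesgue)"
 proof (rule nn_integral_cong_AE)
  show "AE x in lebesgue. ennreal (F x * X x) = ennreal ((F x powr (p / r) * \<mu> x) powr (r / p) *
   (X x powr (p / (p - r)) * \<mu> x powr (- (r / (p - r)))) powr (1 - r / p))"
   using \<mu>(1)
  proof eventually_elim
   case (elim x)
   have c: "1 - r / p = (p - r) / p" using pq by (simp add: diff_divide_distrib)
   have e1: "p / r * (r / p) = 1" "p / (p - r) * (1 - r / p) = 1" "r / (p - r) * (1 - r / p) = r / p" unfolding c using pq by simp_all
   have 1: "(F x powr (p / r) * \<mu> x) powr (r / p) = F x * \<mu> x powr (r / p)"
    unfolding powr_mult powr_powr e1 using F(2)[of x] by simp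
   have 2: "(X x powr (p / (p - r)) * \<mu> x powr (- (r / (p - r)))) powr (1 - r / p) = X x * \<mu> x powr (- (r / p))"
    unfolding powr_mult powr_powr minus_mult_left[symmetric] e1 using X(2)[of x] by simp
   have 3: "\<mu> x powr (r / p) * \<mu> x powr (- (r / p)) = 1" using elim by (simp add: powr_add[symmetric])
   have "F x * \<mu> x powr (r / p) * (X x * \<mu> x powr (- (r / p))) = F x * X x * (\<mu> x powr (r / p) * \<mu> x powr (- (r / p)))" by (simp only: mult_ac)
   then have "F x * \<mu> x powr (r / p) * (X x * \<mu> x powr (- (r / p))) = F x * X x" by (simp only: 3 mult_1_right)
   then show ?case by (simp only: 1 2)
  qed
 qed
 also have "\<dots> <= ennreal (A powr (r / p) * D powr (1 - r / p))"
  using r pq \<mu>(2) by (intro nn_integral_Hoelder A D mult_nonneg_nonneg powr_ge_zero) auto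
 finally show ?thesis .
qed

text \<open>Pairing \<open>F\<close> with the sums of \<open>lower_norm\<close> bounds all linear
  functionals of the sequence of integrals over cells. The extremal choice of the coefficients
  \<open>\<gamma>\<close> turns this into the norm with exponent \<open>1 / (r * \<eta> k)\<close>,
  and the bound itself shows that each integral is finite.\<close>

lemma pair_sum:
 assumes k: "k <= m"
 shows "\<exists>C>0. \<forall>l (b :: real ^ 'n => 'k::euclidean_space) B S J (e0 :: int ^ 'n) F A. 0 < l --> loc_integrable b --> 0 < B --> tame l b B -->
  family l S --> J \<subseteq> S --> e0 \<in> nbs --> F \<in> borel_measurable lebesgue --> (\<forall>x. 0 <= F x) --> 0 <= A -->
  (\<integral>\<^sup>+x. ennreal (F x powr (p / r) * \<mu> x) \<partial>lebesgue) <= ennreal A -->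
  (\<forall>i\<in>J. (\<integral>\<^sup>+x\<in>cell l i. ennreal (F x * rpow (norm (b x - ctr l b (shift e0 i))) (k * r)) \<partial>lebesgue) < \<infinity>) \<and>
  (\<Sum>i\<in>J. (enn2real (\<integral>\<^sup>+x\<in>cell l i. ennreal (F x * rpow (norm (b x - ctr l b (shift e0 i))) (k * r)) \<partial>lebesgue) *
    (\<zeta> k (triple l i) powr r / vol (triple l i))) powr (1 / (r * \<eta> k)))
   <= (C * B powr (k * r) * A powr (r / p)) powr (1 / (r * \<eta> k))"
proof (rule lower_norm[where 'k='k, OF k])
 fix C0 :: real
 assume C0: "0 < C0" and main: "!!l (b :: real ^ 'n => 'k) B S J e0 \<gamma>. 0 < l ==> loc_integrable b ==> 0 < B ==> tame l b B ==>
   finite S ==> (!!i. i \<in> S ==> cell l i \<subseteq> base l) ==> carleson l S L0 ==> J \<subseteq> S ==> e0 \<in> nbs ==> (!!i. i \<in> J ==> 0 <= \<gamma> i) ==>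
   (\<integral>\<^sup>+x. ennreal ((\<Sum>i\<in>J. rpow (norm (b x - ctr l b (shift e0 i))) (k * r) * \<gamma> i * indicator (cell l i) x) powr (p / (p - r)) * \<mu> x powr (- (r / (p - r)))) \<partial>lebesgue)
    <= ennreal (C0 * B powr (k * r * (p / (p - r))) * (\<Sum>i\<in>J. (\<gamma> i * (vol (triple l i) * \<zeta> k (triple l i) powr (- r))) powr (1 / (1 - r * \<eta> k))) powr (p / (p - r) * (1 - r * \<eta> k)))"
 define C where "C = C0 powr (1 - r / p)"
 have C: "0 < C" using C0 by (simp add: C_def)
 show ?thesis
 proof (intro exI[of _ C] conjI C allI impI)
  fix l B A :: real and b :: "real ^ 'n => 'k" and S J :: "'n idx set" and e0 :: "int ^ 'n" and F :: "real ^ 'n => real"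
  assume l: "0 < l" and b: "loc_integrable b" "0 < B" "tame l b B" and S: "family l S" "J \<subseteq> S" "e0 \<in> nbs"
   and F: "F \<in> borel_measurable lebesgue" "\<forall>x. 0 <= F x" and A: "0 <= A" "(\<integral>\<^sup>+x. ennreal (F x powr (p / r) * \<mu> x) \<partial>lebesgue) <= ennreal A"
  note [measurable] = F(1) loc_integrable_measurable[OF b(1)]
  have cm [measurable]: "cell l i \<in> sets lebesgue" for i :: "'n idx" by (rule cell_sets[OF l])
  have S1: "finite S" and S3: "carleson l S L0" using S(1) by (simp_all add: family_def)
  have S2: "!!i. i \<in> S ==> cell l i \<subseteq> base l" using S(1) by (simp add: family_def)
  have finJ: "finite J" using S finite_subset unfolding family_def by blast
  define \<rho> where "\<rho> i x = rpow (norm (b x - ctr l b (shift e0 i))) (k * r)" for i :: "'n idx" and x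
  have \<rho>0: "0 <= \<rho> i x" for i x by (simp add: \<rho>_def)
  have \<rho>m [measurable]: "\<rho> i \<in> borel_measurable lebesgue" for i unfolding \<rho>_def by measurable
  define Y where "Y i = (\<integral>\<^sup>+x\<in>cell l i. ennreal (F x * \<rho> i x) \<partial>lebesgue)" for i :: "'n idx"
  define w where "w i = \<zeta> k (triple l i) powr r / vol (triple l i)" for i :: "'n idx"
  have w: "0 < w i" "vol (triple l i) * \<zeta> k (triple l i) powr (- r) = 1 / w i" for i :: "'n idx"
   using \<zeta>_pos[OF ccell_cubes(2)[OF l, of i], of k] cubes_props(3)[OF ccell_cubes(2)[OF l, of i]] by (simp_all add: w_def powr_minus_divide)
  define v where "v = 1 - r * \<eta> k"
  have v: "0 < v" "v < 1" using \<eta>[OF k] pq by (simp_all add: v_def)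
  define D where "D = A powr (r / p) * (C * B powr (k * r))"
  have D0: "0 <= D" using C by (simp add: D_def)
  have pair: "(\<Sum>i\<in>J. ennreal (\<gamma> i) * Y i) <= ennreal (D * (\<Sum>i\<in>J. (\<gamma> i * (1 / w i)) powr (1 / v)) powr v)"
   if \<gamma>: "!!i. i \<in> J ==> 0 <= \<gamma> i" for \<gamma> :: "'n idx => real"
  proof -
   let ?X = "\<lambda>x. \<Sum>i\<in>J. \<rho> i x * \<gamma> i * indicator (cell l i) x"
   let ?\<Sigma> = "\<Sum>i\<in>J. (\<gamma> i * (1 / w i)) powr (1 / v)"
   let ?D = "C0 * B powr (k * r * (p / (p - r))) * ?\<Sigma> powr (p / (p - r) * v)"
   have X: "?X \<in> borel_measurable lebesgue" by measurable
   have X0: "0 <= ?X x" for x using \<gamma> \<rho>0 by (intro sum_nonneg mult_nonneg_nonneg) auto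
   have "(\<Sum>i\<in>J. ennreal (\<gamma> i) * Y i) = (\<integral>\<^sup>+x. (\<Sum>i\<in>J. ennreal (\<gamma> i) * (ennreal (F x * \<rho> i x) * indicator (cell l i) x)) \<partial>lebesgue)"
   proof -
    have "ennreal (\<gamma> i) * Y i = (\<integral>\<^sup>+x. ennreal (\<gamma> i) * (ennreal (F x * \<rho> i x) * indicator (cell l i) x) \<partial>lebesgue)" for i
     unfolding Y_def by (rule nn_integral_cmult[symmetric]) measurable
    then have "(\<Sum>i\<in>J. ennreal (\<gamma> i) * Y i) = (\<Sum>i\<in>J. (\<integral>\<^sup>+x. ennreal (\<gamma> i) * (ennreal (F x * \<rho> i x) * indicator (cell l i) x) \<partial>lebesgue))" by simp
    also have "\<dots> = (\<integral>\<^sup>+x. (\<Sum>i\<in>J. ennreal (\<gamma> i) * (ennreal (F x * \<rho> i x) * indicator (cell l i) x)) \<partial>lebesgue)"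
     by (rule nn_integral_sum[symmetric]) measurable
    finally show ?thesis .
   qed
   also have "\<dots> = (\<integral>\<^sup>+x. ennreal (F x * ?X x) \<partial>lebesgue)"
   proof (rule nn_integral_cong)
    fix x
    have "ennreal (F x * ?X x) = ennreal (\<Sum>i\<in>J. F x * (\<rho> i x * \<gamma> i * indicator (cell l i) x))" by (simp only: sum_distrib_left)
    also have "\<dots> = (\<Sum>i\<in>J. ennreal (F x * (\<rho> i x * \<gamma> i * indicator (cell l i) x)))"
     using F(2) \<gamma> \<rho>0 by (intro sum_ennreal[symmetric] mult_nonneg_nonneg) auto
    also have "\<dots> = (\<Sum>i\<in>J. ennreal (\<gamma> i) * (ennreal (F x * \<rho> i x) * indicator (cell l i) x))"
     using F(2) \<gamma> \<rho>0 by (intro sum.cong refl) (auto simp: ennreal_mult[symmetric] mult_ac split: split_indicator)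
    finally show "(\<Sum>i\<in>J. ennreal (\<gamma> i) * (ennreal (F x * \<rho> i x) * indicator (cell l i) x)) = ennreal (F x * ?X x)" by simp
   qed
   also have "\<dots> <= ennreal (A powr (r / p) * ?D powr (1 - r / p))"
   proof (rule pairing[OF F(1) _ X X0 A])
    show "0 <= F x" for x using F(2) by simp
    show "0 <= ?D" using C0 by simp
    show "(\<integral>\<^sup>+x. ennreal (?X x powr (p / (p - r)) * \<mu> x powr (- (r / (p - r)))) \<partial>lebesgue) <= ennreal ?D"
     unfolding \<rho>_def v_def w(2)[symmetric] by (rule main[OF l b S1 S2 S3 S(2,3) \<gamma>])
   qed
   also have "A powr (r / p) * ?D powr (1 - r / p) = D * ?\<Sigma> powr v"
   proof -
    have c: "1 - r / p = (p - r) / p" using pq by (simp add: diff_divide_distrib)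
    have e1: "k * r * (p / (p - r)) * (1 - r / p) = k * r" "p / (p - r) * v * (1 - r / p) = v" unfolding c using pq by simp_all
    show ?thesis unfolding D_def C_def powr_mult powr_powr e1 by (simp only: mult_ac)
   qed
   finally show ?thesis .
  qed
  \<comment> \<open>Finiteness comes from a unit sequence. It has to precede the extremal choice,
    which uses the real values of these integrals.\<close>
  have fin: "Y i < \<infinity>" if i: "i \<in> J" for i
  proof -
   let ?\<gamma> = "\<lambda>j. if j = i then 1 else (0::real)"
   have "Y i = ennreal (?\<gamma> i) * Y i" by simp
   also have "\<dots> <= (\<Sum>j\<in>J. ennreal (?\<gamma> j) * Y j)" using finJ i by (intro member_le_sum) auto
   also have "\<dots> <= ennreal (D * (\<Sum>j\<in>J. (?\<gamma> j * (1 / w j)) powr (1 / v)) powr v)" by (rule pair) simp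
   also have "\<dots> < \<infinity>" by simp
   finally show ?thesis .
  qed
  define V where "V = 1 / (r * \<eta> k)"
  have rV: "r * \<eta> k = 1 - v" "0 < 1 - v" "V = 1 / (1 - v)" "0 < V" using v by (simp_all add: v_def V_def)
  have Vv: "(V - 1) * (1 / v) = V" "(1 - v) * V = 1" "1 + (V - 1) = V"
  proof -
   have "V - 1 = v / (1 - v)" using rV(2) unfolding rV(3) by (simp add: field_simps)
   then show "(V - 1) * (1 / v) = V" using v unfolding rV(3) by simp
   show "(1 - v) * V = 1" using rV(2) unfolding rV(3) by simp
  qed simp
  define y where "y i = enn2real (Y i) * w i" for i
  have y0: "0 <= y i" for i using w(1)[of i] by (simp add: y_def)
  define X where "X = (\<Sum>i\<in>J. y i powr V)"
  have X0: "0 <= X" by (simp add: X_def sum_nonneg)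
  \<comment> \<open>The equality case of Hoelder: with these coefficients both sides are expressed
    by \<open>X\<close>, and \<open>X <= D * X powr v\<close> is solved for the finite
    \<open>X\<close>.\<close>
  have "(\<Sum>i\<in>J. ennreal (y i powr (V - 1) * w i) * Y i) <= ennreal (D * (\<Sum>i\<in>J. (y i powr (V - 1) * w i * (1 / w i)) powr (1 / v)) powr v)"
   using w(1) by (intro pair) (simp add: less_imp_le)
  moreover have "(\<Sum>i\<in>J. ennreal (y i powr (V - 1) * w i) * Y i) = ennreal X"
  proof -
   have "ennreal (y i powr (V - 1) * w i) * Y i = ennreal (y i powr V)" if i: "i \<in> J" for i
   proof -
    have Yi: "Y i = ennreal (enn2real (Y i))" using fin[OF i] by simp
    have "ennreal (y i powr (V - 1) * w i) * Y i = ennreal (y i powr (V - 1) * w i * enn2real (Y i))"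
     using w(1)[of i] by (subst Yi) (simp add: ennreal_mult'')
    also have "y i powr (V - 1) * w i * enn2real (Y i) = y i * y i powr (V - 1)" by (simp add: y_def mult_ac)
    also have "\<dots> = y i powr V" unfolding powr_mult_base[OF y0] Vv(3) ..
    finally show ?thesis .
   qed
   then show ?thesis by (simp add: X_def sum_ennreal)
  qed
  moreover have "(\<Sum>i\<in>J. (y i powr (V - 1) * w i * (1 / w i)) powr (1 / v)) = X"
  proof -
   have "(y i powr (V - 1) * w i * (1 / w i)) powr (1 / v) = y i powr V" for i
   proof -
    have "y i powr (V - 1) * w i * (1 / w i) = y i powr (V - 1)" using w(1)[of i] by simp
    then show ?thesis by (simp only: powr_powr Vv(1))
   qed
   then show ?thesis by (simp add: X_def)
  qed
  ultimately have "ennreal X <= ennreal (D * X powr v)" by simp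
  then have XD: "X <= D * X powr v" using D0 by (subst (asm) ennreal_le_iff) auto
  have "X <= D powr V"
  proof (cases "X = 0")
   case False
   then have Xp: "0 < X" using X0 by simp
   have "X powr (1 - v) * X powr v = X" using Xp by (simp add: powr_add[symmetric])
   then have "X powr (1 - v) * X powr v <= D * X powr v" using XD by simp
   then have "X powr (1 - v) <= D" using Xp by simp
   then have "(X powr (1 - v)) powr V <= D powr V" using rV(4) by (intro powr_mono2) auto
   then show ?thesis using Xp unfolding powr_powr Vv(2) by simp
  qed simp
  then have "X <= (C * B powr (k * r) * A powr (r / p)) powr V" by (simp add: D_def mult_ac)
  then show "(\<Sum>i\<in>J. (enn2real (\<integral>\<^sup>+x\<in>cell l i. ennreal (F x * rpow (norm (b x - ctr l b (shift e0 i))) (k * r)) \<partial>lebesgue) *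
    (\<zeta> k (triple l i) powr r / vol (triple l i))) powr (1 / (r * \<eta> k)))
   <= (C * B powr (k * r) * A powr (r / p)) powr (1 / (r * \<eta> k))"
   unfolding X_def y_def Y_def w_def \<rho>_def V_def .
  show "\<forall>i\<in>J. (\<integral>\<^sup>+x\<in>cell l i. ennreal (F x * rpow (norm (b x - ctr l b (shift e0 i))) (k * r)) \<partial>lebesgue) < \<infinity>"
   using fin unfolding Y_def \<rho>_def by blast
 qed
qed

lemma \<zeta>_neighbours:
 assumes k: "k <= m"
 shows "\<exists>c>0. \<forall>l (e0 :: int ^ 'n) i. 0 < l --> e0 \<in> nbs --> \<zeta> k (triple l i) <= c * \<zeta> k (triple l (shift e0 i))"
proof -
 define tp where "tp = 1 / (1 - p * rs)"
 define tq where "tq = 1 / (1 - q * rs)"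
 have t: "0 < tp" "0 < tq" using rs by (simp_all add: tp_def tq_def)
 obtain c1 where c1: "0 < c1" "!!l e0 i. 0 < l ==> e0 \<in> nbs ==> g (triple l i) powr tp <= c1 * g (triple l (shift e0 i)) powr tp"
  using comparable_neighbours[OF comparable_weights(1)] unfolding tp_def by blast
 obtain c2 where c2: "0 < c2" "!!l e0 i. 0 < l ==> e0 \<in> nbs ==> h (triple l i) powr tq <= c2 * h (triple l (shift e0 i)) powr tq"
  using comparable_neighbours[OF comparable_weights(3)] unfolding tq_def by blast
 define x where "x = (1 - k / m) / p"
 define y where "y = k / m / q"
 have xy: "0 <= x" "0 <= y" using k pq by (simp_all add: x_def y_def)
 have pw: "X powr z <= c powr (z / t') * X' powr z" if "X powr t' <= c * X' powr t'" "0 < t'" "0 <= z" for X X' c z t' :: real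
 proof -
  have "(X powr t') powr (z / t') <= (c * X' powr t') powr (z / t')" using that by (intro powr_mono2) auto
  then show ?thesis using that(2) by (simp add: powr_mult powr_powr)
 qed
 have "\<zeta> k (triple l i) <= (c1 powr (x / tp) * c2 powr (y / tq)) * \<zeta> k (triple l (shift e0 i))" if l: "0 < l" and e0: "e0 \<in> nbs" for l and e0 :: "int ^ 'n" and i
 proof -
  have "g (triple l i) powr x * h (triple l i) powr y <= (c1 powr (x / tp) * g (triple l (shift e0 i)) powr x) * (c2 powr (y / tq) * h (triple l (shift e0 i)) powr y)"
   by (intro mult_mono pw c1(2)[OF l e0] c2(2)[OF l e0] t xy) auto
  then have "g (triple l i) powr x * h (triple l i) powr y * vol (triple l i) powr \<eta> k \<le>
   (c1 powr (x / tp) * g (triple l (shift e0 i)) powr x) * (c2 powr (y / tq) * h (triple l (shift e0 i)) powr y) * vol (triple l i) powr \<eta> k"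
   by (intro mult_right_mono) auto
  moreover have "vol (triple l (shift e0 i)) = vol (triple l i)" by (simp only: measure_triple[OF l] measure_shift[OF l])
  ultimately show ?thesis unfolding \<zeta>_def x_def[symmetric] y_def[symmetric] by (simp only: mult_ac)
 qed
 moreover have "0 < c1 powr (x / tp) * c2 powr (y / tq)" using c1(1) c2(1) by simp
 ultimately show ?thesis by blast
qed

definition avf :: "real => (real ^ 'n => 'k::{real_normed_field, euclidean_space}) => (real ^ 'n => 'k) => 'n idx => nat => real"
 where "avf l b f i k = (enn2real (\<integral>\<^sup>+x\<in>triple l i. ennreal (norm ((ctr l b i - b x) ^ k * f x) powr r) \<partial>lebesgue) / vol (triple l i)) powr (1 / r)"

text \<open>An average over a triple is cut into integrals over the neighbouring cells, with the
  centre kept at \<open>i\<close>. Seen from a neighbour, the centre is that of a shifted cell,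
  which is the case provided for in \<open>pair_sum\<close>; hence the family formed by all shifts
  of \<open>S\<close> has to be sparse. The values of \<open>\<zeta>\<close> at neighbours are
  comparable.\<close>

lemma embedding:
 assumes k: "k <= m"
 shows "\<exists>C>0. \<forall>l (b :: real ^ 'n => 'k::{real_normed_field, euclidean_space}) B S f A. 0 < l --> loc_integrable b --> 0 < B --> tame l b B -->
  finite S --> family l (\<Union>e0\<in>nbs. shift e0 ` S) --> f \<in> borel_measurable lebesgue --> 0 <= A -->
  (\<integral>\<^sup>+x. ennreal (norm (f x) powr p * \<mu> x) \<partial>lebesgue) <= ennreal A -->
  (\<Sum>i\<in>S. (avf l b f i k * \<zeta> k (triple l i)) powr (1 / \<eta> k)) <= (C * B ^ k * A powr (1 / p)) powr (1 / \<eta> k)"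
proof -
 let ?E = "nbs :: (int ^ 'n) set"
 define V where "V = 1 / (r * \<eta> k)"
 have \<eta>0: "0 < \<eta> k" by (rule \<eta>(1)[OF k])
 have V: "0 < V" "r * V = 1 / \<eta> k" "1 / r * (1 / \<eta> k) = V" using pq \<eta>0 by (simp_all add: V_def)
 obtain C1 where C1: "0 < C1" "!!l (b :: real ^ 'n => 'k) B S J (e0 :: int ^ 'n) F A. 0 < l ==> loc_integrable b ==> 0 < B ==> tame l b B ==>
  family l S ==> J \<subseteq> S ==> e0 \<in> nbs ==> F \<in> borel_measurable lebesgue ==> (\<forall>x. 0 <= F x) ==> 0 <= A ==>
  (\<integral>\<^sup>+x. ennreal (F x powr (p / r) * \<mu> x) \<partial>lebesgue) <= ennreal A ==>
  (\<forall>i\<in>J. (\<integral>\<^sup>+x\<in>cell l i. ennreal (F x * rpow (norm (b x - ctr l b (shift e0 i))) (k * r)) \<partial>lebesgue) < \<infinity>) \<and>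
  (\<Sum>i\<in>J. (enn2real (\<integral>\<^sup>+x\<in>cell l i. ennreal (F x * rpow (norm (b x - ctr l b (shift e0 i))) (k * r)) \<partial>lebesgue) *
    (\<zeta> k (triple l i) powr r / vol (triple l i))) powr V)
   <= (C1 * B powr (k * r) * A powr (r / p)) powr V"
  using pair_sum[where 'k='k, OF k] unfolding V_def by (elim exE conjE) blast
 obtain c where c: "0 < c" "!!l (e0 :: int ^ 'n) i. 0 < l ==> e0 \<in> nbs ==> \<zeta> k (triple l i) <= c * \<zeta> k (triple l (shift e0 i))"
  using \<zeta>_neighbours[OF k] by blast
 define N where "N = real (card ?E)"
 have N: "0 < N" using finite_nbs zero_nbs[where 'a='n] by (auto simp: N_def card_gt_0_iff)
 define M where "M = (c powr r) powr V * N powr V * N"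
 have M: "0 < M" using c(1) N by (simp add: M_def)
 define C where "C = M powr \<eta> k * C1 powr (1 / r)"
 have C: "0 < C" using M C1(1) by (simp add: C_def)
 show ?thesis
 proof (intro exI[of _ C] conjI C allI impI)
  fix l B A :: real and b f :: "real ^ 'n => 'k" and S :: "'n idx set"
  assume l: "0 < l" and b: "loc_integrable b" "0 < B" "tame l b B" and S: "finite S" "family l (\<Union>e0\<in>nbs. shift e0 ` S)"
   and f: "f \<in> borel_measurable lebesgue" and A: "0 <= A" "(\<integral>\<^sup>+x. ennreal (norm (f x) powr p * \<mu> x) \<partial>lebesgue) <= ennreal A"
  note [measurable] = f loc_integrable_measurable[OF b(1)]
  have cm [measurable]: "cell l i \<in> sets lebesgue" for i :: "'n idx" by (rule cell_sets[OF l])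
  define F where "F x = norm (f x) powr r" for x
  have Fm [measurable]: "F \<in> borel_measurable lebesgue" unfolding F_def by measurable
  have FA: "(\<integral>\<^sup>+x. ennreal (F x powr (p / r) * \<mu> x) \<partial>lebesgue) <= ennreal A"
   using A(2) pq by (simp add: F_def powr_powr)
  define Y where "Y e0 i = (\<integral>\<^sup>+x\<in>cell l (shift e0 i). ennreal (F x * rpow (norm (b x - ctr l b i)) (k * r)) \<partial>lebesgue)" for e0 :: "int ^ 'n" and i
  let ?T = "\<lambda>i :: 'n idx. vol (triple l i)"
  define D where "D = (C1 * B powr (k * r) * A powr (r / p)) powr V"
  define z where "z e0 i = enn2real (Y e0 i) * (\<zeta> k (triple l (shift e0 i)) powr r / ?T i)" for e0 :: "int ^ 'n" and i
  have T: "0 < ?T i" "?T (shift e0 i) = ?T i" for i e0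
   using cubes_props(3)[OF ccell_cubes(2)[OF l, of i]] by (simp_all only: measure_triple[OF l] measure_shift[OF l])
  have z0: "0 <= z e0 i" for e0 i using T(1)[of i] by (simp add: z_def)
  have Yz: "(\<forall>i\<in>S. Y e0 i < \<infinity>) \<and> (\<Sum>i\<in>S. z e0 i powr V) <= D" if e0: "e0 \<in> nbs" for e0
  proof -
   have sub: "shift e0 ` S \<subseteq> (\<Union>e0\<in>nbs. shift e0 ` S)" using e0 by blast
   have inj: "inj_on (shift e0) S" by (rule inj_onI) (rule cell_shift_inj)
   have F0: "\<forall>x. 0 <= F x" by (simp add: F_def)
   show ?thesis
    using C1(2)[OF l b S(2) sub uminus_nbs[OF e0] Fm F0 A(1) FA]
    unfolding sum.reindex[OF inj] o_def ball_simps shift_uminus(2) D_def z_def Y_def T(2) by simp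
  qed
  have Yfin: "Y e0 i < \<infinity>" if "e0 \<in> nbs" "i \<in> S" for e0 i using Yz[OF that(1)] that(2) by blast
  have bnd: "(avf l b f i k * \<zeta> k (triple l i)) powr (1 / \<eta> k) <= (c powr r) powr V * (N powr V * (\<Sum>e0\<in>nbs. z e0 i powr V))" if i: "i \<in> S" for i
  proof -
   let ?I = "\<integral>\<^sup>+x\<in>triple l i. ennreal (norm ((ctr l b i - b x) ^ k * f x) powr r) \<partial>lebesgue"
   have pt: "norm ((ctr l b i - b x) ^ k * f x) powr r = F x * rpow (norm (b x - ctr l b i)) (k * r)" for x
    using r by (simp add: F_def norm_mult norm_power powr_mult rpow_power norm_minus_commute mult.commute)
   have "?I <= (\<integral>\<^sup>+x. (\<Sum>e0\<in>nbs. ennreal (F x * rpow (norm (b x - ctr l b i)) (k * r)) * indicator (cell l (shift e0 i)) x) \<partial>lebesgue)"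
   proof (rule nn_integral_mono_AE)
    show "AE x in lebesgue. ennreal (norm ((ctr l b i - b x) ^ k * f x) powr r) * indicator (triple l i) x \<le>
     (\<Sum>e0\<in>nbs. ennreal (F x * rpow (norm (b x - ctr l b i)) (k * r)) * indicator (cell l (shift e0 i)) x)"
     using AE_triple_cells[OF l, of i]
    proof eventually_elim
     case (elim x)
     show ?case
     proof (cases "x \<in> triple l i")
     case True
     then obtain e0 where e0: "e0 \<in> nbs" "x \<in> cell l (shift e0 i)" using elim by blast
     have "ennreal (F x * rpow (norm (b x - ctr l b i)) (k * r)) * indicator (cell l (shift e0 i)) x \<le>
     (\<Sum>e0\<in>nbs. ennreal (F x * rpow (norm (b x - ctr l b i)) (k * r)) * indicator (cell l (shift e0 i)) x)"
     by (rule member_le_sum[OF e0(1)]) (auto simp: finite_nbs)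
     then show ?thesis using True e0 by (simp add: pt)
     qed simp
    qed
   qed
   also have "\<dots> = (\<Sum>e0\<in>nbs. Y e0 i)" unfolding Y_def by (rule nn_integral_sum) measurable
   also have "\<dots> = (\<Sum>e0\<in>nbs. ennreal (enn2real (Y e0 i)))" using Yfin[OF _ i] by (intro sum.cong) auto
   also have "\<dots> = ennreal (\<Sum>e0\<in>nbs. enn2real (Y e0 i))" by (rule sum_ennreal) simp
   finally have "enn2real ?I <= (\<Sum>e0\<in>nbs. enn2real (Y e0 i))" by (simp add: enn2real_leI sum_nonneg)
   then have "enn2real ?I * (\<zeta> k (triple l i) powr r / ?T i) <= (\<Sum>e0\<in>nbs. enn2real (Y e0 i)) * (\<zeta> k (triple l i) powr r / ?T i)"
    using T(1)[of i] by (intro mult_right_mono) auto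
   also have "\<dots> = (\<Sum>e0\<in>nbs. enn2real (Y e0 i) * (\<zeta> k (triple l i) powr r / ?T i))" by (rule sum_distrib_right)
   also have "\<dots> <= (\<Sum>e0\<in>nbs. c powr r * z e0 i)"
   proof (rule sum_mono)
    fix e0 :: "int ^ 'n" assume e0: "e0 \<in> nbs"
    have "\<zeta> k (triple l i) powr r <= (c * \<zeta> k (triple l (shift e0 i))) powr r"
     using c(2)[OF l e0] \<zeta>_pos[OF ccell_cubes(2)[OF l, of i], of k] pq by (intro powr_mono2) auto
    then have "\<zeta> k (triple l i) powr r <= c powr r * \<zeta> k (triple l (shift e0 i)) powr r" by (simp only: powr_mult)
    then have "enn2real (Y e0 i) * (\<zeta> k (triple l i) powr r / ?T i) <= enn2real (Y e0 i) * ((c powr r * \<zeta> k (triple l (shift e0 i)) powr r) / ?T i)"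
     using T(1)[of i] by (intro mult_left_mono divide_right_mono) auto
    then show "enn2real (Y e0 i) * (\<zeta> k (triple l i) powr r / ?T i) <= c powr r * z e0 i" by (simp add: z_def mult_ac)
   qed
   also have "\<dots> = c powr r * (\<Sum>e0\<in>nbs. z e0 i)" by (rule sum_distrib_left[symmetric])
   finally have le: "enn2real ?I * (\<zeta> k (triple l i) powr r / ?T i) <= c powr r * (\<Sum>e0\<in>nbs. z e0 i)" .
   have "(avf l b f i k * \<zeta> k (triple l i)) powr (1 / \<eta> k) = (enn2real ?I * (\<zeta> k (triple l i) powr r / ?T i)) powr V"
   proof -
    have "avf l b f i k powr (1 / \<eta> k) = (enn2real ?I / ?T i) powr V" unfolding avf_def powr_powr V(3) ..
    moreover have "\<zeta> k (triple l i) powr (1 / \<eta> k) = (\<zeta> k (triple l i) powr r) powr V" unfolding powr_powr V(2) ..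
    moreover have "enn2real ?I * (\<zeta> k (triple l i) powr r / ?T i) = enn2real ?I / ?T i * \<zeta> k (triple l i) powr r" by simp
    ultimately show ?thesis by (simp only: powr_mult)
   qed
   also have "\<dots> <= (c powr r * (\<Sum>e0\<in>nbs. z e0 i)) powr V"
    using le V(1) T(1)[of i] by (intro powr_mono2) auto
   also have "\<dots> = (c powr r) powr V * (\<Sum>e0\<in>nbs. z e0 i) powr V" by (rule powr_mult)
   also have "\<dots> <= (c powr r) powr V * (N powr V * (\<Sum>e0\<in>nbs. z e0 i powr V))"
    unfolding N_def by (intro mult_left_mono sum_powr_le_card finite_nbs z0 V) simp
   finally show ?thesis .
  qed
  have "(\<Sum>i\<in>S. (avf l b f i k * \<zeta> k (triple l i)) powr (1 / \<eta> k)) <= (\<Sum>i\<in>S. (c powr r) powr V * (N powr V * (\<Sum>e0\<in>nbs. z e0 i powr V)))"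
   by (intro sum_mono bnd)
  also have "\<dots> = (c powr r) powr V * (N powr V * (\<Sum>e0\<in>nbs. \<Sum>i\<in>S. z e0 i powr V))"
   unfolding sum_distrib_left[symmetric] by (subst sum.swap) simp
  also have "\<dots> <= (c powr r) powr V * (N powr V * (\<Sum>e0\<in>?E. D))"
   using Yz by (intro mult_left_mono sum_mono) auto
  also have "\<dots> = M * D" by (simp add: M_def N_def)
  also have "\<dots> = (C * B ^ k * A powr (1 / p)) powr (1 / \<eta> k)"
  proof -
   have Bk: "B ^ k = B powr k" using b(2) by (simp add: powr_realpow)
   have e: "k * r * V = k * (1 / \<eta> k)" "r / p * V = 1 / p * (1 / \<eta> k)" "\<eta> k * (1 / \<eta> k) = 1"
    using V(2) \<eta>0 pq by (simp_all add: V_def)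
   have "D = C1 powr V * B powr (k * (1 / \<eta> k)) * A powr (1 / p * (1 / \<eta> k))" unfolding D_def powr_mult powr_powr e ..
   moreover have "(C * B ^ k * A powr (1 / p)) powr (1 / \<eta> k) = M powr 1 * C1 powr V * B powr (k * (1 / \<eta> k)) * A powr (1 / p * (1 / \<eta> k))"
    unfolding C_def Bk powr_mult powr_powr e(3) V(3) ..
   ultimately show ?thesis using M by (simp add: mult_ac)
  qed
  finally show "(\<Sum>i\<in>S. (avf l b f i k * \<zeta> k (triple l i)) powr (1 / \<eta> k)) <= (C * B ^ k * A powr (1 / p)) powr (1 / \<eta> k)" .
 qed
qed

text \<open>\<open>upper_norm\<close> and \<open>embedding\<close> are stated for the same sequence
  with the same exponent \<open>1 / \<eta> k\<close>. Composed, they contribute the powers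
  \<open>m - k\<close> and \<open>k\<close> of \<open>B\<close>.\<close>

lemma level_bound:
 assumes k: "k <= m" and s: "rs = inv_exponent s" "ennreal q < s"
 shows "\<exists>C>0. \<forall>l (b :: real ^ 'n => 'k::{real_normed_field, euclidean_space}) B S f A H c. 0 < l --> loc_integrable b --> 0 < B --> tame l b B -->
  finite S --> family l (\<Union>e0\<in>nbs. shift e0 ` S) --> f \<in> borel_measurable lebesgue --> 0 <= A -->
  (\<integral>\<^sup>+x. ennreal (norm (f x) powr p * \<mu> x) \<partial>lebesgue) <= ennreal A --> 0 <= c -->
  (\<forall>i\<in>S. H i \<in> borel_measurable lebesgue \<and> (\<forall>x. 0 <= H i x) \<and> norm_le_on s (cell l i) (H i) (c * avf l b f i k)) -->
  (\<integral>\<^sup>+x. ennreal ((\<Sum>i\<in>S. norm (b x - ctr l b i) ^ (m - k) * H i x * indicator (cell l i) x) powr q * \<sigma> x) \<partial>lebesgue)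
   <= ennreal ((C * c * B ^ m * A powr (1 / p)) powr q)"
proof (rule upper_norm[where 'k='k, OF k])
 fix C0 :: real
 assume C0: "0 < C0" and main: "!!l (b :: real ^ 'n => 'k) B S f a. 0 < l ==> loc_integrable b ==> 0 < B ==> tame l b B ==>
   finite S ==> (!!i. i \<in> S ==> cell l i \<subseteq> base l) ==> carleson l S L0 ==>
   (!!i. i \<in> S ==> f i \<in> borel_measurable lebesgue) ==> (!!i x. i \<in> S ==> 0 <= f i x) ==> (!!i. i \<in> S ==> 0 <= a i) ==>
   (!!i G A. i \<in> S ==> G \<in> borel_measurable lebesgue ==> (!!x. 0 <= G x) ==> 0 <= A ==>
    (\<integral>\<^sup>+x\<in>cell l i. ennreal (G x powr (1 / (1 - q * rs))) \<partial>lebesgue) <= ennreal A ==>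
    (\<integral>\<^sup>+x\<in>cell l i. ennreal (G x * f i x powr q) \<partial>lebesgue) \<le>
     ennreal (a i powr q * vol (cell l i) powr (1 - 1 / (1 / (1 - q * rs))) * A powr (1 / (1 / (1 - q * rs))))) ==>
   (\<integral>\<^sup>+x. ennreal ((\<Sum>i\<in>S. norm (b x - ctr l b i) ^ (m - k) * f i x * indicator (cell l i) x) powr q * \<sigma> x) \<partial>lebesgue)
    <= ennreal (C0 * B powr (q * real (m - k)) * (\<Sum>i\<in>S. (a i * \<zeta> k (triple l i)) powr (1 / \<eta> k)) powr (q * \<eta> k))"
 obtain C1 where C1: "0 < C1" "!!l (b :: real ^ 'n => 'k) B S f A. 0 < l ==> loc_integrable b ==> 0 < B ==> tame l b B ==>
  finite S ==> family l (\<Union>e0\<in>nbs. shift e0 ` S) ==> f \<in> borel_measurable lebesgue ==> 0 <= A ==>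
  (\<integral>\<^sup>+x. ennreal (norm (f x) powr p * \<mu> x) \<partial>lebesgue) <= ennreal A ==>
  (\<Sum>i\<in>S. (avf l b f i k * \<zeta> k (triple l i)) powr (1 / \<eta> k)) <= (C1 * B ^ k * A powr (1 / p)) powr (1 / \<eta> k)"
  using embedding[where 'k='k, OF k] by (elim exE conjE) blast
 have \<eta>0: "0 < \<eta> k" by (rule \<eta>(1)[OF k])
 define C where "C = C0 powr (1 / q) * C1"
 have C: "0 < C" using C0 C1(1) by (simp add: C_def)
 show ?thesis
 proof (intro exI[of _ C] conjI C allI impI)
  fix l B A c :: real and b f :: "real ^ 'n => 'k" and S :: "'n idx set" and H :: "'n idx => real ^ 'n => real"
  assume l: "0 < l" and b: "loc_integrable b" "0 < B" "tame l b B" and S: "finite S" "family l (\<Union>e0\<in>nbs. shift e0 ` S)"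
   and f: "f \<in> borel_measurable lebesgue" and A: "0 <= A" "(\<integral>\<^sup>+x. ennreal (norm (f x) powr p * \<mu> x) \<partial>lebesgue) <= ennreal A"
   and c: "0 <= c" and H: "\<forall>i\<in>S. H i \<in> borel_measurable lebesgue \<and> (\<forall>x. 0 <= H i x) \<and> norm_le_on s (cell l i) (H i) (c * avf l b f i k)"
  let ?Q = "\<lambda>X. X powr (q * \<eta> k)"
  let ?av = "\<lambda>i. avf l b f i k"
  have S': "S \<subseteq> (\<Union>e0\<in>nbs. shift e0 ` S)"
  proof
   fix i assume "i \<in> S"
   moreover have "i = shift 0 i" by (simp add: shift_def)
   ultimately show "i \<in> (\<Union>e0\<in>nbs. shift e0 ` S)" using zero_nbs by blast
  qed
  have av0: "0 <= c * ?av i" for i using c by (simp add: avf_def)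
  have "(\<integral>\<^sup>+x. ennreal ((\<Sum>i\<in>S. norm (b x - ctr l b i) ^ (m - k) * H i x * indicator (cell l i) x) powr q * \<sigma> x) \<partial>lebesgue)
    <= ennreal (C0 * B powr (q * real (m - k)) * ?Q (\<Sum>i\<in>S. (c * ?av i * \<zeta> k (triple l i)) powr (1 / \<eta> k)))"
  proof (rule main)
   show "carleson l S L0" using S(2) carleson_subset[OF l _ S'] unfolding family_def by blast
   show "cell l i \<subseteq> base l" if "i \<in> S" for i using S(2) S' that unfolding family_def by blast
   show "(\<integral>\<^sup>+x\<in>cell l i. ennreal (G x * H i x powr q) \<partial>lebesgue) \<le>
     ennreal ((c * ?av i) powr q * vol (cell l i) powr (1 - 1 / (1 / (1 - q * rs))) * A' powr (1 / (1 / (1 - q * rs))))"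
    if "i \<in> S" "G \<in> borel_measurable lebesgue" "!!x. 0 <= G x" "0 <= A'"
     "(\<integral>\<^sup>+x\<in>cell l i. ennreal (G x powr (1 / (1 - q * rs))) \<partial>lebesgue) <= ennreal A'" for i G A'
    by (rule norm_le_on_dual[OF _ av0 cell_sets[OF l] measure_cell_pos[OF l] _ _ pq(2) s(2) _ that(2-5)]) (use H that(1) s(1) in auto)
  qed (use l b S(1) H av0 in auto)
  also have "C0 * B powr (q * real (m - k)) * ?Q (\<Sum>i\<in>S. (c * ?av i * \<zeta> k (triple l i)) powr (1 / \<eta> k)) =
   C0 * B powr (q * real (m - k)) * (c powr q * ?Q (\<Sum>i\<in>S. (?av i * \<zeta> k (triple l i)) powr (1 / \<eta> k)))"
  proof -
   have "(\<Sum>i\<in>S. (c * ?av i * \<zeta> k (triple l i)) powr (1 / \<eta> k)) = c powr (1 / \<eta> k) * (\<Sum>i\<in>S. (?av i * \<zeta> k (triple l i)) powr (1 / \<eta> k))"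
    by (simp only: mult.assoc powr_mult sum_distrib_left)
   moreover have "1 / \<eta> k * (q * \<eta> k) = q" using \<eta>0 by simp
   ultimately show ?thesis by (simp only: powr_mult powr_powr)
  qed
  also have "\<dots> <= C0 * B powr (q * real (m - k)) * (c powr q * (C1 * B ^ k * A powr (1 / p)) powr q)"
  proof -
   have "?Q (\<Sum>i\<in>S. (?av i * \<zeta> k (triple l i)) powr (1 / \<eta> k)) <= ?Q ((C1 * B ^ k * A powr (1 / p)) powr (1 / \<eta> k))"
    using pq \<eta>0 by (intro powr_mono2 C1(2)[OF l b S f A] sum_nonneg) auto
   also have "\<dots> = (C1 * B ^ k * A powr (1 / p)) powr q" using \<eta>0 by (simp add: powr_powr)
   finally show ?thesis using C0 by (intro mult_left_mono) auto
  qed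
  also have "\<dots> = (C * c * B ^ m * A powr (1 / p)) powr q"
  proof -
   have B: "B powr (q * real (m - k)) * (B ^ k) powr q = (B ^ m) powr q"
   proof -
    have "(B ^ k) powr q = B powr (q * k)" "(B ^ m) powr q = B powr (q * m)"
     using b(2) by (simp_all add: powr_realpow[symmetric] powr_powr mult.commute)
    moreover have "q * real (m - k) + q * k = q * m" using k by (simp add: of_nat_diff algebra_simps)
    ultimately show ?thesis by (simp add: powr_add[symmetric])
   qed
   have "C powr q = C0 * C1 powr q" using C0 pq by (simp add: C_def powr_mult powr_powr)
   then have "(C * c * B ^ m * A powr (1 / p)) powr q = C0 * C1 powr q * c powr q * (B powr (q * real (m - k)) * (B ^ k) powr q) * (A powr (1 / p)) powr q"
    by (simp only: powr_mult B)
   then show ?thesis by (simp only: powr_mult mult_ac)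
  qed
  finally show "(\<integral>\<^sup>+x. ennreal ((\<Sum>i\<in>S. norm (b x - ctr l b i) ^ (m - k) * H i x * indicator (cell l i) x) powr q * \<sigma> x) \<partial>lebesgue)
   <= ennreal ((C * c * B ^ m * A powr (1 / p)) powr q)" by (simp add: ennreal_leI)
 qed
qed

text \<open>Needed before \<open>T\<close> can be applied, since \<open>b\<close> is only assumed
  locally integrable. \<open>pair_sum\<close> for the family consisting of the central cell, with
  \<open>F\<close> its indicator and with \<open>k = m\<close>, shows that
  \<open>|b - c0| powr (m * r)\<close> is integrable there; smaller powers and other constants
  follow.\<close>

lemma power_times_Lr_comp:
 fixes b f :: "real ^ 'n => 'k::{real_normed_field, euclidean_space}"
 assumes l: "0 < l" and b: "loc_integrable b" "0 < B" "tame l b B" and f: "f \<in> bdd_comp" "!!y. f y \<noteq> 0 ==> y \<in> cell l (0, 0)" and k: "k <= m"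
 shows "(\<lambda>y. (c - b y) ^ k * f y) \<in> Lr_comp r"
proof -
 let ?o = "(0, 0) :: 'n idx"
 note [measurable] = loc_integrable_measurable[OF b(1)] cell_sets[OF l, of ?o]
 have fm [measurable]: "f \<in> borel_measurable lebesgue" using f(1) by (simp add: bdd_comp_def)
 obtain bd where bd: "!!x. norm (f x) <= bd" "0 < bd"
 proof -
  have "bounded (range f)" using f(1) by (simp add: bdd_comp_def)
  then obtain a where "!!x. norm (f x) <= a" "0 < a" by (auto simp: bounded_pos)
  then show thesis by (rule that)
 qed
 define c0 where "c0 = ctr l b ?o"
 have sh: "shift 0 ?o = ?o" by (simp add: shift_def)
 have fam: "family l {?o}"
  unfolding family_def
 proof (intro conjI)
  show "\<forall>i\<in>{?o}. cell l i \<subseteq> base l" using zero_nbs by (auto simp: base_def)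
  show "carleson l {?o} L0"
   unfolding carleson_def
  proof (intro allI)
   fix Q :: "'n idx" and n
   let ?X = "{i \<in> {?o}. fst i <= n \<and> cell l i \<subseteq> cell l Q}"
   have Lm: "1 * vol (cell l Q) <= L0 * vol (cell l Q)" by (intro mult_right_mono L0) simp
   show "(\<Sum>i\<in>?X. vol (cell l i)) <= L0 * vol (cell l Q)"
   proof (cases "cell l ?o \<subseteq> cell l Q")
    case True
    then have "?X = {?o}" by auto
    moreover have "vol (cell l ?o) <= vol (cell l Q)"
     by (rule measure_mono_fmeasurable[OF True cell_sets[OF l] cell_fmeasurable[OF l]])
    ultimately show ?thesis using Lm by simp
   next
    case False
    then have "?X = {}" by auto
    then have "(\<Sum>i\<in>?X. vol (cell l i)) = 0" by (simp only: sum.empty)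
    then show ?thesis using L0 by simp
   qed
  qed
 qed simp
 have "(\<integral>\<^sup>+x. ennreal (indicator (cell l ?o) x powr (p / r) * \<mu> x) \<partial>lebesgue) <= wmeas \<mu> (triple l ?o)"
  unfolding wmeas_def using cell_subset_triple[OF l, of ?o] by (intro nn_integral_mono) (auto split: split_indicator)
 also have "\<dots> < \<infinity>" by (rule mu_loc[OF ccell_cubes(2)[OF l]])
 finally have A: "(\<integral>\<^sup>+x. ennreal (indicator (cell l ?o) x powr (p / r) * \<mu> x) \<partial>lebesgue) \<le>
  ennreal (enn2real (\<integral>\<^sup>+x. ennreal (indicator (cell l ?o) x powr (p / r) * \<mu> x) \<partial>lebesgue))" by simp
 have im: "(indicator (cell l ?o) :: real ^ 'n => real) \<in> borel_measurable lebesgue" by measurable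
 have "(\<integral>\<^sup>+x\<in>cell l ?o. ennreal (indicator (cell l ?o) x * rpow (norm (b x - ctr l b (shift 0 ?o))) (m * r)) \<partial>lebesgue) < \<infinity>"
 proof -
  from pair_sum[where 'k='k, OF order_refl] obtain C where
   "\<forall>l (b :: real ^ 'n => 'k) B S J (e0 :: int ^ 'n) F A. 0 < l --> loc_integrable b --> 0 < B --> tame l b B -->
    family l S --> J \<subseteq> S --> e0 \<in> nbs --> F \<in> borel_measurable lebesgue --> (\<forall>x. 0 <= F x) --> 0 <= A -->
    (\<integral>\<^sup>+x. ennreal (F x powr (p / r) * \<mu> x) \<partial>lebesgue) <= ennreal A -->
    (\<forall>i\<in>J. (\<integral>\<^sup>+x\<in>cell l i. ennreal (F x * rpow (norm (b x - ctr l b (shift e0 i))) (m * r)) \<partial>lebesgue) < \<infinity>)"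
   by (elim exE conjE) blast
  then have X: "!!l (b :: real ^ 'n => 'k) B S J (e0 :: int ^ 'n) F A i. 0 < l ==> loc_integrable b ==> 0 < B ==> tame l b B ==>
    family l S ==> J \<subseteq> S ==> e0 \<in> nbs ==> F \<in> borel_measurable lebesgue ==> (\<forall>x. 0 <= F x) ==> 0 <= A ==>
    (\<integral>\<^sup>+x. ennreal (F x powr (p / r) * \<mu> x) \<partial>lebesgue) <= ennreal A ==> i \<in> J ==>
    (\<integral>\<^sup>+x\<in>cell l i. ennreal (F x * rpow (norm (b x - ctr l b (shift e0 i))) (m * r)) \<partial>lebesgue) < \<infinity>" by blast
  show ?thesis by (rule X[OF l b fam subset_refl zero_nbs im _ _ A]) auto
 qed
 then have Y: "(\<integral>\<^sup>+x\<in>cell l ?o. ennreal (rpow (norm (b x - c0)) (m * r)) \<partial>lebesgue) < \<infinity>"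
  unfolding sh c0_def by (rule le_less_trans[rotated]) (intro nn_integral_mono, simp split: split_indicator)
 \<comment> \<open>The summand 1 puts the majorant above 1, so that its \<open>k\<close>-th power is
   at most its \<open>m\<close>-th power.\<close>
 define a where "a = 1 + norm (c - c0)"
 let ?u = "real m * r"
 have u: "0 < ?u" using pq by simp
 let ?K = "bd powr r * 2 powr ?u"
 have "(\<integral>\<^sup>+x. ennreal (norm ((c - b x) ^ k * f x) powr r) \<partial>lebesgue) \<le>
  (\<integral>\<^sup>+x. ennreal (?K * a powr ?u) * indicator (cell l ?o) x + ennreal ?K * (ennreal (rpow (norm (b x - c0)) ?u) * indicator (cell l ?o) x) \<partial>lebesgue)"
 proof (rule nn_integral_mono)
  fix x
  show "ennreal (norm ((c - b x) ^ k * f x) powr r) <= ennreal (?K * a powr ?u) * indicator (cell l ?o) x + ennreal ?K * (ennreal (rpow (norm (b x - c0)) ?u) * indicator (cell l ?o) x)"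
  proof (cases "x \<in> cell l ?o")
   case True
   let ?\<beta> = "norm (b x - c0)"
   have n: "norm (c - b x) <= a + ?\<beta>" unfolding a_def by norm
   have a1: "1 <= a + ?\<beta>" by (simp add: a_def add_nonneg_nonneg)
   have "norm (c - b x) ^ k <= (a + ?\<beta>) ^ k" using n by (intro power_mono) auto
   also have "\<dots> <= (a + ?\<beta>) ^ m" using a1 k by (intro power_increasing) auto
   finally have "norm ((c - b x) ^ k * f x) <= (a + ?\<beta>) ^ m * bd"
    using bd by (auto simp: norm_mult norm_power intro!: mult_mono zero_le_power) (use a1 in linarith)?
   then have "norm ((c - b x) ^ k * f x) powr r <= ((a + ?\<beta>) ^ m * bd) powr r" using pq by (intro powr_mono2) auto
   also have "\<dots> = rpow (a + ?\<beta>) ?u * bd powr r" using a1 r by (simp add: powr_mult rpow_power)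
   also have "rpow (a + ?\<beta>) ?u <= 2 powr ?u * (a powr ?u + ?\<beta> powr ?u)"
   proof -
    have "rpow (a + ?\<beta>) ?u = (a + ?\<beta>) powr ?u" using u pq by (simp add: rpow_def)
    also have "\<dots> <= (2 * max a ?\<beta>) powr ?u" using u a1 by (intro powr_mono2) (auto simp: max_def)
    also have "\<dots> = 2 powr ?u * max a ?\<beta> powr ?u" by (rule powr_mult)
    also have "\<dots> <= 2 powr ?u * (a powr ?u + ?\<beta> powr ?u)" by (intro mult_left_mono) (auto simp: max_def)
    finally show ?thesis .
   qed
   finally have "norm ((c - b x) ^ k * f x) powr r <= 2 powr ?u * (a powr ?u + ?\<beta> powr ?u) * bd powr r" by (simp add: mult_right_mono)
   also have "\<dots> = ?K * a powr ?u + ?K * rpow ?\<beta> ?u" using u pq(3,6,11,12) by (simp add: rpow_def algebra_simps)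
   finally have "ennreal (norm ((c - b x) ^ k * f x) powr r) <= ennreal (?K * a powr ?u + ?K * rpow ?\<beta> ?u)" by (rule ennreal_leI)
   also have "\<dots> = ennreal (?K * a powr ?u) + ennreal ?K * ennreal (rpow ?\<beta> ?u)" by (subst ennreal_plus) (auto simp: ennreal_mult)
   finally show ?thesis using True by simp
  next
   case False
   then have "f x = 0" using f(2) by blast
   then show ?thesis by simp
  qed
 qed
 also have "\<dots> = ennreal (?K * a powr ?u) * emeasure lebesgue (cell l ?o) + ennreal ?K * (\<integral>\<^sup>+x\<in>cell l ?o. ennreal (rpow (norm (b x - c0)) ?u) \<partial>lebesgue)"
  by (subst nn_integral_add) (auto simp: nn_integral_cmult nn_integral_cmult_indicator)
 also have "\<dots> < \<infinity>"
  unfolding emeasure_eq_measure2[OF cell_fmeasurable[OF l]] using Y by (simp add: ennreal_mult_less_top ennreal_mult[symmetric])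
 finally have fin: "(\<integral>\<^sup>+x. ennreal (norm ((c - b x) ^ k * f x) powr r) \<partial>lebesgue) < \<infinity>" .
 have "bounded {x. (c - b x) ^ k * f x \<noteq> 0}"
  by (rule bounded_subset[of "{x. f x \<noteq> 0}"]) (use f(1) in \<open>auto simp: bdd_comp_def\<close>)
 then show ?thesis using fin by (auto simp: Lr_comp_iff)
qed

lemma support_cell:
 fixes f :: "real ^ 'n => 'k::{real_normed_field, euclidean_space}"
 assumes "f \<in> bdd_comp"
 shows "\<exists>R>0. \<forall>l y. R < l --> f y \<noteq> 0 --> y \<in> cell l (0, 0)"
proof -
 have "bounded {x. f x \<noteq> 0}" using assms by (simp add: bdd_comp_def)
 then obtain a where a: "0 < a" "!!y. f y \<noteq> 0 ==> norm y <= a" by (auto simp: bounded_pos)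
 have "y \<in> cell l (0, 0)" if l: "2 * a < l" and y: "f y \<noteq> 0" for l y
 proof -
  have l0: "0 < l" using l a by linarith
  have "\<bar>y $ c\<bar> <= a" for c using component_le_norm_cart[of y c] a(2)[OF y] by linarith
  then have "- (l / 2) <= y $ c \<and> y $ c < l / 2" for c using l by (smt (verit) field_sum_of_halves)
  then show ?thesis by (simp add: position_iff[OF l0] side_def)
 qed
 then show ?thesis using a(1) by (intro exI[of _ "2 * a"]) simp
qed

lemma Lp_finite:
 fixes f :: "real ^ 'n => 'k::{real_normed_field, euclidean_space}"
 assumes f: "f \<in> bdd_comp"
 shows "(\<integral>\<^sup>+x. ennreal (norm (f x) powr p * \<mu> x) \<partial>lebesgue) < \<infinity>"
proof -
 obtain R where R: "0 < R" "!!l y. R < l ==> f y \<noteq> 0 ==> y \<in> cell l (0, 0)" using support_cell[OF f] by blast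
 define l where "l = R + 1"
 have l: "R < l" "0 < l" using R by (simp_all add: l_def)
 have "bounded (range f)" using f by (simp add: bdd_comp_def)
 then obtain a where a: "!!x. norm (f x) <= a" by (auto simp: bounded_iff)
 have [measurable]: "\<mu> \<in> borel_measurable lebesgue" by (rule \<mu>(3))
 have "(\<integral>\<^sup>+x. ennreal (norm (f x) powr p * \<mu> x) \<partial>lebesgue) <= (\<integral>\<^sup>+x. ennreal (a powr p) * (ennreal (\<mu> x) * indicator (triple l (0, 0)) x) \<partial>lebesgue)"
 proof (rule nn_integral_mono)
  fix x
  show "ennreal (norm (f x) powr p * \<mu> x) <= ennreal (a powr p) * (ennreal (\<mu> x) * indicator (triple l (0, 0)) x)"
  proof (cases "f x = 0")
   case False
   then have "x \<in> triple l (0, 0)" using R(2)[OF l(1)] cell_subset_triple[OF l(2), of "(0, 0)"] by blast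
   moreover have "norm (f x) powr p <= a powr p" using a pq by (intro powr_mono2) auto
   then have "norm (f x) powr p * \<mu> x <= a powr p * \<mu> x" using \<mu>(2) by (intro mult_right_mono) auto
   ultimately show ?thesis using \<mu>(2) by (simp add: ennreal_mult[symmetric] ennreal_leI)
  qed simp
 qed
 also have "\<dots> = ennreal (a powr p) * wmeas \<mu> (triple l (0, 0))"
  unfolding wmeas_def by (rule nn_integral_cmult) measurable
 also have "\<dots> < \<infinity>" using mu_loc[OF ccell_cubes(2)[OF l(2)], of "(0, 0)"] by (simp add: ennreal_mult_less_top)
 finally show ?thesis .
qed

text \<open>For every large side \<open>l\<close> the central cell contains the support of
  \<open>f\<close>, and the estimate on that cell has a constant independent of \<open>l\<close>.
  Letting \<open>l\<close> grow, these cells exhaust the space, and Fatou's lemma gives the global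
  bound. The \<open>m + 1\<close> terms of the binomial sum are estimated separately.\<close>

lemma commutator_bound:
 fixes T :: "('n, 'k::{real_normed_field, euclidean_space}) operator"
 assumes sub: "sublinear_on (Lr_comp r) T" and s: "1 <= s" "rs = inv_exponent s" "ennreal q < s"
  and \<phi>1: "!!\<theta>. \<theta> \<in> {0<..<1} ==> 0 <= \<phi>1 \<theta>" and \<phi>2: "!!\<theta>. \<theta> \<in> {0<..<1} ==> 0 <= \<phi>2 \<theta>"
  and weak1: "!!Q g \<theta>. Q \<in> cubes ==> g \<in> Lr_on r Q ==> \<theta> \<in> {0<..<1} ==>
   outer_measure_of lebesgue {x \<in> Q. ennreal (norm (T (cutoff g Q) x)) > ennreal (\<phi>1 \<theta>) * pavg r (\<lambda>y. ennreal (norm (g y))) Q}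
    <= ennreal \<theta> * emeasure lebesgue Q"
  and weak2: "!!Q g \<theta>. Q \<in> cubes ==> g \<in> Lr_on r Q ==> \<theta> \<in> {0<..<1} ==>
   outer_measure_of lebesgue {x \<in> Q. grand_sharp_max T s (cutoff g Q) x > ennreal (\<phi>2 \<theta>) * pavg r (\<lambda>y. ennreal (norm (g y))) Q}
    <= ennreal \<theta> * emeasure lebesgue Q"
 shows "\<exists>C>0. \<forall>(b :: real ^ 'n => 'k) B f A. loc_integrable b --> 0 < B --> (\<forall>l>0. tame l b B) --> f \<in> bdd_comp --> 0 <= A -->
  (\<integral>\<^sup>+x. ennreal (norm (f x) powr p * \<mu> x) \<partial>lebesgue) <= ennreal A -->
  (\<integral>\<^sup>+x. ennreal (norm (commutator T b m f x) powr q * \<sigma> x) \<partial>lebesgue) <= ennreal ((C * B ^ m * A powr (1 / p)) powr q)"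
proof -
 define LB where "LB k C \<longleftrightarrow> (\<forall>l (b :: real ^ 'n => 'k) B S f A H c. 0 < l --> loc_integrable b --> 0 < B --> tame l b B -->
  finite S --> family l (\<Union>e0\<in>nbs. shift e0 ` S) --> f \<in> borel_measurable lebesgue --> 0 <= A -->
  (\<integral>\<^sup>+x. ennreal (norm (f x) powr p * \<mu> x) \<partial>lebesgue) <= ennreal A --> 0 <= c -->
  (\<forall>i\<in>S. H i \<in> borel_measurable lebesgue \<and> (\<forall>x. 0 <= H i x) \<and> norm_le_on s (cell l i) (H i) (c * avf l b f i k)) -->
  (\<integral>\<^sup>+x. ennreal ((\<Sum>i\<in>S. norm (b x - ctr l b i) ^ (m - k) * H i x * indicator (cell l i) x) powr q * \<sigma> x) \<partial>lebesgue)
   <= ennreal ((C * c * B ^ m * A powr (1 / p)) powr q))" for k C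
 have "\<exists>C>0. LB k C" if "k <= m" for k
  unfolding LB_def by (rule level_bound[OF that s(2,3)])
 then have "\<forall>k. \<exists>C. k <= m --> 0 < C \<and> LB k C" by blast
 from choice[OF this] obtain Cf where Cf: "!!k. k <= m ==> 0 < Cf k" "!!k. k <= m ==> LB k (Cf k)" by blast
 \<comment> \<open>The constants of the locale \<open>domination\<close> are formally attached to
   \<open>b\<close>, \<open>f\<close> and \<open>l\<close>. They are written out here to make
   visible that \<open>C\<close> depends on none of these.\<close>
 define t0 :: real where "t0 = 1 / (4 * (m + 1) * 3 ^ CARD('n) * 2 ^ (CARD('n) + 3))"
 define t1 :: real where "t1 = 1 / (8 * 3 ^ CARD('n))"
 define h0 :: real where "h0 = (m + 1) * 9 ^ CARD('n) * 2 ^ (CARD('n) + 3)"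
 define cd where "cd = 2 * (10 * (\<phi>2 t0 + (\<phi>1 t0 + \<phi>1 t1 * (real (card (nbs :: (int ^ 'n) set)) * h0) powr (1 / r))))"
 define C where "C = ((m + 1) powr q * (\<Sum>k\<le>m. (real (m choose k) * (Cf k * cd)) powr q)) powr (1 / q) + 1"
 have C: "0 < C" unfolding C_def by (intro add_nonneg_pos) auto
 show ?thesis
 proof (intro exI[of _ C] conjI C allI impI)
  fix b f :: "real ^ 'n => 'k" and B A :: real
  assume b: "loc_integrable b" "0 < B" "\<forall>l>0. tame l b B" and f: "f \<in> bdd_comp"
   and A: "0 <= A" "(\<integral>\<^sup>+x. ennreal (norm (f x) powr p * \<mu> x) \<partial>lebesgue) <= ennreal A"
  note [measurable] = loc_integrable_measurable[OF b(1)] \<sigma>(3)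
  have fm [measurable]: "f \<in> borel_measurable lebesgue" using f by (simp add: bdd_comp_def)
  obtain R where R: "0 < R" "!!l y. R < l ==> f y \<noteq> 0 ==> y \<in> cell l (0, 0)" using support_cell[OF f] by blast
  let ?K = "(C * B ^ m * A powr (1 / p)) powr q"
  have key: "\<exists>u. (\<forall>n. u n \<in> borel_measurable lebesgue \<and> (\<integral>\<^sup>+x. u n x \<partial>lebesgue) <= ennreal ?K) \<and>
   (AE x in lebesgue. x \<in> cell l (0, 0) --> (\<forall>\<^sub>F n in sequentially. ennreal (norm (commutator T b m f x) powr q * \<sigma> x) <= u n x))"
   if lR: "R < l" for l
  proof -
   have l: "0 < l" using lR R by linarith
   have tm: "tame l b B" using b(3) l by blast
   have Fd: "(\<lambda>y. (c - b y) ^ k * f y) \<in> Lr_comp r" if "k <= m" for c k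
    by (rule power_times_Lr_comp[OF l b(1,2) tm f R(2)[OF lR] that])
   interpret D: domination T r s m \<phi>1 \<phi>2 b f l
    by (rule domination.intro) (fact r(1) s(1) l sub \<phi>1 \<phi>2 weak1 weak2 Fd)+
   have cd: "2 * D.c_dom = cd"
    by (simp only: D.c_dom_def D.c_local_def D.\<theta>0_def D.\<theta>1_def D.H0_def D.card_nbs_def cd_def t0_def t1_def h0_def)
   have cd0: "0 <= cd" using D.c_local(4) cd by simp
   have av: "D.av i k = avf l b f i k" for i k by (simp only: D.av_def avf_def D.G_def)
   have cl [measurable]: "cell l i \<in> sets lebesgue" for i :: "'n idx" by (rule cell_sets[OF l])
   define W where "W k n x = (\<Sum>i\<in>D.fam n. norm (b x - ctr l b i) ^ (m - k) * D.H n k i x * indicator (cell l i) x)" for k n x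
   have Wm [measurable]: "W k n \<in> borel_measurable lebesgue" if "k <= m" for k n
   proof -
    have [measurable]: "D.H n k i \<in> borel_measurable lebesgue" for i by (rule D.H_measurable[OF that])
    show ?thesis unfolding W_def by measurable
   qed
   have W0: "0 <= W k n x" for k n x unfolding W_def by (intro sum_nonneg mult_nonneg_nonneg D.H_nonneg) auto
   have HsW: "(\<Sum>i\<in>D.fam n. D.Hs n i x * indicator (cell l i) x) = (\<Sum>k\<le>m. real (m choose k) * W k n x)" for n x
    unfolding D.Hs_def W_def sum_distrib_left sum_distrib_right by (subst sum.swap) (simp only: mult_ac)
   have fam: "family l (\<Union>e0\<in>nbs. shift e0 ` D.fam n)" for n
    unfolding family_def
   proof (intro conjI ballI)
    show "finite (\<Union>e0\<in>nbs. shift e0 ` D.fam n)" using finite_nbs D.fam_finite by blast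
    have "carleson l (D.fam n) 2" by (rule carleson_subset[OF l D.principal_sparse]) (auto simp: D.fam_def)
    from carleson_shifts[OF l this] show "carleson l (\<Union>e0\<in>nbs. shift e0 ` D.fam n) L0" by (simp only: L0_def)
    fix i assume "i \<in> (\<Union>e0\<in>nbs. shift e0 ` D.fam n)"
    then obtain e0 j where e0: "e0 \<in> nbs" "i = shift e0 j" "cell l j \<subseteq> cell l (0, 0)" by (auto simp: D.fam_def)
    obtain e1 where e1: "e1 \<in> nbs" "cell l i \<subseteq> cell l (shift e1 (0, 0))" using subset_shift[OF l e0(1,3)] e0(2) by blast
    have "shift e1 (0, 0) = (0, e1)" by (simp add: shift_def)
    then show "cell l i \<subseteq> base l" using e1 subset_base_iff[OF l, of i] by auto
   qed
   have WI: "(\<integral>\<^sup>+x. ennreal (W k n x powr q * \<sigma> x) \<partial>lebesgue) <= ennreal ((Cf k * cd * B ^ m * A powr (1 / p)) powr q)" if k: "k <= m" for k n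
   proof -
    have H: "\<forall>i\<in>D.fam n. D.H n k i \<in> borel_measurable lebesgue \<and> (\<forall>x. 0 <= D.H n k i x) \<and> norm_le_on s (cell l i) (D.H n k i) (cd * avf l b f i k)"
     using D.H_measurable[OF k] D.H_nonneg D.H_norm[OF k] unfolding cd av by blast
    show ?thesis unfolding W_def
     by (rule Cf(2)[OF k, unfolded LB_def, rule_format, OF l b(1,2) tm D.fam_finite fam fm A cd0]) (use H in blast)
   qed
   define u where "u n x = ennreal ((\<Sum>k\<le>m. real (m choose k) * W k n x) powr q * \<sigma> x)" for n x
   have um: "u n \<in> borel_measurable lebesgue" for n
   proof -
    have "(\<lambda>x. \<Sum>k\<in>{..m}. real (m choose k) * W k n x) \<in> borel_measurable lebesgue"
     by (intro borel_measurable_sum borel_measurable_times borel_measurable_const Wm) simp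
    then show ?thesis unfolding u_def by measurable
   qed
   have uK: "(\<integral>\<^sup>+x. u n x \<partial>lebesgue) <= ennreal ?K" for n
   proof -
    let ?X = "B ^ m * A powr (1 / p)"
    let ?N = "(m + 1) powr q" and ?c = "\<lambda>k. real (m choose k) powr q"
    have "(\<integral>\<^sup>+x. u n x \<partial>lebesgue) <= (\<integral>\<^sup>+x. (\<Sum>k\<in>{..m}. ennreal (?N * ?c k) * ennreal (W k n x powr q * \<sigma> x)) \<partial>lebesgue)"
    proof (rule nn_integral_mono)
     fix x
     have "(\<Sum>k\<in>{..m}. real (m choose k) * W k n x) powr q <= real (card {..m}) powr q * (\<Sum>k\<in>{..m}. (real (m choose k) * W k n x) powr q)"
     using W0 pq by (intro sum_powr_le_card) auto
     also have "\<dots> = (\<Sum>k\<in>{..m}. ?N * ?c k * W k n x powr q)"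
     by (simp add: powr_mult sum_distrib_left mult.assoc add.commute)
     finally have "(\<Sum>k\<in>{..m}. real (m choose k) * W k n x) powr q * \<sigma> x <= (\<Sum>k\<in>{..m}. ?N * ?c k * W k n x powr q) * \<sigma> x"
     using \<sigma>(2) by (intro mult_right_mono) auto
     also have "\<dots> = (\<Sum>k\<in>{..m}. ?N * ?c k * (W k n x powr q * \<sigma> x))" by (simp only: sum_distrib_right mult.assoc)
     finally have "u n x <= ennreal (\<Sum>k\<in>{..m}. ?N * ?c k * (W k n x powr q * \<sigma> x))" unfolding u_def by (rule ennreal_leI)
     also have "\<dots> = (\<Sum>k\<in>{..m}. ennreal (?N * ?c k * (W k n x powr q * \<sigma> x)))"
     using \<sigma>(2) by (intro sum_ennreal[symmetric] mult_nonneg_nonneg) auto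
     also have "\<dots> = (\<Sum>k\<in>{..m}. ennreal (?N * ?c k) * ennreal (W k n x powr q * \<sigma> x))"
     using \<sigma>(2) by (intro sum.cong refl ennreal_mult mult_nonneg_nonneg) auto
     finally show "u n x <= (\<Sum>k\<in>{..m}. ennreal (?N * ?c k) * ennreal (W k n x powr q * \<sigma> x))" .
    qed
    also have "\<dots> = (\<Sum>k\<in>{..m}. ennreal (?N * ?c k) * (\<integral>\<^sup>+x. ennreal (W k n x powr q * \<sigma> x) \<partial>lebesgue))"
     by (subst nn_integral_sum) (auto simp: nn_integral_cmult)
    also have "\<dots> <= (\<Sum>k\<in>{..m}. ennreal (?N * ?c k) * ennreal ((Cf k * cd * B ^ m * A powr (1 / p)) powr q))"
     by (intro sum_mono mult_left_mono WI) auto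
    also have "\<dots> = ennreal (\<Sum>k\<in>{..m}. ?N * ?c k * (Cf k * cd * B ^ m * A powr (1 / p)) powr q)"
    proof -
     have "(\<Sum>k\<in>{..m}. ennreal (?N * ?c k) * ennreal ((Cf k * cd * B ^ m * A powr (1 / p)) powr q)) =
     (\<Sum>k\<in>{..m}. ennreal (?N * ?c k * (Cf k * cd * B ^ m * A powr (1 / p)) powr q))"
     by (intro sum.cong refl ennreal_mult[symmetric] mult_nonneg_nonneg powr_ge_zero)
     also have "\<dots> = ennreal (\<Sum>k\<in>{..m}. ?N * ?c k * (Cf k * cd * B ^ m * A powr (1 / p)) powr q)"
     by (intro sum_ennreal mult_nonneg_nonneg powr_ge_zero)
     finally show ?thesis .
    qed
    also have "(\<Sum>k\<in>{..m}. ?N * ?c k * (Cf k * cd * B ^ m * A powr (1 / p)) powr q) = ?N * (\<Sum>k\<le>m. (real (m choose k) * (Cf k * cd)) powr q) * ?X powr q"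
     unfolding sum_distrib_left sum_distrib_right by (intro sum.cong refl) (simp only: powr_mult mult_ac)
    also have "\<dots> = ((?N * (\<Sum>k\<le>m. (real (m choose k) * (Cf k * cd)) powr q)) powr (1 / q)) powr q * ?X powr q"
     using pq by (simp add: powr_powr sum_nonneg)
    also have "\<dots> = (((?N * (\<Sum>k\<le>m. (real (m choose k) * (Cf k * cd)) powr q)) powr (1 / q)) * ?X) powr q" by (simp only: powr_mult)
    also have "\<dots> <= (C * ?X) powr q"
     using pq b(2) by (intro powr_mono2 mult_right_mono mult_nonneg_nonneg) (auto simp: C_def)
    finally show ?thesis by (simp only: mult.assoc ennreal_leI)
   qed
   have "AE x in lebesgue. x \<in> cell l (0, 0) -->
     (\<forall>\<^sub>F n in sequentially. norm (commutator T b m f x) <= (\<Sum>i\<in>D.fam n. D.Hs n i x * indicator (cell l i) x))"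
    by (rule D.sparse_domination) (rule R(2)[OF lR])
   then have "AE x in lebesgue. x \<in> cell l (0, 0) --> (\<forall>\<^sub>F n in sequentially. ennreal (norm (commutator T b m f x) powr q * \<sigma> x) <= u n x)"
   proof eventually_elim
    case (elim x)
    show ?case
    proof
     assume "x \<in> cell l (0, 0)"
     then have "\<forall>\<^sub>F n in sequentially. norm (commutator T b m f x) <= (\<Sum>k\<le>m. real (m choose k) * W k n x)" using elim HsW by simp
     then show "\<forall>\<^sub>F n in sequentially. ennreal (norm (commutator T b m f x) powr q * \<sigma> x) <= u n x"
     proof eventually_elim
     case (elim n)
     then have "norm (commutator T b m f x) powr q <= (\<Sum>k\<le>m. real (m choose k) * W k n x) powr q" using pq by (intro powr_mono2) auto
     then show ?case unfolding u_def using \<sigma>(2) by (intro ennreal_leI mult_right_mono) auto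
     qed
    qed
   qed
   then show ?thesis using um uK by blast
  qed
  have "\<forall>j. \<exists>u. (\<forall>n. u n \<in> borel_measurable lebesgue \<and> (\<integral>\<^sup>+x. u n x \<partial>lebesgue) <= ennreal ?K) \<and>
   (AE x in lebesgue. x \<in> cell (R + 1 + real j) (0, 0) --> (\<forall>\<^sub>F n in sequentially. ennreal (norm (commutator T b m f x) powr q * \<sigma> x) <= u n x))"
   by (intro allI key) simp
  from choice[OF this] obtain u where u: "!!j n. u j n \<in> borel_measurable lebesgue" "!!j n. (\<integral>\<^sup>+x. u j n x \<partial>lebesgue) <= ennreal ?K"
   "!!j. AE x in lebesgue. x \<in> cell (R + 1 + real j) (0, 0) --> (\<forall>\<^sub>F n in sequentially. ennreal (norm (commutator T b m f x) powr q * \<sigma> x) <= u j n x)" by blast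
  show "(\<integral>\<^sup>+x. ennreal (norm (commutator T b m f x) powr q * \<sigma> x) \<partial>lebesgue) <= ennreal ?K"
  proof (rule nn_integral_le_of_cover[OF u])
   fix x :: "real ^ 'n"
   have "\<forall>\<^sub>F j in sequentially. 2 * norm x <= real j" by (intro eventually_sequentiallyI[of "nat \<lceil>2 * norm x\<rceil>"]) linarith
   then show "\<forall>\<^sub>F j in sequentially. x \<in> cell (R + 1 + real j) (0, 0)"
   proof eventually_elim
    case (elim j)
    have between: "- (L / 2) <= a \<and> a < L / 2" if "\<bar>a\<bar> <= n" "2 * n < L" for a n L :: real using that by linarith
    have cellI: "x \<in> cell L (0, 0)" if L: "2 * norm x < L" for L
    proof -
     have L0: "0 < L" using norm_ge_zero[of x] L by linarith
     have "- (L / 2) <= x $ c \<and> x $ c < L / 2" for c by (rule between[OF component_le_norm_cart L])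
     then show ?thesis by (simp add: position_iff[OF L0] side_def)
    qed
    have "2 * norm x < R + 1 + real j" using R(1) elim by linarith
    then show ?case by (rule cellI)
   qed
  qed
 qed
qed

section \<open>The Bloom weight and the norms of \<open>b\<close>\<close>

lemma e_less: "e < 1"
proof -
 have "m * e < 1"
 proof -
  have "1 / q < 1" using r by simp
  moreover have "0 < 1 / p" using pq by simp
  ultimately show ?thesis unfolding me by linarith
 qed
 moreover have "e <= m * e \<or> e <= 0" using m mult_right_mono[of 1 "real m" e] by auto
 ultimately show ?thesis by linarith
qed

text \<open>The averages of the Bloom weight: the same formula in \<open>g\<close> and
  \<open>h\<close> by which \<open>\<nu>\<close> is obtained from \<open>\<mu>\<close> and
  \<open>\<sigma>\<close>, solved by the power \<open>1 / (1 - e)\<close>.\<close>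

definition \<Gamma> :: "(real ^ 'n) set => real"
 where "\<Gamma> Q = g Q powr (1 / (p * m) * (1 / (1 - e))) * h Q powr (- (1 / (q * m) * (1 / (1 - e))))"

lemma \<Gamma>_pos: "Q \<in> cubes ==> 0 < \<Gamma> Q"
 using g[of Q] h[of Q] by (simp add: \<Gamma>_def)

lemma \<Psi>_\<Gamma>: assumes Q: "Q \<in> cubes" shows "\<Psi> Q * vol Q = (\<Gamma> Q * vol Q) powr (1 - e)"
proof -
 have c: "1 / (p * m) * (1 / (1 - e)) * (1 - e) = 1 / (p * m)" "1 / (q * m) * (1 / (1 - e)) * (1 - e) = 1 / (q * m)" using e_less by simp_all
 have "vol Q powr (- e) * vol Q = vol Q powr (1 - e)"
  using cubes_props(3)[OF Q] powr_add[of "vol Q" "- e" 1] by simp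
 then show ?thesis unfolding \<Psi>_def \<Gamma>_def powr_mult powr_powr minus_mult_left[symmetric] c by (simp add: mult_ac)
qed

text \<open>The exponent condition of \<open>bloom_comparable\<close> reduces to
  \<open>(1 / r - rs) / m <= 1\<close>: the terms in \<open>1 / p\<close> and \<open>1 / q\<close>
  combine to \<open>e\<close> and cancel. What is left holds since \<open>r\<close> and
  \<open>m\<close> are at least 1.\<close>

lemma bloom_weight:
 assumes \<nu>: "!!x. 0 <= \<nu> x" "!!x. \<nu> x powr (1 + 1 / (p * m) - 1 / (q * m)) = \<mu> x powr (1 / (p * m)) * \<sigma> x powr (- (1 / (q * m)))"
 shows "comparable \<nu> \<Gamma>"
proof -
 let ?y = "1 / (1 - e)"
 have e1: "1 + 1 / (p * m) - 1 / (q * m) = 1 - e" by (simp add: e_def)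
 have y: "0 < ?y" "(1 - e) * ?y = 1" using e_less by simp_all
 have "\<nu> = (\<lambda>x. \<mu> x powr (1 / (p * m) * ?y) * \<sigma> x powr (- (1 / (q * m) * ?y)))"
 proof
  fix x
  have "\<nu> x = (\<nu> x powr (1 - e)) powr ?y" unfolding powr_powr y(2) using \<nu>(1)[of x] by simp
  also have "\<dots> = (\<mu> x powr (1 / (p * m)) * \<sigma> x powr (- (1 / (q * m)))) powr ?y" using \<nu>(2)[of x] unfolding e1 by simp
  also have "\<dots> = \<mu> x powr (1 / (p * m) * ?y) * \<sigma> x powr (- (1 / (q * m) * ?y))" unfolding powr_mult powr_powr minus_mult_left[symmetric] ..
  finally show "\<nu> x = \<mu> x powr (1 / (p * m) * ?y) * \<sigma> x powr (- (1 / (q * m) * ?y))" .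
 qed
 moreover have "comparable (\<lambda>x. \<mu> x powr (1 / (p * m) * ?y) * \<sigma> x powr (- (1 / (q * m) * ?y))) (\<lambda>Q. g Q powr (1 / (p * m) * ?y) * h Q powr (- (1 / (q * m) * ?y)))"
 proof (rule bloom_comparable[OF avg_\<mu> avg_\<sigma> \<mu>(1) \<sigma>(1) g h])
  show "0 < 1 / (1 - p * rs)" "0 < 1 / (1 - q * rs)" "0 < r / (p - r)" "0 < r / (q - r)" "0 < 1 / (p * m) * ?y" "0 < 1 / (q * m) * ?y"
   using rs pq y by simp_all
  have A: "1 / (p * m) * (1 - p * rs) = (1 / p - rs) / m" using pq by (simp add: field_simps)
  have B: "1 / (q * m) * ((q - r) / r) = (1 / r - 1 / q) / m" using pq by (simp add: field_simps)
  have "(1 / p - rs) / m + (1 / r - 1 / q) / m = (1 / r - rs) / m - (1 / q - 1 / p) / m"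
   by (simp add: add_divide_distrib[symmetric] diff_divide_distrib[symmetric])
  moreover have "(1 / q - 1 / p) / m = e" unfolding me[symmetric] using pq by simp
  moreover have "(1 / r - rs) / m <= 1"
  proof -
   have "1 / r <= 1" using r by simp
   then have "1 / r - rs <= real m" using rs m by linarith
   then show ?thesis using pq by simp
  qed
  ultimately have le: "1 / (p * m) * (1 - p * rs) + 1 / (q * m) * ((q - r) / r) <= 1 - e" unfolding A B by linarith
  have "1 / (p * m) * ?y / (1 / (1 - p * rs)) + 1 / (q * m) * ?y / (r / (q - r)) = (1 / (p * m) * (1 - p * rs) + 1 / (q * m) * ((q - r) / r)) * ?y"
  proof -
   have "a * Y / (1 / c) + b * Y / (d1 / d2) = (a * c + b * (d2 / d1)) * Y" for a b c d1 d2 Y :: real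
    by (simp add: distrib_right)
   then show ?thesis .
  qed
  also have "\<dots> <= (1 - e) * ?y" using le y by (intro mult_right_mono) auto
  finally show "1 / (p * m) * ?y / (1 / (1 - p * rs)) + 1 / (q * m) * ?y / (r / (q - r)) <= 1" unfolding y(2) .
 qed
 ultimately show ?thesis unfolding \<Gamma>_def[abs_def] by simp
qed

lemma wmeas_pos:
 assumes \<nu>: "comparable \<nu> \<Gamma>" and Q: "Q \<in> cubes"
 shows "\<exists>w>0. wmeas \<nu> Q = ennreal w"
proof -
 have "\<exists>c>0. \<forall>Q\<in>cubes. \<forall>F\<in>sets lebesgue. F \<subseteq> Q --> 1 * vol Q <= vol F -->
   ennreal (c * (\<Gamma> Q * vol Q)) <= wmeas \<nu> F"
  using \<nu>[unfolded comparable_def, THEN conjunct2, THEN spec, of 1] by simp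
 then obtain c where c: "0 < c" "ennreal (c * (\<Gamma> Q * vol Q)) <= wmeas \<nu> Q"
  using Q cubes_props(1)[OF Q] by (metis mult_1 order_refl)
 have "0 < c * (\<Gamma> Q * vol Q)" using c(1) \<Gamma>_pos[OF Q] cubes_props(3)[OF Q] by simp
 then have pos: "0 < wmeas \<nu> Q" using c(2) by (meson ennreal_less_zero_iff less_le_trans)
 have "\<exists>K>0. \<forall>Q\<in>cubes. wmeas \<nu> Q <= ennreal (K * (\<Gamma> Q * vol Q))"
  using \<nu> by (simp add: comparable_def avg_le_def wmeas_def)
 then obtain K where "wmeas \<nu> Q <= ennreal (K * (\<Gamma> Q * vol Q))" using Q by blast
 then have "wmeas \<nu> Q < top" by (rule le_less_trans) simp
 then show ?thesis using pos by (intro exI[of _ "enn2real (wmeas \<nu> Q)"]) (simp add: enn2real_positive_iff)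
qed

text \<open>For \<open>e <= 0\<close> the bound is taken cube by cube. For \<open>e > 0\<close> the
  sharp maximal function is at every point of a cell at least the quotient for its triple, so the
  sum over a family is an instance of \<open>sum_le_nn_integral\<close> with the weight
  \<open>\<nu>\<close>. The summand \<open>\<delta>\<close> keeps the resulting bound positive when
  \<open>N = 0\<close>.\<close>

lemma tame_bound:
 assumes \<nu>: "comparable \<nu> \<Gamma>"
 shows "\<exists>K>0. \<forall>l (b :: real ^ 'n => 'k::euclidean_space) N \<delta>. 0 < l --> loc_integrable b --> 0 <= N --> 0 < \<delta> -->
  (if 0 < e then (\<integral>\<^sup>+x. epowr (sharp_max \<nu> b x) (1 / e) * ennreal (\<nu> x) \<partial>lebesgue) <= ennreal (N powr (1 / e))
   else \<forall>Q\<in>cubes. osc b Q <= ennreal N * epowr (wmeas \<nu> Q) (1 - e)) --> tame l b (K * (N + \<delta>))"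
proof -
 have "\<exists>K>0. \<forall>Q\<in>cubes. wmeas \<nu> Q <= ennreal (K * (\<Gamma> Q * vol Q))"
  using \<nu> by (simp add: comparable_def avg_le_def wmeas_def)
 then obtain K\<nu> where K\<nu>: "0 < K\<nu>" "!!Q. Q \<in> cubes ==> wmeas \<nu> Q <= ennreal (K\<nu> * (\<Gamma> Q * vol Q))" by blast
 obtain k1 k2 where k: "0 < k1" "0 < k2" "!!k1' k2' I l L. k1 <= k1' ==> k2' <= k2 ==> 0 < l ==> laminar I (cell l) L ==>
   laminar.adm I (cell l) k1' k2' \<nu> (\<lambda>i. \<Gamma> (triple l i) * vol (triple l i))"
  using comparable_adm[OF \<nu>] by blast
 define kl where "kl = real (nat \<lceil>2 * (2 * (1 + L0))\<rceil> + 1)"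
 have kl: "0 < kl" by (simp add: kl_def)
 define K where "K = (if 0 < e then K\<nu> * (kl / k2) powr e else K\<nu> powr (1 - e))"
 have K: "0 < K" using K\<nu>(1) kl k(2) by (simp add: K_def)
 show ?thesis
 proof (intro exI[of _ K] conjI K allI impI)
  fix l N \<delta> :: real and b :: "real ^ 'n => 'k"
  assume l: "0 < l" and b: "loc_integrable b" and N: "0 <= N" "0 < \<delta>" and
   H: "if 0 < e then (\<integral>\<^sup>+x. epowr (sharp_max \<nu> b x) (1 / e) * ennreal (\<nu> x) \<partial>lebesgue) <= ennreal (N powr (1 / e))
    else \<forall>Q\<in>cubes. osc b Q <= ennreal N * epowr (wmeas \<nu> Q) (1 - e)"
  let ?X = "\<lambda>i :: 'n idx. \<Gamma> (triple l i) * vol (triple l i)"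
  let ?o = "\<lambda>i :: 'n idx. tosc l b i * vol (triple l i)"
  have cu: "triple l i \<in> cubes" for i :: "'n idx" by (rule ccell_cubes(2)[OF l])
  have Xp: "0 < ?X i" for i using \<Gamma>_pos[OF cu] cubes_props(3)[OF cu] by simp
  have o0: "0 <= ?o i" for i by (simp add: mosc_nonneg)
  have oo: "osc b (triple l i) = ennreal (?o i)" for i by (rule osc_tosc(1)[OF b l])
  have quot: "tosc l b i / \<Psi> (triple l i) = ?o i / ?X i powr (1 - e)" for i
   unfolding \<Psi>_\<Gamma>[OF cu, symmetric] using cubes_props(3)[OF cu[of i]] by simp
  have wX: "wmeas \<nu> (triple l i) <= ennreal (K\<nu> * ?X i)" for i by (rule K\<nu>(2)[OF cu])
  show "tame l b (K * (N + \<delta>))"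
   unfolding tame_def
  proof (intro allI impI)
   fix I :: "'n idx set" assume lam: "laminar I (cell l) (2 * (1 + L0))"
   show "lnorm_le e I (\<lambda>i. tosc l b i / \<Psi> (triple l i)) (K * (N + \<delta>))"
   proof (cases "0 < e")
    case False
    have "tosc l b i / \<Psi> (triple l i) <= K * (N + \<delta>)" for i
    proof -
     have "ennreal (?o i) <= ennreal N * epowr (wmeas \<nu> (triple l i)) (1 - e)" using H False cu[of i] by (simp add: oo[symmetric])
     also have "\<dots> <= ennreal N * epowr (ennreal (K\<nu> * ?X i)) (1 - e)"
     using e_less by (intro mult_left_mono epowr_mono wX) auto
     also have "\<dots> = ennreal (N * (K\<nu> * ?X i) powr (1 - e))"
     using K\<nu>(1) Xp[of i] N by (subst epowr_ennreal) (auto simp: ennreal_mult)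
     finally have "?o i <= N * (K\<nu> * ?X i) powr (1 - e)" using N by (subst (asm) ennreal_le_iff) auto
     also have "\<dots> = (N * K) * ?X i powr (1 - e)" using False by (simp add: K_def powr_mult)
     finally have "?o i / ?X i powr (1 - e) <= N * K" using Xp[of i] by (subst pos_divide_le_eq) (auto simp: mult_ac)
     also have "\<dots> <= K * (N + \<delta>)" using K N by (simp add: mult.commute)
     finally show ?thesis unfolding quot .
    qed
    then show ?thesis using False by (simp add: lnorm_le_def)
   next
    case True
    let ?u = "1 / e"
    have u: "0 < ?u" "(1 - e) * ?u = ?u - 1" "e * ?u = 1" using True by (simp_all add: diff_divide_distrib)
    have adm: "laminar.adm I (cell l) k1 k2 \<nu> ?X" by (rule k(3)[OF order_refl order_refl l lam])
    let ?a = "\<lambda>i. (?o i / (K\<nu> * ?X i)) powr ?u"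
    have "ennreal (\<Sum>i\<in>I. ?a i * ?X i) <= ennreal (laminar.K (2 * (1 + L0)) / k2) * (\<integral>\<^sup>+x. epowr (sharp_max \<nu> b x) ?u * ennreal (\<nu> x) \<partial>lebesgue)"
    proof (rule laminar.sum_le_nn_integral[OF lam adm k(2) subset_refl])
     fix i :: "'n idx" and x assume x: "x \<in> cell l i"
     have KX: "0 < K\<nu> * ?X i" using K\<nu>(1) Xp[of i] by simp
     obtain w where w: "0 < w" "wmeas \<nu> (triple l i) = ennreal w" using wmeas_pos[OF \<nu> cu[of i]] by blast
     have wK: "w <= K\<nu> * ?X i" using wX[of i] KX unfolding w(2) by (subst (asm) ennreal_le_iff) auto
     have "?o i / (K\<nu> * ?X i) <= ?o i / w" by (rule divide_left_mono[OF wK o0 mult_pos_pos[OF KX w(1)]])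
     then have "ennreal (?o i / (K\<nu> * ?X i)) <= ennreal (?o i / w)" by (rule ennreal_leI)
     also have "\<dots> = osc b (triple l i) / wmeas \<nu> (triple l i)"
     unfolding oo w(2) by (rule divide_ennreal[OF o0 w(1), symmetric])
     also have "\<dots> <= sharp_max \<nu> b x"
     unfolding sharp_max_def using cu[of i] x cell_subset_triple[OF l, of i] by (intro SUP_upper) auto
     finally have "epowr (ennreal (?o i / (K\<nu> * ?X i))) ?u <= epowr (sharp_max \<nu> b x) ?u" using u by (intro epowr_mono) auto
     moreover have "epowr (ennreal (?o i / (K\<nu> * ?X i))) ?u = ennreal (?a i)" using KX o0[of i] by (intro epowr_ennreal divide_nonneg_nonneg) auto
     ultimately show "ennreal (?a i) <= epowr (sharp_max \<nu> b x) ?u" by simp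
    qed simp
    also have "\<dots> <= ennreal (kl / k2) * ennreal (N powr ?u)"
     unfolding laminar.K_def[OF lam] kl_def using H True by (intro mult_left_mono) auto
    also have "\<dots> = ennreal (kl / k2 * N powr ?u)" by (rule ennreal_mult[symmetric]) (use kl k(2) in auto)
    finally have sum: "(\<Sum>i\<in>I. ?a i * ?X i) <= kl / k2 * N powr ?u" using kl k(2) by (subst (asm) ennreal_le_iff) auto
    \<comment> \<open>Uses \<open>(1 - e) / e = 1 / e - 1\<close>: one power of \<open>?X i\<close>
      is left over and becomes the measure against which the family is summed.\<close>
    have term_eq: "(tosc l b i / \<Psi> (triple l i)) powr ?u = K\<nu> powr ?u * (?a i * ?X i)" for i
    proof -
     have E1: "(tosc l b i / \<Psi> (triple l i)) powr ?u = ?o i powr ?u / (?X i powr (1 - e)) powr ?u"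
     unfolding quot by (rule powr_divide)
     have E2: "(?X i powr (1 - e)) powr ?u = ?X i powr (?u - 1)" by (simp only: powr_powr u(2))
     have gen: "z powr (w - 1) = z powr w / z" if "0 < z" for z w :: real using that by (simp add: powr_diff)
     have 1: "(tosc l b i / \<Psi> (triple l i)) powr ?u = ?o i powr ?u / (?X i powr ?u / ?X i)"
     unfolding E1 E2 gen[OF Xp] ..
     have 2: "?a i = ?o i powr ?u / (K\<nu> powr ?u * ?X i powr ?u)"
     unfolding powr_divide powr_mult ..
     have gen2: "A / (B / X) = c * (A / (c * B) * X)" if "0 < c" for A B c X :: real
     using that by ((simp; fail) | (cases "B = 0"; simp add: field_simps))
     show ?thesis unfolding 1 2 by (rule gen2) (use K\<nu>(1) in simp)
    qed
    have "(\<Sum>i\<in>I. (tosc l b i / \<Psi> (triple l i)) powr ?u) = K\<nu> powr ?u * (\<Sum>i\<in>I. ?a i * ?X i)" unfolding term_eq sum_distrib_left ..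
    also have "\<dots> <= K\<nu> powr ?u * (kl / k2 * N powr ?u)" by (intro mult_left_mono sum) simp
    also have "\<dots> = (K * N) powr ?u"
    proof -
     have E1: "((kl / k2) powr e) powr ?u = kl / k2" unfolding powr_powr u(3) using kl k(2) by simp
     have E2: "K * N = K\<nu> * (kl / k2) powr e * N" using True by (simp add: K_def)
     show ?thesis unfolding E2 powr_mult E1 by simp
    qed
    also have "\<dots> <= (K * (N + \<delta>)) powr ?u" using K N u by (intro powr_mono2 mult_left_mono mult_nonneg_nonneg) auto
    finally show ?thesis using True by (simp add: lnorm_le_def)
   qed
  qed
 qed
qed

text \<open>The estimates require a positive bound \<open>B\<close>, while the norm of
  \<open>b\<close> may vanish. The bound is therefore obtained with \<open>N + \<delta>\<close> for
  every \<open>\<delta> > 0\<close>, and then \<open>\<delta>\<close> tends to 0.\<close>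

lemma op_norm_le:
 fixes T :: "('n, 'k::{real_normed_field, euclidean_space}) operator"
 assumes C: "0 < C" and bound: "!!B f A. 0 < B ==> (\<forall>l>0. tame l b B) ==> f \<in> bdd_comp ==> 0 <= A ==>
   (\<integral>\<^sup>+x. ennreal (norm (f x) powr p * \<mu> x) \<partial>lebesgue) <= ennreal A ==>
   (\<integral>\<^sup>+x. ennreal (norm (commutator T b m f x) powr q * \<sigma> x) \<partial>lebesgue) <= ennreal ((C * B ^ m * A powr (1 / p)) powr q)"
  and K: "0 < K" and N: "0 <= N" and t: "!!l \<delta>. 0 < l ==> 0 < \<delta> ==> tame l b (K * (N + \<delta>))"
 shows "op_norm p \<mu> q \<sigma> (commutator T b m) <= ennreal (C * K ^ m) * ennreal N ^ m"
proof -
 have Ln: "Lnorm (ennreal u) w (\<lambda>x. ennreal (norm (F x))) = epowr (\<integral>\<^sup>+x. ennreal (norm (F x) powr u * w x) \<partial>lebesgue) (1 / u)"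
  if "0 < u" "!!x. 0 <= w x" for u w and F :: "real ^ 'n => 'k"
  using that by (simp add: Lnorm_def epowr_ennreal ennreal_mult)
 have step: "op_norm p \<mu> q \<sigma> (commutator T b m) <= ennreal (C * K ^ m * (N + \<delta>) ^ m)" if \<delta>: "0 < \<delta>" for \<delta>
  unfolding op_norm_def
 proof (rule Inf_lower, rule CollectI, rule ballI)
  fix f :: "real ^ 'n => 'k" assume f: "f \<in> bdd_comp"
  define A where "A = enn2real (\<integral>\<^sup>+x. ennreal (norm (f x) powr p * \<mu> x) \<partial>lebesgue)"
  have A: "0 <= A" "(\<integral>\<^sup>+x. ennreal (norm (f x) powr p * \<mu> x) \<partial>lebesgue) = ennreal A"
   using Lp_finite[OF f] by (simp_all add: A_def)
  let ?B = "K * (N + \<delta>)"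
  have B: "0 < ?B" using K N \<delta> by simp
  have c0: "0 <= C * ?B ^ m * A powr (1 / p)" using C B by simp
  have "(\<integral>\<^sup>+x. ennreal (norm (commutator T b m f x) powr q * \<sigma> x) \<partial>lebesgue) <= ennreal ((C * ?B ^ m * A powr (1 / p)) powr q)"
   using t \<delta> A by (intro bound B f) auto
  then have "Lnorm (ennreal q) \<sigma> (\<lambda>x. ennreal (norm (commutator T b m f x))) <= ennreal (C * ?B ^ m * A powr (1 / p))"
   unfolding Ln[OF pq(2) \<sigma>(2)] using c0 pq by (subst epowr_le_iff) auto
  also have "\<dots> = ennreal (C * K ^ m * (N + \<delta>) ^ m) * ennreal (A powr (1 / p))"
   using C K N \<delta> by (subst ennreal_mult[symmetric]) (auto simp: power_mult_distrib mult.assoc)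
  also have "ennreal (A powr (1 / p)) = Lnorm (ennreal p) \<mu> (\<lambda>x. ennreal (norm (f x)))"
   unfolding Ln[OF pq(1) \<mu>(2)] A(2) using A(1) by (simp add: epowr_ennreal)
  finally show "Lnorm (ennreal q) \<sigma> (\<lambda>x. ennreal (norm (commutator T b m f x))) <= ennreal (C * K ^ m * (N + \<delta>) ^ m) * Lnorm (ennreal p) \<mu> (\<lambda>x. ennreal (norm (f x)))" .
 qed
 have "(\<lambda>j. ennreal (C * K ^ m * (N + inverse (real (Suc j))) ^ m)) \<longlonglongrightarrow> ennreal (C * K ^ m * (N + 0) ^ m)"
  by (intro tendsto_ennrealI tendsto_intros LIMSEQ_inverse_real_of_nat)
 then have "op_norm p \<mu> q \<sigma> (commutator T b m) <= ennreal (C * K ^ m * (N + 0) ^ m)"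
  by (rule LIMSEQ_le_const) (use step in auto)
 then show ?thesis using C K N by (simp add: ennreal_mult ennreal_power)
qed

end

theorem theorem6p1:
  fixes T :: "('n::finite, 'k::{real_normed_field, euclidean_space}) operator"
    and \<mu> \<sigma> \<nu> :: "real ^ 'n \<Rightarrow> real"
    and p q r :: real and s :: ennreal and m :: nat
  assumes "1 \<le> r" "r < p" "r < q" "ennreal p < s" "ennreal q < s" "1 \<le> m"
    and "sublinear_on (Lr_comp r) T"
    and "loc_weak_bounded r (\<lambda>f x. ennreal (norm (T f x)))"
    and "loc_weak_bounded r (grand_sharp_max T s)"
    and "\<mu> \<in> Ap (p / r) \<inter> RH (hoelder_conj (s / ennreal p))"
    and "\<sigma> \<in> Ap (q / r) \<inter> RH (hoelder_conj (s / ennreal q))"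
    and "\<And>x. 0 \<le> \<nu> x"
    and "\<And>x. \<nu> x powr (1 + 1 / (p * m) - 1 / (q * m))
               = \<mu> x powr (1 / (p * m)) * \<sigma> x powr (- (1 / (q * m)))"
  shows "(\<forall>\<alpha>. p \<le> q \<and> \<alpha> = 1 / (p * m) - 1 / (q * m) \<longrightarrow>
           (\<exists>C::real. 0 < C \<and> (\<forall>b :: real ^ 'n \<Rightarrow> 'k. loc_integrable b \<longrightarrow>
             op_norm p \<mu> q \<sigma> (commutator T b m)
               \<le> ennreal C * BMO_norm \<nu> (\<alpha> * real CARD('n)) b ^ m))) \<and>
         (\<forall>t::ennreal. q \<le> p \<and> 1 / t = ennreal (1 / (q * m) - 1 / (p * m)) \<longrightarrow>
           (\<exists>C::real. 0 < C \<and> (\<forall>b :: real ^ 'n \<Rightarrow> 'k. loc_integrable b \<longrightarrow>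
             op_norm p \<mu> q \<sigma> (commutator T b m)
               \<le> ennreal C * Lnorm t \<nu> (sharp_max \<nu> b) ^ m)))"
proof -
 let ?rs = "inv_exponent s"
 have r0: "0 < r" "0 < p" "0 < q" "1 < p / r" "1 < q / r" using assms(1-3) by auto
 note ip = inv_exponent[OF assms(4) r0(2)] and iq = inv_exponent[OF assms(5) r0(3)]
 have s1: "1 <= s" using assms(1,2,4) by (metis ennreal_1 ennreal_leI less_eq_real_def order_le_less_trans order_less_imp_le)
 have ex: "1 / (p / r - 1) = r / (p - r)" "1 / (q / r - 1) = r / (q - r)" using assms(1-3) by (simp_all add: field_simps)
 have wt: "weight \<mu>" "weight \<sigma>" using assms(10,11) by (auto simp: Ap_def)
 obtain \<phi>1 where \<phi>1: "!!\<theta>. \<theta> \<in> {0<..<1} ==> 0 <= \<phi>1 \<theta>"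
  and weak1: "!!Q g \<theta>. Q \<in> cubes ==> g \<in> Lr_on r Q ==> \<theta> \<in> {0<..<1} ==>
   outer_measure_of lebesgue {x \<in> Q. ennreal (norm (T (cutoff g Q) x)) > ennreal (\<phi>1 \<theta>) * pavg r (\<lambda>y. ennreal (norm (g y))) Q}
    <= ennreal \<theta> * emeasure lebesgue Q"
  using assms(8) unfolding loc_weak_bounded_def by blast
 obtain \<phi>2 where \<phi>2: "!!\<theta>. \<theta> \<in> {0<..<1} ==> 0 <= \<phi>2 \<theta>"
  and weak2: "!!Q g \<theta>. Q \<in> cubes ==> g \<in> Lr_on r Q ==> \<theta> \<in> {0<..<1} ==>
   outer_measure_of lebesgue {x \<in> Q. grand_sharp_max T s (cutoff g Q) x > ennreal (\<phi>2 \<theta>) * pavg r (\<lambda>y. ennreal (norm (g y))) Q}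
    <= ennreal \<theta> * emeasure lebesgue Q"
  using assms(9) unfolding loc_weak_bounded_def by blast
 show ?thesis
 proof (rule Ap_RH_avg_le[OF assms(10) r0(4) ip(4)])
  fix g :: "(real ^ 'n) set => real"
  assume g: "!!Q. Q \<in> cubes ==> 0 < g Q"
   "avg_le (\<lambda>x. \<mu> x powr hoelder_conj (s / ennreal p)) (\<lambda>Q. g Q powr hoelder_conj (s / ennreal p))"
   "avg_le (\<lambda>x. \<mu> x powr - (1 / (p / r - 1))) (\<lambda>Q. g Q powr - (1 / (p / r - 1)))"
  show ?thesis
  proof (rule Ap_RH_avg_le[OF assms(11) r0(5) iq(4)])
   fix h :: "(real ^ 'n) set => real"
   assume h: "!!Q. Q \<in> cubes ==> 0 < h Q"
    "avg_le (\<lambda>x. \<sigma> x powr hoelder_conj (s / ennreal q)) (\<lambda>Q. h Q powr hoelder_conj (s / ennreal q))"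
    "avg_le (\<lambda>x. \<sigma> x powr - (1 / (q / r - 1))) (\<lambda>Q. h Q powr - (1 / (q / r - 1)))"
   have w\<mu>: "AE x in lebesgue. 0 < \<mu> x" "!!x. 0 <= \<mu> x" "loc_integrable \<mu>" and w\<sigma>: "AE x in lebesgue. 0 < \<sigma> x" "!!x. 0 <= \<sigma> x"
    using wt by (auto simp: weight_def)
   have loc: "wmeas \<mu> Q < \<infinity>" if "Q \<in> cubes" for Q
    using dev_finite[OF w\<mu>(3) cubes_props(4)[OF that] subset_refl cubes_props(1)[OF that], of 0] w\<mu>(2) by (simp add: dev_def wmeas_def)
   interpret bloom \<mu> \<sigma> g h p q r ?rs m
    by (rule bloom.intro)
     (fact assms(1-3,6) ip(1,2) iq(2) w\<mu> w\<sigma> weight_measurable[OF wt(1)] weight_measurable[OF wt(2)] loc g(1) h(1)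
     g(2)[unfolded ip(3)] g(3)[unfolded ex] h(2)[unfolded iq(3)] h(3)[unfolded ex])+
   have cb: "\<exists>C>0. \<forall>(b :: real ^ 'n => 'k) B f A. loc_integrable b --> 0 < B --> (\<forall>l>0. tame l b B) --> f \<in> bdd_comp --> 0 <= A -->
     (\<integral>\<^sup>+x. ennreal (norm (f x) powr p * \<mu> x) \<partial>lebesgue) <= ennreal A -->
     (\<integral>\<^sup>+x. ennreal (norm (commutator T b m f x) powr q * \<sigma> x) \<partial>lebesgue) <= ennreal ((C * B ^ m * A powr (1 / p)) powr q)"
    by (rule commutator_bound[where ?\<phi>1.0=\<phi>1 and ?\<phi>2.0=\<phi>2 and s=s]) (fact assms(7) s1 refl assms(5) \<phi>1 \<phi>2 weak1 weak2)+
   obtain C where C: "0 < C" and bound: "!!(b :: real ^ 'n => 'k) B f A. loc_integrable b ==> 0 < B ==> (\<forall>l>0. tame l b B) ==> f \<in> bdd_comp ==> 0 <= A ==>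
     (\<integral>\<^sup>+x. ennreal (norm (f x) powr p * \<mu> x) \<partial>lebesgue) <= ennreal A ==>
     (\<integral>\<^sup>+x. ennreal (norm (commutator T b m f x) powr q * \<sigma> x) \<partial>lebesgue) <= ennreal ((C * B ^ m * A powr (1 / p)) powr q)"
    using cb by (elim exE conjE) blast
   have \<nu>: "comparable \<nu> \<Gamma>" by (rule bloom_weight[OF assms(12,13)])
   obtain K where K: "0 < K" and tame: "!!l (b :: real ^ 'n => 'k) N \<delta>. 0 < l ==> loc_integrable b ==> 0 <= N ==> 0 < \<delta> ==>
     (if 0 < e then (\<integral>\<^sup>+x. epowr (sharp_max \<nu> b x) (1 / e) * ennreal (\<nu> x) \<partial>lebesgue) <= ennreal (N powr (1 / e))
     else \<forall>Q\<in>cubes. osc b Q <= ennreal N * epowr (wmeas \<nu> Q) (1 - e)) ==> tame l b (K * (N + \<delta>))"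
    using tame_bound[OF \<nu>, where 'k='k] by (elim exE conjE) blast
   define C' where "C' = C * K ^ m"
   have C': "0 < C'" using C K by (simp add: C'_def)
   have wp: "\<exists>w>0. wmeas \<nu> Q = ennreal w" if "Q \<in> cubes" for Q by (rule wmeas_pos[OF \<nu> that])
   \<comment> \<open>Disposes of \<open>b\<close> with infinite norm, where the claim is trivial;
     since \<open>m >= 1\<close> the power of \<open>top\<close> is again
     \<open>top\<close>.\<close>
   have top_pow: "ennreal C' * top ^ m = top"
   proof -
    have "(top :: ennreal) ^ Suc j = top" for j by (induction j) (simp_all add: ennreal_mult_eq_top_iff)
    then have "(top :: ennreal) ^ m = top" using assms(6) by (metis Suc_pred' less_le_trans zero_less_one)
    then show ?thesis using C' by (simp add: ennreal_mult_eq_top_iff)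
   qed
   have fin: "op_norm p \<mu> q \<sigma> (commutator T b m) <= ennreal C' * N' ^ m"
    if b: "loc_integrable b" and N': "!!N. 0 <= N ==> N' = ennreal N ==>
     (if 0 < e then (\<integral>\<^sup>+x. epowr (sharp_max \<nu> b x) (1 / e) * ennreal (\<nu> x) \<partial>lebesgue) <= ennreal (N powr (1 / e))
     else \<forall>Q\<in>cubes. osc b Q <= ennreal N * epowr (wmeas \<nu> Q) (1 - e))" for b :: "real ^ 'n => 'k" and N'
   proof (cases "N' = top")
    case True
    then show ?thesis using top_pow by simp
   next
    case False
    define N where "N = enn2real N'"
    have N: "0 <= N" "N' = ennreal N" using False by (simp_all add: N_def less_top)
    show ?thesis unfolding N(2) C'_def
     by (rule op_norm_le[OF C bound[OF b] K N(1)]) (auto intro: tame b N(1) N'[OF N])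
   qed
   have "\<exists>C::real. 0 < C \<and> (\<forall>b :: real ^ 'n => 'k. loc_integrable b -->
     op_norm p \<mu> q \<sigma> (commutator T b m) <= ennreal C * BMO_norm \<nu> (\<alpha> * real CARD('n)) b ^ m)"
    if \<alpha>: "p <= q \<and> \<alpha> = 1 / (p * m) - 1 / (q * m)" for \<alpha>
   proof (intro exI[of _ C'] conjI C' allI impI)
    fix b :: "real ^ 'n => 'k" assume b: "loc_integrable b"
    have \<alpha>e: "1 + \<alpha> * real CARD('n) / real CARD('n) = 1 - e" using \<alpha> by (simp add: e_def)
    have "1 / (q * m) <= 1 / (p * m)" using \<alpha> pq by (intro divide_left_mono mult_right_mono) auto
    then have e0: "\<not> 0 < e" by (simp add: e_def)
    show "op_norm p \<mu> q \<sigma> (commutator T b m) <= ennreal C' * BMO_norm \<nu> (\<alpha> * real CARD('n)) b ^ m"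
    proof (rule fin[OF b])
     fix N assume N: "0 <= N" "BMO_norm \<nu> (\<alpha> * real CARD('n)) b = ennreal N"
     have "osc b Q <= ennreal N * epowr (wmeas \<nu> Q) (1 - e)" if Q: "Q \<in> cubes" for Q
     proof -
     obtain w where w: "0 < w" "wmeas \<nu> Q = ennreal w" using wp[OF Q] by blast
     have "osc b Q / epowr (wmeas \<nu> Q) (1 - e) <= ennreal N"
     unfolding N(2)[symmetric] BMO_norm_def \<alpha>e using Q by (intro SUP_upper)
     then show ?thesis unfolding w(2) using w(1) by (simp add: epowr_ennreal ennreal_le_of_divide_le)
     qed
     then show "if 0 < e then (\<integral>\<^sup>+x. epowr (sharp_max \<nu> b x) (1 / e) * ennreal (\<nu> x) \<partial>lebesgue) <= ennreal (N powr (1 / e))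
     else \<forall>Q\<in>cubes. osc b Q <= ennreal N * epowr (wmeas \<nu> Q) (1 - e)" using e0 by simp
    qed
   qed
   moreover have "\<exists>C::real. 0 < C \<and> (\<forall>b :: real ^ 'n => 'k. loc_integrable b -->
     op_norm p \<mu> q \<sigma> (commutator T b m) <= ennreal C * Lnorm t \<nu> (sharp_max \<nu> b) ^ m)"
    if t: "q <= p \<and> 1 / t = ennreal (1 / (q * m) - 1 / (p * m))" for t :: ennreal
   proof (intro exI[of _ C'] conjI C' allI impI)
    fix b :: "real ^ 'n => 'k" assume b: "loc_integrable b"
    have te: "1 / t = ennreal e" using t by (simp add: e_def)
    have "1 / (p * m) <= 1 / (q * m)" using t pq by (intro divide_left_mono mult_right_mono) auto
    then have e0: "0 <= e" by (simp add: e_def)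
    \<comment> \<open>In \<open>ennreal\<close> the reciprocal of 0 is \<open>top\<close>, so the
      relation between \<open>t\<close> and \<open>e\<close> excludes \<open>t = 0\<close>, and
      \<open>t = top\<close> corresponds exactly to \<open>e = 0\<close>.\<close>
    have tt: "if 0 < e then t = ennreal (1 / e) else t = top"
    proof (cases t)
     case (real u)
     show ?thesis
     proof (cases "u = 0")
     case True
     then have "1 / t = top" using real by simp
     then show ?thesis using te by simp
     next
     case False
     then have u: "0 < u" using real by simp
     then have "1 / t = ennreal (1 / u)" using real divide_ennreal[of 1 u] by simp
     then have "1 / u = e" using te e0 u by (simp add: ennreal_inj)
     then have "e = 1 / u" by (rule sym)
     then have "0 < e" "u = 1 / e" using u by simp_all
     then show ?thesis using real by simp
     qed
    next
     case top
     then have "ennreal e = 0" using te by simp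
     then show ?thesis using top e0 by simp
    qed
    show "op_norm p \<mu> q \<sigma> (commutator T b m) <= ennreal C' * Lnorm t \<nu> (sharp_max \<nu> b) ^ m"
    proof (rule fin[OF b])
     fix N assume N: "0 <= N" "Lnorm t \<nu> (sharp_max \<nu> b) = ennreal N"
     show "if 0 < e then (\<integral>\<^sup>+x. epowr (sharp_max \<nu> b x) (1 / e) * ennreal (\<nu> x) \<partial>lebesgue) <= ennreal (N powr (1 / e))
     else \<forall>Q\<in>cubes. osc b Q <= ennreal N * epowr (wmeas \<nu> Q) (1 - e)"
     proof (cases "0 < e")
     case True
     have ie: "0 < 1 / (1 / e)" "enn2real (ennreal (1 / e)) = 1 / e" using True by simp_all
     have "epowr (\<integral>\<^sup>+x. epowr (sharp_max \<nu> b x) (1 / e) * ennreal (\<nu> x) \<partial>lebesgue) (1 / (1 / e)) <= ennreal N"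
     using N(2) tt True unfolding Lnorm_def by (simp only: if_True ie(2)) (simp add: ie(2))
     then have "(\<integral>\<^sup>+x. epowr (sharp_max \<nu> b x) (1 / e) * ennreal (\<nu> x) \<partial>lebesgue) <= ennreal (N powr (1 / (1 / (1 / e))))"
     unfolding epowr_le_iff[OF ie(1) N(1)] .
     then show ?thesis using True by simp
     next
     case False
     then have e: "e = 0" "t = top" using e0 tt by auto
     have es: "esssup lebesgue (sharp_max \<nu> b) = ennreal N" using N(2) e(2) by (simp add: Lnorm_def)
     have AEs: "AE x in lebesgue. sharp_max \<nu> b x <= ennreal N" unfolding es[symmetric] by (rule esssup_AE)
     have "osc b Q <= ennreal N * epowr (wmeas \<nu> Q) (1 - e)" if Q: "Q \<in> cubes" for Q
     proof -
     obtain w where w: "0 < w" "wmeas \<nu> Q = ennreal w" using wp[OF Q] by blast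
     \<comment> \<open>At \<open>e = 0\<close> the essential supremum of the sharp maximal function
       controls every single cube: a cube has positive measure, so it contains a point obeying the
       bound, and the cube competes in the supremum at that point.\<close>
     have "\<exists>x\<in>Q. sharp_max \<nu> b x <= ennreal N"
     proof (rule ccontr)
     assume "\<not> (\<exists>x\<in>Q. sharp_max \<nu> b x <= ennreal N)"
     then have "AE x in lebesgue. x \<notin> Q" using AEs by (auto elim!: eventually_mono)
     then have "emeasure lebesgue Q = 0" using cubes_props(1)[OF Q] by (subst (asm) AE_iff_measurable[OF cubes_props(1)[OF Q]]) auto
     then show False using cubes_props(3)[OF Q] by (simp add: measure_def)
     qed
     then obtain x where x: "x \<in> Q" "sharp_max \<nu> b x <= ennreal N" by blast
     have "osc b Q / wmeas \<nu> Q <= sharp_max \<nu> b x" unfolding sharp_max_def using Q x by (intro SUP_upper) auto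
     then have "osc b Q / ennreal w <= ennreal N" unfolding w(2)[symmetric] using x(2) by (rule order_trans)
     then show ?thesis unfolding w(2) e(1) using w(1) by (simp add: epowr_ennreal ennreal_le_of_divide_le)
     qed
     then show ?thesis using False by simp
     qed
    qed
   qed
   ultimately show ?thesis by blast
  qed
 qed
qed

end
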